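(* Let $\Omega\subset\mathbb{R}^2$ be a bounded domain with $C^2$-boundary and let $\varphi\in C^2(\overline{\Omega})$. Suppose that $u\in H^2(\Omega)$ satisfies $u-\varphi\in H^1_0(\Omega)$. Then there exists a constant $C$ that depends only on $\Omega$ and $\|\varphi\|_{W^{2,1}(\partial\Omega)}$ such that $$\sup_{x\in\Omega}|u(x)|+\int_\Omega\sqrt{1+|\nabla u(x)|^2}\,dx\le C\bigl(W_0(u)^2+1\bigr).$$
   Context: For $u\in H^2(\Omega)$ put $Q=\sqrt{1+|\nabla u|^2}$, $H=\nabla\cdot\bigl(\frac{\nabla u}{Q}\bigr)$ (the mean curvature of the graph of $u$, i.e. the sum of the principal curvatures), and $$W_0(u)=\frac14\int_\Omega H^2\,Q\,dx .$$ $u$ is identified with its continuous representative. The norm $\|\varphi\|_{W^{2,1}(\partial\Omega)}$ means $\|\varphi\circ c\|_{W^{2,1}(I)}$, where $c:I\to\mathbb{R}^2$ is an arclength parametrisation of $\partial\Omega$ (if $\partial\Omega$ has several connected components, all of them are parametrised and the contributions are summed). *)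

theory Defs
  imports "HOL-Analysis.Analysis"
begin

text \<open>
  \<open>Ck_on k \<Omega> A f\<close>: for open \<open>\<Omega> \<subseteq> A \<subseteq> closure \<Omega>\<close>, the function \<open>f\<close> is \<open>k\<close> times differentiable
  on \<open>\<Omega>\<close> and all derivatives of order at most \<open>k\<close> extend continuously to \<open>A\<close> (order 0: \<open>f\<close>
  itself is continuous on \<open>A\<close>). The gradient field \<open>f'\<close> is determined only on \<open>\<Omega>\<close>; its values on
  \<open>A - \<Omega>\<close> are the continuous extension. Thus \<open>Ck_on k \<Omega> \<Omega>\<close> is \<open>C^k(\<Omega>)\<close> and
  \<open>Ck_on k \<Omega> (closure \<Omega>)\<close> is \<open>C^k\<close> up to the boundary.
\<close>

primrec Ck_on :: "nat \<Rightarrow> 'a::euclidean_space set \<Rightarrow> 'a set \<Rightarrow> ('a \<Rightarrow> real) \<Rightarrow> bool" where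
  "Ck_on 0 \<Omega> A f \<longleftrightarrow> continuous_on A f"
| "Ck_on (Suc k) \<Omega> A f \<longleftrightarrow> continuous_on A f \<and>
     (\<exists>f'. (\<forall>x\<in>\<Omega>. GDERIV f x :> f' x) \<and> (\<forall>b\<in>Basis. Ck_on k \<Omega> A (\<lambda>x. f' x \<bullet> b)))"

text \<open>The boundary is locally the graph of a \<open>C^2\<close> function in suitably rotated (or reflected)
  coordinates, and the set lies locally on one side of it.\<close>

definition C2_boundary :: "(real^2) set \<Rightarrow> bool" where
  "C2_boundary \<Omega> \<longleftrightarrow> (\<forall>p\<in>frontier \<Omega>. \<exists>r>0. \<exists>(T :: real^2 \<Rightarrow> real^2) (\<gamma> :: real \<Rightarrow> real). orthogonal_transformation T \<and>
     Ck_on 2 UNIV UNIV \<gamma> \<and> \<Omega> \<inter> ball p r = {x \<in> ball p r. \<gamma> (T x $ 1) < T x $ 2})"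

definition bounded_C2_domain :: "(real^2) set \<Rightarrow> bool" where
  "bounded_C2_domain \<Omega> \<longleftrightarrow> open \<Omega> \<and> connected \<Omega> \<and> \<Omega> \<noteq> {} \<and> bounded \<Omega> \<and> C2_boundary \<Omega>"

definition test_function :: "'a::euclidean_space set \<Rightarrow> ('a \<Rightarrow> real) \<Rightarrow> bool" where
  "test_function \<Omega> \<eta> \<longleftrightarrow> (\<forall>k. Ck_on k UNIV UNIV \<eta>) \<and>
     compact (closure {x. \<eta> x \<noteq> 0}) \<and> closure {x. \<eta> x \<noteq> 0} \<subseteq> \<Omega>"

definition locally_integrable_on :: "('a::euclidean_space \<Rightarrow> real) \<Rightarrow> 'a set \<Rightarrow> bool" where
  "locally_integrable_on f \<Omega> \<longleftrightarrow> (\<forall>K. compact K \<and> K \<subseteq> \<Omega> \<longrightarrow> integrable (lebesgue_on K) f)"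

definition has_weak_partial ::
  "'a::euclidean_space set \<Rightarrow> 'a \<Rightarrow> ('a \<Rightarrow> real) \<Rightarrow> ('a \<Rightarrow> real) \<Rightarrow> bool" where
  "has_weak_partial \<Omega> b f g \<longleftrightarrow> locally_integrable_on f \<Omega> \<and> locally_integrable_on g \<Omega> \<and>
     (\<forall>\<eta>. test_function \<Omega> \<eta> \<longrightarrow>
        (\<integral>x. f x * frechet_derivative \<eta> (at x) b \<partial>(lebesgue_on \<Omega>)) =
        - (\<integral>x. g x * \<eta> x \<partial>(lebesgue_on \<Omega>)))"

text \<open>On an open set a weak derivative is unique up to null sets whenever it exists, so the choice
  below does not affect any integral.\<close>

definition weak_partial ::
  "'a::euclidean_space set \<Rightarrow> 'a \<Rightarrow> ('a \<Rightarrow> real) \<Rightarrow> 'a \<Rightarrow> real" where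
  "weak_partial \<Omega> b f = (SOME g. has_weak_partial \<Omega> b f g)"

definition weak_grad :: "'a::euclidean_space set \<Rightarrow> ('a \<Rightarrow> real) \<Rightarrow> 'a \<Rightarrow> 'a" where
  "weak_grad \<Omega> f x = (\<Sum>b\<in>Basis. weak_partial \<Omega> b f x *\<^sub>R b)"

definition weak_div :: "'a::euclidean_space set \<Rightarrow> ('a \<Rightarrow> 'a) \<Rightarrow> 'a \<Rightarrow> real" where
  "weak_div \<Omega> F x = (\<Sum>b\<in>Basis. weak_partial \<Omega> b (\<lambda>y. F y \<bullet> b) x)"

definition L2 :: "'a::euclidean_space set \<Rightarrow> ('a \<Rightarrow> real) set" where
  "L2 \<Omega> = {f. f \<in> borel_measurable (lebesgue_on \<Omega>) \<and> integrable (lebesgue_on \<Omega>) (\<lambda>x. (f x)\<^sup>2)}"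

primrec Hsob :: "nat \<Rightarrow> 'a::euclidean_space set \<Rightarrow> ('a \<Rightarrow> real) set" where
  "Hsob 0 \<Omega> = L2 \<Omega>"
| "Hsob (Suc k) \<Omega> = {f \<in> L2 \<Omega>. \<forall>b\<in>Basis. \<exists>g\<in>Hsob k \<Omega>. has_weak_partial \<Omega> b f g}"

definition H1_norm :: "'a::euclidean_space set \<Rightarrow> ('a \<Rightarrow> real) \<Rightarrow> real" where
  "H1_norm \<Omega> f = sqrt ((\<integral>x. (f x)\<^sup>2 \<partial>(lebesgue_on \<Omega>)) +
     (\<integral>x. (norm (weak_grad \<Omega> f x))\<^sup>2 \<partial>(lebesgue_on \<Omega>)))"

definition H10 :: "'a::euclidean_space set \<Rightarrow> ('a \<Rightarrow> real) set" where
  "H10 \<Omega> = {f \<in> Hsob 1 \<Omega>. \<exists>\<eta>. (\<forall>n. test_function \<Omega> (\<eta> n)) \<and>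
     (\<lambda>n::nat. H1_norm \<Omega> (\<lambda>x. \<eta> n x - f x)) \<longlonglongrightarrow> 0}"

definition area_element :: "(real^2) set \<Rightarrow> (real^2 \<Rightarrow> real) \<Rightarrow> real^2 \<Rightarrow> real" where
  "area_element \<Omega> u x = sqrt (1 + (norm (weak_grad \<Omega> u x))\<^sup>2)"

definition mean_curvature :: "(real^2) set \<Rightarrow> (real^2 \<Rightarrow> real) \<Rightarrow> real^2 \<Rightarrow> real" where
  "mean_curvature \<Omega> u = weak_div \<Omega> (\<lambda>x. weak_grad \<Omega> u x /\<^sub>R area_element \<Omega> u x)"

definition W0 :: "(real^2) set \<Rightarrow> (real^2 \<Rightarrow> real) \<Rightarrow> real" where
  "W0 \<Omega> u = 1/4 * (\<integral>x. (mean_curvature \<Omega> u x)\<^sup>2 * area_element \<Omega> u x \<partial>(lebesgue_on \<Omega>))"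

text \<open>\<open>c\<close> on \<open>{0..l}\<close> runs once, with unit speed, through the closed curve \<open>\<Gamma>\<close>.\<close>

definition arclength_parametrisation :: "real \<Rightarrow> (real \<Rightarrow> real^2) \<Rightarrow> (real^2) set \<Rightarrow> bool" where
  "arclength_parametrisation l c \<Gamma> \<longleftrightarrow> 0 < l \<and>
     (\<forall>b\<in>Basis. Ck_on 2 {0<..<l} {0..l} (\<lambda>s. c s \<bullet> b)) \<and>
     (\<forall>s\<in>{0<..<l}. norm (vector_derivative c (at s)) = 1) \<and>
     c 0 = c l \<and> inj_on c {0..<l} \<and> c ` {0..l} = \<Gamma>"

text \<open>A choice of arclength parametrisation \<open>c \<Gamma>\<close>, of length \<open>l \<Gamma>\<close>, for each connected component
  \<open>\<Gamma>\<close> of the boundary. For a bounded \<open>C^2\<close> domain there are finitely many components, each of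
  them a closed \<open>C^2\<close> curve.\<close>

definition boundary_parametrisation ::
  "(real^2) set \<Rightarrow> ((real^2) set \<Rightarrow> real) \<Rightarrow> ((real^2) set \<Rightarrow> real \<Rightarrow> real^2) \<Rightarrow> bool" where
  "boundary_parametrisation \<Omega> l c \<longleftrightarrow>
     (\<forall>\<Gamma>\<in>components (frontier \<Omega>). arclength_parametrisation (l \<Gamma>) (c \<Gamma>) \<Gamma>)"

definition W21_norm :: "real set \<Rightarrow> (real \<Rightarrow> real) \<Rightarrow> real" where
  "W21_norm I f = (\<integral>s. \<bar>f s\<bar> \<partial>(lebesgue_on I)) +
     (\<integral>s. \<bar>weak_partial I 1 f s\<bar> \<partial>(lebesgue_on I)) +
     (\<integral>s. \<bar>weak_partial I 1 (weak_partial I 1 f) s\<bar> \<partial>(lebesgue_on I))"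

text \<open>The value does not depend on the parametrisation \<open>(l, c)\<close> of the boundary.\<close>

definition boundary_W21_norm ::
  "(real^2) set \<Rightarrow> ((real^2) set \<Rightarrow> real) \<Rightarrow> ((real^2) set \<Rightarrow> real \<Rightarrow> real^2) \<Rightarrow>
   (real^2 \<Rightarrow> real) \<Rightarrow> real" where
  "boundary_W21_norm \<Omega> l c \<phi> =
     (\<Sum>\<Gamma>\<in>components (frontier \<Omega>). W21_norm {0<..<l \<Gamma>} (\<phi> \<circ> c \<Gamma>))"

end

theory Submission
  imports Defs
begin

text \<open>
  Write \<open>Q\<close> for the area element of the graph of \<open>u\<close> and let \<open>m\<close> bound the boundary values. Testing
  the weak mean curvature equation with \<open>arctan u\<close> controls the area over \<open>{\<bar>u\<bar> \<le> m + 2}\<close> by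
  \<open>1 + sqrt (W0 u)\<close>. The first variation of the graph with respect to horizontal fields
  \<open>X(x\<^sub>i) e\<^sub>i\<close>, cut off in the \<open>u\<close> direction, bounds the area over a superlevel set \<open>{t < u}\<close> with
  \<open>t > m\<close> by the length of its coordinate projections, up to a factor controlled by the volume and
  by \<open>sqrt (W0 u)\<close> times the square root of the area. Since the projections have length at most the
  diameter, this closes the area estimate. Projections of a superlevel set are in turn at most the
  area in a slab below it divided by the height of the slab, so the area above level \<open>s\<close> drops by
  a factor 4 after a height of order \<open>(1 + sqrt (W0 u)) sqrt (area above s)\<close>; summing the resulting
  geometric series bounds \<open>sup u\<close>.

  No trace operator is needed: a Hardy inequality gives \<open>\<integral> v\<^sup>2 = O(\<epsilon>\<^sup>2)\<close> over the boundary layer of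
  width \<open>\<epsilon>\<close> for \<open>v\<close> in \<open>H10\<close>, and this makes the cutoff terms vanish in the limit.
\<close>

section \<open>Test functions\<close>

text \<open>The horizontal variation works because the tensor with entries Q \<delta>_ij - u_i u_j /
  Q has divergence equal to minus the mean curvature times the gradient. For a field that depends on
  one coordinate, the bulk term is X' times the diagonal entry (1 + u_j^2) / Q, which is
  nonnegative, and the two diagonal entries add up to Q + 1/Q. So two fields of one variable control
  the area, while every error term carries the factor |X|, at most the length of a projection. That
  length is the small factor behind the decay across slabs. The obstacle is regularity: second
  derivatives are only square integrable, and at the boundary nothing is known beyond
  \<open>H10\<close>. All identities are linear in the second derivatives, with bounded continuous
  coefficients in u and its gradient. They therefore pass from mollified functions to u by a.e.
  convergence of gradients and L1 convergence of Hessians, always against a cutoff of compact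
  support; removing the cutoff is a separate limit. Every estimate bounds u from above and is
  applied to u and to -u.\<close>

lemma Ck_on_SucD: "Ck_on (Suc k) \<Omega> A f \<Longrightarrow> Ck_on k \<Omega> A f"
proof (induction k arbitrary: f)
  case (Suc k)
  then obtain f' where "\<forall>x\<in>\<Omega>. GDERIV f x :> f' x" "\<forall>b\<in>Basis. Ck_on (Suc k) \<Omega> A (\<lambda>x. f' x \<bullet> b)"
    "continuous_on A f" by auto
  moreover from this have "\<forall>b\<in>Basis. Ck_on k \<Omega> A (\<lambda>x. f' x \<bullet> b)" using Suc.IH by blast
  ultimately show ?case unfolding Ck_on.simps(2) by blast
qed simp

lemma Ck_on_SucI:
  "continuous_on A f \<Longrightarrow> (\<And>x. x \<in> \<Omega> \<Longrightarrow> GDERIV f x :> f' x) \<Longrightarrow>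
    (\<And>b. b \<in> Basis \<Longrightarrow> Ck_on k \<Omega> A (\<lambda>x. f' x \<bullet> b)) \<Longrightarrow> Ck_on (Suc k) \<Omega> A f"
  by auto

lemma Ck_on_continuous: "Ck_on k \<Omega> A f \<Longrightarrow> continuous_on A f"
  by (cases k) auto

lemma Ck_on_const: "Ck_on k \<Omega> A (\<lambda>x. c)"
proof (induction k arbitrary: c)
  case (Suc k)
  then show ?case by (auto intro!: exI[of _ "\<lambda>x. 0"] GDERIV_const)
qed simp

lemma Ck_on_add: "Ck_on k \<Omega> A f \<Longrightarrow> Ck_on k \<Omega> A g \<Longrightarrow> Ck_on k \<Omega> A (\<lambda>x. f x + g x)"
proof (induction k arbitrary: f g)
  case (Suc k)
  then obtain f' g' where f: "\<forall>x\<in>\<Omega>. GDERIV f x :> f' x" "\<forall>b\<in>Basis. Ck_on k \<Omega> A (\<lambda>x. f' x \<bullet> b)"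
    and g: "\<forall>x\<in>\<Omega>. GDERIV g x :> g' x" "\<forall>b\<in>Basis. Ck_on k \<Omega> A (\<lambda>x. g' x \<bullet> b)" by auto
  show ?case using Suc.prems f g
    by (auto intro!: continuous_intros exI[of _ "\<lambda>x. f' x + g' x"] GDERIV_add Suc.IH simp: inner_add_left)
qed (auto intro!: continuous_intros)

lemma Ck_on_mult: "Ck_on k \<Omega> A f \<Longrightarrow> Ck_on k \<Omega> A g \<Longrightarrow> Ck_on k \<Omega> A (\<lambda>x. f x * g x)"
proof (induction k arbitrary: f g)
  case (Suc k)
  then obtain f' g' where f: "\<forall>x\<in>\<Omega>. GDERIV f x :> f' x" "\<forall>b\<in>Basis. Ck_on k \<Omega> A (\<lambda>x. f' x \<bullet> b)"
    and g: "\<forall>x\<in>\<Omega>. GDERIV g x :> g' x" "\<forall>b\<in>Basis. Ck_on k \<Omega> A (\<lambda>x. g' x \<bullet> b)" by auto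
  \<comment> \<open>The product rule multiplies a derivative of one factor by the other factor
    itself, which is given at order \<open>Suc k\<close> but has to be used at order
    \<open>k\<close>.\<close>
  note * = Suc.prems[THEN Ck_on_SucD]
  show ?case using Suc.prems f g *
    by (auto intro!: continuous_intros exI[of _ "\<lambda>x. f x *\<^sub>R g' x + g x *\<^sub>R f' x"] GDERIV_mult Suc.IH
       Ck_on_add simp: inner_add_left)
qed (auto intro!: continuous_intros)

lemma Ck_on_inner: "Ck_on k \<Omega> A (\<lambda>x. x \<bullet> c)"
  by (induction k) (auto intro!: continuous_intros exI[of _ "\<lambda>x. c"] Ck_on_const derivative_eq_intros simp: gderiv_def)

section \<open>Smooth bump functions\<close>

definition hump :: "nat \<Rightarrow> real \<Rightarrow> real" where
  "hump j t = (if 0 < t then exp (- 1 / t) / t ^ j else 0)"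

lemma hump_nonneg [simp]: "0 \<le> hump j t" by (simp add: hump_def)

lemma hump_tendsto_0: "((hump j) \<longlongrightarrow> 0) (at 0)"
proof -
  have "((\<lambda>x. x ^ j / exp x) \<longlongrightarrow> 0) (at_top::real filter)" by (rule tendsto_power_div_exp_0)
  then have "((\<lambda>x. (inverse x) ^ j / exp (inverse x)) \<longlongrightarrow> 0) (at_right (0::real))"
    by (rule filterlim_compose) (rule filterlim_inverse_at_top_right)
  then have r: "((hump j) \<longlongrightarrow> 0) (at_right 0)"
    by (rule Lim_transform_eventually)
       (auto simp: hump_def eventually_at_filter exp_minus field_simps inverse_eq_divide power_one_over)
  have l: "((hump j) \<longlongrightarrow> 0) (at_left 0)"
    by (rule Lim_transform_eventually[of "\<lambda>_. 0"]) (auto simp: hump_def eventually_at_filter)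
  show ?thesis using l r by (simp add: filterlim_at_split)
qed

text \<open>The powers in the denominator make the family closed under differentiation: the
  derivative of one hump combines two humps of higher index, so smoothness of every order follows by
  one induction over all indices at once. At 0 the difference quotient is itself a hump, which tends
  to 0.\<close>

lemma hump_deriv: "(hump j has_real_derivative (hump (j+2) t - j * hump (j+1) t)) (at t)"
proof (cases t "0::real" rule: linorder_cases)
  case greater
  have "((\<lambda>t. exp (- 1 / t) / t ^ j) has_real_derivative (hump (j+2) t - j * hump (j+1) t)) (at t)"
    using greater
    apply (auto intro!: derivative_eq_intros simp: hump_def)
    apply (cases j)
     apply (auto simp: field_simps power2_eq_square)
    done
  then show ?thesis
    by (rule has_field_derivative_transform_within[OF _ greater]) (auto simp: hump_def dist_real_def)
next
  case less
  have "((\<lambda>_. 0) has_real_derivative (hump (j+2) t - j * hump (j+1) t)) (at t)"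
    using less by (auto intro!: derivative_eq_intros simp: hump_def)
  then show ?thesis
    by (rule has_field_derivative_transform_within[where d="-t"]) (use less in \<open>auto simp: hump_def dist_real_def\<close>)
next
  case equal
  have "((\<lambda>h. (hump j (0 + h) - hump j 0) / h) \<longlongrightarrow> 0) (at 0)"
    by (rule Lim_transform_eventually[OF hump_tendsto_0[of "Suc j"]])
       (auto simp: hump_def eventually_at_filter)
  then show ?thesis unfolding equal DERIV_def by (simp add: hump_def)
qed

lemma continuous_hump: "continuous_on A (hump j)"
  using hump_deriv by (meson DERIV_isCont continuous_at_imp_continuous_on)

lemma Ck_on_hump_ball: "Ck_on k UNIV UNIV (\<lambda>y::'a::euclidean_space. hump j (r\<^sup>2 - (y - x) \<bullet> (y - x)))"
proof (induction k arbitrary: j)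
  case 0
  then show ?case by (auto intro!: continuous_intros continuous_on_compose2[OF continuous_hump[of UNIV]])
next
  case (Suc k)
  let ?q = "\<lambda>y::'a. r\<^sup>2 - (y - x) \<bullet> (y - x)"
  let ?f' = "\<lambda>y. (hump (j+2) (?q y) - j * hump (j+1) (?q y)) *\<^sub>R ((-2) *\<^sub>R (y - x))"
  have "GDERIV (\<lambda>y. hump j (?q y)) y :> ?f' y" for y
  proof (rule GDERIV_DERIV_compose[of ?q y _ "hump j"])
    show "GDERIV ?q y :> (-2) *\<^sub>R (y - x)"
      unfolding gderiv_def by (auto intro!: derivative_eq_intros simp: inner_commute algebra_simps)
  qed (rule hump_deriv)
  moreover have "Ck_on k UNIV UNIV (\<lambda>y. ?f' y \<bullet> b)" if "b \<in> Basis" for b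
  proof -
    have "Ck_on k UNIV UNIV (\<lambda>y. (hump (j+2) (?q y) + (- real j) * hump (j+1) (?q y)) * (-2 * (y \<bullet> b + - (x \<bullet> b))))"
      by (intro Ck_on_mult Ck_on_add Suc.IH Ck_on_const Ck_on_inner)
    then show ?thesis by (simp add: inner_diff_left algebra_simps)
  qed
  moreover have "continuous_on UNIV (\<lambda>y. hump j (?q y))"
    by (auto intro!: continuous_intros continuous_on_compose2[OF continuous_hump[of UNIV]])
  ultimately show ?case by (intro Ck_on_SucI[where f'="?f'"])
qed

lemma ball_inner:
  assumes "hump j (r\<^sup>2 - (y - x) \<bullet> (y - x)) \<noteq> 0" "0 < r" shows "dist x y < r"
proof -
  have "(norm (y - x))\<^sup>2 < r\<^sup>2"
    using assms by (auto simp: hump_def dot_square_norm split: if_splits)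
  then show ?thesis using assms(2) by (simp add: dist_norm norm_minus_commute power2_less_imp_less)
qed

lemma test_functionI_support:
  assumes "\<And>k. Ck_on k UNIV UNIV \<eta>" "compact K" "K \<subseteq> \<Omega>" "\<And>x. x \<notin> K \<Longrightarrow> \<eta> x = 0"
  shows "test_function \<Omega> \<eta>"
proof -
  have *: "closure {x. \<eta> x \<noteq> 0} \<subseteq> K"
    using assms(2,4) by (intro closure_minimal) (auto intro: compact_imp_closed)
  then have "compact (K \<inter> closure {x. \<eta> x \<noteq> 0})"
    using assms(2) by (intro compact_Int_closed) auto
  with * have "compact (closure {x. \<eta> x \<noteq> 0})" by (simp add: Int_absorb1)
  then show ?thesis using assms * unfolding test_function_def by blast
qed

text \<open>The type argument selects the dimension: the normalising integral depends on the space
  but on no point of it.\<close>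

definition bump_mass :: "real \<Rightarrow> 'a::euclidean_space itself \<Rightarrow> real" where
  "bump_mass r T = (LBINT z. hump 0 (r\<^sup>2 - z \<bullet> (z::'a)))"

definition bump :: "real \<Rightarrow> 'a::euclidean_space \<Rightarrow> real" where
  "bump r z = hump 0 (r\<^sup>2 - z \<bullet> z) / bump_mass r TYPE('a)"

lemma integrable_dominated:
  fixes f g :: "'a::euclidean_space \<Rightarrow> real"
  assumes "integrable lborel g" "f \<in> borel_measurable lborel" "\<And>x. norm (f x) \<le> norm (g x)"
  shows "integrable lborel f"
  using assms by (rule Bochner_Integration.integrable_bound[OF _ _ AE_I2])

lemma integrable_continuous_compact_support:
  fixes f :: "'a::euclidean_space \<Rightarrow> real"
  assumes "continuous_on UNIV f" "bounded B" "\<And>x. x \<notin> B \<Longrightarrow> f x = 0"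
  shows "integrable lborel f"
proof -
  have "integrable lborel (\<lambda>x. indicator (closure B) x *\<^sub>R f x)"
    using assms by (intro borel_integrable_compact) (auto intro: continuous_on_subset)
  moreover have "(\<lambda>x. indicator (closure B) x *\<^sub>R f x) = f"
    using assms(3) closure_subset[of B] by (auto simp: indicator_def fun_eq_iff)
  ultimately show ?thesis by simp
qed

lemma hump_ball_integrable:
  assumes "0 < r" shows "integrable lborel (\<lambda>y::'a::euclidean_space. hump j (r\<^sup>2 - (y - x) \<bullet> (y - x)))"
proof (rule integrable_continuous_compact_support[OF _ bounded_cball[of x r]])
  show "continuous_on UNIV (\<lambda>y. hump j (r\<^sup>2 - (y - x) \<bullet> (y - x)))"
    using Ck_on_hump_ball[of 0 j r x] by simp
  show "hump j (r\<^sup>2 - (y - x) \<bullet> (y - x)) = 0" if "y \<notin> cball x r" for y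
    using ball_inner[of j r y x] assms that by auto
qed

lemma bump_mass_pos:
  assumes "0 < r" shows "0 < bump_mass r TYPE('a::euclidean_space)"
proof -
  let ?f = "\<lambda>z::'a. hump 0 (r\<^sup>2 - z \<bullet> z)"
  have i: "integrable lborel ?f" using hump_ball_integrable[OF assms, of 0 "0::'a"] by simp
  have "bump_mass r TYPE('a) \<noteq> 0"
  proof
    assume "bump_mass r TYPE('a) = 0"
    then have "AE z in lborel. ?f z = 0"
      using integral_nonneg_eq_0_iff_AE[OF i] by (simp add: bump_mass_def)
    then have "AE z in lborel. z \<notin> ball (0::'a) r"
    proof (rule AE_mp, intro AE_I2 impI notI)
      fix z :: 'a assume a: "?f z = 0" "z \<in> ball 0 r"
      then have "z \<bullet> z < r\<^sup>2" by (simp add: dot_square_norm power_strict_mono)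
      with a show False by (simp add: hump_def)
    qed
    then have "emeasure lborel (ball (0::'a) r) = 0"
      by (subst (asm) AE_iff_measurable[of "ball 0 r"]) auto
    then have "measure lborel (ball (0::'a) r) = 0" by (simp add: measure_def)
    then show False using content_ball_pos[OF assms, of "0::'a"] by simp
  qed
  moreover have "0 \<le> bump_mass r TYPE('a)" by (simp add: bump_mass_def)
  ultimately show ?thesis by simp
qed

lemma bump_nonneg [simp]: "0 < r \<Longrightarrow> 0 \<le> bump r (z::'a::euclidean_space)"
  using bump_mass_pos[of r, where 'a='a] by (auto simp: bump_def intro!: divide_nonneg_nonneg less_imp_le)

lemma Ck_on_bump: "Ck_on k UNIV UNIV (\<lambda>y. bump r (x - y :: 'a::euclidean_space))"
proof -
  have "Ck_on k UNIV UNIV (\<lambda>y. hump 0 (r\<^sup>2 - (y - x) \<bullet> (y - x)) * (1 / bump_mass r TYPE('a)))"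
    by (intro Ck_on_mult Ck_on_hump_ball Ck_on_const)
  moreover have "(y - x) \<bullet> (y - x) = (x - y) \<bullet> (x - y)" for y by (simp add: algebra_simps inner_commute)
  ultimately show ?thesis by (simp add: bump_def)
qed

lemma Ck_on_bump': "Ck_on k UNIV UNIV (bump r :: 'a::euclidean_space \<Rightarrow> real)"
proof -
  have "Ck_on k UNIV UNIV (\<lambda>y::'a. bump r (0 - y))" by (rule Ck_on_bump)
  then show ?thesis by (simp add: bump_def[abs_def])
qed

lemma bump_support: "bump r z \<noteq> 0 \<Longrightarrow> 0 < r \<Longrightarrow> norm z < r"
  using ball_inner[of 0 r z 0] by (auto simp: bump_def)

lemma bump_uminus [simp]: "bump r (- z) = bump r z" by (simp add: bump_def)

lemma bump_test: "0 < r \<Longrightarrow> cball x r \<subseteq> \<Omega> \<Longrightarrow> test_function \<Omega> (\<lambda>y. bump r (x - y))"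
  by (rule test_functionI_support[OF Ck_on_bump, of "cball x r"])
     (auto simp: dist_norm, use bump_support in fastforce)

lemma bump_integrable: "0 < r \<Longrightarrow> integrable lborel (bump r :: 'a::euclidean_space \<Rightarrow> real)"
  using hump_ball_integrable[of r 0 "0::'a"] by (simp add: bump_def[abs_def])

lemma bump_integral: "0 < r \<Longrightarrow> (LBINT z. bump r (z::'a::euclidean_space)) = 1"
  using bump_mass_pos[of r, where 'a='a] by (simp add: bump_def[abs_def] bump_mass_def)

section \<open>Convolution\<close>

lemma lborel_integral_shift:
  fixes f :: "'a::euclidean_space \<Rightarrow> real"
  shows "(LBINT x. f (z + x)) = (LBINT x. f x)" (is ?A)
    and "integrable lborel (\<lambda>x. f (z + x)) \<longleftrightarrow> integrable lborel f" (is ?B)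
proof -
  have B: "integrable lborel f \<Longrightarrow> integrable lborel (\<lambda>x. f (z + x))" for f :: "'a \<Rightarrow> real" and z
    using integrable_distr[of "(+) z" lborel borel f] by (simp add: lborel_distr_plus)
  show ?B using B[of f z] B[of "\<lambda>x. f (z + x)" "- z"] by auto
  show ?A
  proof (cases "integrable lborel f")
    case True
    then show ?thesis
      using integral_distr[of "(+) z" lborel borel f] by (simp add: lborel_distr_plus)
  next
    case False
    with \<open>?B\<close> show ?thesis by (simp add: not_integrable_integral_eq)
  qed
qed

lemma lborel_integral_shift':
  fixes f :: "'a::euclidean_space \<Rightarrow> real"
  shows "(LBINT x. f (x + z)) = (LBINT x. f x)"
    and "integrable lborel (\<lambda>x. f (x + z)) \<longleftrightarrow> integrable lborel f"
  using lborel_integral_shift[of f z] by (simp_all add: add.commute)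

lemma lborel_nn_integral_shift:
  fixes f :: "'a::euclidean_space \<Rightarrow> ennreal"
  assumes "f \<in> borel_measurable borel"
  shows "(\<integral>\<^sup>+x. f (x + z) \<partial>lborel) = (\<integral>\<^sup>+x. f x \<partial>lborel)"
  using nn_integral_distr[of "(+) z" lborel borel f] assms by (simp add: lborel_distr_plus add.commute)

section \<open>Continuity of translations in L1\<close>

definition L1_shift_continuous :: "('a::euclidean_space \<Rightarrow> real) \<Rightarrow> bool" where
  "L1_shift_continuous f \<longleftrightarrow>
    (\<forall>X. X \<longlonglongrightarrow> 0 \<longrightarrow> (\<lambda>n::nat. \<integral>x. \<bar>f (x + X n) - f x\<bar> \<partial>lborel) \<longlonglongrightarrow> 0)"

text \<open>Translation is an isometry of L1, so replacing \<open>f\<close> by an approximation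
  costs the error only twice, once for \<open>f\<close> and once for its shift. The property is thus
  closed under L1 limits.\<close>

lemma L1_shift_continuous_approx:
  fixes f :: "'a::euclidean_space \<Rightarrow> real"
  assumes f: "integrable lborel f"
    and *: "\<And>e. e > 0 \<Longrightarrow> \<exists>g. integrable lborel g \<and> L1_shift_continuous g \<and> (LBINT x. \<bar>f x - g x\<bar>) \<le> e"
  shows "L1_shift_continuous f"
  unfolding L1_shift_continuous_def
proof (intro allI impI)
  fix X :: "nat \<Rightarrow> 'a" assume X: "X \<longlonglongrightarrow> 0"
  show "(\<lambda>n. \<integral>x. \<bar>f (x + X n) - f x\<bar> \<partial>lborel) \<longlonglongrightarrow> 0"
  proof (rule tendstoI)
    fix e :: real assume e: "e > 0"
    obtain g where g: "integrable lborel g" "L1_shift_continuous g" "(LBINT x. \<bar>f x - g x\<bar>) \<le> e / 4"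
      using *[of "e/4"] e by auto
    have "(\<lambda>n. \<integral>x. \<bar>g (x + X n) - g x\<bar> \<partial>lborel) \<longlonglongrightarrow> 0"
      using g(2) X by (simp add: L1_shift_continuous_def)
    then have "\<forall>\<^sub>F n in sequentially. (LBINT x. \<bar>g (x + X n) - g x\<bar>) < e / 4"
      using e by (intro order_tendstoD) auto
    then show "\<forall>\<^sub>F n in sequentially. dist (LBINT x. \<bar>f (x + X n) - f x\<bar>) 0 < e"
    proof eventually_elim
      case (elim n)
      let ?z = "X n"
      have i: "integrable lborel (\<lambda>x. f (x + ?z))" "integrable lborel (\<lambda>x. g (x + ?z))"
        using f g by (simp_all add: lborel_integral_shift')
      have s: "(LBINT x. \<bar>f (x + ?z) - g (x + ?z)\<bar>) = (LBINT x. \<bar>f x - g x\<bar>)"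
        by (rule lborel_integral_shift'(1)[of "\<lambda>x. \<bar>f x - g x\<bar>"])
      have "(LBINT x. \<bar>f (x + ?z) - f x\<bar>) \<le>
         (LBINT x. \<bar>f (x + ?z) - g (x + ?z)\<bar> + \<bar>g (x + ?z) - g x\<bar> + \<bar>f x - g x\<bar>)"
        using i f g(1) by (intro integral_mono) (auto intro!: integrable_abs Bochner_Integration.integrable_diff Bochner_Integration.integrable_add)
      also have "\<dots> = (LBINT x. \<bar>f x - g x\<bar>) + (LBINT x. \<bar>g (x + ?z) - g x\<bar>) + (LBINT x. \<bar>f x - g x\<bar>)"
        using i f g(1) by (simp add: s)
      also have "\<dots> < e" using elim g(3) e by linarith
      finally show ?case by simp
    qed
  qed
qed

lemma L1_shift_continuous_open:
  assumes "open U" "emeasure lborel U < \<infinity>"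
  shows "L1_shift_continuous (indicator U :: 'a::euclidean_space \<Rightarrow> real)"
  unfolding L1_shift_continuous_def
proof (intro allI impI)
  fix X :: "nat \<Rightarrow> 'a" assume X: "X \<longlonglongrightarrow> 0"
  let ?i = "indicator U :: 'a \<Rightarrow> real"
  have i: "integrable lborel ?i" using assms by (simp add: integrable_indicator_iff)
  have i': "integrable lborel (\<lambda>x. ?i (x + z))" for z
    using i by (simp only: lborel_integral_shift'(2)[of ?i])
  \<comment> \<open>Only the positive part of the difference is estimated: it tends to 0 pointwise
    because \<open>U\<close> is open, and it is dominated by the indicator. A shift preserves the
    integral, so positive and negative parts have equal integrals; this is the factor 2
    below.\<close>
  let ?a = "\<lambda>n x. max 0 (?i x - ?i (x + X n))"
  have "(\<lambda>n. \<integral>x. ?a n x \<partial>lborel) \<longlonglongrightarrow> (\<integral>x. (0::real) \<partial>(lborel :: 'a measure))"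
  proof (rule integral_dominated_convergence[where w = ?i])
    show "AE x in lborel. (\<lambda>n. ?a n x) \<longlonglongrightarrow> 0"
    proof (rule AE_I2)
      fix x :: 'a
      show "(\<lambda>n. ?a n x) \<longlonglongrightarrow> 0"
      proof (cases "x \<in> U")
        case True
        have "(\<lambda>n. x + X n) \<longlonglongrightarrow> x + 0" by (intro tendsto_intros X)
        then have "\<forall>\<^sub>F n in sequentially. x + X n \<in> U"
          using True assms(1) by (simp add: topological_tendstoD)
        then have "\<forall>\<^sub>F n in sequentially. ?a n x = 0"
          by eventually_elim (use True in auto)
        then show ?thesis by (rule tendsto_eventually)
      qed simp
    qed
    show "?a n \<in> borel_measurable lborel" for n
      using borel_measurable_integrable[OF i] borel_measurable_integrable[OF i', of "X n"]
      by (intro borel_measurable_max borel_measurable_diff borel_measurable_const)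
    show "AE x in lborel. norm (?a n x) \<le> ?i x" for n by (simp add: indicator_def)
  qed (use i in auto)
  then have "(\<lambda>n. 2 * (LBINT x. ?a n x)) \<longlonglongrightarrow> 2 * 0" by (intro tendsto_intros) simp
  moreover have "(LBINT x. \<bar>?i (x + X n) - ?i x\<bar>) = 2 * (LBINT x. ?a n x)" for n
  proof -
    have "(LBINT x. \<bar>?i (x + X n) - ?i x\<bar>) = (LBINT x. 2 * ?a n x - (?i x - ?i (x + X n)))"
      by (rule Bochner_Integration.integral_cong) (auto simp: indicator_def)
    also have "\<dots> = 2 * (LBINT x. ?a n x) - ((LBINT x. ?i x) - (LBINT x. ?i (x + X n)))"
      using i i' by (simp add: integrable_max)
    also have "(LBINT x. ?i (x + X n)) = (LBINT x. ?i x)"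
      by (rule lborel_integral_shift'(1))
    finally show ?thesis by simp
  qed
  ultimately show "(\<lambda>n. \<integral>x. \<bar>?i (x + X n) - ?i x\<bar> \<partial>lborel) \<longlonglongrightarrow> 0" by simp
qed

lemma L1_shift_continuous_cmult:
  assumes "L1_shift_continuous f" shows "L1_shift_continuous (\<lambda>x. f x * c)"
  unfolding L1_shift_continuous_def
proof (intro allI impI)
  fix X :: "nat \<Rightarrow> 'a" assume X: "X \<longlonglongrightarrow> 0"
  have "(\<lambda>n. (LBINT x. \<bar>f (x + X n) - f x\<bar>) * \<bar>c\<bar>) \<longlonglongrightarrow> 0 * \<bar>c\<bar>"
    using assms X by (intro tendsto_intros) (auto simp: L1_shift_continuous_def)
  then show "(\<lambda>n. \<integral>x. \<bar>f (x + X n) * c - f x * c\<bar> \<partial>lborel) \<longlonglongrightarrow> 0"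
    by (simp add: left_diff_distrib[symmetric] abs_mult)
qed

text \<open>Induction over integrable functions reduces the claim to indicators, and outer
  regularity replaces a Borel set by an open one.\<close>

lemma integrable_L1_shift_continuous:
  fixes f :: "'a::euclidean_space \<Rightarrow> real"
  assumes "integrable lborel f" shows "L1_shift_continuous f"
  using assms
proof (induction rule: integrable_induct)
  case (base A c)
  have A: "A \<in> sets borel" using base by simp
  have iA: "integrable lborel (indicator A :: 'a \<Rightarrow> real)"
    using base by (simp add: integrable_indicator_iff)
  have "L1_shift_continuous (indicator A :: 'a \<Rightarrow> real)"
  proof (rule L1_shift_continuous_approx[OF iA])
    fix e :: real assume e: "e > 0"
    obtain U where U: "open U" "A \<subseteq> U" "emeasure lborel (U - A) < e"
      using outer_regular_lborel[OF A e] by auto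
    have "emeasure lborel U = emeasure lborel A + emeasure lborel (U - A)"
      using U A by (subst plus_emeasure) (auto simp: Un_absorb1)
    also have "\<dots> < \<infinity>" using base U(3) by (auto simp: less_top[symmetric] dest: order_less_trans[OF _ ennreal_less_top])
    finally have fU: "emeasure lborel U < \<infinity>" .
    have "(LBINT x. \<bar>indicator A x - indicator U x :: real\<bar>) = (LBINT x. indicator (U - A) x)"
      using U(2) by (intro Bochner_Integration.integral_cong) (auto simp: indicator_def)
    also have "\<dots> = measure lborel (U - A)" by simp
    also have "\<dots> \<le> e" using U(3) e
      by (simp add: measure_def) (metis enn2real_leI less_le)
    finally show "\<exists>g. integrable lborel g \<and> L1_shift_continuous g \<and> (LBINT x. \<bar>indicator A x - g x\<bar>) \<le> e"
      using fU U L1_shift_continuous_open[OF U(1) fU]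
      by (intro exI[of _ "indicator U"]) (simp add: integrable_indicator_iff)
  qed
  then show ?case using L1_shift_continuous_cmult by simp
next
  case (add f g)
  show ?case unfolding L1_shift_continuous_def
  proof (intro allI impI)
    fix X :: "nat \<Rightarrow> 'a" assume X: "X \<longlonglongrightarrow> 0"
    have i: "integrable lborel (\<lambda>x. f (x + z))" "integrable lborel (\<lambda>x. g (x + z))" for z
      using add by (simp_all add: lborel_integral_shift')
    have "(\<lambda>n. (LBINT x. \<bar>f (x + X n) - f x\<bar>) + (LBINT x. \<bar>g (x + X n) - g x\<bar>)) \<longlonglongrightarrow> 0 + 0"
      using add X by (intro tendsto_intros) (auto simp: L1_shift_continuous_def)
    then have t: "(\<lambda>n. (LBINT x. \<bar>f (x + X n) - f x\<bar>) + (LBINT x. \<bar>g (x + X n) - g x\<bar>)) \<longlonglongrightarrow> 0" by simp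
    show "(\<lambda>n. \<integral>x. \<bar>f (x + X n) + g (x + X n) - (f x + g x)\<bar> \<partial>lborel) \<longlonglongrightarrow> 0"
    proof (rule tendsto_sandwich[OF _ _ tendsto_const t])
      show "\<forall>\<^sub>F n in sequentially. (LBINT x. \<bar>f (x + X n) + g (x + X n) - (f x + g x)\<bar>)
        \<le> (LBINT x. \<bar>f (x + X n) - f x\<bar>) + (LBINT x. \<bar>g (x + X n) - g x\<bar>)"
      proof (intro always_eventually allI)
        fix n
        have "(LBINT x. \<bar>f (x + X n) + g (x + X n) - (f x + g x)\<bar>)
          \<le> (LBINT x. \<bar>f (x + X n) - f x\<bar> + \<bar>g (x + X n) - g x\<bar>)"
          using i add by (intro integral_mono) auto
        also have "\<dots> = (LBINT x. \<bar>f (x + X n) - f x\<bar>) + (LBINT x. \<bar>g (x + X n) - g x\<bar>)"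
          using i add by simp
        finally show "(LBINT x. \<bar>f (x + X n) + g (x + X n) - (f x + g x)\<bar>) \<le> \<dots>" .
      qed
    qed auto
  qed
next
  case (lim f s)
  show ?case
  proof (rule L1_shift_continuous_approx[OF \<open>integrable lborel f\<close>])
    fix e :: real assume e: "e > 0"
    have "(\<lambda>i. \<integral>x. \<bar>f x - s i x\<bar> \<partial>lborel) \<longlonglongrightarrow> (\<integral>x. 0 \<partial>(lborel :: 'a measure))"
    proof (rule integral_dominated_convergence[where w = "\<lambda>x. 3 * \<bar>f x\<bar>"])
      show "AE x in lborel. (\<lambda>i. \<bar>f x - s i x\<bar>) \<longlonglongrightarrow> 0"
      proof (rule AE_I2)
        fix x
        have "(\<lambda>i. \<bar>f x - s i x\<bar>) \<longlonglongrightarrow> \<bar>f x - f x\<bar>" by (intro tendsto_intros lim) auto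
        then show "(\<lambda>i. \<bar>f x - s i x\<bar>) \<longlonglongrightarrow> 0" by simp
      qed
      show "AE x in lborel. norm \<bar>f x - s i x\<bar> \<le> 3 * \<bar>f x\<bar>" for i
      proof (rule AE_I2)
        fix x
        have "norm (s i x) \<le> 2 * norm (f x)" by (rule lim) simp
        then show "norm \<bar>f x - s i x\<bar> \<le> 3 * \<bar>f x\<bar>" by simp
      qed
    qed (use lim in \<open>auto intro: borel_measurable_integrable\<close>)
    then have "\<forall>\<^sub>F i in sequentially. (LBINT x. \<bar>f x - s i x\<bar>) < e"
      using e by (simp add: order_tendsto_iff)
    then obtain i where "(LBINT x. \<bar>f x - s i x\<bar>) < e" by (auto simp: eventually_sequentially)
    then show "\<exists>g. integrable lborel g \<and> L1_shift_continuous g \<and> (LBINT x. \<bar>f x - g x\<bar>) \<le> e"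
      using lim by (intro exI[of _ "s i"]) auto
  qed
qed

lemma bounded_mult_integrable:
  fixes F c :: "'a::euclidean_space \<Rightarrow> real"
  assumes "integrable lborel F" "c \<in> borel_measurable borel" "\<And>x. \<bar>c x\<bar> \<le> (B::real)"
  shows "integrable lborel (\<lambda>x. c x * F x)"
proof (rule Bochner_Integration.integrable_bound[of lborel "\<lambda>x. \<bar>B\<bar> * F x"])
  show "AE x in lborel. norm (c x * F x) \<le> norm (\<bar>B\<bar> * F x)"
    using assms(3) by (intro AE_I2) (auto simp: abs_mult intro!: mult_right_mono order_trans[OF assms(3) abs_ge_self])
qed (use assms in auto)

lemma square_integrable_integrable:
  fixes f :: "'a::euclidean_space \<Rightarrow> real"
  assumes b: "bounded \<Omega>" and S: "\<Omega> \<in> sets borel" and f: "f \<in> borel_measurable borel" "\<And>x. x \<notin> \<Omega> \<Longrightarrow> f x = 0"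
    and f2: "integrable lborel (\<lambda>x. (f x)\<^sup>2)"
  shows "integrable lborel f"
proof (rule integrable_dominated[of "\<lambda>x. indicator \<Omega> x + (f x)\<^sup>2"])
  have "integrable lborel (indicator \<Omega> :: 'a \<Rightarrow> real)"
    using S emeasure_bounded_finite[OF b] by (intro integrable_real_indicator) auto
  then show "integrable lborel (\<lambda>x. indicator \<Omega> x + (f x)\<^sup>2)" using f2 by simp
  fix x
  have "\<bar>f x\<bar> \<le> 1 + (f x)\<^sup>2" using sum_squares_bound[of "\<bar>f x\<bar>" 1] by (simp add: power2_eq_square)
  then show "norm (f x) \<le> norm (indicator \<Omega> x + (f x)\<^sup>2)" using f(2)[of x] by (cases "x \<in> \<Omega>") auto
qed (use f(1) in simp)

section \<open>Mollification\<close>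

definition conv :: "('a::euclidean_space \<Rightarrow> real) \<Rightarrow> ('a \<Rightarrow> real) \<Rightarrow> 'a \<Rightarrow> real" where
  "conv f k x = (LBINT y. f y * k (x - y))"

lemma conv_integrand_integrable:
  fixes f k :: "'a::euclidean_space \<Rightarrow> real"
  assumes "integrable lborel f" "continuous_on UNIV k" "\<And>x. \<bar>k x\<bar> \<le> B"
  shows "integrable lborel (\<lambda>y. f y * k (x - y))"
proof -
  have [measurable]: "k \<in> borel_measurable borel" by (rule borel_measurable_continuous_onI[OF assms(2)])
  have "(\<lambda>y. k (x - y)) \<in> borel_measurable borel" by measurable
  from bounded_mult_integrable[OF assms(1) this assms(3)] show ?thesis by (simp only: mult.commute)
qed

lemma continuous_conv:
  fixes f k :: "'a::euclidean_space \<Rightarrow> real"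
  assumes f: "integrable lborel f" and k: "uniformly_continuous_on UNIV k" and B: "\<And>x. \<bar>k x\<bar> \<le> B"
  shows "continuous_on UNIV (conv f k)"
proof (rule continuous_onI)
  fix x :: 'a and e :: real assume e: "e > 0"
  have kc: "continuous_on UNIV k" using k by (rule uniformly_continuous_imp_continuous)
  let ?I = "(LBINT y. \<bar>f y\<bar>) + 1"
  have I: "?I > 0" by (simp add: add_nonneg_pos)
  obtain d where d: "d > 0" "\<And>x x'. dist x' x < d \<Longrightarrow> dist (k x') (k x) < e / ?I"
    using k[unfolded uniformly_continuous_on_def, rule_format, of "e / ?I"] e I by (auto simp: mult_pos_pos)
  show "\<exists>d>0. \<forall>x'\<in>UNIV. dist x' x < d \<longrightarrow> dist (conv f k x') (conv f k x) \<le> e"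
  proof (intro exI conjI ballI impI)
    fix x' assume x': "dist x' x < d"
    have "conv f k x' - conv f k x = (LBINT y. f y * k (x' - y) - f y * k (x - y))"
      unfolding conv_def by (simp add: conv_integrand_integrable[OF f kc B])
    also have "\<bar>\<dots>\<bar> \<le> (LBINT y. \<bar>f y * k (x' - y) - f y * k (x - y)\<bar>)"
      by (rule integral_abs_bound)
    also have "\<dots> \<le> (LBINT y. (e / ?I) * \<bar>f y\<bar>)"
    proof (rule integral_mono)
      fix y
      have "dist (k (x' - y)) (k (x - y)) < e / ?I" using x' by (intro d(2)) (simp add: dist_norm)
      then show "\<bar>f y * k (x' - y) - f y * k (x - y)\<bar> \<le> (e / ?I) * \<bar>f y\<bar>"
        using mult_left_mono[of "\<bar>k (x' - y) - k (x - y)\<bar>" "e / ?I" "\<bar>f y\<bar>"]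
        by (simp add: right_diff_distrib[symmetric] abs_mult dist_real_def mult.commute)
    qed (use f conv_integrand_integrable[OF f kc B] in auto)
    also have "\<dots> = e * ((?I - 1) / ?I)" by simp
    also have "\<dots> \<le> e * 1" using e I by (intro mult_left_mono) auto
    finally show "dist (conv f k x') (conv f k x) \<le> e" by (simp add: dist_real_def)
  qed (use d in auto)
qed

text \<open>The bump has mass 1, so \<open>conv f (bump r) x - f x\<close> is an average of
  \<open>f (x + z) - f x\<close> over \<open>norm z < r\<close>, and exchanging the integrals bounds
  its L1 norm by the modulus of continuity of translations. The computation uses nonnegative
  integrals, so that integrability of the mollification comes out as a conclusion.\<close>

lemma conv_bump_L1:
  fixes f :: "'a::euclidean_space \<Rightarrow> real"
  assumes f: "integrable lborel f" and r: "0 < r"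
    and w: "\<And>z. norm z < r \<Longrightarrow> (LBINT x. \<bar>f (x + z) - f x\<bar>) \<le> e"
  shows "integrable lborel (conv f (bump r))" "(LBINT x. \<bar>conv f (bump r) x - f x\<bar>) \<le> e"
proof -
  have [measurable]: "f \<in> borel_measurable borel" using borel_measurable_integrable[OF f] by simp
  have kc: "continuous_on UNIV (bump r :: 'a \<Rightarrow> real)" using Ck_on_bump' by (rule Ck_on_continuous)
  then have [measurable]: "(bump r :: 'a \<Rightarrow> real) \<in> borel_measurable borel" by (rule borel_measurable_continuous_onI)
  have bi: "integrable lborel (\<lambda>y. bump r (x - y))" for x :: 'a
  proof -
    have "integrable lborel (\<lambda>y. bump r (y + (- x)))"
      using bump_integrable[OF r, where 'a='a] by (simp only: lborel_integral_shift'(2)[of "bump r"])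
    moreover have "bump r (y + (- x)) = bump r (x - y)" for y using bump_uminus[of r "x - y"] by simp
    ultimately show ?thesis by simp
  qed
  have bI: "(LBINT y. bump r (x - y)) = 1" for x :: 'a
  proof -
    have "(LBINT y. bump r (y + (- x))) = 1"
      using bump_integral[OF r, where 'a='a] lborel_integral_shift'(1)[of "bump r" "-x"] by simp
    moreover have "bump r (y + (- x)) = bump r (x - y)" for y using bump_uminus[of r "x - y"] by simp
    ultimately show ?thesis by simp
  qed
  obtain B where B: "\<And>x::'a. \<bar>bump r x\<bar> \<le> B"
  proof -
    have "bounded (bump r ` cball (0::'a) r)"
      by (intro compact_imp_bounded compact_continuous_image continuous_on_subset[OF kc]) auto
    then obtain B where "\<And>x::'a. x \<in> cball 0 r \<Longrightarrow> \<bar>bump r x\<bar> \<le> B" by (fastforce simp: bounded_iff)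
    moreover have "\<bar>bump r x\<bar> \<le> max B 0" if "x \<notin> cball (0::'a) r" for x
      using bump_support[OF _ r, of x] that by (cases "bump r x = 0") auto
    ultimately have "\<bar>bump r x\<bar> \<le> max B 0" for x :: 'a
      by (cases "x \<in> cball 0 r") (auto simp: max_def, force+)
    then show ?thesis by (rule that)
  qed
  have e0: "0 \<le> e" using w[of 0] r by simp
  have m: "conv f (bump r) \<in> borel_measurable lborel" unfolding conv_def by measurable
  have nn: "(\<integral>\<^sup>+x. ennreal \<bar>conv f (bump r) x - f x\<bar> \<partial>lborel) \<le> ennreal e"
  proof -
    have "(\<integral>\<^sup>+x. ennreal \<bar>conv f (bump r) x - f x\<bar> \<partial>lborel) \<le>
      (\<integral>\<^sup>+x. \<integral>\<^sup>+z. ennreal (\<bar>f (x + z) - f x\<bar> * bump r z) \<partial>lborel \<partial>lborel)"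
    proof (rule nn_integral_mono)
      fix x
      have ci: "integrable lborel (\<lambda>y. f y * bump r (x - y))"
        by (rule conv_integrand_integrable[OF f kc B])
      have "conv f (bump r) x - f x = (LBINT y. f y * bump r (x - y)) - (LBINT y. f x * bump r (x - y))"
        by (simp add: conv_def bI)
      also have "\<dots> = (LBINT y. f y * bump r (x - y) - f x * bump r (x - y))"
        using ci bi by simp
      finally have eq: "conv f (bump r) x - f x = (LBINT y. f y * bump r (x - y) - f x * bump r (x - y))" .
      have ii: "integrable lborel (\<lambda>y. f y * bump r (x - y) - f x * bump r (x - y))"
        using ci bi by simp
      have "ennreal \<bar>conv f (bump r) x - f x\<bar> \<le> (\<integral>\<^sup>+y. ennreal \<bar>f y * bump r (x - y) - f x * bump r (x - y)\<bar> \<partial>lborel)"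
        unfolding eq using ii
        by (subst nn_integral_eq_integral) (auto intro!: ennreal_leI integral_abs_bound)
      also have "\<dots> = (\<integral>\<^sup>+z. ennreal \<bar>f (z + x) * bump r (x - (z + x)) - f x * bump r (x - (z + x))\<bar> \<partial>lborel)"
        by (rule lborel_nn_integral_shift[symmetric]) measurable
      also have "\<dots> = (\<integral>\<^sup>+z. ennreal (\<bar>f (x + z) - f x\<bar> * bump r z) \<partial>lborel)"
        using r by (intro nn_integral_cong arg_cong[where f=ennreal])
         (simp add: left_diff_distrib[symmetric] abs_mult add.commute)
      finally show "ennreal \<bar>conv f (bump r) x - f x\<bar> \<le> (\<integral>\<^sup>+z. ennreal (\<bar>f (x + z) - f x\<bar> * bump r z) \<partial>lborel)" .
    qed
    also have "\<dots> = (\<integral>\<^sup>+z. \<integral>\<^sup>+x. ennreal (\<bar>f (x + z) - f x\<bar> * bump r z) \<partial>lborel \<partial>lborel)"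
      by (rule lborel_pair.Fubini') measurable
    also have "\<dots> \<le> (\<integral>\<^sup>+z. ennreal (e * bump r z) \<partial>(lborel :: 'a measure))"
    proof (rule nn_integral_mono)
      fix z :: 'a
      show "(\<integral>\<^sup>+x. ennreal (\<bar>f (x + z) - f x\<bar> * bump r z) \<partial>lborel) \<le> ennreal (e * bump r z)"
      proof (cases "norm z < r")
        case True
        have i: "integrable lborel (\<lambda>x. \<bar>f (x + z) - f x\<bar> * bump r z)"
          using f by (auto simp: lborel_integral_shift'(2)[of f])
        show ?thesis
          using w[OF True] r by (subst nn_integral_eq_integral[OF i]) (auto intro!: ennreal_leI mult_right_mono)
      next
        case False
        then have "bump r z = 0" using bump_support[OF _ r] by blast
        then show ?thesis by simp
      qed
    qed
    also have "\<dots> = ennreal (\<integral>z. e * bump r z \<partial>(lborel :: 'a measure))"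
      using bump_integrable[OF r, where 'a='a] e0 r by (intro nn_integral_eq_integral) auto
    also have "\<dots> = ennreal e" using bump_integral[OF r, where 'a='a] by simp
    finally show ?thesis .
  qed
  have d: "integrable lborel (\<lambda>x. conv f (bump r) x - f x)"
  proof (rule integrableI_bounded)
    show "(\<integral>\<^sup>+ x. ennreal (norm (conv f (bump r) x - f x)) \<partial>lborel) < \<infinity>"
      using nn by (auto simp: less_top[symmetric] top_unique)
  qed (use m in measurable)
  show "integrable lborel (conv f (bump r))"
    using Bochner_Integration.integrable_add[OF d f] by simp
  show "(LBINT x. \<bar>conv f (bump r) x - f x\<bar>) \<le> e"
    using nn d e0 by (subst (asm) nn_integral_eq_integral) auto
qed

lemma conv_bump_tendsto_L1:
  fixes f :: "'a::euclidean_space \<Rightarrow> real"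
  assumes f: "integrable lborel f" and r: "\<And>n. 0 < r n" "r \<longlonglongrightarrow> 0"
  shows "integrable lborel (conv f (bump (r n)))"
    "(\<lambda>n. \<integral>x. \<bar>conv f (bump (r n)) x - f x\<bar> \<partial>lborel) \<longlonglongrightarrow> 0"
proof -
  let ?w = "\<lambda>z. \<integral>x. \<bar>f (x + z) - f x\<bar> \<partial>lborel"
  have i: "integrable lborel (\<lambda>x. f (x + z))" for z
    using f by (simp add: lborel_integral_shift'(2)[of f])
  have wle: "?w z \<le> 2 * (LBINT x. \<bar>f x\<bar>)" for z
  proof -
    have "?w z \<le> (LBINT x. \<bar>f (x + z)\<bar> + \<bar>f x\<bar>)"
      using i f by (intro integral_mono) auto
    also have "\<dots> = 2 * (LBINT x. \<bar>f x\<bar>)"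
      using i f lborel_integral_shift'(1)[of "\<lambda>x. \<bar>f x\<bar>" z] by simp
    finally show ?thesis .
  qed
  show "integrable lborel (conv f (bump (r n)))"
    by (rule conv_bump_L1(1)[OF f r(1) wle])
  have "(?w \<longlongrightarrow> 0) (at 0)"
    using integrable_L1_shift_continuous[OF f]
    unfolding tendsto_at_iff_sequentially L1_shift_continuous_def comp_def by blast
  show "(\<lambda>n. \<integral>x. \<bar>conv f (bump (r n)) x - f x\<bar> \<partial>lborel) \<longlonglongrightarrow> 0"
  proof (rule LIMSEQ_I)
    fix e :: real assume e: "e > 0"
    obtain d where d: "d > 0" "\<And>z. z \<noteq> 0 \<Longrightarrow> norm z < d \<Longrightarrow> ?w z < e / 2"
      using LIM_D[OF \<open>(?w \<longlongrightarrow> 0) (at 0)\<close>, of "e/2"] e by auto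
    have d': "?w z \<le> e / 2" if "norm z < d" for z
      using d(2)[of z] that e by (cases "z = 0") auto
    obtain N where N: "\<And>n. n \<ge> N \<Longrightarrow> r n < d"
      using order_tendstoD(2)[OF r(2) d(1)] by (auto simp: eventually_sequentially)
    show "\<exists>N. \<forall>n\<ge>N. norm ((LBINT x. \<bar>conv f (bump (r n)) x - f x\<bar>) - 0) < e"
    proof (intro exI allI impI)
      fix n assume "N \<le> n"
      then have "(LBINT x. \<bar>conv f (bump (r n)) x - f x\<bar>) \<le> e / 2"
        using N[of n] by (intro conv_bump_L1(2)[OF f r(1)] d') auto
      then show "norm ((LBINT x. \<bar>conv f (bump (r n)) x - f x\<bar>) - 0) < e" using e by simp
    qed
  qed
qed

section \<open>Weak derivatives\<close>

lemma GDERIV_unique: "GDERIV f x :> a \<Longrightarrow> GDERIV f x :> b \<Longrightarrow> a = b"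
  unfolding gderiv_def by (drule (1) has_derivative_unique) (metis vector_eq_ldot)

lemma GDERIV_frechet: "GDERIV f x :> a \<Longrightarrow> frechet_derivative f (at x) b = a \<bullet> b"
  unfolding gderiv_def by (subst frechet_derivative_at[symmetric]) (auto simp: inner_commute)

lemma GDERIV_basis:
  "GDERIV f x :> a \<Longrightarrow> GDERIV f x :> (\<Sum>b\<in>Basis. frechet_derivative f (at x) b *\<^sub>R b)"
  by (simp add: GDERIV_frechet euclidean_representation)

lemma test_function_GDERIV:
  assumes "test_function \<Omega> \<eta>"
  shows "\<exists>\<eta>'. \<forall>x. GDERIV \<eta> x :> \<eta>' x"
  using assms unfolding test_function_def by (metis Ck_on.simps(2) UNIV_I)

lemma support_pd:
  fixes \<eta> :: "'a::euclidean_space \<Rightarrow> real"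
  assumes "x \<notin> closure {x. \<eta> x \<noteq> 0}"
  shows "GDERIV \<eta> x :> 0"
proof -
  let ?U = "- closure {x. \<eta> x \<noteq> 0}"
  have "((\<lambda>x. 0) has_derivative (\<lambda>h. 0)) (at x)" by simp
  then have "(\<eta> has_derivative (\<lambda>h. 0)) (at x)"
    by (rule has_derivative_transform_within_open[of _ _ _ UNIV ?U])
       (use assms closure_subset[of "{x. \<eta> x \<noteq> 0}"] in auto)
  then show ?thesis by (simp add: gderiv_def)
qed

lemma test_function_pd:
  assumes "test_function \<Omega> \<eta>" "b \<in> Basis"
  shows "test_function \<Omega> (\<lambda>x. frechet_derivative \<eta> (at x) b)"
proof (rule test_functionI_support)
  obtain \<eta>' where \<eta>': "\<And>x. GDERIV \<eta> x :> \<eta>' x" using test_function_GDERIV[OF assms(1)] by blast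
  show "Ck_on k UNIV UNIV (\<lambda>x. frechet_derivative \<eta> (at x) b)" for k
  proof -
    obtain f' where f': "\<And>x. GDERIV \<eta> x :> f' x" "\<And>b. b \<in> Basis \<Longrightarrow> Ck_on k UNIV UNIV (\<lambda>x. f' x \<bullet> b)"
      using assms(1) unfolding test_function_def by (metis Ck_on.simps(2) UNIV_I)
    then show ?thesis using assms(2) by (simp add: GDERIV_frechet[OF f'(1)])
  qed
  let ?K = "closure {x. \<eta> x \<noteq> 0}"
  show "compact ?K" "?K \<subseteq> \<Omega>" using assms(1) by (auto simp: test_function_def)
  show "frechet_derivative \<eta> (at x) b = 0" if "x \<notin> ?K" for x
    using GDERIV_frechet[OF support_pd[OF that]] by simp
qed

lemma test_function_Ck: "test_function A \<eta> \<Longrightarrow> Ck_on k UNIV UNIV \<eta>"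
  by (simp add: test_function_def)

lemma test_function_continuous: "test_function A \<eta> \<Longrightarrow> continuous_on B \<eta>"
  by (rule continuous_on_subset[OF test_function_Ck[of A \<eta> 0, unfolded Ck_on.simps] subset_UNIV])

lemma compact_support_uniformly_continuous:
  fixes k :: "'a::euclidean_space \<Rightarrow> real"
  assumes "continuous_on UNIV k" "bounded K" "\<And>x. x \<notin> K \<Longrightarrow> k x = 0"
  shows "uniformly_continuous_on UNIV k" "\<exists>B. \<forall>x. \<bar>k x\<bar> \<le> B"
proof -
  obtain R where R: "K \<subseteq> cball 0 R" using assms(2) bounded_subset_ballD[of K 0] ball_subset_cball by (meson order_trans)
  have uc: "uniformly_continuous_on (cball 0 (R + 1)) k"
    by (rule compact_uniformly_continuous) (auto intro: continuous_on_subset[OF assms(1)])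
  show "uniformly_continuous_on UNIV k"
    unfolding uniformly_continuous_on_def
  proof (intro allI impI)
    fix e :: real assume "e > 0"
    then obtain d where d: "d > 0"
      "\<And>x x'. x \<in> cball 0 (R+1) \<Longrightarrow> x' \<in> cball 0 (R+1) \<Longrightarrow> dist x' x < d \<Longrightarrow> dist (k x') (k x) < e"
      using uc unfolding uniformly_continuous_on_def by meson
    show "\<exists>d>0. \<forall>x\<in>UNIV. \<forall>x'\<in>UNIV. dist x' x < d \<longrightarrow> dist (k x') (k x) < e"
    proof (intro exI[of _ "min d 1"] conjI ballI impI)
      fix x x' :: 'a assume l: "dist x' x < min d 1"
      show "dist (k x') (k x) < e"
      proof (cases "x \<in> cball 0 R \<or> x' \<in> cball 0 R")
        case True
        have "x \<in> cball 0 (R+1) \<and> x' \<in> cball 0 (R+1)"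
          using True l norm_triangle_ineq2[of x x'] norm_triangle_ineq2[of x' x]
          by (auto simp: dist_norm norm_minus_commute)
        then show ?thesis using d(2) l by auto
      next
        case False
        then have "k x = 0" "k x' = 0" using R assms(3) by blast+
        then show ?thesis using \<open>e > 0\<close> by simp
      qed
    qed (use d in auto)
  qed
  have "compact (k ` cball 0 R)"
    by (intro compact_continuous_image continuous_on_subset[OF assms(1)]) auto
  then obtain B where B: "\<And>x. x \<in> cball 0 R \<Longrightarrow> \<bar>k x\<bar> \<le> B"
    using compact_imp_bounded by (fastforce simp: bounded_iff)
  have "\<bar>k x\<bar> \<le> max B 0" for x
  proof (cases "x \<in> cball 0 R")
    case True then show ?thesis using B[of x] by linarith
  next
    case False
    then have "k x = 0" using R assms(3) by blast
    then show ?thesis by simp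
  qed
  then show "\<exists>B. \<forall>x. \<bar>k x\<bar> \<le> B" by blast
qed

lemma test_function_uniform:
  assumes "test_function \<Omega> \<eta>"
  shows "uniformly_continuous_on UNIV \<eta>" "\<exists>B. \<forall>x. \<bar>\<eta> x\<bar> \<le> B" "integrable lborel \<eta>"
proof -
  let ?K = "closure {x. \<eta> x \<noteq> 0}"
  have *: "continuous_on UNIV \<eta>" "bounded ?K" "\<And>x. x \<notin> ?K \<Longrightarrow> \<eta> x = 0"
    using test_function_continuous[OF assms] assms closure_subset[of "{x. \<eta> x \<noteq> 0}"]
    by (auto simp: test_function_def compact_imp_bounded)
  show "uniformly_continuous_on UNIV \<eta>" "\<exists>B. \<forall>x. \<bar>\<eta> x\<bar> \<le> B"
    using compact_support_uniformly_continuous[OF *] by auto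
  show "integrable lborel \<eta>" using integrable_continuous_compact_support[OF *] .
qed

lemma conv_integrable:
  assumes "integrable lborel f" "test_function \<Omega> k"
  shows "integrable lborel (\<lambda>y. f y * k (x - y))"
proof -
  obtain B where "\<And>x. \<bar>k x\<bar> \<le> B" using test_function_uniform(2)[OF assms(2)] by blast
  then show ?thesis by (rule conv_integrand_integrable[OF assms(1) test_function_continuous[OF assms(2)]])
qed

lemma conv_continuous:
  assumes "integrable lborel f" "test_function \<Omega> k"
  shows "continuous_on UNIV (conv f k)"
proof -
  obtain B where "\<And>x. \<bar>k x\<bar> \<le> B" using test_function_uniform(2)[OF assms(2)] by blast
  then show ?thesis by (rule continuous_conv[OF assms(1) test_function_uniform(1)[OF assms(2)]])
qed

section \<open>Derivatives of mollified functions\<close>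

lemma inner_GDERIV_basis:
  fixes h :: "'a::euclidean_space"
  shows "h \<bullet> (\<Sum>b\<in>Basis. a b *\<^sub>R b) = (\<Sum>b\<in>Basis. a b * (h \<bullet> b))"
  by (simp add: inner_sum_right)

text \<open>The partial derivatives are uniformly continuous, and the mean value inequality turns
  their oscillation into the remainder. Uniformity in the base point \<open>z\<close> is what allows
  differentiation under the convolution integral.\<close>

lemma test_function_uniform_deriv:
  fixes k :: "'a::euclidean_space \<Rightarrow> real"
  assumes k: "test_function \<Omega> k" and e: "e > 0"
  obtains d where "d > 0" "\<And>z h. norm h < d \<Longrightarrow>
    \<bar>k (z + h) - k z - (\<Sum>b\<in>Basis. frechet_derivative k (at z) b * (h \<bullet> b))\<bar> \<le> e * norm h"
proof -
  let ?D = "\<lambda>z b. frechet_derivative k (at z) b"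
  obtain k' where "\<And>x. GDERIV k x :> k' x" using test_function_GDERIV[OF k] by blast
  then have kd: "(k has_derivative (\<lambda>h. \<Sum>b\<in>Basis. ?D z b * (h \<bullet> b))) (at z)" for z
    using GDERIV_basis[of k z "k' z"] by (simp add: gderiv_def inner_GDERIV_basis)
  \<comment> \<open>The operator norm of a difference of gradients is at most the sum of the
    componentwise differences, hence the division by the dimension.\<close>
  define e' where "e' = e / DIM('a)"
  have e': "e' > 0" using e by (simp add: e'_def)
  have "\<forall>b\<in>Basis. \<exists>d>0. \<forall>z z'. dist z' z < d \<longrightarrow> \<bar>?D z' b - ?D z b\<bar> < e'"
    using test_function_uniform(1)[OF test_function_pd[OF k]] e'
    unfolding uniformly_continuous_on_def by (simp add: dist_real_def)
  then obtain d where d: "\<And>b. b \<in> Basis \<Longrightarrow> d b > 0"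
    "\<And>b z z'. b \<in> Basis \<Longrightarrow> dist z' z < d b \<Longrightarrow> \<bar>?D z' b - ?D z b\<bar> < e'"
    by metis
  define \<delta> where "\<delta> = Min (d ` Basis)"
  have \<delta>: "\<delta> > 0" "\<And>b. b \<in> Basis \<Longrightarrow> \<delta> \<le> d b"
    using d(1) by (auto simp: \<delta>_def)
  show ?thesis
  proof (rule that[OF \<delta>(1)])
    fix z h :: 'a assume h: "norm h < \<delta>"
    have "norm (k (z + h) - k z - (\<Sum>b\<in>Basis. ?D z b * ((z + h - z) \<bullet> b))) \<le> norm (z + h - z) * e"
    proof (rule differentiable_bound_linearization[where S = "ball z \<delta>" and f' = "\<lambda>z h. \<Sum>b\<in>Basis. ?D z b * (h \<bullet> b)"])
      show "z + t *\<^sub>R (z + h - z) \<in> ball z \<delta>" if "t \<in> {0..1}" for t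
        using h that by (auto simp: dist_norm intro: le_less_trans[OF mult_left_le_one_le])
      show "(k has_derivative (\<lambda>h. \<Sum>b\<in>Basis. ?D x b * (h \<bullet> b))) (at x within ball z \<delta>)" for x
        by (rule has_derivative_at_withinI[OF kd])
      show "z \<in> ball z \<delta>" using \<delta> by simp
      show "onorm ((\<lambda>h. \<Sum>b\<in>Basis. ?D x b * (h \<bullet> b)) - (\<lambda>h. \<Sum>b\<in>Basis. ?D z b * (h \<bullet> b))) \<le> e"
        if x: "x \<in> ball z \<delta>" for x
      proof (rule onorm_le)
        fix v :: 'a
        have "norm (((\<lambda>h. \<Sum>b\<in>Basis. ?D x b * (h \<bullet> b)) - (\<lambda>h. \<Sum>b\<in>Basis. ?D z b * (h \<bullet> b))) v)
          = \<bar>\<Sum>b\<in>Basis. (?D x b - ?D z b) * (v \<bullet> b)\<bar>"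
          by (simp add: sum_subtractf left_diff_distrib)
        also have "\<dots> \<le> (\<Sum>b\<in>Basis. \<bar>?D x b - ?D z b\<bar> * \<bar>v \<bullet> b\<bar>)"
          by (rule order_trans[OF sum_abs]) (simp add: abs_mult)
        also have "\<dots> \<le> (\<Sum>b\<in>(Basis::'a set). e' * norm v)"
        proof (intro sum_mono mult_mono)
          fix b :: 'a assume b: "b \<in> Basis"
          show "\<bar>?D x b - ?D z b\<bar> \<le> e'"
            using d(2)[OF b, of x z] \<delta>(2)[OF b] x by (auto simp: dist_commute)
          show "\<bar>v \<bullet> b\<bar> \<le> norm v" using b by (rule Basis_le_norm)
        qed (use e' in auto)
        also have "\<dots> = e * norm v" by (simp add: e'_def)
        finally show "norm (((\<lambda>h. \<Sum>b\<in>Basis. ?D x b * (h \<bullet> b)) - (\<lambda>h. \<Sum>b\<in>Basis. ?D z b * (h \<bullet> b))) v) \<le> e * norm v" .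
      qed
    qed
    then show "\<bar>k (z + h) - k z - (\<Sum>b\<in>Basis. ?D z b * (h \<bullet> b))\<bar> \<le> e * norm h"
      by (simp add: mult.commute)
  qed
qed

lemma conv_GDERIV:
  fixes f k :: "'a::euclidean_space \<Rightarrow> real"
  assumes f: "integrable lborel f" and k: "test_function \<Omega> k"
  shows "GDERIV (conv f k) x :> (\<Sum>b\<in>Basis. conv f (\<lambda>z. frechet_derivative k (at z) b) x *\<^sub>R b)"
  unfolding gderiv_def has_derivative_at_alt
proof (intro conjI allI impI)
  let ?D = "\<lambda>z b. frechet_derivative k (at z) b"
  show "bounded_linear (\<lambda>h. h \<bullet> (\<Sum>b\<in>Basis. conv f (\<lambda>z. ?D z b) x *\<^sub>R b))"
    by (rule bounded_linear_inner_left)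
  fix e :: real assume e: "e > 0"
  let ?I = "(LBINT y. \<bar>f y\<bar>) + 1"
  have I: "?I > 0" by (simp add: add_nonneg_pos)
  have "e / ?I > 0" using e I by simp
  obtain d where d: "d > 0" "\<And>z h. norm h < d \<Longrightarrow>
      \<bar>k (z + h) - k z - (\<Sum>b\<in>Basis. ?D z b * (h \<bullet> b))\<bar> \<le> e / ?I * norm h"
    using test_function_uniform_deriv[OF k \<open>e / ?I > 0\<close>] by metis
  show "\<exists>d>0. \<forall>y. norm (y - x) < d \<longrightarrow> norm (conv f k y - conv f k x - (y - x) \<bullet> (\<Sum>b\<in>Basis. conv f (\<lambda>z. ?D z b) x *\<^sub>R b)) \<le> e * norm (y - x)"
  proof (intro exI conjI allI impI)
    fix y assume y: "norm (y - x) < d"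
    define h where "h = y - x"
    have ib: "integrable lborel (\<lambda>t. f t * ?D (x - t) b * (h \<bullet> b))" if "b \<in> Basis" for b
      using conv_integrable[OF f test_function_pd[OF k that]] by (intro integrable_mult_left)
    have i1: "integrable lborel (\<lambda>t. f t * k (y - t))" "integrable lborel (\<lambda>t. f t * k (x - t))"
      using conv_integrable[OF f k] by auto
    have i2: "integrable lborel (\<lambda>t. \<Sum>b\<in>Basis. f t * ?D (x - t) b * (h \<bullet> b))"
      using ib by (intro Bochner_Integration.integrable_sum)
    define R where "R t = f t * k (y - t) - f t * k (x - t) - (\<Sum>b\<in>Basis. f t * ?D (x - t) b * (h \<bullet> b))" for t
    have iR: "integrable lborel R" unfolding R_def using i1 i2 by simp
    have "(LBINT t. R t) = (LBINT t. f t * k (y - t)) - (LBINT t. f t * k (x - t))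
       - (LBINT t. (\<Sum>b\<in>Basis. f t * ?D (x - t) b * (h \<bullet> b)))"
      unfolding R_def using i1 i2 by simp
    also have "(LBINT t. (\<Sum>b\<in>Basis. f t * ?D (x - t) b * (h \<bullet> b)))
       = (\<Sum>b\<in>Basis. \<integral>t. f t * ?D (x - t) b * (h \<bullet> b) \<partial>lborel)"
      using ib by (intro Bochner_Integration.integral_sum)
    finally have eq: "conv f k y - conv f k x - (y - x) \<bullet> (\<Sum>b\<in>Basis. conv f (\<lambda>z. ?D z b) x *\<^sub>R b)
      = (LBINT t. R t)"
      unfolding inner_GDERIV_basis conv_def h_def by simp
    have R: "\<bar>R t\<bar> \<le> (e / ?I * norm h) * \<bar>f t\<bar>" for t
    proof -
      have "\<bar>k ((x - t) + h) - k (x - t) - (\<Sum>b\<in>Basis. ?D (x - t) b * (h \<bullet> b))\<bar> \<le> e / ?I * norm h"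
        using y by (intro d(2)) (simp add: h_def)
      moreover have "(x - t) + h = y - t" by (simp add: h_def)
      ultimately have "\<bar>f t\<bar> * \<bar>k (y - t) - k (x - t) - (\<Sum>b\<in>Basis. ?D (x - t) b * (h \<bullet> b))\<bar> \<le> \<bar>f t\<bar> * (e / ?I * norm h)"
        by (intro mult_left_mono) auto
      moreover have "R t = f t * (k (y - t) - k (x - t) - (\<Sum>b\<in>Basis. ?D (x - t) b * (h \<bullet> b)))"
        by (simp add: R_def right_diff_distrib sum_distrib_left mult.assoc)
      ultimately show ?thesis by (simp only: abs_mult mult.commute)
    qed
    have "\<bar>\<integral>t. R t \<partial>lborel\<bar> \<le> (LBINT t. \<bar>R t\<bar>)" by (rule integral_abs_bound)
    also have "\<dots> \<le> (LBINT t. (e / ?I * norm h) * \<bar>f t\<bar>)"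
      using iR f R by (intro integral_mono) auto
    also have "\<dots> = norm h * (e * ((?I - 1) / ?I))" by simp
    also have "\<dots> \<le> norm h * (e * 1)" using e I by (intro mult_left_mono) auto
    finally show "norm (conv f k y - conv f k x - (y - x) \<bullet> (\<Sum>b\<in>Basis. conv f (\<lambda>z. ?D z b) x *\<^sub>R b)) \<le> e * norm (y - x)"
      unfolding eq by (simp add: h_def mult.commute)
  qed (use d in auto)
qed

text \<open>Meant for integrable Borel functions extended by zero; hence the integrals run over the
  whole space and the integrability clauses of \<open>has_weak_partial\<close> are kept
  apart.\<close>

definition wder :: "'a::euclidean_space set \<Rightarrow> 'a \<Rightarrow> ('a \<Rightarrow> real) \<Rightarrow> ('a \<Rightarrow> real) \<Rightarrow> bool" where
  "wder \<Omega> b f g \<longleftrightarrow> (\<forall>\<eta>. test_function \<Omega> \<eta> \<longrightarrow>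
    (LBINT x. f x * frechet_derivative \<eta> (at x) b) = - (LBINT x. g x * \<eta> x))"

lemma bump_test_UNIV: "0 < r \<Longrightarrow> test_function UNIV (bump r :: 'a::euclidean_space \<Rightarrow> real)"
  using bump_test[of r "0::'a" UNIV] by (simp add: bump_def[abs_def])

text \<open>Test with the reflected bump \<open>\<lambda>y. bump r (x - y)\<close>, which is
  admissible once \<open>cball x r\<close> lies in \<Omega>. The sign from the reflection cancels
  the sign in the definition of the weak derivative.\<close>

lemma conv_wder:
  fixes f g :: "'a::euclidean_space \<Rightarrow> real"
  assumes w: "wder \<Omega> b f g" and r: "0 < r" "cball x r \<subseteq> \<Omega>"
  shows "conv f (\<lambda>z. frechet_derivative (bump r) (at z) b) x = conv g (bump r) x"
proof -
  let ?\<eta> = "\<lambda>y. bump r (x - y)"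
  obtain k' where k': "\<And>x::'a. GDERIV (bump r) x :> k' x" using test_function_GDERIV[OF bump_test_UNIV[OF r(1)]] by blast
  have "GDERIV ?\<eta> y :> - k' (x - y)" for y
  proof -
    have "(bump r has_derivative (\<lambda>h. h \<bullet> k' (x - y))) (at (x - y))" using k' by (simp add: gderiv_def)
    moreover have "((\<lambda>y. x - y) has_derivative (\<lambda>h. - h)) (at y)" by (auto intro!: derivative_eq_intros)
    ultimately show ?thesis unfolding gderiv_def
      using has_derivative_compose[of "\<lambda>y. x - y" "\<lambda>h. -h" y UNIV "bump r" "\<lambda>h. h \<bullet> k' (x - y)"] by simp
  qed
  then have fd: "frechet_derivative ?\<eta> (at y) b = - frechet_derivative (bump r) (at (x - y)) b" for y
    using GDERIV_frechet[OF k'] GDERIV_frechet by (metis inner_minus_left)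
  have "(LBINT y. f y * frechet_derivative ?\<eta> (at y) b) = - (LBINT y. g y * ?\<eta> y)"
    using w bump_test[OF r] by (simp add: wder_def)
  then show ?thesis by (simp add: fd conv_def)
qed

text \<open>The second derivatives of the radial bump are computed explicitly and are visibly
  symmetric in \<open>b\<close> and \<open>c\<close>. Through convolution they make the Hessian of a
  mollified function symmetric, which the horizontal first variation uses.\<close>

lemma bump_second_deriv_symmetric:
  fixes b c :: "'a::euclidean_space"
  assumes "0 < r" "b \<in> Basis" "c \<in> Basis"
  shows "frechet_derivative (\<lambda>z. frechet_derivative (bump r) (at z) b) (at x) c =
    frechet_derivative (\<lambda>z. frechet_derivative (bump r) (at z) c) (at x) b"
proof -
  let ?q = "\<lambda>y::'a. r\<^sup>2 - y \<bullet> y"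
  define M where "M = 1 / bump_mass r TYPE('a)"
  have bM: "bump r = (\<lambda>z::'a. hump 0 (?q z) * M)" by (simp add: bump_def fun_eq_iff M_def)
  have q: "GDERIV ?q y :> (-2) *\<^sub>R y" for y
    unfolding gderiv_def by (auto intro!: derivative_eq_intros simp: inner_commute algebra_simps)
  have h: "GDERIV (\<lambda>y. hump j (?q y)) y :> (hump (j+2) (?q y) - j * hump (j+1) (?q y)) *\<^sub>R ((-2) *\<^sub>R y)" for j y
    by (rule GDERIV_DERIV_compose[of ?q y _ "hump j"]) (rule q, rule hump_deriv)
  have h': "((\<lambda>y. hump j (?q y)) has_derivative (\<lambda>v. (hump (j+2) (?q y) - j * hump (j+1) (?q y)) * (-2 * (v \<bullet> y)))) (at y)" for j y
    by (rule has_derivative_eq_rhs[OF h[unfolded gderiv_def]]) (auto simp: algebra_simps)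
  have h0: "((\<lambda>y. hump 0 (?q y)) has_derivative (\<lambda>v. hump 2 (?q y) * (-2 * (v \<bullet> y)))) (at y)" for y
    using h'[of 0 y] by (simp add: numeral_2_eq_2)
  have h2: "((\<lambda>y. hump 2 (?q y)) has_derivative (\<lambda>v. (hump 4 (?q y) - 2 * hump 3 (?q y)) * (-2 * (v \<bullet> y)))) (at y)" for y
    by (rule has_derivative_eq_rhs[OF h'[of 2 y]]) simp
  have d1: "frechet_derivative (bump r) (at z) b = - 2 * (z \<bullet> b) * hump 2 (?q z) * M" for z b :: 'a
  proof -
    have "(bump r has_derivative (\<lambda>v. hump 2 (?q z) * (-2 * (v \<bullet> z)) * M)) (at z)"
      unfolding bM by (auto intro!: derivative_eq_intros h0)
    then show ?thesis by (subst frechet_derivative_at[symmetric]) (auto simp: inner_commute mult.commute)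
  qed
  have "frechet_derivative (\<lambda>z. frechet_derivative (bump r) (at z) b) (at x) c
    = (- 2 * (c \<bullet> b) * hump 2 (?q x) - 2 * (x \<bullet> b) * ((hump 4 (?q x) - 2 * hump 3 (?q x)) * (-2 * (c \<bullet> x)))) * M" for b c
  proof -
    have "((\<lambda>z. - 2 * (z \<bullet> b) * hump 2 (?q z) * M) has_derivative
      (\<lambda>v. (- 2 * (v \<bullet> b) * hump 2 (?q x) - 2 * (x \<bullet> b) * ((hump 4 (?q x) - 2 * hump 3 (?q x)) * (-2 * (v \<bullet> x)))) * M)) (at x)"
      by (rule derivative_eq_intros h2 refl | simp add: fun_eq_iff algebra_simps)+
    then show ?thesis unfolding d1 by (subst frechet_derivative_at[symmetric]) auto
  qed
  note * = this
  show ?thesis unfolding *[of b c] *[of c b] by (simp add: inner_commute algebra_simps)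
qed

text \<open>Difference quotients have integral zero by translation invariance, and dominated
  convergence passes to the derivative. Differentiability is asked for on a neighbourhood
  \<open>V\<close> of \<open>K\<close> only, because mollified functions are controlled only near
  compact subsets of \<Omega>.\<close>

lemma integral_pd_zero:
  fixes w :: "'a::euclidean_space \<Rightarrow> real"
  assumes K: "compact K" "open V" "K \<subseteq> V" and w0: "\<And>x. x \<notin> K \<Longrightarrow> w x = 0"
    and w': "\<And>x. x \<in> V \<Longrightarrow> GDERIV w x :> w' x" and b: "b \<in> Basis"
    and cont: "continuous_on V (\<lambda>x. w' x \<bullet> b)"
  shows "integrable lborel (\<lambda>x. indicator V x * (w' x \<bullet> b))"
    "(LBINT x. indicator V x * (w' x \<bullet> b)) = 0"
proof -
  let ?D = "\<lambda>x. indicator V x * (w' x \<bullet> b)"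
  have cK: "closed K" using K(1) by (rule compact_imp_closed)
  have g0: "GDERIV w x :> 0" if "x \<notin> K" for x
  proof -
    have "((\<lambda>x. 0) has_derivative (\<lambda>h. 0)) (at x)" by simp
    then have "(w has_derivative (\<lambda>h. 0)) (at x)"
      by (rule has_derivative_transform_within_open[of _ _ _ UNIV "- K"]) (use that w0 cK in auto)
    then show ?thesis by (simp add: gderiv_def)
  qed
  have D0: "?D x = 0" if "x \<notin> K" for x
    using GDERIV_unique[OF g0[OF that] w'] by (auto simp: indicator_def)
  have g: "(w has_derivative (\<lambda>h. h \<bullet> (if x \<in> V then w' x else 0))) (at x)" for x
    using w'[of x] g0[of x] K(3) by (auto simp: gderiv_def)
  have cD: "continuous_on UNIV ?D"
  proof -
    have "continuous_on (V \<union> - K) ?D"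
    proof (rule continuous_on_open_Un)
      show "continuous_on V ?D"
        using cont by (rule continuous_on_eq) simp
      show "continuous_on (- K) ?D"
        by (rule continuous_on_eq[of _ "\<lambda>_. 0"]) (use D0 in auto)
    qed (use K cK in auto)
    moreover have "V \<union> - K = UNIV" using K(3) by auto
    ultimately show ?thesis by simp
  qed
  show iD: "integrable lborel ?D"
    using cD compact_imp_bounded[OF K(1)] D0 by (rule integrable_continuous_compact_support)
  have cw: "continuous_on UNIV w"
    using g by (meson continuous_at_imp_continuous_on has_derivative_continuous)
  have iw: "integrable lborel w"
    using cw compact_imp_bounded[OF K(1)] w0 by (rule integrable_continuous_compact_support)
  obtain B where B: "\<And>x. \<bar>?D x\<bar> \<le> B"
    using compact_support_uniformly_continuous(2)[OF cD compact_imp_bounded[OF K(1)] D0] by blast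
  define R where "R n x = (w (x + (1 / Suc n) *\<^sub>R b) - w x) / (1 / Suc n)" for n x
  \<comment> \<open>The closed 1-neighbourhood of \<open>K\<close>: the increments
    \<open>1 / Suc n\<close> are at most 1, so all difference quotients vanish outside it.\<close>
  define K' where "K' = (\<Union>x\<in>K. cball x 1)"
  have K': "compact K'"
  proof -
    have "compact {x + y |x y. x \<in> K \<and> y \<in> cball 0 1}" by (intro compact_sums K compact_cball)
    moreover have "K' = {x + y |x y. x \<in> K \<and> y \<in> cball 0 1}"
      unfolding K'_def by (auto simp: dist_norm) (metis add_diff_cancel_left' diff_add_cancel norm_minus_commute add.commute)
    ultimately show ?thesis by simp
  qed
  have line: "((\<lambda>t. w (x + t *\<^sub>R b)) has_real_derivative ?D (x + t *\<^sub>R b)) (at t)" for x t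
  proof -
    have "((\<lambda>t. x + t *\<^sub>R b) has_derivative (\<lambda>h. h *\<^sub>R b)) (at t)" by (auto intro!: derivative_eq_intros)
    from has_derivative_compose[OF this g[of "x + t *\<^sub>R b"]]
    show ?thesis by (auto simp: has_field_derivative_def inner_commute elim!: has_derivative_eq_rhs)
  qed
  have Rb: "\<bar>R n x\<bar> \<le> B * indicator K' x" for n x
  proof (cases "x \<in> K'")
    case True
    obtain t where "w (x + (1 / Suc n) *\<^sub>R b) - w (x + 0 *\<^sub>R b) = (1 / Suc n - 0) * ?D (x + t *\<^sub>R b)"
      using MVT2[of 0 "1 / Suc n" "\<lambda>t. w (x + t *\<^sub>R b)" "\<lambda>t. ?D (x + t *\<^sub>R b)"] line by auto
    then have "R n x = ?D (x + t *\<^sub>R b)" by (simp add: R_def)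
    then show ?thesis using B[of "x + t *\<^sub>R b"] True by simp
  next
    case False
    then have "x \<notin> K" "x + (1 / Suc n) *\<^sub>R b \<notin> K"
      using b by (auto simp: K'_def dist_norm)
    then show ?thesis using w0 False by (simp add: R_def)
  qed
  have "(\<lambda>n. \<integral>x. R n x \<partial>lborel) \<longlonglongrightarrow> (LBINT x. ?D x)"
  proof (rule integral_dominated_convergence[where w = "\<lambda>x. B * indicator K' x"])
    show "AE x in lborel. (\<lambda>n. R n x) \<longlonglongrightarrow> ?D x"
    proof (rule AE_I2)
      fix x
      have "((\<lambda>h. (w (x + (0 + h) *\<^sub>R b) - w (x + 0 *\<^sub>R b)) / h) \<longlongrightarrow> ?D (x + 0 *\<^sub>R b)) (at 0)"
        using line[of x 0] unfolding DERIV_def .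
      then have "((\<lambda>h. (w (x + h *\<^sub>R b) - w x) / h) \<longlongrightarrow> ?D x) (at 0)" by simp
      moreover have "filterlim (\<lambda>n. 1 / real (Suc n)) (at 0) sequentially"
        using LIMSEQ_inverse_real_of_nat by (simp add: filterlim_at inverse_eq_divide del: of_nat_Suc)
      ultimately show "(\<lambda>n. R n x) \<longlonglongrightarrow> ?D x" unfolding R_def by (rule filterlim_compose)
    qed
    show "integrable lborel (\<lambda>x. B * indicator K' x)"
      using emeasure_compact_finite[OF K'] borel_compact[OF K']
      by (intro integrable_mult_right) (simp add: integrable_indicator_iff)
    show "?D \<in> borel_measurable lborel" using iD by simp
    show "R n \<in> borel_measurable lborel" for n
      unfolding R_def using iw by (auto simp: lborel_integral_shift'(2)[of w] intro!: borel_measurable_integrable)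
    show "AE x in lborel. norm (R n x) \<le> B * indicator K' x" for n using Rb by simp
  qed
  moreover have "(LBINT x. R n x) = 0" for n
    unfolding R_def using iw by (simp add: lborel_integral_shift' del: of_nat_Suc)
  ultimately have "(\<lambda>n. 0) \<longlonglongrightarrow> (LBINT x. ?D x)" by simp
  then show "(LBINT x. ?D x) = 0" by (simp add: LIMSEQ_const_iff)
qed

section \<open>From Lebesgue to Borel integrals; uniqueness of weak derivatives\<close>

lemma lebesgue_on_integral_eq:
  fixes f :: "'a::euclidean_space \<Rightarrow> real"
  assumes "S \<in> sets lebesgue"
  shows "(\<integral>x. f x \<partial>(lebesgue_on S)) = (\<integral>x. indicator S x * f x \<partial>lebesgue)"
    "integrable (lebesgue_on S) f \<longleftrightarrow> integrable lebesgue (\<lambda>x. indicator S x * f x)"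
  using assms by (simp_all add: integral_restrict_space integrable_restrict_space set_integrable_def)

lemma lebesgue_eq_lborel_integral:
  fixes f g :: "'a::euclidean_space \<Rightarrow> real"
  assumes "AE x in lebesgue. f x = g x" "g \<in> borel_measurable borel" "f \<in> borel_measurable lebesgue"
  shows "(\<integral>x. f x \<partial>lebesgue) = (LBINT x. g x)" "integrable lebesgue f \<longleftrightarrow> integrable lborel g"
proof -
  have g: "g \<in> borel_measurable lborel" "g \<in> borel_measurable lebesgue"
    using assms(2) by (auto intro: measurable_completion)
  have "(\<integral>x. f x \<partial>lebesgue) = (\<integral>x. g x \<partial>lebesgue)"
    by (rule integral_cong_AE) (use assms g in auto)
  also have "\<dots> = (LBINT x. g x)" using g(1) by (rule integral_completion)
  finally show "(\<integral>x. f x \<partial>lebesgue) = (LBINT x. g x)" .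
  have "integrable lebesgue f \<longleftrightarrow> integrable lebesgue g"
    by (rule integrable_cong_AE) (use assms g in auto)
  also have "\<dots> \<longleftrightarrow> integrable lborel g" using g(1) by (rule integrable_completion)
  finally show "integrable lebesgue f \<longleftrightarrow> integrable lborel g" .
qed

lemma borel_representative:
  fixes f :: "'a::euclidean_space \<Rightarrow> real"
  assumes "f \<in> borel_measurable lebesgue"
  obtains g where "g \<in> borel_measurable borel" "AE x in lebesgue. f x = g x"
  using completion_ex_borel_measurable_real[OF assms] AE_completion by (metis measurable_lborel2)

text \<open>A mollification of \<open>h\<close> at a point is itself an integral against an
  admissible test function. So all mollifications at scales below \<open>r\<close> vanish on
  \<open>ball p r\<close>, and they converge to \<open>h\<close> in L1. The radius
  \<open>2 * r\<close> leaves room for the supports of the bumps.\<close>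

lemma weak_zero_ball:
  fixes h :: "'a::euclidean_space \<Rightarrow> real"
  assumes \<Omega>: "open \<Omega>" and h: "integrable (lebesgue_on (cball p (2*r))) h"
    and test: "\<And>\<eta>. test_function \<Omega> \<eta> \<Longrightarrow> (\<integral>x. h x * \<eta> x \<partial>(lebesgue_on \<Omega>)) = 0"
    and r: "0 < r" "cball p (2*r) \<subseteq> \<Omega>"
  shows "AE x in lebesgue. x \<in> ball p r \<longrightarrow> h x = 0"
proof -
  let ?C = "cball p (2*r)"
  have iC: "integrable lebesgue (\<lambda>x. indicator ?C x * h x)"
    using h by (subst (asm) lebesgue_on_integral_eq) auto
  obtain f where f: "f \<in> borel_measurable borel" "AE x in lebesgue. indicator ?C x * h x = f x"
    using borel_representative[OF borel_measurable_integrable[OF iC]] .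
  have fi: "integrable lborel f" using lebesgue_eq_lborel_integral(2)[OF f(2,1)] iC by auto
  have c0: "conv f (bump s) x = 0" if s: "0 < s" "s < r" and x: "x \<in> ball p r" for s x
  proof -
    let ?\<eta> = "\<lambda>y. bump s (x - y)"
    have sub: "cball x s \<subseteq> ?C"
    proof
      fix y assume "y \<in> cball x s"
      then show "y \<in> ?C" using s x dist_triangle[of p y x] by (auto simp: dist_commute)
    qed
    have \<eta>: "test_function \<Omega> ?\<eta>" using bump_test[OF s(1)] sub r by blast
    have z: "?\<eta> y = 0" if "y \<notin> ?C" for y
      using sub that bump_support[OF _ s(1), of "x - y"] by (force simp: dist_norm)
    have m: "?\<eta> \<in> borel_measurable borel"
      using test_function_continuous[OF \<eta>, of UNIV] by (rule borel_measurable_continuous_onI)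
    have "0 = (\<integral>y. indicator \<Omega> y * (h y * ?\<eta> y) \<partial>lebesgue)"
      using test[OF \<eta>] \<Omega> by (simp add: lebesgue_on_integral_eq)
    also have "\<dots> = (\<integral>y. (indicator ?C y * h y) * ?\<eta> y \<partial>lebesgue)"
      using z r(2) by (intro Bochner_Integration.integral_cong) (auto simp: indicator_def)
    also have "\<dots> = (LBINT y. f y * ?\<eta> y)"
    proof (rule lebesgue_eq_lborel_integral(1))
      show "AE y in lebesgue. indicator ?C y * h y * ?\<eta> y = f y * ?\<eta> y" using f(2) by eventually_elim simp
      show "(\<lambda>y. f y * ?\<eta> y) \<in> borel_measurable borel" using f(1) m by measurable
      show "(\<lambda>y. indicator ?C y * h y * ?\<eta> y) \<in> borel_measurable lebesgue"
        using m by (intro borel_measurable_times[OF borel_measurable_integrable[OF iC]] measurable_completion) simp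
    qed
    finally show ?thesis by (simp add: conv_def)
  qed
  let ?r = "\<lambda>n. r / real (Suc (Suc n))"
  have rn: "0 < ?r n" "?r n < r" for n :: nat using r by (auto simp: field_simps intro!: add_pos_nonneg)
  have rl: "?r \<longlonglongrightarrow> 0"
    using LIMSEQ_ignore_initial_segment[OF lim_const_over_n[of r], of 2] by simp
  have L1: "(\<lambda>n. \<integral>x. \<bar>conv f (bump (?r n)) x - f x\<bar> \<partial>lborel) \<longlonglongrightarrow> 0" and ci: "\<And>n. integrable lborel (conv f (bump (?r n)))"
    using conv_bump_tendsto_L1[OF fi rn(1) rl] by auto
  let ?I = "\<integral>x. indicator (ball p r) x * \<bar>f x\<bar> \<partial>lborel"
  have iI: "integrable lborel (\<lambda>x. indicator (ball p r) x * \<bar>f x\<bar>)"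
    using integrable_mult_indicator[of "ball p r" lborel "\<lambda>x. \<bar>f x\<bar>"] fi by simp
  have "?I \<le> (LBINT x. \<bar>conv f (bump (?r n)) x - f x\<bar>)" for n :: nat
    using iI ci fi c0[OF rn(1) rn(2), of _ n] by (intro integral_mono) (auto simp: indicator_def)
  then have "?I \<le> 0" by (intro LIMSEQ_le_const[OF L1]) auto
  then have "?I = 0" by (intro antisym integral_nonneg_AE) auto
  then have "AE x in lborel. indicator (ball p r) x * \<bar>f x\<bar> = 0"
    using integral_nonneg_eq_0_iff_AE[OF iI] by auto
  then have "AE x in lebesgue. indicator (ball p r) x * \<bar>f x\<bar> = 0" by (rule AE_completion)
  with f(2) show ?thesis
    by eventually_elim (use r in \<open>auto simp: indicator_def split: if_splits\<close>)
qed

lemma weak_zero: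
  fixes h :: "'a::euclidean_space \<Rightarrow> real"
  assumes \<Omega>: "open \<Omega>" and h: "locally_integrable_on h \<Omega>"
    and test: "\<And>\<eta>. test_function \<Omega> \<eta> \<Longrightarrow> (\<integral>x. h x * \<eta> x \<partial>(lebesgue_on \<Omega>)) = 0"
  shows "AE x in lebesgue. x \<in> \<Omega> \<longrightarrow> h x = 0"
proof -
  have "\<forall>p\<in>\<Omega>. \<exists>r>0. cball p (2*r) \<subseteq> \<Omega>"
  proof
    fix p assume "p \<in> \<Omega>"
    then obtain e where "e > 0" "cball p e \<subseteq> \<Omega>" using \<Omega> open_contains_cball by blast
    then show "\<exists>r>0. cball p (2*r) \<subseteq> \<Omega>" by (intro exI[of _ "e/2"]) auto
  qed
  then obtain r where r: "\<And>p. p \<in> \<Omega> \<Longrightarrow> r p > 0 \<and> cball p (2 * r p) \<subseteq> \<Omega>" by metis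
  let ?F = "(\<lambda>p. ball p (r p)) ` \<Omega>"
  \<comment> \<open>A countable subcover keeps the union of the exceptional sets a null set.\<close>
  obtain F where F: "F \<subseteq> ?F" "countable F" "\<Union>F = \<Union>?F"
    using Lindelof[of ?F] by auto
  have "\<Omega> \<subseteq> \<Union>F" using r F(3) by auto
  have "\<forall>B\<in>F. AE x in lebesgue. x \<in> B \<longrightarrow> h x = 0"
  proof
    fix B assume "B \<in> F"
    then obtain p where p: "p \<in> \<Omega>" "B = ball p (r p)" using F(1) by auto
    have "integrable (lebesgue_on (cball p (2 * r p))) h"
      using h r[OF p(1)] by (auto simp: locally_integrable_on_def)
    then show "AE x in lebesgue. x \<in> B \<longrightarrow> h x = 0"
      unfolding p(2) using r[OF p(1)] by (intro weak_zero_ball[OF \<Omega> _ test]) auto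
  qed
  then have "AE x in lebesgue. \<forall>B\<in>F. x \<in> B \<longrightarrow> h x = 0"
    using F(2) by (intro AE_ball_countable[THEN iffD2]) auto
  then show ?thesis by eventually_elim (use \<open>\<Omega> \<subseteq> \<Union>F\<close> in auto)
qed

lemma locally_integrable_test:
  fixes h :: "'a::euclidean_space \<Rightarrow> real"
  assumes "open \<Omega>" "locally_integrable_on h \<Omega>" "test_function \<Omega> \<eta>"
  shows "integrable (lebesgue_on \<Omega>) (\<lambda>x. h x * \<eta> x)"
proof -
  let ?K = "closure {x. \<eta> x \<noteq> 0}"
  have K: "compact ?K" "?K \<subseteq> \<Omega>" using assms(3) by (auto simp: test_function_def)
  obtain B where B: "\<And>x. \<bar>\<eta> x\<bar> \<le> B" using test_function_uniform(2)[OF assms(3)] by blast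
  have "integrable (lebesgue_on ?K) h" using assms(2) K by (auto simp: locally_integrable_on_def)
  then have i: "integrable lebesgue (\<lambda>x. indicator ?K x * h x)"
    using K by (subst (asm) lebesgue_on_integral_eq) auto
  have m: "\<eta> \<in> borel_measurable lebesgue"
    using test_function_continuous[OF assms(3), of UNIV] borel_measurable_continuous_onI measurable_completion by (metis measurable_lborel2)
  have "integrable lebesgue (\<lambda>x. \<eta> x * (indicator ?K x * h x))"
    by (rule Bochner_Integration.integrable_bound[OF integrable_mult_right[OF i, of B]])
      (use B m borel_measurable_integrable[OF i] in \<open>auto simp: abs_mult intro!: AE_I2 mult_right_mono order_trans[OF B]\<close>)
  moreover have "\<eta> x * (indicator ?K x * h x) = indicator \<Omega> x * (h x * \<eta> x)" for x
    using K closure_subset[of "{x. \<eta> x \<noteq> 0}"] by (auto simp: indicator_def)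
  ultimately show ?thesis using assms(1) by (simp add: lebesgue_on_integral_eq)
qed

lemma has_weak_partial_unique:
  fixes f :: "'a::euclidean_space \<Rightarrow> real"
  assumes \<Omega>: "open \<Omega>" and "has_weak_partial \<Omega> b f g" "has_weak_partial \<Omega> b f g'"
  shows "AE x in lebesgue. x \<in> \<Omega> \<longrightarrow> g x = g' x"
proof -
  have l: "locally_integrable_on g \<Omega>" "locally_integrable_on g' \<Omega>"
    using assms by (auto simp: has_weak_partial_def)
  have "AE x in lebesgue. x \<in> \<Omega> \<longrightarrow> g x - g' x = 0"
  proof (rule weak_zero[OF \<Omega>])
    show "locally_integrable_on (\<lambda>x. g x - g' x) \<Omega>" using l by (auto simp: locally_integrable_on_def)
    fix \<eta> assume \<eta>: "test_function \<Omega> \<eta>"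
    have "(\<integral>x. (g x - g' x) * \<eta> x \<partial>(lebesgue_on \<Omega>)) =
      (\<integral>x. g x * \<eta> x \<partial>(lebesgue_on \<Omega>)) - (\<integral>x. g' x * \<eta> x \<partial>(lebesgue_on \<Omega>))"
      using l[THEN locally_integrable_test[OF \<Omega> _ \<eta>]] by (simp add: left_diff_distrib)
    also have "\<dots> = 0" using assms \<eta> unfolding has_weak_partial_def by fastforce
    finally show "(\<integral>x. (g x - g' x) * \<eta> x \<partial>(lebesgue_on \<Omega>)) = 0" .
  qed
  then show ?thesis by eventually_elim simp
qed

lemma has_weak_partial_weak_partial: "has_weak_partial \<Omega> b f g \<Longrightarrow> has_weak_partial \<Omega> b f (weak_partial \<Omega> b f)"
  unfolding weak_partial_def by (rule someI[of "has_weak_partial \<Omega> b f"])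

lemma weak_partial_AE:
  "open \<Omega> \<Longrightarrow> has_weak_partial \<Omega> b f g \<Longrightarrow> AE x in lebesgue. x \<in> \<Omega> \<longrightarrow> weak_partial \<Omega> b f x = g x"
  by (rule has_weak_partial_unique[OF _ has_weak_partial_weak_partial])

lemma sum_basis_unique:
  fixes a c :: "'a::euclidean_space \<Rightarrow> real"
  assumes "(\<Sum>b\<in>Basis. a b *\<^sub>R b) = (\<Sum>b\<in>Basis. c b *\<^sub>R b)" "b \<in> Basis" shows "a b = c b"
  using arg_cong[OF assms(1), of "\<lambda>v. v \<bullet> b"] assms(2) by (simp add: inner_sum_left_Basis)

lemma conv_bump_GDERIV:
  assumes f: "integrable lborel f" and w: "\<And>b. b \<in> Basis \<Longrightarrow> wder \<Omega> b f (g b)"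
    and r: "0 < r" "cball x r \<subseteq> \<Omega>"
  shows "GDERIV (conv f (bump r)) x :> (\<Sum>b\<in>Basis. conv (g b) (bump r) x *\<^sub>R b)"
proof -
  have "(\<Sum>b\<in>Basis. conv f (\<lambda>z. frechet_derivative (bump r) (at z) b) x *\<^sub>R b) = (\<Sum>b\<in>Basis. conv (g b) (bump r) x *\<^sub>R b)"
    using conv_wder[OF w r] by (intro sum.cong) auto
  then show ?thesis using conv_GDERIV[OF f bump_test_UNIV[OF r(1)], of x] by simp
qed

text \<open>Both mixed derivatives are rewritten as convolutions of \<open>f\<close> with a second
  derivative of the bump, where symmetry is known. The open set \<open>V\<close> is there because
  the first derivatives must agree on a neighbourhood before they can be differentiated
  again.\<close>

lemma conv_bump_symmetric:
  assumes f: "integrable lborel f" and g: "\<And>b. b \<in> Basis \<Longrightarrow> integrable lborel (g b)"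
    and w: "\<And>b. b \<in> Basis \<Longrightarrow> wder \<Omega> b f (g b)"
    and w2: "\<And>b c. b \<in> Basis \<Longrightarrow> c \<in> Basis \<Longrightarrow> wder \<Omega> c (g b) (h b c)"
    and r: "0 < r" and V: "open V" "x \<in> V" "\<And>y. y \<in> V \<Longrightarrow> cball y r \<subseteq> \<Omega>"
    and bc: "b \<in> Basis" "c \<in> Basis"
  shows "conv (h b c) (bump r) x = conv (h c b) (bump r) x"
proof -
  let ?k = "bump r" and ?D = "\<lambda>b z. frechet_derivative (bump r) (at z) b"
  have *: "conv (h b c) ?k x = conv f (\<lambda>z. frechet_derivative (?D b) (at z) c) x"
    if bc: "b \<in> Basis" "c \<in> Basis" for b c
  proof -
    have t: "test_function UNIV (?D b)" by (rule test_function_pd[OF bump_test_UNIV[OF r] bc(1)])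
    have 1: "GDERIV (conv f (?D b)) x :> (\<Sum>c\<in>Basis. conv f (\<lambda>z. frechet_derivative (?D b) (at z) c) x *\<^sub>R c)"
      by (rule conv_GDERIV[OF f t])
    have "GDERIV (conv (g b) ?k) x :> (\<Sum>c\<in>Basis. conv (h b c) ?k x *\<^sub>R c)"
      by (rule conv_bump_GDERIV[OF g[OF bc(1)] w2[OF bc(1)] r V(3)[OF V(2)]])
    then have "GDERIV (conv f (?D b)) x :> (\<Sum>c\<in>Basis. conv (h b c) ?k x *\<^sub>R c)"
      unfolding gderiv_def
      by (rule has_derivative_transform_within_open[OF _ V(1,2)]) (use conv_wder[OF w[OF bc(1)] r V(3)] in auto)
    from GDERIV_unique[OF this 1] show ?thesis by (rule sum_basis_unique) (rule bc)
  qed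
  show ?thesis using *[OF bc] *[OF bc(2,1)] bump_second_deriv_symmetric[OF r bc] by simp
qed

lemma conv_bump_close:
  fixes f :: "'a::euclidean_space \<Rightarrow> real"
  assumes f: "integrable lborel f" and r: "0 < r"
    and c: "\<And>y. dist x y < r \<Longrightarrow> \<bar>f y - f x\<bar> \<le> e"
  shows "\<bar>conv f (bump r) x - f x\<bar> \<le> e"
proof -
  have sh: "bump r (x - y) = bump r (y + (- x))" for y using bump_uminus[of r "x - y"] by simp
  have bi: "integrable lborel (\<lambda>y. bump r (x - y))" and bI: "(LBINT y. bump r (x - y)) = 1"
    using bump_integrable[OF r, where 'a='a] bump_integral[OF r, where 'a='a]
    unfolding sh by (simp_all only: lborel_integral_shift'[of "bump r" "-x"])
  have ci: "integrable lborel (\<lambda>y. f y * bump r (x - y))"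
    by (rule conv_integrable[OF f bump_test_UNIV[OF r]])
  have "conv f (bump r) x - f x = (LBINT y. f y * bump r (x - y)) - (LBINT y. f x * bump r (x - y))"
    by (simp add: conv_def bI)
  also have "\<dots> = (LBINT y. f y * bump r (x - y) - f x * bump r (x - y))" using ci bi by simp
  finally have "\<bar>conv f (bump r) x - f x\<bar> \<le> (LBINT y. \<bar>f y * bump r (x - y) - f x * bump r (x - y)\<bar>)"
    by (simp only: integral_abs_bound)
  also have "\<dots> \<le> (LBINT y. e * bump r (x - y))"
  proof (rule integral_mono)
    fix y
    show "\<bar>f y * bump r (x - y) - f x * bump r (x - y)\<bar> \<le> e * bump r (x - y)"
    proof (cases "dist x y < r")
      case True
      then show ?thesis using c[OF True] r by (auto simp: left_diff_distrib[symmetric] abs_mult intro!: mult_right_mono)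
    next
      case False
      then have "bump r (x - y) = 0" using bump_support[OF _ r, of "x - y"] by (auto simp: dist_norm)
      then show ?thesis by simp
    qed
  qed (use ci bi in auto)
  also have "\<dots> = e" by (simp add: bI)
  finally show ?thesis .
qed

section \<open>Simultaneous smooth approximation of a function and its weak derivatives\<close>

lemma compact_nbhd:
  fixes K :: "'a::euclidean_space set"
  assumes "compact K" "K \<subseteq> \<Omega>" "open \<Omega>"
  obtains e where "e > 0" "compact (\<Union>x\<in>K. cball x e)" "(\<Union>x\<in>K. cball x e) \<subseteq> \<Omega>"
proof -
  obtain e where e: "e > 0" "(\<Union>x\<in>K. ball x e) \<subseteq> \<Omega>"
    using compact_subset_open_imp_ball_epsilon_subset[OF assms(1,3,2)] by metis
  have "compact {x + y |x y. x \<in> K \<and> y \<in> cball 0 (e/2)}" by (intro compact_sums assms compact_cball)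
  moreover have "(\<Union>x\<in>K. cball x (e/2)) = {x + y |x y. x \<in> K \<and> y \<in> cball 0 (e/2)}"
    by (auto simp: dist_norm) (metis add_diff_cancel_left' diff_add_cancel norm_minus_commute add.commute)
  moreover have "(\<Union>x\<in>K. cball x (e/2)) \<subseteq> (\<Union>x\<in>K. ball x e)" using e(1) by (intro UN_mono) auto
  ultimately show ?thesis using e by (intro that[of "e/2"]) auto
qed

text \<open>L1 convergence gives a.e. convergence along a subsequence; the extraction is iterated
  over a finite index set, so that one subsequence serves all directions.\<close>

lemma AE_subsequence_finite:
  fixes F :: "'b \<Rightarrow> nat \<Rightarrow> 'a::euclidean_space \<Rightarrow> real"
  assumes "finite B" and i: "\<And>b n. b \<in> B \<Longrightarrow> integrable lborel (F b n)"
    and L: "\<And>b. b \<in> B \<Longrightarrow> (\<lambda>n. \<integral>x. \<bar>F b n x\<bar> \<partial>lborel) \<longlonglongrightarrow> 0"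
  shows "\<exists>s::nat\<Rightarrow>nat. strict_mono s \<and> (\<forall>b\<in>B. AE x in lborel. (\<lambda>n. F b (s n) x) \<longlonglongrightarrow> 0)"
  using assms
proof (induction B rule: finite_induct)
  case empty
  show ?case by (intro exI[of _ id]) (auto simp: strict_mono_def)
next
  case (insert b B)
  obtain s where s: "strict_mono s" "\<forall>b\<in>B. AE x in lborel. (\<lambda>n. F b (s n) x) \<longlonglongrightarrow> 0"
    using insert by auto
  have "(\<lambda>n. \<integral>x. norm (F b (s n) x) \<partial>lborel) \<longlonglongrightarrow> 0"
    using LIMSEQ_subseq_LIMSEQ[OF insert.prems(2)[of b] s(1)] by (simp add: comp_def)
  then obtain t where t: "strict_mono t" "AE x in lborel. (\<lambda>n. F b (s (t n)) x) \<longlonglongrightarrow> 0"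
    using tendsto_L1_AE_subseq[of lborel "\<lambda>n. F b (s n)"] insert.prems(1)[of b] by auto
  have "AE x in lborel. (\<lambda>n. F c (s (t n)) x) \<longlonglongrightarrow> 0" if "c \<in> B" for c
    using s(2)[rule_format, OF that] by eventually_elim (use LIMSEQ_subseq_LIMSEQ[OF _ t(1)] in \<open>auto simp: comp_def\<close>)
  with t s(1) show ?case by (intro exI[of _ "s \<circ> t"]) (auto simp: strict_mono_def)
qed

text \<open>The mode of convergence matches the way each quantity enters later: the function
  converges uniformly on compact sets, the gradient a.e. and in L1 because it enters nonlinearly,
  the second derivatives in L1 because they enter linearly. The differential relations hold near a
  given compact set as soon as the mollification radius is small.\<close>

definition smooth_approx where
  "smooth_approx \<Omega> f g h U G H \<longleftrightarrow> (\<forall>n. continuous_on UNIV (U n)) \<and>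
    (\<forall>n. \<forall>b\<in>Basis. continuous_on UNIV (G n b)) \<and>
    (\<forall>n. \<forall>b\<in>Basis. \<forall>c\<in>Basis. continuous_on UNIV (H n b c)) \<and>
    (\<forall>n. \<forall>b\<in>Basis. integrable lborel (G n b)) \<and>
    (\<forall>n. \<forall>b\<in>Basis. \<forall>c\<in>Basis. integrable lborel (H n b c)) \<and>
    (\<forall>K. compact K \<longrightarrow> K \<subseteq> \<Omega> \<longrightarrow> (\<forall>\<^sub>F n in sequentially. \<exists>V. open V \<and> K \<subseteq> V \<and>
      (\<forall>x\<in>V. GDERIV (U n) x :> (\<Sum>b\<in>Basis. G n b x *\<^sub>R b) \<and>
        (\<forall>b\<in>Basis. GDERIV (G n b) x :> (\<Sum>c\<in>Basis. H n b c x *\<^sub>R c) \<and>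
        (\<forall>c\<in>Basis. H n b c x = H n c b x))))) \<and>
    (\<forall>K e. compact K \<longrightarrow> K \<subseteq> \<Omega> \<longrightarrow> e > 0 \<longrightarrow> (\<forall>\<^sub>F n in sequentially. \<forall>x\<in>K. \<bar>U n x - f x\<bar> \<le> e)) \<and>
    (\<forall>b\<in>Basis. (\<lambda>n. \<integral>x. \<bar>G n b x - g b x\<bar> \<partial>lborel) \<longlonglongrightarrow> 0) \<and>
    (\<forall>b\<in>Basis. \<forall>c\<in>Basis. (\<lambda>n. \<integral>x. \<bar>H n b c x - h b c x\<bar> \<partial>lborel) \<longlonglongrightarrow> 0) \<and>
    (\<forall>b\<in>Basis. AE x in lborel. (\<lambda>n. G n b x) \<longlonglongrightarrow> g b x)"
  for \<Omega> :: "'a::euclidean_space set" and f :: "'a \<Rightarrow> real" and U :: "nat \<Rightarrow> 'a \<Rightarrow> real"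
    and g :: "'a \<Rightarrow> 'a \<Rightarrow> real" and G :: "nat \<Rightarrow> 'a \<Rightarrow> 'a \<Rightarrow> real"
    and h :: "'a \<Rightarrow> 'a \<Rightarrow> 'a \<Rightarrow> real" and H :: "nat \<Rightarrow> 'a \<Rightarrow> 'a \<Rightarrow> 'a \<Rightarrow> real"

lemma smooth_approximation:
  fixes f :: "'a::euclidean_space \<Rightarrow> real"
  assumes \<Omega>: "open \<Omega>" and f: "integrable lborel f" "continuous_on \<Omega> f"
    and g: "\<And>b. b \<in> Basis \<Longrightarrow> integrable lborel (g b)"
    and h: "\<And>b c. b \<in> Basis \<Longrightarrow> c \<in> Basis \<Longrightarrow> integrable lborel (h b c)"
    and wg: "\<And>b. b \<in> Basis \<Longrightarrow> wder \<Omega> b f (g b)"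
    and wh: "\<And>b c. b \<in> Basis \<Longrightarrow> c \<in> Basis \<Longrightarrow> wder \<Omega> c (g b) (h b c)"
  shows "\<exists>U G H. smooth_approx \<Omega> f g h U G H"
proof -
  define r0 where "r0 n = 1 / real (Suc n)" for n
  have r0: "\<And>n. 0 < r0 n" "r0 \<longlonglongrightarrow> 0"
    using LIMSEQ_inverse_real_of_nat by (simp_all add: r0_def[abs_def] inverse_eq_divide del: of_nat_Suc)
  have "\<exists>s::nat\<Rightarrow>nat. strict_mono s \<and> (\<forall>b\<in>Basis. AE x in lborel. (\<lambda>n. conv (g b) (bump (r0 (s n))) x - g b x) \<longlonglongrightarrow> 0)"
    by (rule AE_subsequence_finite[of Basis "\<lambda>b n x. conv (g b) (bump (r0 n)) x - g b x"])
       (use g conv_bump_tendsto_L1[OF g r0] in auto)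
  then obtain s :: "nat \<Rightarrow> nat" where s: "strict_mono s"
    "\<And>b. b \<in> Basis \<Longrightarrow> AE x in lborel. (\<lambda>n. conv (g b) (bump (r0 (s n))) x - g b x) \<longlonglongrightarrow> 0" by auto
  define r where "r n = r0 (s n)" for n
  have r: "\<And>n. 0 < r n" "r \<longlonglongrightarrow> 0"
    using r0 LIMSEQ_subseq_LIMSEQ[OF r0(2) s(1)] by (auto simp: r_def[abs_def] comp_def)
  note t = bump_test_UNIV[OF r(1)]
  have "smooth_approx \<Omega> f g h (\<lambda>n. conv f (bump (r n))) (\<lambda>n b. conv (g b) (bump (r n))) (\<lambda>n b c. conv (h b c) (bump (r n)))"
    unfolding smooth_approx_def
  proof (intro conjI allI impI ballI)
    fix K assume K: "compact K" "K \<subseteq> \<Omega>"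
    obtain e where e: "e > 0" "compact (\<Union>x\<in>K. cball x e)" "(\<Union>x\<in>K. cball x e) \<subseteq> \<Omega>"
      using compact_nbhd[OF K \<Omega>] .
    let ?V = "\<Union>x\<in>K. ball x (e/2)"
    have "\<forall>\<^sub>F n in sequentially. r n < e / 2" using r(2) e(1) by (intro order_tendstoD) auto
    then show "\<forall>\<^sub>F n in sequentially. \<exists>V. open V \<and> K \<subseteq> V \<and>
      (\<forall>x\<in>V. GDERIV (conv f (bump (r n))) x :> (\<Sum>b\<in>Basis. conv (g b) (bump (r n)) x *\<^sub>R b) \<and>
        (\<forall>b\<in>Basis. GDERIV (conv (g b) (bump (r n))) x :> (\<Sum>c\<in>Basis. conv (h b c) (bump (r n)) x *\<^sub>R c) \<and>
        (\<forall>c\<in>Basis. conv (h b c) (bump (r n)) x = conv (h c b) (bump (r n)) x)))"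
    proof eventually_elim
      case (elim n)
      have sub: "cball y (r n) \<subseteq> \<Omega>" if y: "y \<in> ?V" for y
      proof -
        obtain x where x: "x \<in> K" "dist x y < e/2" using y by auto
        have "cball y (r n) \<subseteq> cball x e"
        proof
          fix z assume "z \<in> cball y (r n)"
          then show "z \<in> cball x e" using x(2) elim dist_triangle[of x z y] by simp
        qed
        then show ?thesis using x e(3) by auto
      qed
      have "open ?V" by auto
      moreover have "K \<subseteq> ?V" using e(1) by auto
      moreover have "conv (h b c) (bump (r n)) x = conv (h c b) (bump (r n)) x" if "x \<in> ?V" "b \<in> Basis" "c \<in> Basis" for x b c
        using conv_bump_symmetric[OF f(1) g wg wh r(1) \<open>open ?V\<close> that(1) sub that(2,3)] by blast
      moreover have "GDERIV (conv f (bump (r n))) x :> (\<Sum>b\<in>Basis. conv (g b) (bump (r n)) x *\<^sub>R b)" if "x \<in> ?V" for x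
        using conv_bump_GDERIV[OF f(1) wg r(1) sub[OF that]] .
      moreover have "GDERIV (conv (g b) (bump (r n))) x :> (\<Sum>c\<in>Basis. conv (h b c) (bump (r n)) x *\<^sub>R c)"
        if "x \<in> ?V" "b \<in> Basis" for x b
        using conv_bump_GDERIV[OF g[OF that(2)] wh[OF that(2)] r(1) sub[OF that(1)]] .
      ultimately show ?case by (intro exI[of _ ?V]) blast
    qed
  next
    fix K and d :: real assume K: "compact K" "K \<subseteq> \<Omega>" and d: "d > 0"
    obtain e where e: "e > 0" "compact (\<Union>x\<in>K. cball x e)" "(\<Union>x\<in>K. cball x e) \<subseteq> \<Omega>"
      using compact_nbhd[OF K \<Omega>] .
    have "uniformly_continuous_on (\<Union>x\<in>K. cball x e) f"
      by (rule compact_uniformly_continuous[OF continuous_on_subset[OF f(2) e(3)] e(2)])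
    then obtain \<delta> where \<delta>: "\<delta> > 0" "\<And>x y. x \<in> (\<Union>x\<in>K. cball x e) \<Longrightarrow> y \<in> (\<Union>x\<in>K. cball x e) \<Longrightarrow> dist y x < \<delta> \<Longrightarrow> dist (f y) (f x) < d"
      unfolding uniformly_continuous_on_def using d by meson
    have "\<forall>\<^sub>F n in sequentially. r n < min e \<delta>" using r(2) e(1) \<delta>(1) by (intro order_tendstoD) auto
    then show "\<forall>\<^sub>F n in sequentially. \<forall>x\<in>K. \<bar>conv f (bump (r n)) x - f x\<bar> \<le> d"
    proof eventually_elim
      case (elim n)
      show ?case
      proof
        fix x assume x: "x \<in> K"
        show "\<bar>conv f (bump (r n)) x - f x\<bar> \<le> d"
        proof (rule conv_bump_close[OF f(1) r(1)])
          fix y assume y: "dist x y < r n"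
          have "dist (f y) (f x) < d"
          proof (rule \<delta>(2))
            show "x \<in> (\<Union>x\<in>K. cball x e)" using x e(1) by (intro UN_I[of x]) auto
            show "y \<in> (\<Union>x\<in>K. cball x e)" using x y elim by (intro UN_I[of x]) auto
            show "dist y x < \<delta>" using y elim by (simp add: dist_commute)
          qed
          then show "\<bar>f y - f x\<bar> \<le> d" by (simp add: dist_real_def)
        qed
      qed
    qed
  next
    fix b :: 'a assume b: "b \<in> Basis"
    show "AE x in lborel. (\<lambda>n. conv (g b) (bump (r n)) x) \<longlonglongrightarrow> g b x"
      using s(2)[OF b] unfolding r_def
    proof eventually_elim
      case (elim x)
      from tendsto_add[OF this tendsto_const[of "g b x"]] show ?case by simp
    qed
  qed (use conv_continuous[OF f(1) t] conv_continuous[OF g t] conv_continuous[OF h t]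
        conv_bump_tendsto_L1[OF g r] conv_bump_tendsto_L1[OF h r] in auto)
  then show ?thesis by blast
qed

text \<open>The two errors are separated: replacing \<open>wn\<close> by \<open>w\<close> costs at
  most \<open>B\<close> times their L1 distance, and for the fixed weight \<open>w\<close> dominated
  convergence handles the bounded factor.\<close>

lemma integral_mult_tendsto:
  fixes b :: "nat \<Rightarrow> 'a \<Rightarrow> real"
  assumes b: "\<And>n. b n \<in> borel_measurable M" "\<And>n. AE x in M. \<bar>b n x\<bar> \<le> B"
    and bl: "AE x in M. w x \<noteq> 0 \<longrightarrow> (\<lambda>n. b n x) \<longlonglongrightarrow> b' x" "b' \<in> borel_measurable M"
    and w: "\<And>n. integrable M (wn n)" "integrable M w" "(\<lambda>n. \<integral>x. \<bar>wn n x - w x\<bar> \<partial>M) \<longlonglongrightarrow> 0"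
  shows "integrable M (\<lambda>x. b' x * w x)" "\<And>n. integrable M (\<lambda>x. b n x * wn n x)"
    "(\<lambda>n. \<integral>x. b n x * wn n x \<partial>M) \<longlonglongrightarrow> (\<integral>x. b' x * w x \<partial>M)"
proof -
  have dc: "(\<lambda>n. b n x * w x) \<longlonglongrightarrow> b' x * w x" if "w x \<noteq> 0 \<longrightarrow> (\<lambda>n. b n x) \<longlonglongrightarrow> b' x" for x
    using that by (cases "w x = 0") (auto intro!: tendsto_intros)
  have lim: "AE x in M. (\<lambda>n. b n x * w x) \<longlonglongrightarrow> b' x * w x"
    using bl(1) by eventually_elim (rule dc)
  have bd: "AE x in M. norm (b n x * w x) \<le> \<bar>B\<bar> * \<bar>w x\<bar>" for n
    using b(2)[of n] by eventually_elim (auto simp: abs_mult intro!: mult_right_mono)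
  have wi: "integrable M (\<lambda>x. \<bar>B\<bar> * \<bar>w x\<bar>)" using w(2) by simp
  have m: "(\<lambda>x. b' x * w x) \<in> borel_measurable M" "\<And>n. (\<lambda>x. b n x * w x) \<in> borel_measurable M"
    using b(1) bl(2) borel_measurable_integrable[OF w(2)] by simp_all
  note D = integral_dominated_convergence[OF m wi lim bd] integrable_dominated_convergence[OF m wi lim bd]
    integrable_dominated_convergence2[OF m wi lim bd]
  show "integrable M (\<lambda>x. b' x * w x)" by (rule D(2))
  have ib: "integrable M (\<lambda>x. b n x * w x)" for n by (rule D(3))
  have ibw: "integrable M (\<lambda>x. b n x * wn n x)" for n
  proof (rule Bochner_Integration.integrable_bound[of M "\<lambda>x. \<bar>B\<bar> * \<bar>wn n x\<bar>"])
    show "AE x in M. norm (b n x * wn n x) \<le> norm (\<bar>B\<bar> * \<bar>wn n x\<bar>)"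
      using b(2)[of n] by eventually_elim (auto simp: abs_mult intro!: mult_right_mono)
    show "(\<lambda>x. b n x * wn n x) \<in> borel_measurable M"
      using b(1) borel_measurable_integrable[OF w(1)] by (intro borel_measurable_times)
  qed (use w in simp)
  then show "integrable M (\<lambda>x. b n x * wn n x)" for n .
  have "(\<lambda>n. \<integral>x. b n x * wn n x - b n x * w x \<partial>M) \<longlonglongrightarrow> 0"
  proof (rule tendsto_0_le[OF tendsto_mult_right_zero[OF w(3), of "\<bar>B\<bar>"], of _ 1], rule always_eventually, rule allI)
    fix n
    have "norm (\<integral>x. b n x * wn n x - b n x * w x \<partial>M) \<le> (\<integral>x. \<bar>b n x * wn n x - b n x * w x\<bar> \<partial>M)"
      using integral_abs_bound by simp
    also have "\<dots> \<le> (\<integral>x. \<bar>B\<bar> * \<bar>wn n x - w x\<bar> \<partial>M)"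
    proof (rule integral_mono_AE)
      show "AE x in M. \<bar>b n x * wn n x - b n x * w x\<bar> \<le> \<bar>B\<bar> * \<bar>wn n x - w x\<bar>"
        using b(2)[of n] by eventually_elim (auto simp: right_diff_distrib[symmetric] abs_mult intro!: mult_right_mono)
    qed (use ib ibw w in auto)
    also have "\<dots> \<le> norm (\<bar>B\<bar> * (\<integral>x. \<bar>wn n x - w x\<bar> \<partial>M)) * 1" by simp
    finally show "norm (\<integral>x. b n x * wn n x - b n x * w x \<partial>M) \<le> norm (\<bar>B\<bar> * (\<integral>x. \<bar>wn n x - w x\<bar> \<partial>M)) * 1" .
  qed
  from tendsto_add[OF this D(1)] show "(\<lambda>n. \<integral>x. b n x * wn n x \<partial>M) \<longlonglongrightarrow> (\<integral>x. b' x * w x \<partial>M)"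
    using ib ibw by simp
qed

section \<open>First variation of smooth graphs\<close>

text \<open>For \<open>v\<close> the gradient of \<open>u\<close>, \<open>Rf v\<close> is \<open>1/Q\<close> and \<open>Ff i v\<close> is the \<open>i\<close>-th component of \<open>\<nabla>u/Q\<close>.\<close>

definition Rf :: "real^2 \<Rightarrow> real" where "Rf v = 1 / sqrt (1 + (norm v)\<^sup>2)"
definition Ff :: "2 \<Rightarrow> real^2 \<Rightarrow> real" where "Ff i v = v $ i * Rf v"

lemma sum_2_neq: "i \<noteq> j \<Longrightarrow> sum f (UNIV :: 2 set) = f i + (f j :: real)"
  using exhaust_2[of i] exhaust_2[of j] by (auto simp: sum_2)

lemma norm_2_neq: "i \<noteq> j \<Longrightarrow> (norm (v::real^2))\<^sup>2 = (v$i)\<^sup>2 + (v$j)\<^sup>2"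
  by (simp add: norm_vec_def L2_set_def sum_2_neq sum_nonneg)

lemma sqrt_pos [simp]: "0 < sqrt (1 + (norm v)\<^sup>2)" "sqrt (1 + (norm v)\<^sup>2) \<noteq> 0" "0 < 1 + (norm v)\<^sup>2"
proof -
  show p: "0 < 1 + (norm v)\<^sup>2" by (simp add: add_pos_nonneg)
  then show "0 < sqrt (1 + (norm v)\<^sup>2)" by simp
  show "sqrt (1 + (norm v)\<^sup>2) \<noteq> 0" using p by (metis real_sqrt_gt_0_iff less_irrefl)
qed

lemma Rf_pos [simp]: "0 < Rf v" unfolding Rf_def by (intro divide_pos_pos sqrt_pos(1)) simp

text \<open>The three numbers are, up to sign, the components of the unit normal of the
  graph.\<close>

lemma Rf_Ff_sq: "i \<noteq> j \<Longrightarrow> (Rf v)\<^sup>2 + (Ff i v)\<^sup>2 + (Ff j v)\<^sup>2 = 1"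
proof -
  assume ij: "i \<noteq> j"
  have "(Rf v)\<^sup>2 + (Ff i v)\<^sup>2 + (Ff j v)\<^sup>2 = (1 + (norm v)\<^sup>2) * (Rf v)\<^sup>2"
    unfolding Ff_def norm_2_neq[OF ij, of v] by (simp add: algebra_simps)
  also have "\<dots> = 1"
    using sqrt_pos(3)[of v] by (simp add: Rf_def power_divide less_imp_neq[THEN not_sym] del: sqrt_pos)
  finally show ?thesis .
qed

lemma ex_neq_2: "\<exists>j::2. j \<noteq> i"
  using exhaust_2[of i] by (metis one_neq_zero zero_neq_one exhaust_2 num1_eq1 zero_neq_numeral numeral_One)

lemma Ff_le: "\<bar>Ff i v\<bar> \<le> 1" and Rf_le: "Rf v \<le> 1"
proof -
  obtain j where j: "j \<noteq> i" using ex_neq_2 by blast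
  note * = Rf_Ff_sq[OF j[symmetric], of v]
  have "(Ff i v)\<^sup>2 \<le> 1" "(Rf v)\<^sup>2 \<le> 1" using * zero_le_power2[of "Rf v"] zero_le_power2[of "Ff i v"] zero_le_power2[of "Ff j v"] by linarith+
  then have "\<bar>Ff i v\<bar> \<le> 1" "\<bar>Rf v\<bar> \<le> 1" by (simp_all only: abs_square_le_1)
  then show "\<bar>Ff i v\<bar> \<le> 1" "Rf v \<le> 1" by auto
qed

lemma continuous_Rf [continuous_intros]: "continuous_on A f \<Longrightarrow> continuous_on A (\<lambda>x. Rf (f x))"
  unfolding Rf_def by (intro continuous_intros ballI sqrt_pos)

lemma continuous_Ff [continuous_intros]: "continuous_on A f \<Longrightarrow> continuous_on A (\<lambda>x. Ff i (f x))"
  unfolding Ff_def by (auto intro!: continuous_intros)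

lemma DERIV_inverse_sqrt:
  assumes "0 < s" shows "((\<lambda>s. 1 / sqrt s) has_real_derivative - (1 / 2) * (1 / sqrt s) ^ 3) (at s)"
proof -
  have r: "0 < sqrt s" using assms by simp
  have "((\<lambda>s. inverse (sqrt s)) has_real_derivative - (inverse (sqrt s) * (inverse (sqrt s) / 2) * inverse (sqrt s))) (at s)"
    by (rule DERIV_inverse'[OF DERIV_real_sqrt]) (use assms r in auto)
  moreover have "- (inverse r * (inverse r / 2) * inverse r) = - (1 / 2) * (1 / r) ^ 3" for r :: real
    by (simp add: inverse_eq_divide power3_eq_cube)
  ultimately show ?thesis unfolding inverse_eq_divide by metis
qed

text \<open>The vector in parentheses is the gradient of Q, and the gradient of 1/Q is -1/Q^2 times
  it.\<close>

lemma GDERIV_Rf: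
  fixes G :: "real^2 \<Rightarrow> real^2" and q :: "2 \<Rightarrow> real^2"
  assumes ij: "i \<noteq> j" and G: "\<And>i. GDERIV (\<lambda>x. G x $ i) x :> q i"
  shows "GDERIV (\<lambda>x. Rf (G x)) x :> (- (Rf (G x))\<^sup>2) *\<^sub>R (Ff i (G x) *\<^sub>R q i + Ff j (G x) *\<^sub>R q j)"
proof -
  let ?S = "\<lambda>x. 1 + (G x $ i * G x $ i + G x $ j * G x $ j)"
  have S: "?S x = 1 + (norm (G x))\<^sup>2" for x using norm_2_neq[OF ij, of "G x"] by (simp add: power2_eq_square)
  have dS: "GDERIV ?S x :> 0 + ((G x $ i *\<^sub>R q i + G x $ i *\<^sub>R q i) + (G x $ j *\<^sub>R q j + G x $ j *\<^sub>R q j))"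
    by (intro GDERIV_add GDERIV_const GDERIV_mult G)
  have pos: "?S x > 0" using sqrt_pos(3)[of "G x"] S by simp
  have ds: "((\<lambda>s. 1 / sqrt s) has_real_derivative - (1 / 2) * (1 / sqrt (?S x)) ^ 3) (at (?S x))"
    using pos by (rule DERIV_inverse_sqrt)
  have R: "1 / sqrt (?S x) = Rf (G x)" for x unfolding Rf_def S ..
  have "GDERIV (\<lambda>x. 1 / sqrt (?S x)) x :> (- (1 / 2) * (1 / sqrt (?S x)) ^ 3) *\<^sub>R
      (0 + ((G x $ i *\<^sub>R q i + G x $ i *\<^sub>R q i) + (G x $ j *\<^sub>R q j + G x $ j *\<^sub>R q j)))"
    by (rule GDERIV_DERIV_compose[OF dS ds])
  moreover have "(- (1 / 2) * (1 / sqrt (?S x)) ^ 3) *\<^sub>R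
      (0 + ((G x $ i *\<^sub>R q i + G x $ i *\<^sub>R q i) + (G x $ j *\<^sub>R q j + G x $ j *\<^sub>R q j)))
     = (- (Rf (G x))\<^sup>2) *\<^sub>R (Ff i (G x) *\<^sub>R q i + Ff j (G x) *\<^sub>R q j)"
    unfolding R Ff_def by (simp add: vec_eq_iff algebra_simps power2_eq_square power3_eq_cube)
  ultimately show ?thesis unfolding R by simp
qed

lemma GDERIV_Ff:
  fixes G :: "real^2 \<Rightarrow> real^2" and q :: "2 \<Rightarrow> real^2"
  assumes ij: "i \<noteq> j" and G: "\<And>i. GDERIV (\<lambda>x. G x $ i) x :> q i"
  shows "GDERIV (\<lambda>x. Ff k (G x)) x :> Rf (G x) *\<^sub>R q k - (Rf (G x) * Ff k (G x)) *\<^sub>R (Ff i (G x) *\<^sub>R q i + Ff j (G x) *\<^sub>R q j)"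
proof -
  have "GDERIV (\<lambda>x. G x $ k * Rf (G x)) x :> G x $ k *\<^sub>R ((- (Rf (G x))\<^sup>2) *\<^sub>R (Ff i (G x) *\<^sub>R q i + Ff j (G x) *\<^sub>R q j)) + Rf (G x) *\<^sub>R q k"
    by (intro GDERIV_mult G GDERIV_Rf[OF ij])
  then show ?thesis unfolding Ff_def by (rule back_subst[where P="\<lambda>D. gderiv _ _ D"])
     (simp add: vec_eq_iff algebra_simps power2_eq_square)
qed

lemma axis_in_Basis2 [simp]: "axis i (1::real) \<in> Basis" by (simp add: axis_in_Basis_iff)

lemma GDERIV_support:
  assumes "closed K" "\<And>x. x \<notin> K \<Longrightarrow> f x = 0" "x \<notin> K" "GDERIV f x :> D" shows "D = 0"
proof -
  have "((\<lambda>x. 0) has_derivative (\<lambda>h. 0)) (at x)" by simp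
  then have "(f has_derivative (\<lambda>h. 0)) (at x)"
    by (rule has_derivative_transform_within_open[of _ _ _ UNIV "- K"]) (use assms in auto)
  then have "GDERIV f x :> 0" by (simp add: gderiv_def)
  from GDERIV_unique[OF assms(4) this] show ?thesis .
qed

text \<open>Exactly what a mollified function provides: second-order information, with a symmetric
  Hessian, on a neighbourhood \<open>V\<close> of one compact set \<open>K\<close>, and a cutoff
  \<kappa> that hides everything outside \<open>K\<close>.\<close>

locale smooth_graph =
  fixes K V :: "(real^2) set" and U :: "real^2 \<Rightarrow> real" and G :: "real^2 \<Rightarrow> real^2" and H :: "2 \<Rightarrow> 2 \<Rightarrow> real^2 \<Rightarrow> real"
    and \<kappa> :: "real^2 \<Rightarrow> real" and \<kappa>' :: "real^2 \<Rightarrow> real^2"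
  assumes K: "compact K" "open V" "K \<subseteq> V"
    and U: "\<And>x. x \<in> V \<Longrightarrow> GDERIV U x :> G x"
    and G: "\<And>x i. x \<in> V \<Longrightarrow> GDERIV (\<lambda>x. G x $ i) x :> (\<chi> j. H i j x)"
    and sym: "\<And>x i j. x \<in> V \<Longrightarrow> H i j x = H j i x"
    and cont: "continuous_on V U" "continuous_on V G" "\<And>i j. continuous_on V (H i j)"
    and chi: "\<And>x. GDERIV \<kappa> x :> \<kappa>' x" "continuous_on UNIV \<kappa>'" "\<And>x. x \<notin> K \<Longrightarrow> \<kappa> x = 0"
begin

lemma chi'_0: "x \<notin> K \<Longrightarrow> \<kappa>' x = 0"
  by (rule GDERIV_support[OF compact_imp_closed[OF K(1)] chi(3) _ chi(1)])

lemma chi_cont: "continuous_on A \<kappa>"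
  using chi(1) unfolding gderiv_def
  by (meson continuous_at_imp_continuous_on has_derivative_continuous)

lemma G_cont: "continuous_on V (\<lambda>x. G x $ i)"
  using cont(2) by (intro continuous_intros)

text \<open>Lets the integrand be supplied in expanded form \<open>E\<close>, which has to match the
  partial derivative on \<open>V\<close> and to vanish off \<open>K\<close>.\<close>

lemma pd_zero:
  assumes w: "\<And>x. x \<notin> K \<Longrightarrow> w x = 0" and w': "\<And>x. x \<in> V \<Longrightarrow> GDERIV w x :> w' x"
    and c: "continuous_on V (\<lambda>x. w' x $ j)" and E: "\<And>x. x \<in> V \<Longrightarrow> w' x $ j = E x" "\<And>x. x \<notin> K \<Longrightarrow> E x = 0"
  shows "integrable lborel E" "(LBINT x. E x) = 0"
proof -
  have e: "indicator V x * (w' x \<bullet> axis j 1) = E x" for x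
    using E K(3) by (auto simp: inner_axis indicator_def)
  have c': "continuous_on V (\<lambda>x. w' x \<bullet> axis j 1)" using c by (simp add: inner_axis)
  show "integrable lborel E" "(LBINT x. E x) = 0"
    using integral_pd_zero[OF K w w' axis_in_Basis2 c'] unfolding e by auto
qed

text \<open>One term of the divergence of \<kappa> \<theta>(U) times grad U / Q, integrated over the
  plane, for each coordinate separately. The first bracket is the derivative of
  \<open>Ff k (G x)\<close> in direction \<open>k\<close>.\<close>

lemma first_variation_vertical:
  assumes th: "\<And>t. (\<theta> has_real_derivative \<theta>' t) (at t)" "continuous_on UNIV \<theta>'" and ij: "i \<noteq> j"
  shows "(LBINT x. \<kappa> x * \<theta> (U x) * (Rf (G x) * H k k x - Rf (G x) * Ff k (G x) * (Ff i (G x) * H i k x + Ff j (G x) * H j k x))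
     + \<kappa> x * \<theta>' (U x) * (Ff k (G x) * G x $ k) + \<kappa>' x $ k * \<theta> (U x) * Ff k (G x)) = 0"
proof -
  have thc: "continuous_on UNIV \<theta>" using th(1) by (meson DERIV_isCont continuous_at_imp_continuous_on)
  let ?w = "\<lambda>x. (\<kappa> x * \<theta> (U x)) * Ff k (G x)"
  let ?q = "\<lambda>x i. (\<chi> j. H i j x) :: real^2"
  let ?w' = "\<lambda>x. (\<kappa> x * \<theta> (U x)) *\<^sub>R (Rf (G x) *\<^sub>R ?q x k - (Rf (G x) * Ff k (G x)) *\<^sub>R (Ff i (G x) *\<^sub>R ?q x i + Ff j (G x) *\<^sub>R ?q x j))
    + Ff k (G x) *\<^sub>R (\<kappa> x *\<^sub>R (\<theta>' (U x) *\<^sub>R G x) + \<theta> (U x) *\<^sub>R \<kappa>' x)"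
  show ?thesis
  proof (rule pd_zero(2))
    show "GDERIV ?w x :> ?w' x" if "x \<in> V" for x
      by (intro GDERIV_mult chi GDERIV_Ff[OF ij] G that GDERIV_DERIV_compose[OF U[OF that] th(1)])
    show "?w x = 0" if "x \<notin> K" for x using chi(3)[OF that] by simp
    show "continuous_on V (\<lambda>x. ?w' x $ k)"
      by (auto intro!: continuous_intros cont chi_cont continuous_on_subset[OF chi(2)] G_cont
          continuous_on_compose2[OF thc] continuous_on_compose2[OF th(2)])
    show "?w' x $ k = \<kappa> x * \<theta> (U x) * (Rf (G x) * H k k x - Rf (G x) * Ff k (G x) * (Ff i (G x) * H i k x + Ff j (G x) * H j k x))
     + \<kappa> x * \<theta>' (U x) * (Ff k (G x) * G x $ k) + \<kappa>' x $ k * \<theta> (U x) * Ff k (G x)" for x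
      by (simp add: algebra_simps)
  qed (simp add: chi chi'_0)
qed

text \<open>Integrates the divergence of \<kappa> \<theta>(U) X(x_i) times the vector with
  \<open>i\<close>-th entry \<open>?A\<close> and \<open>j\<close>-th entry minus \<open>?B\<close>.
  This vector is Q e_i - (u_i / Q) grad U, a column of the stress tensor of the area functional:
  \<open>?A\<close> is Q - u_i^2 / Q = (1 + u_j^2) / Q and \<open>?B\<close> is u_i u_j / Q. Its
  divergence is -u_i times the mean curvature, which is the last group of terms.\<close>

lemma first_variation_horizontal:
  assumes th: "\<And>t. (\<theta> has_real_derivative \<theta>' t) (at t)" "continuous_on UNIV \<theta>'" and ij: "i \<noteq> j"
    and X: "\<And>t. (X has_real_derivative X' t) (at t)" "continuous_on UNIV X'"
  shows "(LBINT x. \<kappa>' x $ i * X (x $ i) * \<theta> (U x) * (Rf (G x) + Ff j (G x) * G x $ j)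
     - \<kappa>' x $ j * X (x $ i) * \<theta> (U x) * (Ff i (G x) * G x $ j)
     + \<kappa> x * X (x $ i) * \<theta>' (U x) * Ff i (G x)
     + \<kappa> x * X' (x $ i) * \<theta> (U x) * (Rf (G x) + Ff j (G x) * G x $ j)
     - \<kappa> x * X (x $ i) * \<theta> (U x) * (Ff i (G x) * H i i x - Ff i (G x) * Ff i (G x) * (Ff i (G x) * H i i x + Ff j (G x) * H j i x)
         + Ff i (G x) * H j j x - Ff i (G x) * Ff j (G x) * (Ff i (G x) * H i j x + Ff j (G x) * H j j x))) = 0"
proof -
  have thc: "continuous_on UNIV \<theta>" using th(1) by (meson DERIV_isCont continuous_at_imp_continuous_on)
  have Xc: "continuous_on UNIV X" using X(1) by (meson DERIV_isCont continuous_at_imp_continuous_on)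
  let ?q = "\<lambda>x i. (\<chi> j. H i j x) :: real^2"
  let ?\<eta> = "\<lambda>x. (\<kappa> x * \<theta> (U x)) * X (x $ i)"
  let ?\<eta>' = "\<lambda>x. (\<kappa> x * \<theta> (U x)) *\<^sub>R (X' (x $ i) *\<^sub>R axis i 1) + X (x $ i) *\<^sub>R (\<kappa> x *\<^sub>R (\<theta>' (U x) *\<^sub>R G x) + \<theta> (U x) *\<^sub>R \<kappa>' x)"
  let ?FF = "\<lambda>x. Ff i (G x) *\<^sub>R ?q x i + Ff j (G x) *\<^sub>R ?q x j"
  let ?dR = "\<lambda>x. (- (Rf (G x))\<^sup>2) *\<^sub>R ?FF x"
  let ?dF = "\<lambda>k x. Rf (G x) *\<^sub>R ?q x k - (Rf (G x) * Ff k (G x)) *\<^sub>R ?FF x"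
  let ?A = "\<lambda>x. Rf (G x) + Ff j (G x) * G x $ j"
  let ?A' = "\<lambda>x. ?dR x + (Ff j (G x) *\<^sub>R ?q x j + G x $ j *\<^sub>R ?dF j x)"
  let ?B = "\<lambda>x. Ff i (G x) * G x $ j"
  let ?B' = "\<lambda>x. Ff i (G x) *\<^sub>R ?q x j + G x $ j *\<^sub>R ?dF i x"
  have dc: "GDERIV (\<lambda>x. x $ i) x :> axis i 1" for x :: "real^2"
    unfolding gderiv_def by (simp add: inner_axis bounded_linear_imp_has_derivative bounded_linear_vec_nth)
  have d\<eta>: "GDERIV ?\<eta> x :> ?\<eta>' x" if "x \<in> V" for x
    by (intro GDERIV_mult chi GDERIV_DERIV_compose[OF U[OF that] th(1)] GDERIV_DERIV_compose[OF dc X(1)])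
  have dA: "GDERIV ?A x :> ?A' x" "GDERIV ?B x :> ?B' x" if "x \<in> V" for x
    by (intro GDERIV_add GDERIV_mult GDERIV_Rf[OF ij] GDERIV_Ff[OF ij] G that)+
  note ci = continuous_intros cont chi_cont continuous_on_subset[OF chi(2)] G_cont
          continuous_on_compose2[OF thc] continuous_on_compose2[OF th(2)]
          continuous_on_compose2[OF Xc] continuous_on_compose2[OF X(2)]
  let ?E1 = "\<lambda>x. (?\<eta> x *\<^sub>R ?A' x + ?A x *\<^sub>R ?\<eta>' x) $ i"
  let ?E2 = "\<lambda>x. (?\<eta> x *\<^sub>R ?B' x + ?B x *\<^sub>R ?\<eta>' x) $ j"
  have z: "?\<eta> x = 0" "?\<eta>' x = 0" if "x \<notin> K" for x using chi(3)[OF that] chi'_0[OF that] by simp_all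
  have 1: "integrable lborel ?E1" "(LBINT x. ?E1 x) = 0"
  proof -
    have *: "GDERIV (\<lambda>x. ?\<eta> x * ?A x) x :> ?\<eta> x *\<^sub>R ?A' x + ?A x *\<^sub>R ?\<eta>' x" if "x \<in> V" for x
      by (intro GDERIV_mult d\<eta> dA that)
    have w0: "?\<eta> x * ?A x = 0" "?E1 x = 0" if "x \<notin> K" for x
      unfolding z[OF that] by simp_all
    have c: "continuous_on V ?E1" by (auto intro!: ci)
    show "integrable lborel ?E1" "(LBINT x. ?E1 x) = 0"
      using pd_zero[OF w0(1) * c refl w0(2)] by blast+
  qed
  have 2: "integrable lborel ?E2" "(LBINT x. ?E2 x) = 0"
  proof -
    have *: "GDERIV (\<lambda>x. ?\<eta> x * ?B x) x :> ?\<eta> x *\<^sub>R ?B' x + ?B x *\<^sub>R ?\<eta>' x" if "x \<in> V" for x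
      by (intro GDERIV_mult d\<eta> dA that)
    have w0: "?\<eta> x * ?B x = 0" "?E2 x = 0" if "x \<notin> K" for x
      unfolding z[OF that] by simp_all
    have c: "continuous_on V ?E2" by (auto intro!: ci)
    show "integrable lborel ?E2" "(LBINT x. ?E2 x) = 0"
      using pd_zero[OF w0(1) * c refl w0(2)] by blast+
  qed
  have "(LBINT x. ?E1 x - ?E2 x) = 0" using 1 2 by simp
  moreover have "?E1 x - ?E2 x = \<kappa>' x $ i * X (x $ i) * \<theta> (U x) * (Rf (G x) + Ff j (G x) * G x $ j)
     - \<kappa>' x $ j * X (x $ i) * \<theta> (U x) * (Ff i (G x) * G x $ j)
     + \<kappa> x * X (x $ i) * \<theta>' (U x) * Ff i (G x)
     + \<kappa> x * X' (x $ i) * \<theta> (U x) * (Rf (G x) + Ff j (G x) * G x $ j)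
     - \<kappa> x * X (x $ i) * \<theta> (U x) * (Ff i (G x) * H i i x - Ff i (G x) * Ff i (G x) * (Ff i (G x) * H i i x + Ff j (G x) * H j i x)
         + Ff i (G x) * H j j x - Ff i (G x) * Ff j (G x) * (Ff i (G x) * H i j x + Ff j (G x) * H j j x))" for x
  proof (cases "x \<in> K")
    case False
    then show ?thesis using z[OF False] chi(3)[OF False] chi'_0[OF False] by simp
  next
    case True
    then have s: "H j i x = H i j x" using sym K(3) by blast
    define R F1 F2 g1 g2 where d: "R = Rf (G x)" "F1 = Ff i (G x)" "F2 = Ff j (G x)" "g1 = G x $ i" "g2 = G x $ j"
    have r: "F1 = g1 * R" "F2 = g2 * R" by (auto simp: d Ff_def)
    have n: "R\<^sup>2 + F1\<^sup>2 + F2\<^sup>2 = 1" unfolding d by (rule Rf_Ff_sq[OF ij])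
    define a b e where "a = H i i x" "b = H i j x" "e = H j j x"
    \<comment> \<open>The Noether identity of the area functional under horizontal translation: the
      divergence of the column is -u_i times the mean curvature. Symmetry of the Hessian enters
      through the single letter \<open>b\<close> for both mixed derivatives.\<close>
    have core: "(- R\<^sup>2 * (F1 * a + F2 * b) + (F2 * b + g2 * (R * b - R * F2 * (F1 * a + F2 * b))))
       - (F1 * e + g2 * (R * b - R * F1 * (F1 * b + F2 * e)))
      = - (F1 * a - F1 * F1 * (F1 * a + F2 * b) + F1 * e - F1 * F2 * (F1 * b + F2 * e))"
    proof -
      have g2: "g2 * (R * b - R * F2 * (F1 * a + F2 * b)) = F2 * b - F2 * F2 * (F1 * a + F2 * b)"
        "g2 * (R * b - R * F1 * (F1 * b + F2 * e)) = F2 * b - F2 * F1 * (F1 * b + F2 * e)"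
        by (simp_all add: r algebra_simps)
      have R2: "R\<^sup>2 = 1 - F1 * F1 - F2 * F2" using n by (simp add: power2_eq_square)
      show ?thesis unfolding g2 R2 by (simp add: algebra_simps)
    qed
    have ax: "axis i (1::real) $ i = 1" "axis i (1::real) $ j = 0" using ij by (auto simp: axis_def)
    \<comment> \<open>The coefficient of \<theta>': pairing the column with grad U leaves u_i / Q, a
      bounded quantity.\<close>
    have cross: "(R + F2 * g2) * g1 - F1 * g2 * g2 = F1" by (simp add: r algebra_simps)
    have "?E1 x - ?E2 x = \<kappa> x * \<theta> (U x) * X (x $ i) * ((- R\<^sup>2 * (F1 * a + F2 * b) + (F2 * b + g2 * (R * b - R * F2 * (F1 * a + F2 * b))))
       - (F1 * e + g2 * (R * b - R * F1 * (F1 * b + F2 * e))))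
       + (R + F2 * g2) * (\<kappa> x * \<theta> (U x) * X' (x $ i) + X (x $ i) * \<theta> (U x) * \<kappa>' x $ i)
       - F1 * g2 * (X (x $ i) * \<theta> (U x) * \<kappa>' x $ j)
       + \<kappa> x * X (x $ i) * \<theta>' (U x) * ((R + F2 * g2) * g1 - F1 * g2 * g2)"
      by (simp add: s d(1)[symmetric] d(2)[symmetric] d(3)[symmetric] d(4)[symmetric] d(5)[symmetric]
          a_b_e_def[symmetric] ax algebra_simps)
    then show ?thesis unfolding core cross
      by (simp add: s d(1)[symmetric] d(2)[symmetric] d(3)[symmetric] d(4)[symmetric] d(5)[symmetric]
          a_b_e_def[symmetric] algebra_simps)
  qed
  ultimately show ?thesis by simp
qed

end

section \<open>Limits of integrals, slicing of the plane, projections\<close>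

definition int_lim :: "(nat \<Rightarrow> 'a::euclidean_space \<Rightarrow> real) \<Rightarrow> ('a \<Rightarrow> real) \<Rightarrow> bool" where
  "int_lim a a' \<longleftrightarrow> (\<forall>n. integrable lborel (a n)) \<and> integrable lborel a' \<and>
     (\<lambda>n. \<integral>x. a n x \<partial>lborel) \<longlonglongrightarrow> (LBINT x. a' x)"

lemma int_lim_add: "int_lim a a' \<Longrightarrow> int_lim b b' \<Longrightarrow> int_lim (\<lambda>n x. a n x + b n x) (\<lambda>x. a' x + b' x)"
  unfolding int_lim_def by (auto intro!: tendsto_add)

lemma int_lim_diff: "int_lim a a' \<Longrightarrow> int_lim b b' \<Longrightarrow> int_lim (\<lambda>n x. a n x - b n x) (\<lambda>x. a' x - b' x)"
  unfolding int_lim_def by (auto intro!: tendsto_diff)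

lemma int_lim_zero:
  assumes "int_lim a a'" "\<forall>\<^sub>F n in sequentially. (LBINT x. a n x) = 0"
  shows "(LBINT x. a' x) = 0"
proof -
  have "(\<lambda>n. \<integral>x. a n x \<partial>lborel) \<longlonglongrightarrow> 0" using assms(2) by (rule tendsto_eventually)
  with assms(1) show ?thesis unfolding int_lim_def using LIMSEQ_unique by blast
qed

lemma int_lim_le:
  assumes "int_lim a a'" "\<forall>\<^sub>F n in sequentially. C \<le> (LBINT x. a n x)"
  shows "C \<le> (LBINT x. a' x)"
  using assms by (auto simp: int_lim_def intro: tendsto_lowerbound)

text \<open>Coordinates of the plane with a distinguished index, to apply Fubini on \<^typ>\<open>real^2\<close>.\<close>

definition plane_pt :: "2 \<Rightarrow> real \<times> real \<Rightarrow> real^2" where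
  "plane_pt i p = (\<chi> k. if k = i then fst p else snd p)"

lemma plane_pt_measurable [measurable]: "plane_pt i \<in> borel \<rightarrow>\<^sub>M borel"
proof -
  have "continuous_on UNIV (\<lambda>p::real \<times> real. if k = i then fst p else snd p)" for k
    by (cases "k = i") (auto intro!: continuous_intros)
  then show ?thesis
    unfolding plane_pt_def by (intro borel_measurable_continuous_onI continuous_on_vec_lambda)
qed

lemma lborel_plane: "lborel = distr (lborel \<Otimes>\<^sub>M lborel) borel (plane_pt i)"
proof (rule lborel_eqI)
  fix l u :: "real^2" assume lu: "\<And>b. b \<in> Basis \<Longrightarrow> l \<bullet> b \<le> u \<bullet> b"
  obtain j where j: "j \<noteq> i" using ex_neq_2 by blast
  have ij: "\<forall>k. k = i \<or> k = j" using j exhaust_2 by metis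
  have le: "l $ k \<le> u $ k" for k using lu[of "axis k 1"] by (simp add: inner_axis)
  have m: "plane_pt i \<in> (lborel \<Otimes>\<^sub>M lborel) \<rightarrow>\<^sub>M borel"
    by (simp add: lborel_prod)
  have v: "plane_pt i -` box l u \<inter> space (lborel \<Otimes>\<^sub>M lborel) = {l$i<..<u$i} \<times> {l$j<..<u$j}"
  proof -
    have all: "(\<forall>k. P k) \<longleftrightarrow> P i \<and> P j" for P using ij by metis
    show ?thesis unfolding space_pair_measure using j by (auto simp: mem_box_cart plane_pt_def all)
  qed
  have "emeasure (distr (lborel \<Otimes>\<^sub>M lborel) borel (plane_pt i)) (box l u) = emeasure (lborel \<Otimes>\<^sub>M lborel) ({l$i<..<u$i} \<times> {l$j<..<u$j})"
    unfolding v[symmetric] by (rule emeasure_distr[OF m]) auto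
  also have "\<dots> = ennreal (u$i - l$i) * ennreal (u$j - l$j)"
    using le[of i] le[of j] by (subst lborel.emeasure_pair_measure_Times) auto
  also have "\<dots> = ennreal ((u$i - l$i) * (u$j - l$j))" using le by (simp add: ennreal_mult)
  also have "(u$i - l$i) * (u$j - l$j) = (\<Prod>b\<in>Basis. (u - l) \<bullet> b)"
  proof -
    have B: "(Basis :: (real^2) set) = {axis i 1, axis j 1}"
      using ij by (auto simp: Basis_vec_def)
    have "axis i (1::real) \<noteq> axis j 1" using j by (auto simp: axis_eq_axis)
    then show ?thesis unfolding B by (simp add: inner_axis)
  qed
  finally show "emeasure (distr (lborel \<Otimes>\<^sub>M lborel) borel (plane_pt i)) (box l u) = ennreal (\<Prod>b\<in>Basis. (u - l) \<bullet> b)" .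
qed simp

lemma nn_integral_plane:
  assumes "f \<in> borel_measurable borel"
  shows "(\<integral>\<^sup>+x. f x \<partial>lborel) = (\<integral>\<^sup>+s. \<integral>\<^sup>+t. f (plane_pt i (s, t)) \<partial>lborel \<partial>lborel)"
proof -
  have [measurable]: "f \<in> borel_measurable borel" by fact
  have m: "plane_pt i \<in> (lborel \<Otimes>\<^sub>M lborel) \<rightarrow>\<^sub>M borel"
    by (simp add: lborel_prod)
  have m2: "(\<lambda>p. f (plane_pt i p)) \<in> borel_measurable (lborel \<Otimes>\<^sub>M lborel)"
    using measurable_compose[OF m assms] .
  have "(\<integral>\<^sup>+x. f x \<partial>lborel) = (\<integral>\<^sup>+p. f (plane_pt i p) \<partial>(lborel \<Otimes>\<^sub>M lborel))"
    by (subst lborel_plane[of i], rule nn_integral_distr[OF m]) (simp add: assms)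
  also have "\<dots> = (\<integral>\<^sup>+s. \<integral>\<^sup>+t. f (plane_pt i (s, t)) \<partial>lborel \<partial>lborel)"
    using lborel.nn_integral_fst[OF m2] by simp
  finally show ?thesis .
qed

lemma FTC_abs_le:
  fixes f :: "real \<Rightarrow> real"
  assumes f: "\<And>t. (f has_real_derivative f' t) (at t)" "continuous_on UNIV f'"
    and z: "\<And>t. t \<le> a \<Longrightarrow> f t = 0"
  shows "ennreal \<bar>f s\<bar> \<le> (\<integral>\<^sup>+t. ennreal \<bar>f' t\<bar> \<partial>lborel)"
proof (cases "s \<le> a")
  case True
  then show ?thesis using z by simp
next
  case False
  have *: "has_bochner_integral lborel (\<lambda>x. indicator {a..s} x *\<^sub>R f' x) (f s - f a)"
    by (rule has_bochner_integral_FTC_Icc)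
      (use False f in \<open>auto simp: has_real_derivative_iff_has_vector_derivative[symmetric] intro: has_field_derivative_at_within continuous_on_subset\<close>)
  then have "f s = (LBINT x. indicator {a..s} x *\<^sub>R f' x)" and i: "integrable lborel (\<lambda>x. indicator {a..s} x *\<^sub>R f' x)"
    using z[of a] by (auto simp: has_bochner_integral_iff)
  then have "ennreal \<bar>f s\<bar> \<le> (\<integral>\<^sup>+x. ennreal (norm (indicator {a..s} x *\<^sub>R f' x)) \<partial>lborel)"
    using integral_norm_bound_ennreal[OF i] by simp
  also have "\<dots> \<le> (\<integral>\<^sup>+t. ennreal \<bar>f' t\<bar> \<partial>lborel)"
    by (intro nn_integral_mono) (auto simp: indicator_def)
  finally show ?thesis .
qed

text \<open>On each line in direction \<open>j\<close> that meets \<open>D\<close>, the function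
  climbs from 0 outside \<open>K\<close> to at least \<open>c0\<close>, so its absolute derivative
  along the line has integral at least \<open>c0\<close>. Integrating over the lines counts the
  projection of \<open>D\<close>.\<close>

lemma projection_bound:
  fixes w :: "real^2 \<Rightarrow> real"
  assumes ij: "i \<noteq> j" and w: "\<And>x. GDERIV w x :> w' x" and c: "continuous_on UNIV w'"
    and K: "bounded K" "\<And>x. x \<notin> K \<Longrightarrow> w x = 0"
    and D: "open ((\<lambda>x. x $ i) ` D)" "\<And>x. x \<in> D \<Longrightarrow> c0 \<le> w x" and c0: "0 \<le> c0"
  shows "ennreal c0 * emeasure lborel ((\<lambda>x. x $ i) ` D) \<le> (\<integral>\<^sup>+x. ennreal \<bar>w' x $ j\<bar> \<partial>lborel)"
proof -
  have ex: "\<forall>k. k = i \<or> k = j" using ij exhaust_2 by metis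
  obtain M where M: "\<And>x. x \<in> K \<Longrightarrow> norm x < M" using bounded_subset_ballD[OF K(1), of 0] by (metis mem_ball_0 subsetD)
  have wj: "continuous_on UNIV (\<lambda>x. w' x $ j)" using c by (intro continuous_intros)
  have mp: "(\<lambda>x. ennreal \<bar>w' x $ j\<bar>) \<in> borel_measurable borel"
    using borel_measurable_continuous_onI[OF wj] by measurable
  have "ennreal c0 * emeasure lborel ((\<lambda>x. x $ i) ` D) = (\<integral>\<^sup>+s. ennreal c0 * indicator ((\<lambda>x. x $ i) ` D) s \<partial>lborel)"
    using D(1) by (subst nn_integral_cmult_indicator) auto
  also have "\<dots> \<le> (\<integral>\<^sup>+s. \<integral>\<^sup>+t. ennreal \<bar>w' (plane_pt i (s, t)) $ j\<bar> \<partial>lborel \<partial>lborel)"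
  proof (rule nn_integral_mono)
    fix s
    show "ennreal c0 * indicator ((\<lambda>x. x $ i) ` D) s \<le> (\<integral>\<^sup>+t. ennreal \<bar>w' (plane_pt i (s, t)) $ j\<bar> \<partial>lborel)"
    proof (cases "s \<in> (\<lambda>x. x $ i) ` D")
      case True
      then obtain x where x: "x \<in> D" "s = x $ i" by auto
      have xp: "x = plane_pt i (s, x $ j)" using x ex by (auto simp: plane_pt_def vec_eq_iff)
      have "ennreal \<bar>w (plane_pt i (s, x $ j))\<bar> \<le> (\<integral>\<^sup>+t. ennreal \<bar>w' (plane_pt i (s, t)) $ j\<bar> \<partial>lborel)"
      proof (rule FTC_abs_le[where a = "- M" and f = "\<lambda>t. w (plane_pt i (s, t))" and f' = "\<lambda>t. w' (plane_pt i (s, t)) $ j"])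
        fix t
        define a where "a = plane_pt i (s, 0)"
        have e: "plane_pt i (s, t) = a + t *\<^sub>R axis j 1" for t
          using ex ij by (auto simp: a_def plane_pt_def vec_eq_iff axis_def)
        have "((\<lambda>t. plane_pt i (s, t)) has_derivative (\<lambda>h. h *\<^sub>R axis j 1)) (at t)"
          unfolding e by (auto intro!: derivative_eq_intros)
        from has_derivative_compose[OF this w[of "plane_pt i (s, t)", unfolded gderiv_def]]
        show "((\<lambda>t. w (plane_pt i (s, t))) has_real_derivative w' (plane_pt i (s, t)) $ j) (at t)"
          by (simp add: has_field_derivative_def inner_axis' mult_commute_abs)
        have cp: "continuous_on UNIV (\<lambda>t. plane_pt i (s, t))" unfolding e by (intro continuous_intros)
        show "continuous_on UNIV (\<lambda>t. w' (plane_pt i (s, t)) $ j)"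
          by (rule continuous_on_compose2[OF wj cp]) auto
        assume t: "t \<le> - M"
        show "w (plane_pt i (s, t)) = 0"
        proof (rule K(2), rule notI)
          assume "plane_pt i (s, t) \<in> K"
          then have "norm (plane_pt i (s, t)) < M" by (rule M)
          moreover have "\<bar>plane_pt i (s, t) $ j\<bar> \<le> norm (plane_pt i (s, t))" by (rule component_le_norm_cart)
          ultimately show False using t ij by (simp add: plane_pt_def)
        qed
      qed
      moreover have "c0 \<le> \<bar>w (plane_pt i (s, x $ j))\<bar>" using D(2)[OF x(1)] xp by simp
      ultimately show ?thesis using True by (auto intro: order_trans[OF ennreal_leI])
    qed simp
  qed
  also have "\<dots> = (\<integral>\<^sup>+x. ennreal \<bar>w' x $ j\<bar> \<partial>lborel)"
    by (rule nn_integral_plane[OF mp, symmetric])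
  finally show ?thesis .
qed

text \<open>Every term of the first variation has this shape: a fixed factor of compact support, a
  bounded function of \<open>U\<close>, a bounded function of the gradient, and one possibly
  unbounded weight that converges in L1.\<close>

lemma term_tendsto:
  fixes U :: "nat \<Rightarrow> real^2 \<Rightarrow> real" and G :: "nat \<Rightarrow> real^2 \<Rightarrow> real^2"
  assumes K: "compact K" and c: "continuous_on UNIV c" "\<And>x. x \<notin> K \<Longrightarrow> c x = 0"
    and tau: "continuous_on UNIV \<tau>" "\<And>t. \<bar>\<tau> t\<bar> \<le> B"
    and beta: "continuous_on UNIV \<beta>" "\<And>v. \<bar>\<beta> v\<bar> \<le> B'"
    and U: "\<And>n. continuous_on UNIV (U n)" "\<And>x. x \<in> K \<Longrightarrow> (\<lambda>n. U n x) \<longlonglongrightarrow> u x"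
    and G: "\<And>n. continuous_on UNIV (G n)" "AE x in lborel. (\<lambda>n. G n x) \<longlonglongrightarrow> gr x"
    and m: "u \<in> borel_measurable borel" "gr \<in> borel_measurable borel"
    and w: "\<And>n. integrable lborel (wn n)" "integrable lborel w" "(\<lambda>n. \<integral>x. \<bar>wn n x - w x\<bar> \<partial>lborel) \<longlonglongrightarrow> 0"
  shows "int_lim (\<lambda>n x. (c x * \<tau> (U n x) * \<beta> (G n x)) * wn n x) (\<lambda>x. (c x * \<tau> (u x) * \<beta> (gr x)) * w x)"
proof -
  obtain C where C: "\<And>x. \<bar>c x\<bar> \<le> C"
    using compact_support_uniformly_continuous(2)[OF c(1) compact_imp_bounded[OF K] c(2)] by blast
  have nn: "0 \<le> C" "0 \<le> B" "0 \<le> B'" using C[of 0] tau(2)[of 0] beta(2)[of 0] by linarith+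
  have bd: "\<bar>c x * \<tau> (U n x) * \<beta> (G n x)\<bar> \<le> C * B * B'" for n x
    unfolding abs_mult by (intro mult_mono C tau(2) beta(2)) (auto simp: nn)
  have [measurable]: "c \<in> borel_measurable borel" "\<tau> \<in> borel_measurable borel" "\<beta> \<in> borel_measurable borel"
     "\<And>n. U n \<in> borel_measurable borel" "\<And>n. G n \<in> borel_measurable borel" "u \<in> borel_measurable borel" "gr \<in> borel_measurable borel"
    using c(1) tau(1) beta(1) U(1) G(1) m by (auto intro: borel_measurable_continuous_onI)
  have bl: "AE x in lborel. w x \<noteq> 0 \<longrightarrow> (\<lambda>n. c x * \<tau> (U n x) * \<beta> (G n x)) \<longlonglongrightarrow> c x * \<tau> (u x) * \<beta> (gr x)"
    using G(2)
  proof eventually_elim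
    case (elim x)
    show ?case
    proof (cases "x \<in> K")
      case True
      have "(\<lambda>n. \<tau> (U n x)) \<longlonglongrightarrow> \<tau> (u x)" "(\<lambda>n. \<beta> (G n x)) \<longlonglongrightarrow> \<beta> (gr x)"
        using continuous_on_tendsto_compose[OF tau(1) U(2)[OF True]] continuous_on_tendsto_compose[OF beta(1) elim] by auto
      then show ?thesis by (intro impI tendsto_intros)
    qed (simp add: c)
  qed
  have bd': "AE x in lborel. \<bar>c x * \<tau> (U n x) * \<beta> (G n x)\<bar> \<le> C * B * B'" for n
    using bd by simp
  have m1: "(\<lambda>x. c x * \<tau> (U n x) * \<beta> (G n x)) \<in> borel_measurable lborel" for n by measurable
  have m2: "(\<lambda>x. c x * \<tau> (u x) * \<beta> (gr x)) \<in> borel_measurable lborel" by measurable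
  note D = integral_mult_tendsto[where b = "\<lambda>n x. c x * \<tau> (U n x) * \<beta> (G n x)" and wn = wn and w = w
      and b' = "\<lambda>x. c x * \<tau> (u x) * \<beta> (gr x)", OF m1 bd' bl m2 w]
  show ?thesis unfolding int_lim_def by (intro conjI allI D)
qed

section \<open>First variation of Sobolev graphs\<close>

lemma Basis_2: "(Basis :: (real^2) set) = range (\<lambda>i. axis i 1)"
  by (auto simp: Basis_vec_def)

lemma sum_Basis_2: "(\<Sum>b\<in>Basis. a b *\<^sub>R b) = (\<chi> i. a (axis i (1::real)) :: real^2)"
proof -
  have "(\<Sum>b\<in>Basis. a b *\<^sub>R b) $ i = a (axis i 1)" for i
  proof -
    have "(\<Sum>b\<in>Basis. a b *\<^sub>R b) $ i = (\<Sum>b\<in>Basis. a b *\<^sub>R b) \<bullet> (axis i 1 :: real^2)" by (simp add: inner_axis)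
    also have "\<dots> = a (axis i 1)" by (simp add: inner_sum_left_Basis)
    finally show ?thesis .
  qed
  then show ?thesis by (simp add: vec_eq_iff)
qed

text \<open>Sign and size of \<kappa> are left open so that an arbitrary test function also
  qualifies; \<open>wder_Ff\<close> relies on this.\<close>

definition cutoff :: "(real^2) set \<Rightarrow> (real^2) set \<Rightarrow> (real^2 \<Rightarrow> real) \<Rightarrow> (real^2 \<Rightarrow> real^2) \<Rightarrow> bool" where
  "cutoff \<Omega> K \<kappa> \<kappa>' \<longleftrightarrow> compact K \<and> K \<subseteq> \<Omega> \<and> (\<forall>x. GDERIV \<kappa> x :> \<kappa>' x) \<and> continuous_on UNIV \<kappa>' \<and> (\<forall>x. x \<notin> K \<longrightarrow> \<kappa> x = 0)"

definition C1b :: "(real \<Rightarrow> real) \<Rightarrow> (real \<Rightarrow> real) \<Rightarrow> bool" where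
  "C1b \<theta> \<theta>' \<longleftrightarrow> (\<forall>t. (\<theta> has_real_derivative \<theta>' t) (at t)) \<and> continuous_on UNIV \<theta>' \<and>
     (\<exists>B. \<forall>t. \<bar>\<theta> t\<bar> \<le> B \<and> \<bar>\<theta>' t\<bar> \<le> B)"

lemma cutoffD:
  assumes "cutoff \<Omega> K \<kappa> \<kappa>'"
  shows "compact K" "K \<subseteq> \<Omega>" "\<And>x. GDERIV \<kappa> x :> \<kappa>' x" "continuous_on UNIV \<kappa>'" "\<And>x. x \<notin> K \<Longrightarrow> \<kappa> x = 0"
    "continuous_on UNIV \<kappa>" "\<And>x. x \<notin> K \<Longrightarrow> \<kappa>' x = 0" "continuous_on UNIV (\<lambda>x. \<kappa>' x $ i)"
proof -
  show 1: "compact K" "K \<subseteq> \<Omega>" "\<And>x. GDERIV \<kappa> x :> \<kappa>' x" "continuous_on UNIV \<kappa>'" "\<And>x. x \<notin> K \<Longrightarrow> \<kappa> x = 0"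
    using assms by (auto simp: cutoff_def)
  show "continuous_on UNIV \<kappa>"
    using 1(3) unfolding gderiv_def by (meson continuous_at_imp_continuous_on has_derivative_continuous)
  show "\<And>x. x \<notin> K \<Longrightarrow> \<kappa>' x = 0" by (rule GDERIV_support[OF compact_imp_closed[OF 1(1)] 1(5) _ 1(3)])
  show "continuous_on UNIV (\<lambda>x. \<kappa>' x $ i)" using 1(4) by (intro continuous_intros)
qed

lemma C1bD:
  assumes "C1b \<theta> \<theta>'"
  shows "\<And>t. (\<theta> has_real_derivative \<theta>' t) (at t)" "continuous_on UNIV \<theta>'" "continuous_on UNIV \<theta>"
    "\<exists>B. \<forall>t. \<bar>\<theta> t\<bar> \<le> B" "\<exists>B. \<forall>t. \<bar>\<theta>' t\<bar> \<le> B"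
  using assms unfolding C1b_def by (auto, meson DERIV_isCont continuous_at_imp_continuous_on)

text \<open>\<open>u\<close>, its gradient \<open>gr\<close> and its second derivatives \<open>h i j\<close> are Borel functions extended by zero,
  so that all integrals run over the plane.\<close>

locale sobolev_graph =
  fixes \<Omega> :: "(real^2) set" and u :: "real^2 \<Rightarrow> real" and gr :: "real^2 \<Rightarrow> real^2" and h :: "2 \<Rightarrow> 2 \<Rightarrow> real^2 \<Rightarrow> real"
  assumes open_\<Omega>: "open \<Omega>" and bdd: "bounded \<Omega>"
    and u: "continuous_on \<Omega> u" "integrable lborel u" "\<And>x. x \<notin> \<Omega> \<Longrightarrow> u x = 0"
    and gr_meas: "gr \<in> borel_measurable borel" and gr0: "\<And>x. x \<notin> \<Omega> \<Longrightarrow> gr x = 0"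
    and gr2: "integrable lborel (\<lambda>x. (norm (gr x))\<^sup>2)"
    and h_meas: "\<And>i j. h i j \<in> borel_measurable borel" and h0: "\<And>i j x. x \<notin> \<Omega> \<Longrightarrow> h i j x = 0"
    and h2: "\<And>i j. integrable lborel (\<lambda>x. (h i j x)\<^sup>2)"
    and wgr: "\<And>i. wder \<Omega> (axis i 1) u (\<lambda>x. gr x $ i)"
    and wh: "\<And>i j. wder \<Omega> (axis j 1) (\<lambda>x. gr x $ i) (h i j)"
begin

lemma emeasure_\<Omega>: "emeasure lborel \<Omega> < \<infinity>"
  using bdd by (rule emeasure_bounded_finite)

lemma ind_integrable: "integrable lborel (indicator \<Omega> :: real^2 \<Rightarrow> real)"
  using emeasure_\<Omega> open_\<Omega> by (simp add: integrable_indicator_iff)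

lemma L2_L1:
  fixes f :: "real^2 \<Rightarrow> real"
  assumes "f \<in> borel_measurable borel" "\<And>x. x \<notin> \<Omega> \<Longrightarrow> f x = 0" "integrable lborel (\<lambda>x. (f x)\<^sup>2)"
  shows "integrable lborel f"
  by (rule square_integrable_integrable[OF bdd _ assms]) (use open_\<Omega> in simp)

lemma grj_meas [measurable]: "(\<lambda>x. gr x $ i) \<in> borel_measurable borel"
  using gr_meas by (intro measurable_compose[OF gr_meas]) (simp add: borel_measurable_continuous_onI continuous_on_component)

lemma gr_integrable: "integrable lborel (\<lambda>x. gr x $ i)"
proof (rule L2_L1)
  show "integrable lborel (\<lambda>x. (gr x $ i)\<^sup>2)"
  proof (rule Bochner_Integration.integrable_bound[OF gr2])
    show "AE x in lborel. norm ((gr x $ i)\<^sup>2) \<le> norm ((norm (gr x))\<^sup>2)"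
      using component_le_norm_cart[of "gr _" i] by (intro AE_I2) (simp add: abs_le_square_iff[symmetric])
  qed measurable
qed (use gr0 in auto)

lemma h_integrable: "integrable lborel (h i j)"
  by (rule L2_L1[OF h_meas h0 h2])

text \<open>The formal derivative of \<open>Ff k (gr x)\<close> in direction \<open>k\<close>. It is
  only a candidate until \<open>wder_Ff\<close> identifies it as a weak derivative.\<close>

definition fdiv :: "2 \<Rightarrow> real^2 \<Rightarrow> real" where
  "fdiv k x = Rf (gr x) * h k k x - Rf (gr x) * Ff k (gr x) * (Ff 1 (gr x) * h 1 k x + Ff 2 (gr x) * h 2 k x)"

definition mc :: "real^2 \<Rightarrow> real" where "mc x = fdiv 1 x + fdiv 2 x"

lemma fdiv_neq: "i \<noteq> j \<Longrightarrow>
  fdiv k x = Rf (gr x) * h k k x - Rf (gr x) * Ff k (gr x) * (Ff i (gr x) * h i k x + Ff j (gr x) * h j k x)"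
  using exhaust_2[of i] exhaust_2[of j] by (auto simp: fdiv_def algebra_simps)

lemma mc_neq: "i \<noteq> j \<Longrightarrow> mc x = fdiv i x + fdiv j x"
  using exhaust_2[of i] exhaust_2[of j] by (auto simp: mc_def)

definition approx :: "(nat \<Rightarrow> real^2 \<Rightarrow> real) \<Rightarrow> (nat \<Rightarrow> real^2 \<Rightarrow> real^2) \<Rightarrow> (nat \<Rightarrow> 2 \<Rightarrow> 2 \<Rightarrow> real^2 \<Rightarrow> real) \<Rightarrow> bool" where
  "approx U G H \<longleftrightarrow> (\<forall>n. continuous_on UNIV (U n)) \<and> (\<forall>n. continuous_on UNIV (G n)) \<and> (\<forall>n i j. continuous_on UNIV (H n i j)) \<and>
    (\<forall>n i. integrable lborel (\<lambda>x. G n x $ i)) \<and> (\<forall>n i j. integrable lborel (H n i j)) \<and>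
    (\<forall>K. compact K \<longrightarrow> K \<subseteq> \<Omega> \<longrightarrow> (\<forall>\<^sub>F n in sequentially. \<exists>V. open V \<and> K \<subseteq> V \<and>
      (\<forall>x\<in>V. GDERIV (U n) x :> G n x \<and> (\<forall>i. GDERIV (\<lambda>x. G n x $ i) x :> (\<chi> j. H n i j x)) \<and>
        (\<forall>i j. H n i j x = H n j i x)))) \<and>
    (\<forall>K e. compact K \<longrightarrow> K \<subseteq> \<Omega> \<longrightarrow> e > 0 \<longrightarrow> (\<forall>\<^sub>F n in sequentially. \<forall>x\<in>K. \<bar>U n x - u x\<bar> \<le> e)) \<and>
    (\<forall>i. (\<lambda>n. \<integral>x. \<bar>G n x $ i - gr x $ i\<bar> \<partial>lborel) \<longlonglongrightarrow> 0) \<and>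
    (\<forall>i j. (\<lambda>n. \<integral>x. \<bar>H n i j x - h i j x\<bar> \<partial>lborel) \<longlonglongrightarrow> 0) \<and>
    (AE x in lborel. (\<lambda>n. G n x) \<longlonglongrightarrow> gr x)"

lemma approx_exists: "\<exists>U G H. approx U G H"
proof -
  \<comment> \<open>\<open>smooth_approx\<close> is indexed by basis vectors and the locale by
    coordinate numbers; \<open>ix\<close> translates.\<close>
  define ix where "ix b = (THE i. b = axis i (1::real))" for b :: "real^2"
  have ix: "ix (axis i 1) = i" for i by (auto simp: ix_def axis_eq_axis intro!: the_equality)
  let ?g = "\<lambda>b x. gr x $ ix b" and ?h = "\<lambda>b c. h (ix b) (ix c)"
  have g: "integrable lborel (?g b)" "wder \<Omega> b u (?g b)" if "b \<in> Basis" for b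
    using that gr_integrable wgr unfolding Basis_2 by (auto simp: ix)
  have h: "integrable lborel (?h b c)" "wder \<Omega> c (?g b) (?h b c)" if "b \<in> Basis" "c \<in> Basis" for b c
    using that h_integrable wh unfolding Basis_2 by (auto simp: ix)
  obtain U G H where "smooth_approx \<Omega> u ?g ?h U G H"
    using smooth_approximation[of \<Omega> u ?g ?h] open_\<Omega> u g h by blast
  note A = this[unfolded smooth_approx_def Basis_2 ball_simps(9) ix simp_thms]
  let ?G = "\<lambda>n x. (\<chi> i. G n (axis i 1) x) :: real^2" and ?H = "\<lambda>n i j. H n (axis i 1) (axis j 1)"
  have "approx U ?G ?H"
    unfolding approx_def
  proof (intro conjI allI impI)
    fix K assume K: "compact K" "K \<subseteq> \<Omega>"
    show "\<forall>\<^sub>F n in sequentially. \<exists>V. open V \<and> K \<subseteq> V \<and>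
      (\<forall>x\<in>V. GDERIV (U n) x :> ?G n x \<and> (\<forall>i. GDERIV (\<lambda>x. ?G n x $ i) x :> (\<chi> j. ?H n i j x)) \<and>
        (\<forall>i j. ?H n i j x = ?H n j i x))"
      using A K unfolding Basis_2[symmetric] sum_Basis_2 by (simp add: all_conj_distrib)
  next
    show "continuous_on UNIV (?G n)" for n using A by (intro continuous_on_vec_lambda) auto
    have "AE x in lborel. \<forall>i. (\<lambda>n. ?G n x $ i) \<longlonglongrightarrow> gr x $ i"
      unfolding AE_all_countable using A by auto
    then show "AE x in lborel. (\<lambda>n. ?G n x) \<longlonglongrightarrow> gr x"
      by eventually_elim (auto intro: vec_tendstoI)
  qed (use A in auto)
  then show ?thesis by blast
qed

lemma approxD:
  assumes "approx U G H"
  shows "\<And>n. continuous_on UNIV (U n)" "\<And>n. continuous_on UNIV (G n)" "\<And>n i j. continuous_on UNIV (H n i j)"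
    "\<And>n i. integrable lborel (\<lambda>x. G n x $ i)" "\<And>n i j. integrable lborel (H n i j)"
    "\<And>K. compact K \<Longrightarrow> K \<subseteq> \<Omega> \<Longrightarrow> \<forall>\<^sub>F n in sequentially. \<exists>V. open V \<and> K \<subseteq> V \<and>
      (\<forall>x\<in>V. GDERIV (U n) x :> G n x \<and> (\<forall>i. GDERIV (\<lambda>x. G n x $ i) x :> (\<chi> j. H n i j x)) \<and>
        (\<forall>i j. H n i j x = H n j i x))"
    "\<And>K e. compact K \<Longrightarrow> K \<subseteq> \<Omega> \<Longrightarrow> e > 0 \<Longrightarrow> \<forall>\<^sub>F n in sequentially. \<forall>x\<in>K. \<bar>U n x - u x\<bar> \<le> e"
    "\<And>i. (\<lambda>n. \<integral>x. \<bar>G n x $ i - gr x $ i\<bar> \<partial>lborel) \<longlonglongrightarrow> 0"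
    "\<And>i j. (\<lambda>n. \<integral>x. \<bar>H n i j x - h i j x\<bar> \<partial>lborel) \<longlonglongrightarrow> 0"
    "AE x in lborel. (\<lambda>n. G n x) \<longlonglongrightarrow> gr x"
  using assms unfolding approx_def by (elim conjE, simp only: )+

lemma approx_pointwise: "approx U G H \<Longrightarrow> x \<in> \<Omega> \<Longrightarrow> (\<lambda>n. U n x) \<longlonglongrightarrow> u x"
proof (rule LIMSEQ_I)
  fix e :: real assume a: "approx U G H" "x \<in> \<Omega>" "e > 0"
  then have "\<forall>\<^sub>F n in sequentially. \<forall>x\<in>{x}. \<bar>U n x - u x\<bar> \<le> e/2"
    by (intro approxD(7)[OF a(1)]) auto
  then obtain N where "\<And>n. n \<ge> N \<Longrightarrow> \<bar>U n x - u x\<bar> \<le> e/2" by (auto simp: eventually_sequentially)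
  then show "\<exists>N. \<forall>n\<ge>N. norm (U n x - u x) < e" using a(3) by (intro exI[of _ N]) fastforce
qed

lemma u_meas: "u \<in> borel_measurable borel" using u(2) by auto

text \<open>Four kinds of weight occur: none, a gradient component, its absolute value (for
  projections), and a second derivative.\<close>

lemma approx_term:
  assumes A: "approx U G H" and K: "cutoff \<Omega> K \<kappa> \<kappa>'" and c: "continuous_on UNIV c" "\<And>x. x \<notin> K \<Longrightarrow> c x = 0"
    and tau: "continuous_on UNIV \<tau>" "\<exists>B. \<forall>t. \<bar>\<tau> t\<bar> \<le> B"
    and beta: "continuous_on UNIV \<beta>" "\<And>v. \<bar>\<beta> v\<bar> \<le> 1"
  shows "int_lim (\<lambda>n x. c x * \<tau> (U n x) * \<beta> (G n x)) (\<lambda>x. c x * \<tau> (u x) * \<beta> (gr x))"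
    "int_lim (\<lambda>n x. (c x * \<tau> (U n x) * \<beta> (G n x)) * G n x $ i) (\<lambda>x. (c x * \<tau> (u x) * \<beta> (gr x)) * gr x $ i)"
    "int_lim (\<lambda>n x. (c x * \<tau> (U n x) * \<beta> (G n x)) * \<bar>G n x $ i\<bar>) (\<lambda>x. (c x * \<tau> (u x) * \<beta> (gr x)) * \<bar>gr x $ i\<bar>)"
    "int_lim (\<lambda>n x. (c x * \<tau> (U n x) * \<beta> (G n x)) * H n i j x) (\<lambda>x. (c x * \<tau> (u x) * \<beta> (gr x)) * h i j x)"
proof -
  obtain B where B: "\<And>t. \<bar>\<tau> t\<bar> \<le> B" using tau(2) by blast
  note K' = cutoffD[OF K]
  have p: "(\<lambda>n. U n x) \<longlonglongrightarrow> u x" if "x \<in> K" for x using approx_pointwise[OF A] that K'(2) by blast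
  note A' = approxD(1,2,10,4,5,8,9)[OF A]
  have T: "int_lim (\<lambda>n x. (c x * \<tau> (U n x) * \<beta> (G n x)) * wn n x) (\<lambda>x. (c x * \<tau> (u x) * \<beta> (gr x)) * w x)"
    if "\<And>n. integrable lborel (wn n)" "integrable lborel w" "(\<lambda>n. \<integral>x. \<bar>wn n x - w x\<bar> \<partial>lborel) \<longlonglongrightarrow> 0" for wn w
    by (rule term_tendsto[OF K'(1) c(1) _ tau(1) B beta(1) _ A'(1) _ A'(2,3) u_meas gr_meas that]) (use c beta p in blast)+
  show "int_lim (\<lambda>n x. (c x * \<tau> (U n x) * \<beta> (G n x)) * G n x $ i) (\<lambda>x. (c x * \<tau> (u x) * \<beta> (gr x)) * gr x $ i)"
    by (rule T[OF A'(4) gr_integrable A'(6)])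
  show "int_lim (\<lambda>n x. (c x * \<tau> (U n x) * \<beta> (G n x)) * H n i j x) (\<lambda>x. (c x * \<tau> (u x) * \<beta> (gr x)) * h i j x)"
    by (rule T[OF A'(5) h_integrable A'(7)])
  show "int_lim (\<lambda>n x. (c x * \<tau> (U n x) * \<beta> (G n x)) * \<bar>G n x $ i\<bar>) (\<lambda>x. (c x * \<tau> (u x) * \<beta> (gr x)) * \<bar>gr x $ i\<bar>)"
  proof (rule T[OF integrable_abs[OF A'(4)] integrable_abs[OF gr_integrable]])
    have "norm (LBINT x. \<bar>\<bar>G n x $ i\<bar> - \<bar>gr x $ i\<bar>\<bar>) \<le> (LBINT x. \<bar>G n x $ i - gr x $ i\<bar>)" for n
    proof -
      have "(LBINT x. \<bar>\<bar>G n x $ i\<bar> - \<bar>gr x $ i\<bar>\<bar>) \<le> (LBINT x. \<bar>G n x $ i - gr x $ i\<bar>)"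
        using A'(4) gr_integrable by (intro integral_mono) auto
      moreover have "0 \<le> (LBINT x. \<bar>\<bar>G n x $ i\<bar> - \<bar>gr x $ i\<bar>\<bar>)" by simp
      ultimately show ?thesis by simp
    qed
    then show "(\<lambda>n. \<integral>x. \<bar>\<bar>G n x $ i\<bar> - \<bar>gr x $ i\<bar>\<bar> \<partial>lborel) \<longlonglongrightarrow> 0"
      by (intro Lim_null_comparison[OF always_eventually A'(6)[of i]]) auto
  qed
  have iK: "integrable lborel (indicator K :: real^2 \<Rightarrow> real)"
    using emeasure_compact_finite[OF K'(1)] borel_compact[OF K'(1)] by (simp add: integrable_indicator_iff)
  \<comment> \<open>The unweighted case: the indicator of \<open>K\<close> plays the role of the
    weight and is then absorbed by \<open>c\<close>.\<close>
  have "int_lim (\<lambda>n x. (c x * \<tau> (U n x) * \<beta> (G n x)) * indicator K x) (\<lambda>x. (c x * \<tau> (u x) * \<beta> (gr x)) * indicator K x)"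
    by (rule T[of "\<lambda>n. indicator K" "indicator K", OF iK iK]) simp
  moreover have "(c x * a * b) * indicator K x = c x * a * b" for x and a b :: real using c(2) by (auto simp: indicator_def)
  ultimately show "int_lim (\<lambda>n x. c x * \<tau> (U n x) * \<beta> (G n x)) (\<lambda>x. c x * \<tau> (u x) * \<beta> (gr x))" by simp
qed

end

context sobolev_graph
begin

lemma approx_smooth_graph:
  assumes A: "approx U G H" and K: "cutoff \<Omega> K \<kappa> \<kappa>'"
  shows "\<forall>\<^sub>F n in sequentially. \<exists>V. smooth_graph K V (U n) (G n) (H n) \<kappa> \<kappa>'"
  using approxD(6)[OF A cutoffD(1,2)[OF K]]
proof eventually_elim
  case (elim n)
  then obtain V where V: "open V" "K \<subseteq> V" and P: "\<forall>x\<in>V. GDERIV (U n) x :> G n x \<and>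
      (\<forall>i. GDERIV (\<lambda>x. G n x $ i) x :> (\<chi> j. H n i j x)) \<and> (\<forall>i j. H n i j x = H n j i x)"
    by blast
  have "smooth_graph K V (U n) (G n) (H n) \<kappa> \<kappa>'"
    by unfold_locales (use V P[rule_format, THEN conjunct1] P[rule_format, THEN conjunct2, THEN conjunct1, rule_format]
       P[rule_format, THEN conjunct2, THEN conjunct2, rule_format] cutoffD[OF K] approxD(1,2,3)[OF A, THEN continuous_on_subset[OF _ subset_UNIV]] in auto)
  then show ?case by blast
qed

lemma abs_mult_le_1: "\<bar>a\<bar> \<le> 1 \<Longrightarrow> \<bar>b\<bar> \<le> 1 \<Longrightarrow> \<bar>a * b\<bar> \<le> (1::real)"
  unfolding abs_mult by (rule mult_le_one) auto

lemma abs_Rf_le: "\<bar>Rf v\<bar> \<le> 1" using Rf_le[of v] Rf_pos[of v] by linarith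

lemma vertical_identity:
  assumes K: "cutoff \<Omega> K \<kappa> \<kappa>'" and th: "C1b \<theta> \<theta>'"
  shows "(LBINT x. \<kappa> x * \<theta> (u x) * fdiv k x + \<kappa> x * \<theta>' (u x) * (Ff k (gr x) * gr x $ k)
     + \<kappa>' x $ k * \<theta> (u x) * Ff k (gr x)) = 0" (is ?zero)
    and "integrable lborel (\<lambda>x. \<kappa> x * \<theta> (u x) * fdiv k x + \<kappa> x * \<theta>' (u x) * (Ff k (gr x) * gr x $ k)
     + \<kappa>' x $ k * \<theta> (u x) * Ff k (gr x))" (is ?int)
proof -
  obtain U G H where A: "approx U G H" using approx_exists by blast
  note c = cutoffD[OF K] and t = C1bD[OF th]
  define i j :: 2 where "i = 1" and "j = 2"
  have ij: "i \<noteq> j" by (simp add: i_def j_def)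
  note T = approx_term[OF A K]
  note b = abs_mult_le_1 abs_Rf_le Ff_le
  have 1: "int_lim (\<lambda>n x. (\<kappa> x * \<theta> (U n x) * Rf (G n x)) * H n k k x) (\<lambda>x. (\<kappa> x * \<theta> (u x) * Rf (gr x)) * h k k x)"
    by (rule T(4)[OF c(6,5) t(3,4)]) (auto intro!: continuous_intros b)
  have 2: "int_lim (\<lambda>n x. (\<kappa> x * \<theta> (U n x) * (Rf (G n x) * Ff k (G n x) * Ff l (G n x))) * H n l k x)
     (\<lambda>x. (\<kappa> x * \<theta> (u x) * (Rf (gr x) * Ff k (gr x) * Ff l (gr x))) * h l k x)" for l
    by (rule T(4)[OF c(6,5) t(3,4)]) (auto intro!: continuous_intros b)
  have 3: "int_lim (\<lambda>n x. (\<kappa> x * \<theta>' (U n x) * Ff k (G n x)) * G n x $ k) (\<lambda>x. (\<kappa> x * \<theta>' (u x) * Ff k (gr x)) * gr x $ k)"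
    by (rule T(2)[OF c(6,5) t(2,5)]) (auto intro!: continuous_intros b)
  have 4: "int_lim (\<lambda>n x. \<kappa>' x $ k * \<theta> (U n x) * Ff k (G n x)) (\<lambda>x. \<kappa>' x $ k * \<theta> (u x) * Ff k (gr x))"
    by (rule T(1)[OF c(8) _ t(3,4)]) (auto intro!: continuous_intros b simp: c)
  note L = int_lim_add[OF int_lim_add[OF int_lim_diff[OF int_lim_diff[OF 1 2[of i]] 2[of j]] 3] 4]
  have "(LBINT x. \<kappa> x * \<theta> (u x) * Rf (gr x) * h k k x - \<kappa> x * \<theta> (u x) * (Rf (gr x) * Ff k (gr x) * Ff i (gr x)) * h i k x
     - \<kappa> x * \<theta> (u x) * (Rf (gr x) * Ff k (gr x) * Ff j (gr x)) * h j k x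
     + \<kappa> x * \<theta>' (u x) * Ff k (gr x) * gr x $ k + \<kappa>' x $ k * \<theta> (u x) * Ff k (gr x)) = 0"
  proof (rule int_lim_zero[OF L])
    show "\<forall>\<^sub>F n in sequentially. (LBINT x. \<kappa> x * \<theta> (U n x) * Rf (G n x) * H n k k x
      - \<kappa> x * \<theta> (U n x) * (Rf (G n x) * Ff k (G n x) * Ff i (G n x)) * H n i k x
      - \<kappa> x * \<theta> (U n x) * (Rf (G n x) * Ff k (G n x) * Ff j (G n x)) * H n j k x
      + \<kappa> x * \<theta>' (U n x) * Ff k (G n x) * G n x $ k + \<kappa>' x $ k * \<theta> (U n x) * Ff k (G n x)) = 0"
      using approx_smooth_graph[OF A K]
    proof eventually_elim
      case (elim n)
      then obtain V where "smooth_graph K V (U n) (G n) (H n) \<kappa> \<kappa>'" by blast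
      then interpret smooth_graph K V "U n" "G n" "H n" \<kappa> \<kappa>' .
      show ?case using first_variation_vertical[OF t(1,2) ij, of k] by (simp add: algebra_simps)
    qed
  qed
  then show ?zero unfolding fdiv_neq[OF ij] by (simp add: algebra_simps)
  show ?int using L unfolding int_lim_def fdiv_neq[OF ij] by (simp add: algebra_simps)
qed

lemma horizontal_identity:
  assumes K: "cutoff \<Omega> K \<kappa> \<kappa>'" and th: "C1b \<theta> \<theta>'" and ij: "i \<noteq> j"
    and X: "\<And>t. (X has_real_derivative X' t) (at t)" "continuous_on UNIV X'"
  shows "(LBINT x. \<kappa>' x $ i * X (x $ i) * \<theta> (u x) * (Rf (gr x) + Ff j (gr x) * gr x $ j)
     - \<kappa>' x $ j * X (x $ i) * \<theta> (u x) * (Ff i (gr x) * gr x $ j)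
     + \<kappa> x * X (x $ i) * \<theta>' (u x) * Ff i (gr x)
     + \<kappa> x * X' (x $ i) * \<theta> (u x) * (Rf (gr x) + Ff j (gr x) * gr x $ j)
     - \<kappa> x * X (x $ i) * \<theta> (u x) * (gr x $ i * mc x)) = 0" (is ?zero)
    and "integrable lborel (\<lambda>x. \<kappa>' x $ i * X (x $ i) * \<theta> (u x) * (Rf (gr x) + Ff j (gr x) * gr x $ j)
     - \<kappa>' x $ j * X (x $ i) * \<theta> (u x) * (Ff i (gr x) * gr x $ j)
     + \<kappa> x * X (x $ i) * \<theta>' (u x) * Ff i (gr x)
     + \<kappa> x * X' (x $ i) * \<theta> (u x) * (Rf (gr x) + Ff j (gr x) * gr x $ j)
     - \<kappa> x * X (x $ i) * \<theta> (u x) * (gr x $ i * mc x))" (is ?int)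
proof -
  obtain U G H where A: "approx U G H" using approx_exists by blast
  note c = cutoffD[OF K] and t = C1bD[OF th]
  note T = approx_term[OF A K]
  note b = abs_mult_le_1 abs_Rf_le Ff_le
  have Xc: "continuous_on UNIV X" using X(1) by (meson DERIV_isCont continuous_at_imp_continuous_on)
  have Xi: "continuous_on UNIV (\<lambda>x::real^2. X (x $ i))" "continuous_on UNIV (\<lambda>x::real^2. X' (x $ i))"
    by (auto intro!: continuous_on_compose2[OF Xc] continuous_on_compose2[OF X(2)] continuous_intros)
  have c1: "continuous_on UNIV (\<lambda>x. \<kappa>' x $ l * X (x $ i))" for l by (intro continuous_intros c Xi)
  have c2: "continuous_on UNIV (\<lambda>x. \<kappa> x * X (x $ i))" by (intro continuous_intros c Xi)
  have c3: "continuous_on UNIV (\<lambda>x. \<kappa> x * X' (x $ i))" by (intro continuous_intros c Xi)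
  have z: "\<kappa>' x $ l * X (x $ i) = 0" "\<kappa> x * X (x $ i) = 0" "\<kappa> x * X' (x $ i) = 0" if "x \<notin> K" for x l
    using c(5,7)[OF that] by simp_all
  have 1: "int_lim (\<lambda>n x. (\<kappa>' x $ i * X (x $ i)) * \<theta> (U n x) * Rf (G n x)) (\<lambda>x. (\<kappa>' x $ i * X (x $ i)) * \<theta> (u x) * Rf (gr x))"
    by (rule T(1)[OF c1 z(1) t(3,4)]) (auto intro!: continuous_intros b)
  have 2: "int_lim (\<lambda>n x. (\<kappa>' x $ l * X (x $ i)) * \<theta> (U n x) * Ff k (G n x) * G n x $ j)
     (\<lambda>x. (\<kappa>' x $ l * X (x $ i)) * \<theta> (u x) * Ff k (gr x) * gr x $ j)" for l k
    by (rule T(2)[OF c1 z(1) t(3,4)]) (auto intro!: continuous_intros b)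
  have 3: "int_lim (\<lambda>n x. (\<kappa> x * X (x $ i)) * \<theta>' (U n x) * Ff i (G n x)) (\<lambda>x. (\<kappa> x * X (x $ i)) * \<theta>' (u x) * Ff i (gr x))"
    by (rule T(1)[OF c2 z(2) t(2,5)]) (auto intro!: continuous_intros b)
  have 4: "int_lim (\<lambda>n x. (\<kappa> x * X' (x $ i)) * \<theta> (U n x) * Rf (G n x)) (\<lambda>x. (\<kappa> x * X' (x $ i)) * \<theta> (u x) * Rf (gr x))"
    by (rule T(1)[OF c3 z(3) t(3,4)]) (auto intro!: continuous_intros b)
  have 5: "int_lim (\<lambda>n x. (\<kappa> x * X' (x $ i)) * \<theta> (U n x) * Ff j (G n x) * G n x $ j)
     (\<lambda>x. (\<kappa> x * X' (x $ i)) * \<theta> (u x) * Ff j (gr x) * gr x $ j)"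
    by (rule T(2)[OF c3 z(3) t(3,4)]) (auto intro!: continuous_intros b)
  have 6: "int_lim (\<lambda>n x. (\<kappa> x * X (x $ i)) * \<theta> (U n x) * Ff i (G n x) * H n l l x)
     (\<lambda>x. (\<kappa> x * X (x $ i)) * \<theta> (u x) * Ff i (gr x) * h l l x)" for l
    by (rule T(4)[OF c2 z(2) t(3,4)]) (auto intro!: continuous_intros b)
  have 7: "int_lim (\<lambda>n x. (\<kappa> x * X (x $ i)) * \<theta> (U n x) * (Ff i (G n x) * Ff l (G n x) * Ff k (G n x)) * H n k l x)
     (\<lambda>x. (\<kappa> x * X (x $ i)) * \<theta> (u x) * (Ff i (gr x) * Ff l (gr x) * Ff k (gr x)) * h k l x)" for k l
    by (rule T(4)[OF c2 z(2) t(3,4)]) (auto intro!: continuous_intros b)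
  note L = int_lim_add[OF int_lim_add[OF int_lim_add[OF int_lim_add[OF int_lim_diff[OF int_lim_add[OF 1 2[of i j]] 2[of j i]] 3] 4] 5]
    int_lim_diff[OF int_lim_add[OF 7[of i i] int_lim_add[OF 7[of i j] int_lim_add[OF 7[of j i] 7[of j j]]]] int_lim_add[OF 6[of i] 6[of j]]]]
  have "\<forall>\<^sub>F n in sequentially. (LBINT x. \<kappa>' x $ i * X (x $ i) * \<theta> (U n x) * Rf (G n x) + \<kappa>' x $ i * X (x $ i) * \<theta> (U n x) * Ff j (G n x) * G n x $ j -
      \<kappa>' x $ j * X (x $ i) * \<theta> (U n x) * Ff i (G n x) * G n x $ j +
      \<kappa> x * X (x $ i) * \<theta>' (U n x) * Ff i (G n x) +
      \<kappa> x * X' (x $ i) * \<theta> (U n x) * Rf (G n x) +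
      \<kappa> x * X' (x $ i) * \<theta> (U n x) * Ff j (G n x) * G n x $ j +
      (\<kappa> x * X (x $ i) * \<theta> (U n x) * (Ff i (G n x) * Ff i (G n x) * Ff i (G n x)) * H n i i x +
       (\<kappa> x * X (x $ i) * \<theta> (U n x) * (Ff i (G n x) * Ff i (G n x) * Ff j (G n x)) * H n j i x +
        (\<kappa> x * X (x $ i) * \<theta> (U n x) * (Ff i (G n x) * Ff j (G n x) * Ff i (G n x)) * H n i j x +
         \<kappa> x * X (x $ i) * \<theta> (U n x) * (Ff i (G n x) * Ff j (G n x) * Ff j (G n x)) * H n j j x)) -
       (\<kappa> x * X (x $ i) * \<theta> (U n x) * Ff i (G n x) * H n i i x +
        \<kappa> x * X (x $ i) * \<theta> (U n x) * Ff i (G n x) * H n j j x))) = 0"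
    using approx_smooth_graph[OF A K]
  proof eventually_elim
    case (elim n)
    then obtain V where "smooth_graph K V (U n) (G n) (H n) \<kappa> \<kappa>'" by blast
    then interpret smooth_graph K V "U n" "G n" "H n" \<kappa> \<kappa>' .
    show ?case using first_variation_horizontal[OF t(1,2) ij X] by (simp add: algebra_simps)
  qed
  from int_lim_zero[OF L this]
  have *: "(LBINT x. \<kappa>' x $ i * X (x $ i) * \<theta> (u x) * Rf (gr x) + \<kappa>' x $ i * X (x $ i) * \<theta> (u x) * Ff j (gr x) * gr x $ j -
      \<kappa>' x $ j * X (x $ i) * \<theta> (u x) * Ff i (gr x) * gr x $ j +
      \<kappa> x * X (x $ i) * \<theta>' (u x) * Ff i (gr x) +
      \<kappa> x * X' (x $ i) * \<theta> (u x) * Rf (gr x) +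
      \<kappa> x * X' (x $ i) * \<theta> (u x) * Ff j (gr x) * gr x $ j +
      (\<kappa> x * X (x $ i) * \<theta> (u x) * (Ff i (gr x) * Ff i (gr x) * Ff i (gr x)) * h i i x +
       (\<kappa> x * X (x $ i) * \<theta> (u x) * (Ff i (gr x) * Ff i (gr x) * Ff j (gr x)) * h j i x +
        (\<kappa> x * X (x $ i) * \<theta> (u x) * (Ff i (gr x) * Ff j (gr x) * Ff i (gr x)) * h i j x +
         \<kappa> x * X (x $ i) * \<theta> (u x) * (Ff i (gr x) * Ff j (gr x) * Ff j (gr x)) * h j j x)) -
       (\<kappa> x * X (x $ i) * \<theta> (u x) * Ff i (gr x) * h i i x +
        \<kappa> x * X (x $ i) * \<theta> (u x) * Ff i (gr x) * h j j x))) = 0" .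
  \<comment> \<open>The unbounded factor \<open>gr x $ i\<close> meets the factor \<open>Rf\<close>
    inside the curvature and becomes the bounded \<open>Ff i\<close>. The limit passage needs
    exactly this bounded form of the coefficients of the second derivatives.\<close>
  have m: "gr x $ i * mc x = (Ff i (gr x) * h i i x - Ff i (gr x) * Ff i (gr x) * (Ff i (gr x) * h i i x + Ff j (gr x) * h j i x)
         + Ff i (gr x) * h j j x - Ff i (gr x) * Ff j (gr x) * (Ff i (gr x) * h i j x + Ff j (gr x) * h j j x))" for x
  proof -
    have F: "gr x $ i * Rf (gr x) = Ff i (gr x)" by (simp add: Ff_def)
    have "gr x $ i * mc x = (gr x $ i * Rf (gr x)) * h i i x - (gr x $ i * Rf (gr x)) * Ff i (gr x) * (Ff i (gr x) * h i i x + Ff j (gr x) * h j i x)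
         + (gr x $ i * Rf (gr x)) * h j j x - (gr x $ i * Rf (gr x)) * Ff j (gr x) * (Ff i (gr x) * h i j x + Ff j (gr x) * h j j x)"
      unfolding mc_neq[OF ij] fdiv_neq[OF ij] by (simp add: algebra_simps)
    then show ?thesis unfolding F .
  qed
  show ?zero using * unfolding m by (simp add: algebra_simps)
  show ?int using L unfolding int_lim_def m by (simp add: algebra_simps)
qed

lemma projection_estimate:
  assumes K: "cutoff \<Omega> K \<kappa> \<kappa>'" and th: "C1b \<theta> \<theta>'" and ij: "i \<noteq> j"
    and pos: "\<And>x. 0 \<le> \<kappa> x" "\<And>t. 0 \<le> \<theta> t" "\<And>t. 0 \<le> \<theta>' t"
    and D: "open D" "D \<subseteq> K" "\<And>x. x \<in> D \<Longrightarrow> \<kappa> x = 1 \<and> 1 \<le> \<theta> (u x)"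
  shows "measure lborel ((\<lambda>x. x $ i) ` D) \<le> (LBINT x. \<bar>\<kappa>' x $ j\<bar> * \<theta> (u x) + \<kappa> x * \<theta>' (u x) * \<bar>gr x $ j\<bar>)"
proof -
  obtain U G H where A: "approx U G H" using approx_exists by blast
  note c = cutoffD[OF K] and t = C1bD[OF th]
  note T = approx_term[OF A K]
  let ?P = "(\<lambda>x. x $ i) ` D"
  have oP: "open ?P"
    by (rule open_image_vec_nth[OF D(1)])
  have bP: "bounded ?P"
    using bounded_subset[OF compact_imp_bounded[OF c(1)] D(2)] by (rule bounded_component_cart)
  then have fP: "emeasure lborel ?P < \<infinity>" by (rule emeasure_bounded_finite)
  have 1: "int_lim (\<lambda>n x. \<bar>\<kappa>' x $ j\<bar> * \<theta> (U n x) * 1) (\<lambda>x. \<bar>\<kappa>' x $ j\<bar> * \<theta> (u x) * 1)"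
    by (rule T(1)[OF _ _ t(3,4)]) (auto intro!: continuous_intros c simp: c)
  have 2: "int_lim (\<lambda>n x. (\<kappa> x * \<theta>' (U n x) * 1) * \<bar>G n x $ j\<bar>) (\<lambda>x. (\<kappa> x * \<theta>' (u x) * 1) * \<bar>gr x $ j\<bar>)"
    by (rule T(3)[OF c(6,5) t(2,5)]) (auto intro!: continuous_intros)
  note L = int_lim_add[OF 1 2]
  let ?I = "\<integral>x. \<bar>\<kappa>' x $ j\<bar> * \<theta> (u x) + \<kappa> x * \<theta>' (u x) * \<bar>gr x $ j\<bar> \<partial>lborel"
  \<comment> \<open>For the mollified functions, uniform convergence yields only the lower bound
    \<open>s < 1\<close> on \<open>D\<close>; letting \<open>s\<close> tend to 1 comes last.\<close>
  have main: "s * measure lborel ?P \<le> ?I" if s: "0 < s" "s < 1" for s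
  proof -
    obtain B where B: "\<And>t. \<bar>\<theta>' t\<bar> \<le> B" using t(5) by blast
    have B0: "0 \<le> B" using B[of 0] by linarith
    \<comment> \<open>A deviation \<open>e\<close> of \<open>U n\<close> from \<open>u\<close>
      changes \<theta> by at most \<open>B * e\<close>, hence by at most \<open>1 - s\<close>; the
      \<open>+ 1\<close> covers \<open>B = 0\<close>.\<close>
    define e where "e = (1 - s) / (B + 1)"
    have e: "e > 0" using s B0 by (simp add: e_def)
    have Be: "B * e \<le> 1 - s" unfolding e_def using s B0 by (simp add: field_simps mult_left_mono)
    have "\<forall>\<^sub>F n in sequentially. s * measure lborel ?P \<le> (LBINT x. \<bar>\<kappa>' x $ j\<bar> * \<theta> (U n x) * 1 + (\<kappa> x * \<theta>' (U n x) * 1) * \<bar>G n x $ j\<bar>)"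
      using approx_smooth_graph[OF A K] approxD(7)[OF A c(1,2) e]
    proof eventually_elim
      case (elim n)
      then obtain V where "smooth_graph K V (U n) (G n) (H n) \<kappa> \<kappa>'" by blast
      then interpret sg: smooth_graph K V "U n" "G n" "H n" \<kappa> \<kappa>' .
      let ?w = "\<lambda>x. \<kappa> x * \<theta> (U n x)"
      let ?w' = "\<lambda>x. \<kappa> x *\<^sub>R (\<theta>' (U n x) *\<^sub>R G n x) + \<theta> (U n x) *\<^sub>R \<kappa>' x"
      have w0: "?w x = 0" "?w' x = 0" if "x \<notin> K" for x using c(5,7)[OF that] by simp_all
      have wd: "GDERIV ?w x :> ?w' x" for x
      proof (cases "x \<in> V")
        case True
        show ?thesis by (intro GDERIV_mult c(3) GDERIV_DERIV_compose[OF sg.U[OF True] t(1)])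
      next
        case False
        then have x: "x \<notin> K" using sg.K(3) by blast
        have "((\<lambda>x. 0) has_derivative (\<lambda>h. 0)) (at x)" by simp
        then have "(?w has_derivative (\<lambda>h. 0)) (at x)"
          by (rule has_derivative_transform_within_open[of _ _ _ UNIV "- K"])
            (use x w0 compact_imp_closed[OF c(1)] in auto)
        then show ?thesis using w0(2)[OF x] by (simp add: gderiv_def)
      qed
      have wc: "continuous_on UNIV ?w'"
        by (intro continuous_intros c continuous_on_compose2[OF t(2) approxD(1)[OF A]]
          continuous_on_compose2[OF t(3) approxD(1)[OF A]] approxD(2)[OF A]) auto
      have wD: "s \<le> ?w x" if x: "x \<in> D" for x
      proof -
        have "\<bar>\<theta> (U n x) - \<theta> (u x)\<bar> \<le> B * \<bar>U n x - u x\<bar>"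
          using field_differentiable_bound[of UNIV \<theta> \<theta>' B "U n x" "u x"] t(1) B by auto
        also have "\<dots> \<le> B * e" using elim(2) x D(2) B0 by (intro mult_left_mono) auto
        finally show ?thesis using D(3)[OF x] Be by auto
      qed
      have i: "integrable lborel (\<lambda>x. \<bar>\<kappa>' x $ j\<bar> * \<theta> (U n x) * 1 + (\<kappa> x * \<theta>' (U n x) * 1) * \<bar>G n x $ j\<bar>)"
        using L unfolding int_lim_def by blast
      have "ennreal (s * measure lborel ?P) = ennreal s * emeasure lborel ?P"
        using fP s by (simp add: emeasure_eq_ennreal_measure ennreal_mult)
      also have "\<dots> \<le> (\<integral>\<^sup>+x. ennreal \<bar>?w' x $ j\<bar> \<partial>lborel)"
        by (rule projection_bound[OF ij wd wc compact_imp_bounded[OF c(1)] w0(1) oP wD less_imp_le[OF s(1)]])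
      also have "\<dots> \<le> (\<integral>\<^sup>+x. ennreal (\<bar>\<kappa>' x $ j\<bar> * \<theta> (U n x) * 1 + (\<kappa> x * \<theta>' (U n x) * 1) * \<bar>G n x $ j\<bar>) \<partial>lborel)"
      proof (intro nn_integral_mono ennreal_leI)
        fix x
        have "\<bar>?w' x $ j\<bar> \<le> \<bar>\<kappa> x * (\<theta>' (U n x) * G n x $ j)\<bar> + \<bar>\<theta> (U n x) * \<kappa>' x $ j\<bar>" by simp
        also have "\<dots> = \<bar>\<kappa>' x $ j\<bar> * \<theta> (U n x) * 1 + (\<kappa> x * \<theta>' (U n x) * 1) * \<bar>G n x $ j\<bar>"
          using pos by (simp add: abs_mult)
        finally show "\<bar>?w' x $ j\<bar> \<le> \<bar>\<kappa>' x $ j\<bar> * \<theta> (U n x) * 1 + (\<kappa> x * \<theta>' (U n x) * 1) * \<bar>G n x $ j\<bar>" .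
      qed
      also have "\<dots> = ennreal (LBINT x. \<bar>\<kappa>' x $ j\<bar> * \<theta> (U n x) * 1 + (\<kappa> x * \<theta>' (U n x) * 1) * \<bar>G n x $ j\<bar>)"
        using i pos by (intro nn_integral_eq_integral) auto
      finally show ?case
        by (subst (asm) ennreal_le_iff) (use pos in \<open>auto intro!: integral_nonneg_AE\<close>)
    qed
    from int_lim_le[OF L this] show ?thesis by simp
  qed
  have "((\<lambda>s. s * measure lborel ?P) \<longlongrightarrow> 1 * measure lborel ?P) (at_left 1)" by (intro tendsto_intros)
  then have "1 * measure lborel ?P \<le> ?I"
  proof (rule tendsto_upperbound)
    have "eventually (\<lambda>s::real. s \<in> {0<..<1}) (at_left 1)" by (rule eventually_at_left_real) simp
    then show "\<forall>\<^sub>F s in at_left 1. s * measure lborel ?P \<le> ?I" by eventually_elim (use main in auto)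
  qed simp
  then show ?thesis by simp
qed

end

section \<open>Boundary charts and the boundary layer\<close>

text \<open>Extracts from the local graph, free of coordinates, what is used later. \<open>L\<close>
  measures the steepness of the boundary: a point at distance less than \<open>d\<close> from it
  leaves \<Omega> when pushed back by \<open>L * d\<close>. The clause on connected sets serves to
  count the boundary components.\<close>

definition inward_chart :: "(real^2) set \<Rightarrow> real^2 \<Rightarrow> real \<Rightarrow> real^2 \<Rightarrow> real \<Rightarrow> bool" where
  "inward_chart \<Omega> p r e L \<longleftrightarrow> 0 < r \<and> norm e = 1 \<and> 0 < L \<and>
    (\<forall>x\<in>closure \<Omega> \<inter> ball p r. \<forall>t>0. x + t *\<^sub>R e \<in> ball p r \<longrightarrow> x + t *\<^sub>R e \<in> \<Omega>) \<and>
    (\<forall>x\<in>ball p r. \<forall>y\<in>frontier \<Omega> \<inter> ball p r. \<forall>d. dist x y < d \<longrightarrow>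
       x - (L * d) *\<^sub>R e \<in> ball p r \<longrightarrow> x - (L * d) *\<^sub>R e \<notin> \<Omega>) \<and>
    (\<exists>\<delta>>0. \<exists>C. connected C \<and> C \<subseteq> frontier \<Omega> \<and> frontier \<Omega> \<inter> ball p \<delta> \<subseteq> C)"

text \<open>\<open>e\<close> is the vertical direction of the graph coordinates, and
  \<open>L\<close> is a Lipschitz constant of the graph function plus 1: a vertical drop of
  \<open>L * d\<close> makes up both for the height difference to the boundary point and for the
  variation of the graph in between.\<close>

lemma inward_chart_exists:
  assumes \<Omega>: "open \<Omega>" "C2_boundary \<Omega>" and p: "p \<in> frontier \<Omega>"
  shows "\<exists>r e L. inward_chart \<Omega> p r e L"
proof -
  obtain r T \<gamma> where r: "r > 0" and T: "orthogonal_transformation (T :: real^2 \<Rightarrow> real^2)"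
    and \<gamma>: "Ck_on 2 UNIV UNIV (\<gamma> :: real \<Rightarrow> real)"
    and \<Omega>b: "\<Omega> \<inter> ball p r = {x \<in> ball p r. \<gamma> (T x $ 1) < T x $ 2}"
    using \<Omega>(2) p unfolding C2_boundary_def by blast
  have inO: "x \<in> \<Omega> \<longleftrightarrow> \<gamma> (T x $ 1) < T x $ 2" if "x \<in> ball p r" for x using \<Omega>b that by blast
  have lin: "linear T" and nT: "\<And>x. norm (T x) = norm x"
    using T by (auto simp: orthogonal_transformation)
  have contT: "continuous_on A T" for A by (rule linear_continuous_on[OF linear_conv_bounded_linear[THEN iffD1, OF lin]])
  have bij: "bij T" using T by (rule orthogonal_transformation_bij)
  define S where "S = inv T"
  have TS: "T (S x) = x" and ST: "S (T x) = x" for x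
    using bij by (simp_all add: S_def bij_is_surj surj_f_inv_f bij_is_inj)
  have linS: "linear S" unfolding S_def using orthogonal_transformation_inv[OF T] by (simp add: orthogonal_transformation)
  have contS: "continuous_on A S" for A by (rule linear_continuous_on[OF linear_conv_bounded_linear[THEN iffD1, OF linS]])
  define e where "e = S (axis 2 1)"
  have Te: "T e = axis 2 1" by (simp add: e_def TS)
  have ne: "norm e = 1" using nT[of e] by (simp add: Te)
  have T1: "T (x + t *\<^sub>R e) $ 1 = T x $ 1" and T2: "T (x + t *\<^sub>R e) $ 2 = T x $ 2 + t" for x t
    by (simp_all add: linear_add[OF lin] linear_cmul[OF lin] Te axis_def)
  have "Ck_on (Suc 1) UNIV UNIV \<gamma>" using \<gamma> by (simp add: numeral_2_eq_2)
  then obtain \<gamma>' where \<gamma>': "\<And>x. (\<gamma> has_real_derivative \<gamma>' x) (at x)" "continuous_on UNIV \<gamma>'" and \<gamma>c: "continuous_on UNIV \<gamma>"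
    by auto
  define R where "R = norm p + r"
  have "compact (\<gamma>' ` {-R..R})" by (intro compact_continuous_image continuous_on_subset[OF \<gamma>'(2)]) auto
  then obtain B where B: "\<And>t. t \<in> {-R..R} \<Longrightarrow> \<bar>\<gamma>' t\<bar> \<le> B" using compact_imp_bounded by (fastforce simp: bounded_iff)
  have lip: "\<bar>\<gamma> s - \<gamma> t\<bar> \<le> \<bar>B\<bar> * \<bar>s - t\<bar>" if "s \<in> {-R..R}" "t \<in> {-R..R}" for s t
  proof -
    have "norm (\<gamma> s - \<gamma> t) \<le> \<bar>B\<bar> * norm (s - t)"
    proof (rule field_differentiable_bound[of "{-R..R}" \<gamma> \<gamma>'])
      show "norm (\<gamma>' z) \<le> \<bar>B\<bar>" if "z \<in> {-R..R}" for z using B[OF that] by simp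
    qed (use that \<gamma>'(1) in \<open>auto intro: has_field_derivative_at_within\<close>)
    then show ?thesis by simp
  qed
  have Tb: "T x $ 1 \<in> {-R..R}" if "x \<in> ball p r" for x
  proof -
    have "\<bar>T x $ 1\<bar> \<le> norm (T x)" by (rule component_le_norm_cart)
    also have "\<dots> \<le> R" using that norm_triangle_ineq2[of x p] by (simp add: nT R_def dist_norm norm_minus_commute)
    finally show ?thesis by auto
  qed
  have comp: "\<bar>T x $ i - T y $ i\<bar> \<le> dist x y" for x y i
  proof -
    have "\<bar>T (x - y) $ i\<bar> \<le> norm (T (x - y))" by (rule component_le_norm_cart)
    moreover have "T x $ i - T y $ i = T (x - y) $ i" by (simp add: linear_diff[OF lin])
    ultimately show ?thesis by (simp only: nT dist_norm)
  qed
  have cl: "\<gamma> (T x $ 1) \<le> T x $ 2" if x: "x \<in> closure \<Omega> \<inter> ball p r" for x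
  proof (rule ccontr)
    assume a: "\<not> \<gamma> (T x $ 1) \<le> T x $ 2"
    let ?N = "{x. \<gamma> (T x $ 1) > T x $ 2} \<inter> ball p r"
    have "open {x. T x $ 2 < \<gamma> (T x $ 1)}"
      by (intro open_Collect_less continuous_intros contT continuous_on_compose2[OF \<gamma>c]) auto
    then have "open ?N" by auto
    moreover have "?N \<inter> \<Omega> = {}" using inO by auto
    moreover have "x \<in> ?N" using a x by auto
    ultimately show False using x open_Int_closure_eq_empty[of ?N \<Omega>] by blast
  qed
  have fr: "\<gamma> (T x $ 1) = T x $ 2" if x: "x \<in> frontier \<Omega> \<inter> ball p r" for x
  proof -
    have "x \<notin> \<Omega>" "x \<in> closure \<Omega>" using x \<Omega>(1) by (auto simp: frontier_def interior_open)
    then show ?thesis using inO[of x] cl[of x] x by auto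
  qed
  have up: "x + t *\<^sub>R e \<in> \<Omega>" if "x \<in> closure \<Omega> \<inter> ball p r" "t > 0" "x + t *\<^sub>R e \<in> ball p r" for x t
    unfolding inO[OF that(3)] T1 T2 using cl[OF that(1)] that(2) by linarith
  have low: "x - ((\<bar>B\<bar> + 1) * d) *\<^sub>R e \<notin> \<Omega>"
    if x: "x \<in> ball p r" and y: "y \<in> frontier \<Omega> \<inter> ball p r" and d: "dist x y < d"
      and b: "x - ((\<bar>B\<bar> + 1) * d) *\<^sub>R e \<in> ball p r" for x y d
  proof -
    let ?h = "(\<bar>B\<bar> + 1) * d"
    have "T x $ 2 \<le> T y $ 2 + d" using comp[of x 2 y] d by linarith
    moreover have "T y $ 2 = \<gamma> (T y $ 1)" using fr[OF y] by simp
    moreover have "\<gamma> (T y $ 1) \<le> \<gamma> (T x $ 1) + \<bar>B\<bar> * d"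
    proof -
      have "\<bar>\<gamma> (T y $ 1) - \<gamma> (T x $ 1)\<bar> \<le> \<bar>B\<bar> * \<bar>T y $ 1 - T x $ 1\<bar>" using x y by (intro lip Tb) auto
      also have "\<dots> \<le> \<bar>B\<bar> * d" using comp[of y 1 x] d by (intro mult_left_mono) (auto simp: dist_commute)
      finally show ?thesis by linarith
    qed
    ultimately have "T x $ 2 - ?h \<le> \<gamma> (T x $ 1)" by (simp add: algebra_simps)
    moreover have "x - ?h *\<^sub>R e = x + (- ?h) *\<^sub>R e" by simp
    ultimately show ?thesis using inO[OF b] T1[of x "- ?h"] T2[of x "- ?h"] by simp
  qed
  \<comment> \<open>The boundary parametrised over the first graph coordinate; the image of a short
    interval is the connected piece demanded by the last clause.\<close>
  define c where "c s = S (\<chi> i. if i = 1 then s else \<gamma> s)" for s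
  have cc: "continuous_on UNIV c" unfolding c_def
  proof (rule continuous_on_compose2[OF contS[of UNIV]])
    have "continuous_on UNIV (\<lambda>s. if i = 1 then s else \<gamma> s)" for i :: 2
      using \<gamma>c by (cases "i = 1") (auto intro: continuous_intros)
    then show "continuous_on UNIV (\<lambda>s. (\<chi> i. if i = 1 then s else \<gamma> s) :: real^2)" by (rule continuous_on_vec_lambda)
  qed auto
  have cfr: "x = c (T x $ 1)" if "x \<in> frontier \<Omega> \<inter> ball p r" for x
  proof -
    have "T x = (\<chi> i. if i = 1 then T x $ 1 else \<gamma> (T x $ 1))"
      using fr[OF that] by (simp add: vec_eq_iff forall_2)
    then show ?thesis unfolding c_def using ST by metis
  qed
  let ?s0 = "T p $ 1"
  have "c ?s0 = p" using cfr[of p] p r by auto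
  then have "isCont c ?s0" using cc by (simp add: continuous_on_eq_continuous_at)
  then obtain d1 where d1: "d1 > 0" "\<And>s. dist s ?s0 < d1 \<Longrightarrow> dist (c s) p < r"
    using r \<open>c ?s0 = p\<close> unfolding continuous_at_eps_delta by metis
  have cin: "c s \<in> frontier \<Omega>" if s: "dist s ?s0 < d1" for s
  proof -
    have b: "c s \<in> ball p r" using d1(2)[OF s] by (simp add: dist_commute)
    have g: "\<gamma> (T (c s) $ 1) = T (c s) $ 2" by (simp add: c_def TS)
    then have "c s \<notin> \<Omega>" using inO[OF b] by simp
    moreover have "c s \<in> closure \<Omega>"
    proof (rule closure_approachable[THEN iffD2], intro allI impI)
      fix \<epsilon> :: real assume \<epsilon>: "\<epsilon> > 0"
      define t where "t = min \<epsilon> (r - dist (c s) p) / 2"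
      have t: "t > 0" "t < \<epsilon>" "t < r - dist (c s) p" using \<epsilon> d1(2)[OF s] by (auto simp: t_def min_def)
      have d: "dist (c s + t *\<^sub>R e) (c s) = t" using t ne by (simp add: dist_norm)
      then have "dist (c s + t *\<^sub>R e) p < r" using t dist_triangle[of "c s + t *\<^sub>R e" p "c s"] by linarith
      then have "c s + t *\<^sub>R e \<in> ball p r" by (simp add: dist_commute)
      from inO[OF this] have "c s + t *\<^sub>R e \<in> \<Omega>" using T1[of "c s" t] T2[of "c s" t] g t by simp
      then show "\<exists>y\<in>\<Omega>. dist y (c s) < \<epsilon>" using d t(2) by (intro bexI[of _ "c s + t *\<^sub>R e"]) simp_all
    qed
    ultimately show ?thesis using \<Omega>(1) by (simp add: frontier_def interior_open)
  qed
  have con: "\<exists>\<delta>>0. \<exists>C. connected C \<and> C \<subseteq> frontier \<Omega> \<and> frontier \<Omega> \<inter> ball p \<delta> \<subseteq> C"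
  proof (intro exI[of _ "min d1 r"] exI[of _ "c ` ball ?s0 d1"] conjI)
    show "connected (c ` ball ?s0 d1)"
      by (intro connected_continuous_image continuous_on_subset[OF cc]) auto
    show "c ` ball ?s0 d1 \<subseteq> frontier \<Omega>" using cin by (auto simp: dist_commute)
    show "frontier \<Omega> \<inter> ball p (min d1 r) \<subseteq> c ` ball ?s0 d1"
    proof
      fix x assume x: "x \<in> frontier \<Omega> \<inter> ball p (min d1 r)"
      then have "x = c (T x $ 1)" by (intro cfr) auto
      moreover have "T x $ 1 \<in> ball ?s0 d1" using x comp[of p 1 x] by (auto simp: dist_real_def)
      ultimately show "x \<in> c ` ball ?s0 d1" by blast
    qed
  qed (use d1 r in auto)
  have "inward_chart \<Omega> p r e (\<bar>B\<bar> + 1)" unfolding inward_chart_def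
    using r ne up low con by auto
  then show ?thesis by blast
qed

text \<open>Each component is relatively open in the boundary by the last clause of
  \<open>inward_chart\<close>, and the boundary is compact. Finiteness matters because a sum over an
  infinite set is 0 by convention, and the boundary norm is a sum over the components.\<close>

lemma finite_components_frontier:
  assumes "bounded_C2_domain \<Omega>" shows "finite (components (frontier \<Omega>))"
proof -
  let ?F = "frontier \<Omega>"
  have \<Omega>: "open \<Omega>" "C2_boundary \<Omega>" "bounded \<Omega>" using assms by (auto simp: bounded_C2_domain_def)
  have "\<forall>p\<in>?F. \<exists>\<delta>>0. \<exists>C. connected C \<and> C \<subseteq> ?F \<and> ?F \<inter> ball p \<delta> \<subseteq> C"
    using inward_chart_exists[OF \<Omega>(1,2)] unfolding inward_chart_def by blast
  then obtain \<delta> C where *: "\<And>p. p \<in> ?F \<Longrightarrow> \<delta> p > 0 \<and> connected (C p) \<and> C p \<subseteq> ?F \<and> ?F \<inter> ball p (\<delta> p) \<subseteq> C p"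
    by metis
  have "compact ?F" using \<Omega>(3) by (rule compact_frontier_bounded)
  moreover have "?F \<subseteq> (\<Union>p\<in>?F. ball p (\<delta> p))" using * by force
  ultimately obtain P where P: "P \<subseteq> ?F" "finite P" "?F \<subseteq> (\<Union>p\<in>P. ball p (\<delta> p))"
    using compactE_image[of ?F ?F "\<lambda>p. ball p (\<delta> p)"] by (metis open_ball)
  have "components ?F \<subseteq> (\<lambda>p. connected_component_set ?F p) ` P"
  proof
    fix G assume "G \<in> components ?F"
    then obtain x where x: "x \<in> ?F" "G = connected_component_set ?F x" by (auto simp: components_def)
    then obtain p where p: "p \<in> P" "x \<in> ball p (\<delta> p)" using P(3) by auto
    then have pF: "p \<in> ?F" using P by blast
    have "x \<in> C p" "p \<in> C p" using *[OF pF] x p pF by auto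
    then have "connected_component ?F p x" using *[OF pF] unfolding connected_component_def by blast
    then show "G \<in> (\<lambda>p. connected_component_set ?F p) ` P"
      using x(2) p(1) connected_component_eq[of x ?F p] by auto
  qed
  then show ?thesis using P(2) finite_surj by blast
qed

lemma boundary_charts:
  assumes "bounded_C2_domain \<Omega>"
  obtains I :: "((real^2) \<times> real \<times> (real^2)) set" and L \<epsilon>0 where "finite I" "0 < L" "0 < \<epsilon>0"
    "\<And>p r e. (p, r, e) \<in> I \<Longrightarrow> 0 < r \<and> norm e = 1"
    "\<And>p r e x t. (p, r, e) \<in> I \<Longrightarrow> x \<in> \<Omega> \<Longrightarrow> x \<in> ball p r \<Longrightarrow> 0 \<le> t \<Longrightarrow> t < r \<Longrightarrow> x + t *\<^sub>R e \<in> \<Omega>"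
    "\<And>x \<epsilon>. x \<in> \<Omega> \<Longrightarrow> infdist x (- \<Omega>) < \<epsilon> \<Longrightarrow> \<epsilon> < \<epsilon>0 \<Longrightarrow> \<exists>(p, r, e)\<in>I. x \<in> ball p r \<and> x - (L * \<epsilon>) *\<^sub>R e \<notin> \<Omega>"
proof -
  let ?F = "frontier \<Omega>"
  have \<Omega>: "open \<Omega>" "C2_boundary \<Omega>" "bounded \<Omega>" "\<Omega> \<noteq> {}" using assms by (auto simp: bounded_C2_domain_def)
  have neU: "- \<Omega> \<noteq> {}"
  proof
    assume "- \<Omega> = {}"
    then have "\<Omega> = UNIV" by blast
    then show False using \<Omega>(3) not_bounded_UNIV by simp
  qed
  have "\<forall>p\<in>?F. \<exists>t. inward_chart \<Omega> p (fst t) (fst (snd t)) (snd (snd t))"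
    using inward_chart_exists[OF \<Omega>(1,2)] by fastforce
  then obtain t where t: "\<forall>p\<in>?F. inward_chart \<Omega> p (fst (t p)) (fst (snd (t p))) (snd (snd (t p)))"
    by (rule bchoice[THEN exE])
  define r where "r p = fst (t p)" for p
  define e where "e p = fst (snd (t p))" for p
  define L where "L p = snd (snd (t p))" for p
  have *: "inward_chart \<Omega> p (r p) (e p) (L p)" if "p \<in> ?F" for p
    unfolding r_def e_def L_def using t that by (rule bspec)
  have c1: "0 < r p" "norm (e p) = 1" "0 < L p" if "p \<in> ?F" for p
    using *[OF that] by (auto simp: inward_chart_def)
  have cF: "compact ?F" using \<Omega>(3) by (rule compact_frontier_bounded)
  \<comment> \<open>Quarter balls cover the boundary, and half balls go into the index set. A point
    within \<epsilon>0 of a quarter ball lies in the half ball, and from there a shift shorter than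
    half the radius stays in the chart.\<close>
  have "?F \<subseteq> (\<Union>p\<in>?F. ball p (r p / 4))" using c1 by force
  then obtain P where P: "P \<subseteq> ?F" "finite P" "?F \<subseteq> (\<Union>p\<in>P. ball p (r p / 4))"
  proof (rule compactE_image[OF cF, rotated])
    show "thesis" if "C' \<subseteq> ?F" "finite C'" "?F \<subseteq> (\<Union>p\<in>C'. ball p (r p / 4))" for C'
      using that by (rule \<open>\<And>P. P \<subseteq> ?F \<Longrightarrow> finite P \<Longrightarrow> ?F \<subseteq> (\<Union>p\<in>P. ball p (r p / 4)) \<Longrightarrow> thesis\<close>)
  qed auto
  define Lm where "Lm = Max (insert 1 (L ` P))"
  have Lm: "0 < Lm" "\<And>p. p \<in> P \<Longrightarrow> L p \<le> Lm"
    using P(2) by (auto simp: Lm_def Max_gr_iff)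
  define rm where "rm = Min (insert 1 (r ` P))"
  have rm: "0 < rm" "\<And>p. p \<in> P \<Longrightarrow> rm \<le> r p"
    using P(1,2) c1 by (auto simp: rm_def)
  define \<epsilon>0 where "\<epsilon>0 = min (rm / 4) (rm / (4 * Lm))"
  show ?thesis
  proof (rule that[of "(\<lambda>p. (p, r p / 2, e p)) ` P" Lm \<epsilon>0])
    show "finite ((\<lambda>p. (p, r p / 2, e p)) ` P)" using P by simp
    show "0 < Lm" by fact
    show "0 < \<epsilon>0" using rm Lm by (simp add: \<epsilon>0_def)
    show "0 < r' \<and> norm e' = 1" if "(p, r', e') \<in> (\<lambda>p. (p, r p / 2, e p)) ` P" for p r' e'
      using that c1 P by auto
    show "x + t *\<^sub>R e' \<in> \<Omega>" if "(p, r', e') \<in> (\<lambda>p. (p, r p / 2, e p)) ` P" "x \<in> \<Omega>" "x \<in> ball p r'" "0 \<le> t" "t < r'" for p r' e' x t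
    proof (cases "t = 0")
      case False
      have p: "p \<in> P" "r' = r p / 2" "e' = e p" using that by auto
      then have pF: "p \<in> ?F" using P by auto
      have "dist p (x + t *\<^sub>R e p) \<le> dist p x + t"
        using dist_triangle[of p "x + t *\<^sub>R e p" x] c1(2)[OF pF] that(4) by (simp add: dist_norm)
      then have "x + t *\<^sub>R e p \<in> ball p (r p)" "x \<in> ball p (r p)" using that p c1(1)[OF pF] by auto
      moreover have "x \<in> closure \<Omega>" using that(2) closure_subset by blast
      moreover have "t > 0" using that False by simp
      ultimately show ?thesis using *[OF pF] p unfolding inward_chart_def by blast
    qed (use that in simp)
    fix x \<epsilon> assume x: "x \<in> \<Omega>" "infdist x (- \<Omega>) < \<epsilon>" "\<epsilon> < \<epsilon>0"
    have "closed (- \<Omega>)" using \<Omega>(1) by (rule closed_Compl)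
    then obtain z where z: "z \<in> - \<Omega>" "infdist x (- \<Omega>) = dist x z"
      using infdist_attains_inf[OF _ neU] by metis
    have "closed_segment x z \<inter> ?F \<noteq> {}"
      using x z by (intro connected_Int_frontier) (auto simp: disjoint_iff intro: ends_in_segment)
    then obtain y where y: "y \<in> closed_segment x z" "y \<in> ?F" by auto
    have "dist x y \<le> dist x z" using segment_bound1[OF y(1)] by (simp add: dist_norm norm_minus_commute)
    then have dxy: "dist x y < \<epsilon>" using x z by simp
    obtain p where p: "p \<in> P" "y \<in> ball p (r p / 4)" using P(3) y(2) by auto
    have pF: "p \<in> ?F" using p P by auto
    have e0: "\<epsilon> < r p / 4" "Lm * \<epsilon> < r p / 4"
      using x(3) rm(2)[OF p(1)] Lm(1) by (auto simp: \<epsilon>0_def field_simps)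
    have ep: "\<epsilon> > 0" using dxy zero_le_dist[of x y] by linarith
    have xb: "dist p x < r p / 2" using p(2) e0 dxy dist_triangle[of p x y] by (simp add: dist_commute)
    \<comment> \<open>The chart at \<open>p\<close> prescribes the step \<open>L p * d\<close>; this
      choice turns it into the common step \<open>Lm * \<epsilon>\<close>, and
      \<open>L p \<le> Lm\<close> ensures \<open>d \<ge> \<epsilon>\<close>.\<close>
    define d where "d = Lm * \<epsilon> / L p"
    have d: "dist x y < d" "L p * d = Lm * \<epsilon>"
    proof -
      have "\<epsilon> \<le> d" unfolding d_def using Lm(2)[OF p(1)] c1(3)[OF pF] ep by (simp add: field_simps)
      then show "dist x y < d" using dxy by simp
      show "L p * d = Lm * \<epsilon>" using c1(3)[OF pF] by (simp add: d_def)
    qed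
    have "dist p (x - (Lm * \<epsilon>) *\<^sub>R e p) \<le> dist p x + Lm * \<epsilon>"
      using dist_triangle[of p "x - (Lm * \<epsilon>) *\<^sub>R e p" x] c1(2)[OF pF] Lm ep by (simp add: dist_norm)
    then have "x - (Lm * \<epsilon>) *\<^sub>R e p \<in> ball p (r p)" unfolding mem_ball using xb e0 c1(1)[OF pF] by linarith
    moreover have "x \<in> ball p (r p)" "y \<in> ball p (r p)" using xb p(2) c1(1)[OF pF] by auto
    moreover have "\<forall>x\<in>ball p (r p). \<forall>y\<in>?F \<inter> ball p (r p). \<forall>d. dist x y < d \<longrightarrow>
       x - (L p * d) *\<^sub>R e p \<in> ball p (r p) \<longrightarrow> x - (L p * d) *\<^sub>R e p \<notin> \<Omega>"
      using *[OF pF] by (simp add: inward_chart_def)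
    ultimately have "x - (Lm * \<epsilon>) *\<^sub>R e p \<notin> \<Omega>" using d y(2) by (metis IntI)
    then show "\<exists>(p, r, e)\<in>(\<lambda>p. (p, r p / 2, e p)) ` P. x \<in> ball p r \<and> x - (Lm * \<epsilon>) *\<^sub>R e \<notin> \<Omega>"
      using p(1) xb by force
  qed
qed

section \<open>Hardy inequality and measure of boundary layers\<close>

lemma FTC_sq_bound:
  fixes f :: "real \<Rightarrow> real"
  assumes f: "\<And>t. (f has_real_derivative f' t) (at t)" "continuous_on UNIV f'" and h: "0 \<le> h" and z: "f (- h) = 0"
  shows "ennreal ((f 0)\<^sup>2) \<le> ennreal h * (\<integral>\<^sup>+t. indicator {-h..0} t * ennreal ((f' t)\<^sup>2) \<partial>lborel)"
proof -
  have *: "has_bochner_integral lborel (\<lambda>x. indicator {-h..0} x *\<^sub>R f' x) (f 0 - f (- h))"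
    by (rule has_bochner_integral_FTC_Icc)
      (use h f in \<open>auto simp: has_real_derivative_iff_has_vector_derivative[symmetric] intro: has_field_derivative_at_within continuous_on_subset\<close>)
  then have "f 0 = (LBINT x. indicator {-h..0} x *\<^sub>R f' x)" and i: "integrable lborel (\<lambda>x. indicator {-h..0} x *\<^sub>R f' x)"
    using z by (auto simp: has_bochner_integral_iff)
  then have "ennreal \<bar>f 0\<bar> \<le> (\<integral>\<^sup>+x. ennreal (norm (indicator {-h..0} x *\<^sub>R f' x)) \<partial>lborel)"
    using integral_norm_bound_ennreal[OF i] by simp
  also have "\<dots> = (\<integral>\<^sup>+x. indicator {-h..0} x * (indicator {-h..0} x * ennreal \<bar>f' x\<bar>) \<partial>lborel)"
    by (intro nn_integral_cong) (auto simp: indicator_def)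
  finally have "(ennreal \<bar>f 0\<bar>)\<^sup>2 \<le> (\<integral>\<^sup>+x. indicator {-h..0} x * (indicator {-h..0} x * ennreal \<bar>f' x\<bar>) \<partial>lborel)\<^sup>2"
    by (rule power_mono) simp
  also have "\<dots> \<le> (\<integral>\<^sup>+x. (indicator {-h..0} x)\<^sup>2 \<partial>lborel) * (\<integral>\<^sup>+x. (indicator {-h..0} x * ennreal \<bar>f' x\<bar>)\<^sup>2 \<partial>lborel)"
    using borel_measurable_continuous_onI[OF f(2)] by (intro Cauchy_Schwarz_nn_integral) measurable
  also have "(\<integral>\<^sup>+x. (indicator {-h..0} x)\<^sup>2 \<partial>lborel) = (\<integral>\<^sup>+x. indicator {-h..0} (x::real) \<partial>lborel)"
    by (intro nn_integral_cong) (auto simp: indicator_def)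
  also have "\<dots> = ennreal h" using h by simp
  also have "(\<integral>\<^sup>+x. (indicator {-h..0} x * ennreal \<bar>f' x\<bar>)\<^sup>2 \<partial>lborel) = (\<integral>\<^sup>+t. indicator {-h..0} t * ennreal ((f' t)\<^sup>2) \<partial>lborel)"
    by (intro nn_integral_cong) (auto simp: indicator_def ennreal_power)
  also have "(ennreal \<bar>f 0\<bar>)\<^sup>2 = ennreal ((f 0)\<^sup>2)" by (simp add: ennreal_power)
  finally show ?thesis .
qed

lemma line_GDERIV:
  assumes "\<And>x. GDERIV w x :> w' x"
  shows "((\<lambda>t. w (x + t *\<^sub>R e)) has_real_derivative (w' (x + t *\<^sub>R e) \<bullet> e)) (at t)"
proof -
  have "((\<lambda>t. x + t *\<^sub>R e) has_derivative (\<lambda>h. h *\<^sub>R e)) (at t)" by (auto intro!: derivative_eq_intros)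
  from has_derivative_compose[OF this assms[of "x + t *\<^sub>R e", unfolded gderiv_def]]
  show ?thesis by (simp add: has_field_derivative_def inner_commute mult_commute_abs)
qed

text \<open>Going back by \<open>h\<close> leads to a zero of \<open>w\<close>, so Cauchy-Schwarz on
  the segment gives one factor \<open>h\<close>. After integration over \<open>x\<close> every shift
  \<open>t\<close> between \<open>- h\<close> and 0 contributes the same gradient integral, which
  gives the other.\<close>

lemma translate_hardy:
  fixes w :: "real^2 \<Rightarrow> real"
  assumes w: "\<And>x. GDERIV w x :> w' x" "continuous_on UNIV w'" and e: "norm e = 1" and h: "0 \<le> h"
    and S: "\<And>x. x \<in> S \<Longrightarrow> w (x - h *\<^sub>R e) = 0"
  shows "(\<integral>\<^sup>+x. indicator S x * ennreal ((w x)\<^sup>2) \<partial>lborel) \<le> ennreal (h\<^sup>2) * (\<integral>\<^sup>+x. ennreal ((norm (w' x))\<^sup>2) \<partial>lborel)"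
proof -
  have [measurable]: "w' \<in> borel_measurable borel" using w(2) by (rule borel_measurable_continuous_onI)
  have "(\<integral>\<^sup>+x. indicator S x * ennreal ((w x)\<^sup>2) \<partial>lborel) \<le>
    (\<integral>\<^sup>+x. ennreal h * (\<integral>\<^sup>+t. indicator {-h..0} t * ennreal ((norm (w' (x + t *\<^sub>R e)))\<^sup>2) \<partial>lborel) \<partial>lborel)"
  proof (rule nn_integral_mono)
    fix x
    show "indicator S x * ennreal ((w x)\<^sup>2) \<le> ennreal h * (\<integral>\<^sup>+t. indicator {-h..0} t * ennreal ((norm (w' (x + t *\<^sub>R e)))\<^sup>2) \<partial>lborel)"
    proof (cases "x \<in> S")
      case True
      have c: "continuous_on UNIV (\<lambda>t. w' (x + t *\<^sub>R e) \<bullet> e)"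
        by (intro continuous_intros continuous_on_compose2[OF w(2)]) auto
      have "ennreal ((w (x + 0 *\<^sub>R e))\<^sup>2) \<le> ennreal h * (\<integral>\<^sup>+t. indicator {-h..0} t * ennreal ((w' (x + t *\<^sub>R e) \<bullet> e)\<^sup>2) \<partial>lborel)"
        by (rule FTC_sq_bound[OF line_GDERIV[OF w(1)] c h]) (use S[OF True] in simp)
      also have "\<dots> \<le> ennreal h * (\<integral>\<^sup>+t. indicator {-h..0} t * ennreal ((norm (w' (x + t *\<^sub>R e)))\<^sup>2) \<partial>lborel)"
      proof (intro mult_left_mono nn_integral_mono ennreal_leI)
        fix t
        have "\<bar>w' (x + t *\<^sub>R e) \<bullet> e\<bar> \<le> \<bar>norm (w' (x + t *\<^sub>R e))\<bar>"
          using Cauchy_Schwarz_ineq2[of "w' (x + t *\<^sub>R e)" e] e by simp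
        then show "(w' (x + t *\<^sub>R e) \<bullet> e)\<^sup>2 \<le> (norm (w' (x + t *\<^sub>R e)))\<^sup>2" by (simp only: abs_le_square_iff)
      qed auto
      finally show ?thesis using True by simp
    qed simp
  qed
  also have "\<dots> = ennreal h * (\<integral>\<^sup>+x. \<integral>\<^sup>+t. indicator {-h..0} t * ennreal ((norm (w' (x + t *\<^sub>R e)))\<^sup>2) \<partial>lborel \<partial>lborel)"
    by (rule nn_integral_cmult) measurable
  also have "(\<integral>\<^sup>+x. \<integral>\<^sup>+t. indicator {-h..0} t * ennreal ((norm (w' (x + t *\<^sub>R e)))\<^sup>2) \<partial>lborel \<partial>lborel)
    = (\<integral>\<^sup>+t. \<integral>\<^sup>+x. indicator {-h..0} t * ennreal ((norm (w' (x + t *\<^sub>R e)))\<^sup>2) \<partial>lborel \<partial>lborel)"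
    by (rule lborel_pair.Fubini') measurable
  also have "\<dots> = (\<integral>\<^sup>+t. indicator {-h..0} t * (\<integral>\<^sup>+x. ennreal ((norm (w' x))\<^sup>2) \<partial>lborel) \<partial>lborel)"
  proof (rule nn_integral_cong)
    fix t :: real
    have "(\<integral>\<^sup>+x. ennreal ((norm (w' (x + t *\<^sub>R e)))\<^sup>2) \<partial>lborel) = (\<integral>\<^sup>+x. ennreal ((norm (w' x))\<^sup>2) \<partial>lborel)"
      by (rule lborel_nn_integral_shift) measurable
    then show "(\<integral>\<^sup>+x. indicator {-h..0} t * ennreal ((norm (w' (x + t *\<^sub>R e)))\<^sup>2) \<partial>lborel) = indicator {-h..0} t * (\<integral>\<^sup>+x. ennreal ((norm (w' x))\<^sup>2) \<partial>lborel)"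
      by (subst nn_integral_cmult) auto
  qed
  also have "\<dots> = ennreal h * (\<integral>\<^sup>+x. ennreal ((norm (w' x))\<^sup>2) \<partial>lborel)"
    using h by (subst nn_integral_multc) auto
  also have "ennreal h * (ennreal h * (\<integral>\<^sup>+x. ennreal ((norm (w' x))\<^sup>2) \<partial>lborel)) = ennreal (h\<^sup>2) * (\<integral>\<^sup>+x. ennreal ((norm (w' x))\<^sup>2) \<partial>lborel)"
    using h by (simp add: mult.assoc[symmetric] ennreal_mult[symmetric] power2_eq_square)
  finally show ?thesis .
qed

lemma boundary_layer_sum:
  assumes I: "finite I" and c: "\<And>x. x \<in> A \<Longrightarrow> \<exists>i\<in>I. x \<in> S i"
    and m: "\<And>i. i \<in> I \<Longrightarrow> (\<lambda>x. indicator (S i) x * f x) \<in> borel_measurable lborel"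
  shows "(\<integral>\<^sup>+x. indicator A x * f x \<partial>lborel) \<le> (\<Sum>i\<in>I. \<integral>\<^sup>+x. indicator (S i) x * (f x :: ennreal) \<partial>lborel)"
proof -
  have "(\<integral>\<^sup>+x. indicator A x * f x \<partial>lborel) \<le> (\<integral>\<^sup>+x. (\<Sum>i\<in>I. indicator (S i) x * f x) \<partial>lborel)"
  proof (rule nn_integral_mono)
    fix x
    show "indicator A x * f x \<le> (\<Sum>i\<in>I. indicator (S i) x * f x)"
    proof (cases "x \<in> A")
      case True
      then obtain i where i: "i \<in> I" "x \<in> S i" using c by blast
      have "indicator A x * f x = indicator (S i) x * f x" using True i by simp
      also have "\<dots> \<le> (\<Sum>i\<in>I. indicator (S i) x * f x)" using I i(1) by (intro member_le_sum) auto
      finally show ?thesis .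
    qed simp
  qed
  also have "\<dots> = (\<Sum>i\<in>I. \<integral>\<^sup>+x. indicator (S i) x * f x \<partial>lborel)" by (rule nn_integral_sum[OF m])
  finally show ?thesis .
qed

text \<open>The layer is covered by the sets \<open>S \<epsilon> i\<close> of points that leave
  \<Omega> when pushed back by \<open>L * \<epsilon>\<close> in the direction of chart
  \<open>i\<close>. For functions vanishing outside \<Omega> this is the situation of
  \<open>translate_hardy\<close>. For the measure, the translates of \<open>S \<epsilon> i\<close>
  by multiples of that step are disjoint subsets of \<Omega>, and a number of them inversely
  proportional to \<epsilon> fits in.\<close>

lemma layer_estimates:
  assumes "bounded_C2_domain \<Omega>"
  obtains C \<epsilon>0 where "0 < C" "0 < \<epsilon>0"
    "\<And>\<epsilon> \<eta> \<eta>'. 0 < \<epsilon> \<Longrightarrow> \<epsilon> < \<epsilon>0 \<Longrightarrow> (\<And>x. GDERIV \<eta> x :> \<eta>' x) \<Longrightarrow> continuous_on UNIV \<eta>' \<Longrightarrow> (\<And>x. x \<notin> \<Omega> \<Longrightarrow> \<eta> x = 0) \<Longrightarrow>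
      (\<integral>\<^sup>+x. indicator {x\<in>\<Omega>. infdist x (- \<Omega>) < \<epsilon>} x * ennreal ((\<eta> x)\<^sup>2) \<partial>lborel)
        \<le> ennreal (C * \<epsilon>\<^sup>2) * (\<integral>\<^sup>+x. ennreal ((norm (\<eta>' x))\<^sup>2) \<partial>lborel)"
    "\<And>\<epsilon>. 0 < \<epsilon> \<Longrightarrow> \<epsilon> < \<epsilon>0 \<Longrightarrow> emeasure lborel {x\<in>\<Omega>. infdist x (- \<Omega>) < \<epsilon>} \<le> ennreal (C * \<epsilon>)"
proof -
  have \<Omega>: "open \<Omega>" "bounded \<Omega>" using assms by (auto simp: bounded_C2_domain_def)
  obtain I :: "((real^2) \<times> real \<times> (real^2)) set" and L \<epsilon>0 where I: "finite I" "0 < L" "0 < \<epsilon>0"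
    "\<And>p r e. (p, r, e) \<in> I \<Longrightarrow> 0 < r \<and> norm e = 1"
    "\<And>p r e x t. (p, r, e) \<in> I \<Longrightarrow> x \<in> \<Omega> \<Longrightarrow> x \<in> ball p r \<Longrightarrow> 0 \<le> t \<Longrightarrow> t < r \<Longrightarrow> x + t *\<^sub>R e \<in> \<Omega>"
    "\<And>x \<epsilon>. x \<in> \<Omega> \<Longrightarrow> infdist x (- \<Omega>) < \<epsilon> \<Longrightarrow> \<epsilon> < \<epsilon>0 \<Longrightarrow> \<exists>(p, r, e)\<in>I. x \<in> ball p r \<and> x - (L * \<epsilon>) *\<^sub>R e \<notin> \<Omega>"
    using boundary_charts[OF assms] by blast
  define R where "R = (\<lambda>(p::real^2, r::real, e::real^2). r)"
  define E where "E = (\<lambda>(p::real^2, r::real, e::real^2). e)"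
  define S where "S \<epsilon> i = {x\<in>\<Omega>. x \<in> ball (fst i) (R i) \<and> x - (L * \<epsilon>) *\<^sub>R E i \<notin> \<Omega>}" for \<epsilon> i
  have Ii: "0 < R i" "norm (E i) = 1" if "i \<in> I" for i
    using I(4)[of "fst i" "R i" "E i"] that by (auto simp: R_def E_def split: prod.splits)
  have Iup: "x + t *\<^sub>R E i \<in> \<Omega>" if "i \<in> I" "x \<in> \<Omega>" "x \<in> ball (fst i) (R i)" "0 \<le> t" "t < R i" for i x t
    using I(5)[of "fst i" "R i" "E i"] that by (auto simp: R_def E_def split: prod.splits)
  have Icov: "\<exists>i\<in>I. x \<in> S \<epsilon> i" if x: "x \<in> {x\<in>\<Omega>. infdist x (- \<Omega>) < \<epsilon>}" and e: "\<epsilon> < \<epsilon>0" for x \<epsilon>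
  proof -
    obtain p r e where "(p, r, e) \<in> I" "x \<in> ball p r" "x - (L * \<epsilon>) *\<^sub>R e \<notin> \<Omega>" using I(6)[OF _ _ e, of x] x by auto
    then show ?thesis using x by (intro bexI[of _ "(p, r, e)"]) (auto simp: S_def R_def E_def)
  qed
  have Sm [measurable]: "S \<epsilon> i \<in> sets borel" for \<epsilon> i
  proof -
    have "closed ((\<lambda>x. x - (L * \<epsilon>) *\<^sub>R E i) -` (- \<Omega>))"
      using \<Omega>(1) by (intro closed_vimage closed_Compl continuous_intros)
    then have "\<Omega> \<inter> ball (fst i) (R i) \<inter> ((\<lambda>x. x - (L * \<epsilon>) *\<^sub>R E i) -` (- \<Omega>)) \<in> sets borel"
      using \<Omega>(1) by (intro sets.Int borel_open borel_closed) auto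
    moreover have "S \<epsilon> i = \<Omega> \<inter> ball (fst i) (R i) \<inter> ((\<lambda>x. x - (L * \<epsilon>) *\<^sub>R E i) -` (- \<Omega>))"
      by (auto simp: S_def)
    ultimately show ?thesis by simp
  qed
  define rm where "rm = Min (insert 1 (R ` I))"
  have rm: "0 < rm" "\<And>i. i \<in> I \<Longrightarrow> rm \<le> R i" using I(1) Ii by (auto simp: rm_def)
  have f\<Omega>: "emeasure lborel \<Omega> < \<infinity>" using \<Omega>(2) by (rule emeasure_bounded_finite)
  define M where "M = measure lborel \<Omega>"
  have M: "emeasure lborel \<Omega> = ennreal M" "0 \<le> M" using f\<Omega> by (auto simp: M_def emeasure_eq_ennreal_measure)
  define C where "C = card I * L\<^sup>2 + card I * (2 * M * L / rm) + 1"
  have C: "0 < C" "card I * L\<^sup>2 \<le> C" "card I * (2 * M * L / rm) \<le> C"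
    using I(2) rm(1) M(2) by (auto simp: C_def add_nonneg_pos intro!: add_nonneg_pos)
  show ?thesis
  proof (rule that[of C "min \<epsilon>0 (rm / L)"])
    show "0 < C" by fact
    show "0 < min \<epsilon>0 (rm / L)" using I rm by simp
    fix \<epsilon> \<eta> \<eta>' assume e: "0 < \<epsilon>" "\<epsilon> < min \<epsilon>0 (rm / L)" and \<eta>: "\<And>x. GDERIV \<eta> x :> \<eta>' x" "continuous_on UNIV \<eta>'" "\<And>x. x \<notin> \<Omega> \<Longrightarrow> \<eta> x = 0"
    have \<eta>c: "continuous_on UNIV \<eta>"
      using \<eta>(1) unfolding gderiv_def by (meson continuous_at_imp_continuous_on has_derivative_continuous)
    then have [measurable]: "\<eta> \<in> borel_measurable borel" by (rule borel_measurable_continuous_onI)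
    let ?D = "\<integral>\<^sup>+x. ennreal ((norm (\<eta>' x))\<^sup>2) \<partial>lborel"
    have "(\<integral>\<^sup>+x. indicator {x\<in>\<Omega>. infdist x (- \<Omega>) < \<epsilon>} x * ennreal ((\<eta> x)\<^sup>2) \<partial>lborel)
      \<le> (\<Sum>i\<in>I. \<integral>\<^sup>+x. indicator (S \<epsilon> i) x * ennreal ((\<eta> x)\<^sup>2) \<partial>lborel)"
      by (rule boundary_layer_sum[OF I(1) Icov]) (use e in auto)
    also have "\<dots> \<le> (\<Sum>i\<in>I. ennreal ((L * \<epsilon>)\<^sup>2) * ?D)"
    proof (rule sum_mono)
      fix i assume i: "i \<in> I"
      show "(\<integral>\<^sup>+x. indicator (S \<epsilon> i) x * ennreal ((\<eta> x)\<^sup>2) \<partial>lborel) \<le> ennreal ((L * \<epsilon>)\<^sup>2) * ?D"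
        by (rule translate_hardy[OF \<eta>(1,2) Ii(2)[OF i]]) (use I(2) e \<eta>(3) in \<open>auto simp: S_def\<close>)
    qed
    also have "\<dots> = ennreal (card I * L\<^sup>2 * \<epsilon>\<^sup>2) * ?D"
      using e by (simp add: ennreal_of_nat_eq_real_of_nat mult.assoc[symmetric] ennreal_mult[symmetric] power_mult_distrib)
    also have "\<dots> \<le> ennreal (C * \<epsilon>\<^sup>2) * ?D"
      using C by (intro mult_right_mono ennreal_leI) auto
    finally show "(\<integral>\<^sup>+x. indicator {x\<in>\<Omega>. infdist x (- \<Omega>) < \<epsilon>} x * ennreal ((\<eta> x)\<^sup>2) \<partial>lborel) \<le> ennreal (C * \<epsilon>\<^sup>2) * ?D" .
  next
    fix \<epsilon> assume e: "0 < \<epsilon>" "\<epsilon> < min \<epsilon>0 (rm / L)"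
    define h where "h = L * \<epsilon>"
    have h: "0 < h" "h \<le> rm" using e I(2) by (auto simp: h_def field_simps)
    have Sb: "emeasure lborel (S \<epsilon> i) \<le> ennreal (2 * M * h / rm)" if i: "i \<in> I" for i
    proof -
      define n where "n = nat \<lfloor>R i / h\<rfloor>"
      have nf: "real n = of_int \<lfloor>R i / h\<rfloor>" using h(1) Ii(1)[OF i] by (simp add: n_def)
      have n1: "real n * h \<le> R i"
      proof -
        have "real n \<le> R i / h" unfolding nf by (rule of_int_floor_le)
        then show ?thesis using h(1) by (simp add: field_simps)
      qed
      \<comment> \<open>The integer part of a number that is at least 1 is at least half of that
        number.\<close>
      have n2: "rm / (2 * h) \<le> real n"
      proof -
        have "1 \<le> rm / h" using h by simp
        moreover have "rm / h \<le> R i / h" using rm(2)[OF i] h by (intro divide_right_mono) auto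
        moreover have "R i / h < real n + 1" unfolding nf by linarith
        moreover have "1 \<le> real n"
        proof -
          have "1 \<le> R i / h" using calculation(1,2) by linarith
          then have "(1::int) \<le> \<lfloor>R i / h\<rfloor>" by (simp add: le_floor_iff)
          then show ?thesis unfolding nf by linarith
        qed
        ultimately have "rm / h \<le> 2 * real n" by linarith
        then show ?thesis using h by (simp add: field_simps)
      qed
      have pt: "(\<Sum>j<n. indicator (S \<epsilon> i) (x + (- (real j * h)) *\<^sub>R E i)) \<le> (indicator \<Omega> x :: ennreal)" for x
      proof -
        let ?J = "{j. j < n \<and> x + (- (real j * h)) *\<^sub>R E i \<in> S \<epsilon> i}"
        \<comment> \<open>If \<open>x\<close> lay in the \<open>j\<close>-th and the
          \<open>j'\<close>-th translate, the point \<open>j'\<close> steps behind \<open>x\<close>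
          could be moved forward by \<open>j' - j - 1\<close> steps inside \<Omega>. It would arrive
          one step behind the point of \<open>S \<epsilon> i\<close> that belongs to
          \<open>j\<close>, and that place is outside \<Omega> by definition of
          \<open>S\<close>.\<close>
        have lt: False if "j \<in> ?J" "j' \<in> ?J" "j < j'" for j j'
        proof -
          let ?y = "x + (- (real j' * h)) *\<^sub>R E i" and ?t = "(real j' - real j - 1) * h"
          have y: "?y \<in> \<Omega>" "?y \<in> ball (fst i) (R i)" using that(2) by (auto simp: S_def)
          have "real j' - real j - 1 \<ge> 0" using that(3) by linarith
          then have t0: "0 \<le> ?t" using h by simp
          have "?t \<le> (real n - 1) * h" using that(2) h by (intro mult_right_mono) auto
          also have "\<dots> < R i" using n1 h by (simp add: algebra_simps)
          finally have "?y + ?t *\<^sub>R E i \<in> \<Omega>" using Iup[OF i y t0] by simp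
          moreover have eq: "?y + ?t *\<^sub>R E i = x + (- (real j * h)) *\<^sub>R E i - (L * \<epsilon>) *\<^sub>R E i"
            by (simp add: h_def algebra_simps)
          ultimately have "x + (- (real j * h)) *\<^sub>R E i - (L * \<epsilon>) *\<^sub>R E i \<in> \<Omega>" by (simp only: eq)
          then show False using that(1) by (simp add: S_def)
        qed
        then have J1: "j = j'" if "j \<in> ?J" "j' \<in> ?J" for j j'
          using lt[OF that] lt[OF that(2,1)] by (cases j j' rule: linorder_cases) blast+
        show ?thesis
        proof (cases "?J = {}")
          case True
          then have "(\<Sum>j<n. indicator (S \<epsilon> i) (x + (- (real j * h)) *\<^sub>R E i)) = (0::ennreal)"
            by (intro sum.neutral) (auto simp: indicator_def)
          then show ?thesis by simp
        next
          case False
          then obtain j where j: "j \<in> ?J" by blast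
          have "(\<Sum>j<n. indicator (S \<epsilon> i) (x + (- (real j * h)) *\<^sub>R E i)) = (\<Sum>k<n. if k = j then 1 else (0::ennreal))"
          proof (rule sum.cong)
            fix k assume k: "k \<in> {..<n}"
            show "indicator (S \<epsilon> i) (x + (- (real k * h)) *\<^sub>R E i) = (if k = j then 1 else (0::ennreal))"
            proof (cases "k = j")
              case True
              then show ?thesis using j by simp
            next
              case False
              then have "x + (- (real k * h)) *\<^sub>R E i \<notin> S \<epsilon> i" using J1[OF _ j, of k] k by blast
              then show ?thesis using False by simp
            qed
          qed simp
          also have "\<dots> = 1" using j by simp
          also have "1 = (indicator \<Omega> x :: ennreal)"
          proof -
            let ?y = "x + (- (real j * h)) *\<^sub>R E i"
            have "real j * h \<le> (real n - 1) * h" using j h by (intro mult_right_mono) auto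
            also have "\<dots> < R i" using n1 h by (simp add: algebra_simps)
            finally have jr: "real j * h < R i" .
            have y: "?y \<in> \<Omega>" "?y \<in> ball (fst i) (R i)" using j by (auto simp: S_def)
            have "?y + (real j * h) *\<^sub>R E i \<in> \<Omega>" by (rule Iup[OF i y _ jr]) (use h in simp)
            then show ?thesis by simp
          qed
          finally show ?thesis by simp
        qed
      qed
      have sh: "(\<integral>\<^sup>+x. indicator (S \<epsilon> i) (x + z) \<partial>lborel) = emeasure lborel (S \<epsilon> i)" for z
        by (subst lborel_nn_integral_shift) (auto simp: Sm)
      have "ennreal (real n) * emeasure lborel (S \<epsilon> i) = (\<Sum>j<n. \<integral>\<^sup>+x. indicator (S \<epsilon> i) (x + (- (real j * h)) *\<^sub>R E i) \<partial>lborel)"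
        unfolding sh by (simp add: ennreal_of_nat_eq_real_of_nat)
      also have "\<dots> = (\<integral>\<^sup>+x. (\<Sum>j<n. indicator (S \<epsilon> i) (x + (- (real j * h)) *\<^sub>R E i)) \<partial>lborel)"
        by (rule nn_integral_sum[symmetric]) measurable
      also have "\<dots> \<le> (\<integral>\<^sup>+x. indicator \<Omega> x \<partial>lborel)" by (intro nn_integral_mono pt)
      also have "\<dots> = ennreal M" using \<Omega>(1) M by simp
      finally have nS: "ennreal (real n) * emeasure lborel (S \<epsilon> i) \<le> ennreal M" .
      have "emeasure lborel (S \<epsilon> i) \<le> emeasure lborel \<Omega>" using \<Omega>(1) by (intro emeasure_mono) (auto simp: S_def)
      then have fS: "emeasure lborel (S \<epsilon> i) = ennreal (measure lborel (S \<epsilon> i))"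
        using f\<Omega> by (intro emeasure_eq_ennreal_measure) (auto simp: top_unique)
      have "real n * measure lborel (S \<epsilon> i) \<le> M"
        using nS M(2) unfolding fS by (simp add: ennreal_mult[symmetric])
      moreover have "rm / (2 * h) * measure lborel (S \<epsilon> i) \<le> real n * measure lborel (S \<epsilon> i)"
        using n2 by (intro mult_right_mono) auto
      ultimately have "rm / (2 * h) * measure lborel (S \<epsilon> i) \<le> M" by linarith
      then have "measure lborel (S \<epsilon> i) \<le> 2 * M * h / rm" using h rm(1) by (simp add: field_simps)
      then show ?thesis unfolding fS by (rule ennreal_leI)
    qed
    have lm: "{x\<in>\<Omega>. infdist x (- \<Omega>) < \<epsilon>} \<in> sets borel"
    proof -
      have "open (\<Omega> \<inter> {x. infdist x (- \<Omega>) < \<epsilon>})"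
        using \<Omega>(1) by (intro open_Int open_Collect_less continuous_intros)
      moreover have "{x\<in>\<Omega>. infdist x (- \<Omega>) < \<epsilon>} = \<Omega> \<inter> {x. infdist x (- \<Omega>) < \<epsilon>}" by blast
      ultimately show ?thesis by (simp only: borel_open)
    qed
    have "emeasure lborel {x\<in>\<Omega>. infdist x (- \<Omega>) < \<epsilon>} = (\<integral>\<^sup>+x. indicator {x\<in>\<Omega>. infdist x (- \<Omega>) < \<epsilon>} x * 1 \<partial>lborel)"
      using lm by simp
    also have "\<dots> \<le> (\<Sum>i\<in>I. \<integral>\<^sup>+x. indicator (S \<epsilon> i) x * 1 \<partial>lborel)"
      by (rule boundary_layer_sum[OF I(1) Icov]) (use e in auto)
    also have "\<dots> = (\<Sum>i\<in>I. emeasure lborel (S \<epsilon> i))" by simp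
    also have "\<dots> \<le> (\<Sum>i\<in>I. ennreal (2 * M * h / rm))" using Sb by (rule sum_mono)
    also have "\<dots> = ennreal (card I * (2 * M * L / rm) * \<epsilon>)"
      using M h rm e I(2) by (simp add: ennreal_of_nat_eq_real_of_nat ennreal_mult[symmetric] h_def algebra_simps)
    also have "\<dots> \<le> ennreal (C * \<epsilon>)" using C e by (intro ennreal_leI mult_right_mono) auto
    finally show "emeasure lborel {x\<in>\<Omega>. infdist x (- \<Omega>) < \<epsilon>} \<le> ennreal (C * \<epsilon>)" .
  qed
qed

section \<open>Cutoff functions adapted to the boundary layer\<close>

definition layer :: "(real^2) set \<Rightarrow> real \<Rightarrow> (real^2) set" where
  "layer \<Omega> \<epsilon> = {x\<in>\<Omega>. infdist x (- \<Omega>) < \<epsilon>}"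

lemma layer_borel: "open \<Omega> \<Longrightarrow> layer \<Omega> \<epsilon> \<in> sets borel"
proof -
  assume "open \<Omega>"
  then have "open (\<Omega> \<inter> {x. infdist x (- \<Omega>) < \<epsilon>})" by (intro open_Int open_Collect_less continuous_intros)
  moreover have "layer \<Omega> \<epsilon> = \<Omega> \<inter> {x. infdist x (- \<Omega>) < \<epsilon>}" by (auto simp: layer_def)
  ultimately show ?thesis by simp
qed

text \<open>The derivative along the gradient itself is its squared norm, and the Lipschitz bound
  caps it by \<open>M\<close> times the norm.\<close>

lemma GDERIV_norm_le:
  fixes f :: "'a::euclidean_space \<Rightarrow> real"
  assumes D: "GDERIV f x :> D" and lip: "\<And>y. \<bar>f y - f x\<bar> \<le> M * norm (y - x)"
  shows "norm D \<le> M"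
proof (cases "D = 0")
  case True
  have "0 \<le> M * norm (x + D - x)" for D using lip[of "x + D"] abs_ge_zero order_trans by blast
  obtain b :: 'a where b: "b \<in> Basis" using nonempty_Basis by blast
  have "0 \<le> M * norm (x + b - x)" using lip[of "x + b"] abs_ge_zero order_trans by blast
  then show ?thesis using True b by simp
next
  case False
  have d: "((\<lambda>t. f (x + t *\<^sub>R D)) has_real_derivative (D \<bullet> D)) (at 0)"
  proof -
    have "((\<lambda>t. x + t *\<^sub>R D) has_derivative (\<lambda>h. h *\<^sub>R D)) (at 0)" by (auto intro!: derivative_eq_intros)
    from has_derivative_compose[OF this, of f "\<lambda>h. h \<bullet> D"] D
    show ?thesis by (simp add: gderiv_def has_field_derivative_def mult_commute_abs)
  qed
  then have "((\<lambda>h. (f (x + (0 + h) *\<^sub>R D) - f (x + 0 *\<^sub>R D)) / h) \<longlongrightarrow> D \<bullet> D) (at 0)" by (simp only: DERIV_def)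
  then have "((\<lambda>h. (f (x + h *\<^sub>R D) - f x) / h) \<longlongrightarrow> D \<bullet> D) (at 0)" by simp
  then have "D \<bullet> D \<le> M * norm D"
  proof (rule tendsto_upperbound)
    show "\<forall>\<^sub>F h in at 0. (f (x + h *\<^sub>R D) - f x) / h \<le> M * norm D"
    proof (rule eventually_at_topological[THEN iffD2], intro exI[of _ UNIV] conjI ballI impI)
      fix h :: real assume h: "h \<noteq> 0"
      have "\<bar>f (x + h *\<^sub>R D) - f x\<bar> \<le> M * (\<bar>h\<bar> * norm D)" using lip[of "x + h *\<^sub>R D"] by simp
      then have "\<bar>(f (x + h *\<^sub>R D) - f x) / h\<bar> \<le> M * norm D" using h by (simp add: abs_divide field_simps)
      then show "(f (x + h *\<^sub>R D) - f x) / h \<le> M * norm D" by linarith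
    qed auto
  qed simp
  then show ?thesis using False by (simp add: dot_square_norm power2_eq_square)
qed

lemma conv_bump_shift:
  fixes f :: "'a::euclidean_space \<Rightarrow> real"
  shows "conv f (bump r) x = (LBINT z. f (x + z) * bump r z)"
proof -
  have "conv f (bump r) x = (LBINT y. f (x + y) * bump r (x - (x + y)))"
    unfolding conv_def by (rule lborel_integral_shift(1)[symmetric])
  then show ?thesis by simp
qed

lemma conv_bump_lipschitz:
  fixes f :: "'a::euclidean_space \<Rightarrow> real"
  assumes f: "integrable lborel f" and r: "0 < r" and lip: "\<And>x y. \<bar>f x - f y\<bar> \<le> M * norm (x - y)"
  shows "\<bar>conv f (bump r) x - conv f (bump r) y\<bar> \<le> M * norm (x - y)"
proof -
  have i: "integrable lborel (\<lambda>z. f (x + z) * bump r z)" for x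
  proof -
    have "integrable lborel (\<lambda>y. f y * bump r (x - y))" by (rule conv_integrable[OF f bump_test_UNIV[OF r]])
    then have "integrable lborel (\<lambda>y. f (x + y) * bump r (x - (x + y)))"
      using lborel_integral_shift(2)[of "\<lambda>y. f y * bump r (x - y)" x] by blast
    then show ?thesis by simp
  qed
  have "conv f (bump r) x - conv f (bump r) y = (LBINT z. f (x + z) * bump r z - f (y + z) * bump r z)"
    unfolding conv_bump_shift using i by simp
  also have "\<bar>\<dots>\<bar> \<le> (LBINT z. \<bar>f (x + z) * bump r z - f (y + z) * bump r z\<bar>)" by (rule integral_abs_bound)
  also have "\<dots> \<le> (\<integral>z. (M * norm (x - y)) * bump r z \<partial>(lborel :: 'a measure))"
  proof (rule integral_mono)
    fix z
    have "\<bar>f (x + z) - f (y + z)\<bar> \<le> M * norm (x - y)" using lip[of "x + z" "y + z"] by simp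
    then show "\<bar>f (x + z) * bump r z - f (y + z) * bump r z\<bar> \<le> M * norm (x - y) * bump r z"
      using r by (simp add: left_diff_distrib[symmetric] abs_mult mult_right_mono)
  qed (use i bump_integrable[OF r, where 'a='a] in auto)
  also have "\<dots> = M * norm (x - y)" using bump_integral[OF r, where 'a='a] by simp
  finally show ?thesis .
qed

text \<open>A clipped multiple of the distance to the complement, mollified. The clipped function is
  0 up to distance \<open>a / 3\<close> and 1 from \<open>2 * a / 3\<close> on, with slope
  \<open>3 / a\<close>. The mollification radius \<open>a / 6\<close> moves the thresholds to
  \<open>a / 6\<close> and \<open>5 * a / 6\<close> and keeps the Lipschitz constant, which bounds
  the gradient.\<close>

lemma cutoff_exists:
  assumes \<Omega>: "open \<Omega>" "bounded \<Omega>" and a: "0 < (a::real)"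
  shows "\<exists>K \<kappa> \<kappa>'. cutoff \<Omega> K \<kappa> \<kappa>' \<and> (\<forall>x. 0 \<le> \<kappa> x \<and> \<kappa> x \<le> 1) \<and> (\<forall>x. a \<le> infdist x (- \<Omega>) \<longrightarrow> \<kappa> x = 1) \<and>
    (\<forall>x. norm (\<kappa>' x) \<le> 3 / a * indicator (layer \<Omega> (2 * a)) x)"
proof -
  let ?d = "\<lambda>x. infdist x (- \<Omega>)"
  have d0: "?d x = 0" if "x \<notin> \<Omega>" for x using that by simp
  define f where "f x = min 1 (max 0 (3 / a * ?d x - 1))" for x
  have f01: "0 \<le> f x" "f x \<le> 1" for x by (auto simp: f_def)
  have fc: "continuous_on UNIV f" unfolding f_def by (intro continuous_intros)
  have fi: "integrable lborel f"
    by (rule integrable_continuous_compact_support[OF fc \<Omega>(2)]) (simp add: f_def d0)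
  have dl: "\<bar>?d x - ?d y\<bar> \<le> norm (x - y)" for x y using infdist_triangle_abs[of x "- \<Omega>" y] by (simp add: dist_norm)
  have fl: "\<bar>f x - f y\<bar> \<le> 3 / a * norm (x - y)" for x y
  proof -
    have "\<bar>f x - f y\<bar> \<le> \<bar>3 / a * ?d x - 3 / a * ?d y\<bar>" unfolding f_def by (auto simp: min_def max_def)
    also have "3 / a * ?d x - 3 / a * ?d y = 3 / a * (?d x - ?d y)" by (simp only: right_diff_distrib)
    also have "\<bar>3 / a * (?d x - ?d y)\<bar> = 3 / a * \<bar>?d x - ?d y\<bar>"
      unfolding abs_mult using a by simp
    also have "\<dots> \<le> 3 / a * norm (x - y)" using dl a by (intro mult_left_mono) auto
    finally show ?thesis .
  qed
  define r where "r = a / 6"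
  have r: "0 < r" using a by (simp add: r_def)
  note t = bump_test_UNIV[OF r, where 'a="real^2"]
  define \<kappa> where "\<kappa> = conv f (bump r)"
  define \<kappa>' where "\<kappa>' x = (\<Sum>b\<in>Basis. conv f (\<lambda>z. frechet_derivative (bump r) (at z) b) x *\<^sub>R b)" for x
  define K where "K = {x. a / 6 \<le> ?d x}"
  have g: "GDERIV \<kappa> x :> \<kappa>' x" for x unfolding \<kappa>_def \<kappa>'_def by (rule conv_GDERIV[OF fi t])
  have gc: "continuous_on UNIV \<kappa>'" unfolding \<kappa>'_def
    by (intro continuous_intros conv_continuous[OF fi test_function_pd[OF t]])
  have near: "\<bar>?d y - ?d x\<bar> < a / 6" if "dist x y < r" for x y
    using dl[of y x] that by (simp add: r_def dist_norm norm_minus_commute)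
  have \<kappa>0: "\<kappa> x = 0" if "?d x < a / 6" for x
  proof -
    have "f y = 0" if "dist x y < r" for y
    proof -
      have "?d y < a / 3" using near[OF that] \<open>?d x < a / 6\<close> by linarith
      then show ?thesis using a by (simp add: f_def field_simps max_def)
    qed
    moreover have "f x = 0" using calculation[of x] r by simp
    ultimately have "\<bar>\<kappa> x - f x\<bar> \<le> 0" unfolding \<kappa>_def by (intro conv_bump_close[OF fi r]) auto
    with \<open>f x = 0\<close> show ?thesis by simp
  qed
  have \<kappa>1: "\<kappa> x = 1" if "a * (5/6) \<le> ?d x" for x
  proof -
    have "f y = 1" if "dist x y < r" for y
    proof -
      have "2 * a / 3 \<le> ?d y" using near[OF that] \<open>a * (5/6) \<le> ?d x\<close> by linarith
      then show ?thesis using a by (simp add: f_def field_simps max_def min_def)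
    qed
    moreover have "f x = 1" using calculation[of x] r by simp
    ultimately have "\<bar>\<kappa> x - f x\<bar> \<le> 0" unfolding \<kappa>_def by (intro conv_bump_close[OF fi r]) auto
    with \<open>f x = 1\<close> show ?thesis by simp
  qed
  have K: "compact K" "K \<subseteq> \<Omega>"
  proof -
    show "K \<subseteq> \<Omega>"
    proof
      fix x assume "x \<in> K"
      then have "0 < ?d x" using a by (simp add: K_def)
      then show "x \<in> \<Omega>" using d0[of x] by (cases "x \<in> \<Omega>") auto
    qed
    have "closed K" unfolding K_def by (intro closed_Collect_le continuous_intros)
    then show "compact K" using \<open>K \<subseteq> \<Omega>\<close> \<Omega>(2) bounded_subset compact_eq_bounded_closed by blast
  qed
  have "cutoff \<Omega> K \<kappa> \<kappa>'" unfolding cutoff_def using K g gc \<kappa>0 by (auto simp: K_def not_le)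
  moreover have "0 \<le> \<kappa> x \<and> \<kappa> x \<le> 1" for x
  proof
    show "0 \<le> \<kappa> x" unfolding \<kappa>_def conv_bump_shift using f01 r by (intro integral_nonneg_AE AE_I2 mult_nonneg_nonneg) auto
    have i: "integrable lborel (\<lambda>z. f (x + z) * bump r z)"
      by (rule Bochner_Integration.integrable_bound[OF bump_integrable[OF r, where 'a="real^2"]])
         (use f01 r borel_measurable_continuous_onI[OF fc] borel_measurable_integrable[OF bump_integrable[OF r, where 'a="real^2"]]
            in \<open>auto intro!: mult_left_le_one_le\<close>)
    have "\<kappa> x \<le> (\<integral>z. bump r z \<partial>(lborel :: (real^2) measure))" unfolding \<kappa>_def conv_bump_shift
      using f01 r i bump_integrable[OF r, where 'a="real^2"] by (intro integral_mono) (auto intro!: mult_left_le_one_le)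
    then show "\<kappa> x \<le> 1" using bump_integral[OF r, where 'a="real^2"] by simp
  qed
  moreover have "\<kappa> x = 1" if "a \<le> ?d x" for x using that a by (intro \<kappa>1) simp
  moreover have "norm (\<kappa>' x) \<le> 3 / a * indicator (layer \<Omega> (2 * a)) x" for x
  proof (cases "x \<in> layer \<Omega> (2 * a)")
    case True
    have "norm (\<kappa>' x) \<le> 3 / a"
      using g conv_bump_lipschitz[OF fi r fl] unfolding \<kappa>_def by (rule GDERIV_norm_le)
    then show ?thesis using True by simp
  next
    case False
    have "\<kappa>' x = 0"
    proof (cases "x \<in> \<Omega>")
      case True
      then have "2 * a \<le> ?d x" using False by (simp add: layer_def)
      let ?U = "{x. a * (5/6) < ?d x}"
      have U: "open ?U" "x \<in> ?U" using \<open>2 * a \<le> ?d x\<close> a by (auto intro!: open_Collect_less continuous_intros)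
      have "((\<lambda>x. 1) has_derivative (\<lambda>h. 0)) (at x)" by simp
      then have "(\<kappa> has_derivative (\<lambda>h. 0)) (at x)"
        by (rule has_derivative_transform_within_open[OF _ U]) (use \<kappa>1 in auto)
      then have "GDERIV \<kappa> x :> 0" by (simp add: gderiv_def)
      then show ?thesis by (rule GDERIV_unique[OF g])
    next
      case x: False
      let ?U = "{x. ?d x < a / 6}"
      have U: "open ?U" "x \<in> ?U" using d0[OF x] a by (auto intro!: open_Collect_less continuous_intros)
      have "((\<lambda>x. 0) has_derivative (\<lambda>h. 0)) (at x)" by simp
      then have "(\<kappa> has_derivative (\<lambda>h. 0)) (at x)"
        by (rule has_derivative_transform_within_open[OF _ U]) (use \<kappa>0 in auto)
      then have "GDERIV \<kappa> x :> 0" by (simp add: gderiv_def)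
      then show ?thesis by (rule GDERIV_unique[OF g])
    qed
    then show ?thesis using False by simp
  qed
  ultimately show ?thesis by blast
qed

lemma cutoff_sequence:
  assumes \<Omega>: "open \<Omega>" "bounded \<Omega>"
  obtains K \<kappa> \<kappa>' where "\<And>n::nat. cutoff \<Omega> (K n) (\<kappa> n) (\<kappa>' n)" "\<And>n x. 0 \<le> \<kappa> n x" "\<And>n x. \<kappa> n x \<le> 1"
    "\<And>n x. 1 / Suc n \<le> infdist x (- \<Omega>) \<Longrightarrow> \<kappa> n x = 1"
    "\<And>n x. norm (\<kappa>' n x) \<le> 3 * real (Suc n) * indicator (layer \<Omega> (2 / Suc n)) x"
proof -
  have "\<forall>n. \<exists>t. cutoff \<Omega> (fst t) (fst (snd t)) (snd (snd t)) \<and> (\<forall>x. 0 \<le> (fst (snd t)) x \<and> (fst (snd t)) x \<le> 1) \<and>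
    (\<forall>x. 1 / Suc n \<le> infdist x (- \<Omega>) \<longrightarrow> (fst (snd t)) x = 1) \<and>
    (\<forall>x. norm ((snd (snd t)) x) \<le> 3 * real (Suc n) * indicator (layer \<Omega> (2 / Suc n)) x)"
  proof
    fix n :: nat
    have "0 < 1 / real (Suc n)" by simp
    from cutoff_exists[OF \<Omega> this] obtain K \<kappa> \<kappa>' where
      "cutoff \<Omega> K \<kappa> \<kappa>' \<and> (\<forall>x. 0 \<le> \<kappa> x \<and> \<kappa> x \<le> 1) \<and> (\<forall>x. 1 / Suc n \<le> infdist x (- \<Omega>) \<longrightarrow> \<kappa> x = 1) \<and>
        (\<forall>x. norm (\<kappa>' x) \<le> 3 / (1 / Suc n) * indicator (layer \<Omega> (2 * (1 / Suc n))) x)" by blast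
    then show "\<exists>t. cutoff \<Omega> (fst t) (fst (snd t)) (snd (snd t)) \<and> (\<forall>x. 0 \<le> (fst (snd t)) x \<and> (fst (snd t)) x \<le> 1) \<and>
    (\<forall>x. 1 / Suc n \<le> infdist x (- \<Omega>) \<longrightarrow> (fst (snd t)) x = 1) \<and>
    (\<forall>x. norm ((snd (snd t)) x) \<le> 3 * real (Suc n) * indicator (layer \<Omega> (2 / Suc n)) x)"
      by (intro exI[of _ "(K, \<kappa>, \<kappa>')"]) (simp del: of_nat_Suc)
  qed
  then obtain t where t: "\<forall>n. cutoff \<Omega> (fst (t n)) (fst (snd (t n))) (snd (snd (t n))) \<and> (\<forall>x. 0 \<le> (fst (snd (t n))) x \<and> (fst (snd (t n))) x \<le> 1) \<and>
    (\<forall>x. 1 / Suc n \<le> infdist x (- \<Omega>) \<longrightarrow> (fst (snd (t n))) x = 1) \<and>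
    (\<forall>x. norm ((snd (snd (t n))) x) \<le> 3 * real (Suc n) * indicator (layer \<Omega> (2 / Suc n)) x)"
    by (rule choice[THEN exE])
  show ?thesis by (rule that[of "\<lambda>n. fst (t n)" "\<lambda>n. fst (snd (t n))" "\<lambda>n. snd (snd (t n))"]) (use t in blast)+
qed

section \<open>Area and supremum estimates\<close>

lemma DERIV_pos_square: "((\<lambda>x. (max 0 x)\<^sup>2) has_real_derivative 2 * max 0 x) (at (x::real))"
proof (cases x "0::real" rule: linorder_cases)
  case less
  have "((\<lambda>x::real. 0) has_real_derivative 2 * max 0 x) (at x)" using less by simp
  then show ?thesis
    by (rule has_field_derivative_transform_within[where d = "- x"]) (use less in \<open>auto simp: dist_real_def\<close>)
next
  case greater
  have "((\<lambda>x::real. x\<^sup>2) has_real_derivative 2 * max 0 x) (at x)" using greater by (auto intro!: derivative_eq_intros)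
  then show ?thesis
    by (rule has_field_derivative_transform_within[where d = x]) (use greater in \<open>auto simp: dist_real_def\<close>)
next
  case equal
  have "((\<lambda>h. max 0 h) \<longlongrightarrow> max 0 (0::real)) (at 0)" by (intro tendsto_intros)
  then have "((\<lambda>h::real. ((max 0 (0 + h))\<^sup>2 - (max 0 0)\<^sup>2) / h) \<longlongrightarrow> 0) (at 0)"
    by (auto elim!: Lim_transform_eventually simp: eventually_at_filter max_def power2_eq_square)
  then show ?thesis unfolding equal DERIV_def by simp
qed

text \<open>Two parabolic arcs joined at the midpoint, written with squares of positive parts so
  that the joints are automatically differentiable. Bounding \<theta> by a multiple of the positive
  part of \<open>r - s\<close> lets the decay of the positive part of \<open>u - s\<close> near the
  boundary control the cutoff terms.\<close>

lemma step_exists: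
  fixes s t :: real
  assumes st: "s < t"
  shows "\<exists>\<theta> \<theta>'. C1b \<theta> \<theta>' \<and> (\<forall>r. 0 \<le> \<theta> r \<and> \<theta> r \<le> 1 \<and> 0 \<le> \<theta>' r \<and> \<theta>' r \<le> 2 / (t - s)
     \<and> \<theta> r \<le> 2 / (t - s) * max 0 (r - s) \<and> (r \<le> s \<longrightarrow> \<theta> r = 0 \<and> \<theta>' r = 0) \<and> (t \<le> r \<longrightarrow> \<theta> r = 1 \<and> \<theta>' r = 0))"
proof -
  define z where "z r = (r - s) / (t - s)" for r
  define f where "f x = 2 * (max 0 x)\<^sup>2 - 4 * (max 0 (x - 1/2))\<^sup>2 + 2 * (max 0 (x - 1))\<^sup>2" for x :: real
  define f' where "f' x = 4 * max 0 x - 8 * max 0 (x - 1/2) + 4 * max 0 (x - 1)" for x :: real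
  have a: "((\<lambda>x. (max 0 (x - a))\<^sup>2) has_real_derivative 2 * max 0 (x - a)) (at x)" for a x :: real
  proof -
    have "((\<lambda>x. x - a) has_real_derivative 1) (at x)" by (auto intro!: derivative_eq_intros)
    from DERIV_chain2[OF DERIV_pos_square this] show ?thesis by simp
  qed
  have df: "(f has_real_derivative f' x) (at x)" for x
    using DERIV_add[OF DERIV_diff[OF DERIV_cmult[OF a[of 0 x], of 2] DERIV_cmult[OF a[of "1/2" x], of 4]] DERIV_cmult[OF a[of 1 x], of 2]]
    unfolding f_def[abs_def] f'_def by simp
  have f'b: "0 \<le> f' x" "f' x \<le> 2" for x by (auto simp: f'_def max_def)
  have fb: "0 \<le> f x" "f x \<le> 1" "f x \<le> 2 * max 0 x" for x
  proof -
    consider "x \<le> 0" | "0 < x" "x \<le> 1/2" | "1/2 < x" "x \<le> 1" | "1 < x" by linarith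
    then have "0 \<le> f x \<and> f x \<le> 1 \<and> f x \<le> 2 * max 0 x"
    proof cases
      case 1
      then show ?thesis by (simp add: f_def)
    next
      case 2
      then have e: "f x = 2 * x\<^sup>2" "max 0 x = x" by (auto simp: f_def)
      have "x * x \<le> (1/2) * (1/2)" using 2 by (intro mult_mono) auto
      moreover have "x * x \<le> x * 1" using 2 by (intro mult_left_mono) auto
      ultimately show ?thesis unfolding e by (simp add: power2_eq_square)
    next
      case 3
      then have e: "f x = 1 - 2 * (1 - x)\<^sup>2" "max 0 x = x" by (auto simp: f_def power2_eq_square algebra_simps)
      have "(1 - x) * (1 - x) \<le> (1/2) * (1/2)" using 3 by (intro mult_mono) auto
      moreover have "0 \<le> (1 - x) * (1 - x)" by simp
      ultimately have "0 \<le> 1 - 2 * ((1 - x) * (1 - x))" "1 - 2 * ((1 - x) * (1 - x)) \<le> 1"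
        "1 - 2 * ((1 - x) * (1 - x)) \<le> 2 * x" using 3 by linarith+
      then show ?thesis unfolding e power2_eq_square by blast
    next
      case 4
      then have "f x = 1" by (simp add: f_def power2_eq_square algebra_simps)
      then show ?thesis using 4 by simp
    qed
    then show "0 \<le> f x" "f x \<le> 1" "f x \<le> 2 * max 0 x" by auto
  qed
  have lo: "f x = 0" "f' x = 0" if "x \<le> 0" for x using that by (auto simp: f_def f'_def)
  have hi: "f x = 1" "f' x = 0" if "1 \<le> x" for x
    using that by (auto simp: f_def f'_def power2_eq_square algebra_simps)
  define \<theta> where "\<theta> r = f (z r)" for r
  define \<theta>' where "\<theta>' r = f' (z r) * (1 / (t - s))" for r
  have d: "(\<theta> has_real_derivative \<theta>' r) (at r)" for r
  proof -
    have "(z has_real_derivative 1 / (t - s)) (at r)" unfolding z_def[abs_def] using st by (auto intro!: derivative_eq_intros)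
    from DERIV_chain2[OF df this] show ?thesis by (simp add: \<theta>_def[abs_def] \<theta>'_def)
  qed
  have c: "continuous_on UNIV \<theta>'" unfolding \<theta>'_def f'_def z_def using st by (intro continuous_intros) auto
  have b: "0 \<le> \<theta>' r" "\<theta>' r \<le> 2 / (t - s)" for r
    using f'b[of "z r"] st by (auto simp: \<theta>'_def divide_right_mono)
  have "C1b \<theta> \<theta>'"
    unfolding C1b_def
  proof (intro conjI allI d c exI[of _ "max 1 (2 / (t - s))"])
    show "\<bar>\<theta> r\<bar> \<le> max 1 (2 / (t - s))" "\<bar>\<theta>' r\<bar> \<le> max 1 (2 / (t - s))" for r
      using fb(1,2)[of "z r"] b[of r] by (auto simp: \<theta>_def)
  qed
  moreover have "\<theta> r \<le> 2 / (t - s) * max 0 (r - s)" for r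
  proof -
    have "max 0 (z r) = max 0 (r - s) / (t - s)" using st by (auto simp: z_def max_def divide_le_0_iff zero_le_divide_iff)
    then show ?thesis using fb(3)[of "z r"] by (simp add: \<theta>_def)
  qed
  moreover have "z r \<le> 0" if "r \<le> s" for r using that st by (simp add: z_def divide_le_0_iff)
  moreover have "1 \<le> z r" if "t \<le> r" for r using that st by (simp add: z_def)
  ultimately show ?thesis using b fb lo hi unfolding \<theta>_def \<theta>'_def
    by (intro exI[of _ "\<lambda>r. f (z r)"] exI[of _ "\<lambda>r. f' (z r) * (1 / (t - s))"]) auto
qed

lemma ennreal_square_le:
  assumes "x\<^sup>2 \<le> ennreal (e\<^sup>2)" "0 \<le> e" shows "x \<le> ennreal e"
proof (cases x)
  case (real r)
  then have "ennreal (r\<^sup>2) \<le> ennreal (e\<^sup>2)" using assms(1) by (simp add: ennreal_power)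
  then have "r\<^sup>2 \<le> e\<^sup>2" by (simp add: ennreal_le_iff)
  then have "r \<le> e" using assms(2) by (rule power2_le_imp_le)
  then show ?thesis using real by (simp add: ennreal_leI)
next
  case top
  then have "x\<^sup>2 = top" by (simp add: power2_eq_square ennreal_top_mult)
  then show ?thesis using assms(1) by (simp add: top_unique)
qed

text \<open>The boundary condition \<open>u \<le> m\<close>, expressed by the decay of the positive part of \<open>u - s\<close> in thin
  boundary layers.\<close>

locale trace_graph = sobolev_graph +
  fixes m C\<Omega> \<epsilon>0 :: real
  assumes m0: "0 \<le> m" and C\<Omega>: "0 < C\<Omega>" "0 < \<epsilon>0"
    and layer_measure: "\<And>\<epsilon>. 0 < \<epsilon> \<Longrightarrow> \<epsilon> < \<epsilon>0 \<Longrightarrow> emeasure lborel (layer \<Omega> \<epsilon>) \<le> ennreal (C\<Omega> * \<epsilon>)"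
    and trace: "\<And>s. m < s \<Longrightarrow> \<exists>C \<delta>. 0 \<le> C \<and> 0 < \<delta> \<and> (\<forall>\<epsilon>. 0 < \<epsilon> \<longrightarrow> \<epsilon> < \<delta> \<longrightarrow>
      (\<integral>\<^sup>+x. indicator (layer \<Omega> \<epsilon>) x * ennreal ((max 0 (u x - s))\<^sup>2) \<partial>lborel) \<le> ennreal (C * \<epsilon>\<^sup>2))"

text \<open>Adds one sequence of cutoffs exhausting \<Omega>, along which all limits are taken.
  \<open>one_sided_bounds\<close> supplies such a sequence, and its conclusions no longer mention
  it.\<close>

locale cutoff_graph = trace_graph +
  fixes K :: "nat \<Rightarrow> (real^2) set" and \<kappa> :: "nat \<Rightarrow> real^2 \<Rightarrow> real" and \<kappa>' :: "nat \<Rightarrow> real^2 \<Rightarrow> real^2"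
  assumes cut: "\<And>n. cutoff \<Omega> (K n) (\<kappa> n) (\<kappa>' n)" and \<kappa>0: "\<And>n x. 0 \<le> \<kappa> n x" and \<kappa>1: "\<And>n x. \<kappa> n x \<le> 1"
    and \<kappa>eq1: "\<And>n x. 1 / Suc n \<le> infdist x (- \<Omega>) \<Longrightarrow> \<kappa> n x = 1"
    and \<kappa>'_le: "\<And>n x. norm (\<kappa>' n x) \<le> 3 * real (Suc n) * indicator (layer \<Omega> (2 / Suc n)) x"

context sobolev_graph
begin

lemma gr_norm_meas [measurable]: "(\<lambda>x. norm (gr x)) \<in> borel_measurable borel"
  using gr_meas by measurable

lemma Rf_meas [measurable]: "(\<lambda>x. Rf (gr x)) \<in> borel_measurable borel"
  using measurable_compose[OF gr_meas borel_measurable_continuous_onI[OF continuous_Rf[OF continuous_on_id]]] .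

lemma Ff_meas [measurable]: "(\<lambda>x. Ff i (gr x)) \<in> borel_measurable borel"
  using measurable_compose[OF gr_meas borel_measurable_continuous_onI[OF continuous_Ff[OF continuous_on_id]]] .

lemma fdiv_meas [measurable]: "fdiv k \<in> borel_measurable borel"
proof -
  have [measurable]: "h i j \<in> borel_measurable borel" for i j by (rule h_meas)
  show ?thesis unfolding fdiv_def by measurable
qed

lemma mc_meas [measurable]: "mc \<in> borel_measurable borel" unfolding mc_def[abs_def] by measurable

declare u_meas [measurable]

definition hsum :: "real^2 \<Rightarrow> real" where "hsum x = (\<Sum>i\<in>UNIV. \<Sum>j\<in>UNIV. \<bar>h i j x\<bar>)"

lemma hsum_integrable: "integrable lborel hsum"
  unfolding hsum_def[abs_def] using h_integrable by (intro Bochner_Integration.integrable_sum integrable_abs)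

lemma hsum_nonneg: "0 \<le> hsum x" by (simp add: hsum_def sum_nonneg)

lemma hsum_sq_integrable: "integrable lborel (\<lambda>x. (hsum x)\<^sup>2)"
proof (rule integrable_dominated[of "\<lambda>x. 4 * (\<Sum>i\<in>UNIV. \<Sum>j\<in>UNIV. (h i j x)\<^sup>2)"])
  show "integrable lborel (\<lambda>x. 4 * (\<Sum>i\<in>UNIV. \<Sum>j\<in>UNIV. (h i j x)\<^sup>2))"
    using h2 by (intro integrable_mult_right Bochner_Integration.integrable_sum)
  show "(\<lambda>x. (hsum x)\<^sup>2) \<in> borel_measurable lborel" using borel_measurable_integrable[OF hsum_integrable] by measurable
  fix x
  have s4: "(a + b + (c + d))\<^sup>2 \<le> 4 * (a\<^sup>2 + b\<^sup>2 + (c\<^sup>2 + d\<^sup>2))" for a b c d :: real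
  proof -
    have "0 \<le> (a - b)\<^sup>2 + (a - c)\<^sup>2 + (a - d)\<^sup>2 + (b - c)\<^sup>2 + (b - d)\<^sup>2 + (c - d)\<^sup>2" by simp
    then show ?thesis by (simp add: power2_eq_square algebra_simps)
  qed
  have "(hsum x)\<^sup>2 \<le> 4 * (\<Sum>i\<in>UNIV. \<Sum>j\<in>UNIV. (h i j x)\<^sup>2)"
    unfolding hsum_def sum_2 using s4[of "\<bar>h 1 1 x\<bar>" "\<bar>h 1 2 x\<bar>" "\<bar>h 2 1 x\<bar>" "\<bar>h 2 2 x\<bar>"] by simp
  then show "norm ((hsum x)\<^sup>2) \<le> norm (4 * (\<Sum>i\<in>UNIV. \<Sum>j\<in>UNIV. (h i j x)\<^sup>2))"
    by (simp add: sum_nonneg)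
qed

text \<open>The factor \<open>Rf\<close>, that is 1/Q, is the gain that matters: it makes
  \<open>ar x * mc x\<close> and the integrand of \<open>Ws\<close> controlled by second derivatives
  alone, hence integrable.\<close>

lemma mc_le: "\<bar>mc x\<bar> \<le> 2 * Rf (gr x) * hsum x"
proof -
  have F: "\<bar>fdiv k x\<bar> \<le> Rf (gr x) * (\<bar>h k k x\<bar> + (\<bar>h 1 k x\<bar> + \<bar>h 2 k x\<bar>))" for k
  proof -
    have "\<bar>Ff 1 (gr x) * h 1 k x + Ff 2 (gr x) * h 2 k x\<bar> \<le> \<bar>h 1 k x\<bar> + \<bar>h 2 k x\<bar>"
      by (rule order_trans[OF abs_triangle_ineq]) (auto simp: abs_mult Ff_le intro!: add_mono mult_left_le_one_le)
    then have "\<bar>Ff k (gr x)\<bar> * \<bar>Ff 1 (gr x) * h 1 k x + Ff 2 (gr x) * h 2 k x\<bar> \<le> 1 * (\<bar>h 1 k x\<bar> + \<bar>h 2 k x\<bar>)"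
      by (intro mult_mono Ff_le) auto
    then have "\<bar>h k k x - Ff k (gr x) * (Ff 1 (gr x) * h 1 k x + Ff 2 (gr x) * h 2 k x)\<bar> \<le> \<bar>h k k x\<bar> + (\<bar>h 1 k x\<bar> + \<bar>h 2 k x\<bar>)"
      by (intro order_trans[OF abs_triangle_ineq4]) (simp add: abs_mult)
    then have "\<bar>Rf (gr x)\<bar> * \<bar>h k k x - Ff k (gr x) * (Ff 1 (gr x) * h 1 k x + Ff 2 (gr x) * h 2 k x)\<bar> \<le> \<bar>Rf (gr x)\<bar> * (\<bar>h k k x\<bar> + (\<bar>h 1 k x\<bar> + \<bar>h 2 k x\<bar>))"
      by (intro mult_left_mono) auto
    moreover have "fdiv k x = Rf (gr x) * (h k k x - Ff k (gr x) * (Ff 1 (gr x) * h 1 k x + Ff 2 (gr x) * h 2 k x))"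
      by (simp add: fdiv_def algebra_simps)
    ultimately show ?thesis by (simp only: abs_mult abs_of_pos[OF Rf_pos])
  qed
  have "\<bar>mc x\<bar> \<le> \<bar>fdiv 1 x\<bar> + \<bar>fdiv 2 x\<bar>" by (simp add: mc_def)
  also have "\<dots> \<le> Rf (gr x) * (\<bar>h 1 1 x\<bar> + (\<bar>h 1 1 x\<bar> + \<bar>h 2 1 x\<bar>)) + Rf (gr x) * (\<bar>h 2 2 x\<bar> + (\<bar>h 1 2 x\<bar> + \<bar>h 2 2 x\<bar>))"
    by (intro add_mono F)
  also have "\<dots> = Rf (gr x) * (\<bar>h 1 1 x\<bar> + (\<bar>h 1 1 x\<bar> + \<bar>h 2 1 x\<bar>) + (\<bar>h 2 2 x\<bar> + (\<bar>h 1 2 x\<bar> + \<bar>h 2 2 x\<bar>)))"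
    by (simp add: distrib_left)
  also have "\<dots> \<le> Rf (gr x) * (2 * hsum x)"
    by (intro mult_left_mono less_imp_le[OF Rf_pos]) (auto simp: hsum_def sum_2)
  finally show ?thesis by (simp add: mult_ac)
qed

definition ar :: "real^2 \<Rightarrow> real" where "ar x = sqrt (1 + (norm (gr x))\<^sup>2)"

lemma ar_Rf: "Rf (gr x) * ar x = 1" "ar x = 1 / Rf (gr x)"
  using sqrt_pos(2)[of "gr x"] by (simp_all add: Rf_def ar_def del: sqrt_pos)

lemma ar_ge_1: "1 \<le> ar x" by (simp add: ar_def)

lemma norm_le_ar: "norm (gr x) \<le> ar x" unfolding ar_def by (rule real_le_rsqrt) simp

lemma ar_le: "ar x \<le> 1 + norm (gr x)"
  unfolding ar_def by (rule real_le_lsqrt) (auto simp: power2_eq_square algebra_simps)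

lemma ar_meas [measurable]: "ar \<in> borel_measurable borel" unfolding ar_def[abs_def] by measurable

lemma mc_integrable: "integrable lborel mc"
proof (rule integrable_dominated[of "\<lambda>x. 2 * hsum x"])
  fix x
  have "Rf (gr x) * hsum x \<le> 1 * hsum x" using Rf_le hsum_nonneg by (intro mult_right_mono)
  then show "norm (mc x) \<le> norm (2 * hsum x)" using mc_le[of x] hsum_nonneg[of x] by simp
qed (use hsum_integrable in auto)

lemma ar_mc_integrable: "integrable lborel (\<lambda>x. ar x * mc x)"
proof (rule integrable_dominated[of "\<lambda>x. 2 * hsum x"])
  fix x
  have "ar x * \<bar>mc x\<bar> \<le> ar x * (2 * Rf (gr x) * hsum x)" using mc_le ar_ge_1[of x] by (intro mult_left_mono) auto
  also have "\<dots> = (Rf (gr x) * ar x) * (2 * hsum x)" by (simp add: mult_ac)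
  finally show "norm (ar x * mc x) \<le> norm (2 * hsum x)" using ar_ge_1[of x] hsum_nonneg[of x]
    unfolding ar_Rf(1) by (simp add: abs_mult)
qed (use hsum_integrable in auto)

lemma mc_sq_integrable: "integrable lborel (\<lambda>x. (mc x)\<^sup>2 * ar x)"
proof (rule integrable_dominated[of "\<lambda>x. 4 * (hsum x)\<^sup>2"])
  fix x
  have "\<bar>mc x\<bar>\<^sup>2 \<le> (2 * Rf (gr x) * hsum x)\<^sup>2" using mc_le[of x] by (intro power_mono) auto
  then have "(mc x)\<^sup>2 * ar x \<le> (2 * Rf (gr x) * hsum x)\<^sup>2 * ar x" using ar_ge_1[of x] by (intro mult_right_mono) auto
  also have "\<dots> = 4 * (hsum x)\<^sup>2 * Rf (gr x) * (Rf (gr x) * ar x)" by (simp add: power2_eq_square mult_ac)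
  also have "\<dots> \<le> 4 * (hsum x)\<^sup>2 * 1" unfolding ar_Rf(1) using Rf_le[of "gr x"] by (simp add: mult_left_le)
  finally show "norm ((mc x)\<^sup>2 * ar x) \<le> norm (4 * (hsum x)\<^sup>2)" using ar_ge_1[of x] by simp
qed (use hsum_sq_integrable in auto)

lemma zero_outside:
  assumes "x \<notin> \<Omega>" shows "Ff i (gr x) = 0" "fdiv k x = 0" "mc x = 0" "gr x $ i = 0" "norm (gr x) = 0"
  using gr0[OF assms] h0[OF assms] by (simp_all add: Ff_def fdiv_def mc_def)

lemma norm_gr_integrable: "integrable lborel (\<lambda>x. norm (gr x))"
  by (rule L2_L1) (use gr2 gr0 in auto)

lemma ar_integrable: "integrable lborel (\<lambda>x. indicator \<Omega> x * ar x)"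
proof (rule Bochner_Integration.integrable_bound[of lborel "\<lambda>x. indicator \<Omega> x + norm (gr x)"])
  show "integrable lborel (\<lambda>x. indicator \<Omega> x + norm (gr x))" using ind_integrable norm_gr_integrable by simp
  show "(\<lambda>x. indicator \<Omega> x * ar x) \<in> borel_measurable lborel"
    using open_\<Omega> ar_meas by (intro borel_measurable_times borel_measurable_indicator) auto
  show "AE x in lborel. norm (indicator \<Omega> x * ar x) \<le> norm (indicator \<Omega> x + norm (gr x))"
    using ar_le ar_ge_1 by (intro AE_I2) (auto simp: indicator_def order_trans[OF zero_le_one])
qed

end

section \<open>Removing the cutoff\<close>

context cutoff_graph
begin

lemma \<kappa>_tendsto_1: "x \<in> \<Omega> \<Longrightarrow> \<forall>\<^sub>F n in sequentially. \<kappa> n x = 1"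
proof -
  assume x: "x \<in> \<Omega>"
  have "- \<Omega> \<noteq> {}"
  proof
    assume "- \<Omega> = {}"
    then have "\<Omega> = UNIV" by blast
    then show False using bdd not_bounded_UNIV by simp
  qed
  then have d: "0 < infdist x (- \<Omega>)" using x open_\<Omega> by (intro infdist_pos_not_in_closed) (auto intro: closed_Compl)
  have "\<forall>\<^sub>F n in sequentially. 1 / real (Suc n) < infdist x (- \<Omega>)"
    using order_tendstoD(2)[OF LIMSEQ_inverse_real_of_nat d] by (simp add: inverse_eq_divide del: of_nat_Suc)
  then show ?thesis by eventually_elim (use \<kappa>eq1 in \<open>auto simp del: of_nat_Suc\<close>)
qed

lemma \<kappa>_cont: "continuous_on A (\<kappa> n)" using cutoffD(6)[OF cut] continuous_on_subset by blast

lemma \<kappa>_meas [measurable]: "\<kappa> n \<in> borel_measurable borel"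
  by (rule borel_measurable_continuous_onI[OF \<kappa>_cont])

lemma \<kappa>'_meas [measurable]: "\<kappa>' n \<in> borel_measurable borel"
  by (rule borel_measurable_continuous_onI[OF cutoffD(4)[OF cut]])

lemma \<kappa>_mult_integrable:
  assumes "integrable lborel F" shows "integrable lborel (\<lambda>x. \<kappa> n x * F x)"
  by (rule Bochner_Integration.integrable_bound[OF assms])
    (use assms \<kappa>0 \<kappa>1 in \<open>auto simp: abs_mult intro!: mult_left_le_one_le\<close>)

text \<open>By dominated convergence an inequality for the cut-off integrals, with arbitrarily small
  error for large \<open>n\<close>, passes to the full integral.\<close>

lemma \<kappa>_integral_le:
  assumes F: "integrable lborel F" "\<And>x. x \<notin> \<Omega> \<Longrightarrow> F x = 0"
    and le: "\<And>e. 0 < e \<Longrightarrow> \<forall>\<^sub>F n in sequentially. (LBINT x. \<kappa> n x * F x) \<le> R + e"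
  shows "(LBINT x. F x) \<le> R"
proof (rule field_le_epsilon)
  fix e :: real assume e: "0 < e"
  have "(\<lambda>n. \<integral>x. \<kappa> n x * F x \<partial>lborel) \<longlonglongrightarrow> (LBINT x. F x)"
  proof (rule integral_dominated_convergence[where w = "\<lambda>x. \<bar>F x\<bar>"])
    show "AE x in lborel. (\<lambda>n. \<kappa> n x * F x) \<longlonglongrightarrow> F x"
    proof (rule AE_I2)
      fix x
      show "(\<lambda>n. \<kappa> n x * F x) \<longlonglongrightarrow> F x"
      proof (cases "x \<in> \<Omega>")
        case True
        have "\<forall>\<^sub>F n in sequentially. \<kappa> n x * F x = F x" using \<kappa>_tendsto_1[OF True] by eventually_elim simp
        then show ?thesis by (rule tendsto_eventually)
      qed (simp add: F(2))
    qed
    show "AE x in lborel. norm (\<kappa> n x * F x) \<le> \<bar>F x\<bar>" for n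
      using \<kappa>0 \<kappa>1 by (intro AE_I2) (auto simp: abs_mult intro!: mult_left_le_one_le)
  qed (use F in auto)
  then show "(LBINT x. F x) \<le> R + e"
    by (rule tendsto_upperbound[OF _ le[OF e]]) simp
qed

text \<open>A common majorant, up to constant factors, of the terms that contain the gradient of a
  cutoff in the estimates above a level \<open>s\<close>.\<close>

definition bd :: "real \<Rightarrow> nat \<Rightarrow> real^2 \<Rightarrow> real" where
  "bd s n x = max 0 (u x - s) * norm (\<kappa>' n x) * (1 + norm (gr x))"

lemma bd_nonneg: "0 \<le> bd s n x" by (simp add: bd_def)

lemma bd_meas [measurable]: "bd s n \<in> borel_measurable borel" unfolding bd_def[abs_def] by measurable

lemma layer_integral_tendsto: "(\<lambda>n. \<integral>x. indicator (layer \<Omega> (2 / Suc n)) x * (1 + norm (gr x))\<^sup>2 \<partial>lborel) \<longlonglongrightarrow> 0"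
proof -
  have [measurable]: "layer \<Omega> a \<in> sets borel" for a by (rule layer_borel[OF open_\<Omega>])
  have "(\<lambda>n. \<integral>x. indicator (layer \<Omega> (2 / Suc n)) x * (1 + norm (gr x))\<^sup>2 \<partial>lborel) \<longlonglongrightarrow> (\<integral>x. 0 \<partial>(lborel :: (real^2) measure))"
  proof (rule integral_dominated_convergence[where w = "\<lambda>x. 2 * (indicator \<Omega> x + (norm (gr x))\<^sup>2)"])
    show "integrable lborel (\<lambda>x. 2 * (indicator \<Omega> x + (norm (gr x))\<^sup>2))" using ind_integrable gr2 by simp
    show "AE x in lborel. norm (indicator (layer \<Omega> (2 / Suc n)) x * (1 + norm (gr x))\<^sup>2) \<le> 2 * (indicator \<Omega> x + (norm (gr x))\<^sup>2)" for n
    proof (rule AE_I2)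
      fix x
      have "(1 + norm (gr x))\<^sup>2 \<le> 2 * (1 + (norm (gr x))\<^sup>2)"
        using zero_le_power2[of "1 - norm (gr x)"] by (simp add: power2_eq_square algebra_simps)
      then show "norm (indicator (layer \<Omega> (2 / Suc n)) x * (1 + norm (gr x))\<^sup>2) \<le> 2 * (indicator \<Omega> x + (norm (gr x))\<^sup>2)"
        by (auto simp: indicator_def layer_def)
    qed
    show "AE x in lborel. (\<lambda>n. indicator (layer \<Omega> (2 / Suc n)) x * (1 + norm (gr x))\<^sup>2) \<longlonglongrightarrow> 0"
    proof (rule AE_I2)
      fix x
      have "\<forall>\<^sub>F n in sequentially. indicator (layer \<Omega> (2 / Suc n)) x * (1 + norm (gr x))\<^sup>2 = 0"
      proof (cases "x \<in> \<Omega>")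
        case True
        have "- \<Omega> \<noteq> {}"
        proof
          assume "- \<Omega> = {}"
          then have "\<Omega> = UNIV" by blast
          then show False using bdd not_bounded_UNIV by simp
        qed
        then have d: "0 < infdist x (- \<Omega>) / 2" using True open_\<Omega> by (simp add: infdist_pos_not_in_closed closed_Compl)
        have "\<forall>\<^sub>F n in sequentially. 1 / real (Suc n) < infdist x (- \<Omega>) / 2"
          using order_tendstoD(2)[OF LIMSEQ_inverse_real_of_nat d] by (simp add: inverse_eq_divide del: of_nat_Suc)
        then show ?thesis by eventually_elim (auto simp: layer_def indicator_def field_simps)
      qed (auto simp: layer_def)
      then show "(\<lambda>n. indicator (layer \<Omega> (2 / Suc n)) x * (1 + norm (gr x))\<^sup>2) \<longlonglongrightarrow> 0" by (rule tendsto_eventually)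
    qed
  qed measurable
  then show ?thesis by simp
qed

text \<open>Cauchy-Schwarz on the layer of width \<open>2 / N\<close>: the positive part has L2 norm
  O(1/N) there and the cutoff gradient is O(N), so these rates cancel. Smallness comes from the
  remaining factor, the L2 norm of \<open>1 + norm (gr x)\<close> over a shrinking layer.\<close>

lemma bd_small:
  assumes s: "m < s" and e: "0 < e"
  shows "\<forall>\<^sub>F n in sequentially. integrable lborel (bd s n) \<and> (LBINT x. bd s n x) \<le> e"
proof -
  have [measurable]: "layer \<Omega> a \<in> sets borel" for a by (rule layer_borel[OF open_\<Omega>])
  obtain C \<delta> where C: "0 \<le> C" "0 < \<delta>" "\<And>\<epsilon>. 0 < \<epsilon> \<Longrightarrow> \<epsilon> < \<delta> \<Longrightarrow>
      (\<integral>\<^sup>+x. indicator (layer \<Omega> \<epsilon>) x * ennreal ((max 0 (u x - s))\<^sup>2) \<partial>lborel) \<le> ennreal (C * \<epsilon>\<^sup>2)"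
    using trace[OF s] by blast
  let ?J = "\<lambda>n. \<integral>x. indicator (layer \<Omega> (2 / Suc n)) x * (1 + norm (gr x))\<^sup>2 \<partial>lborel"
  \<comment> \<open>36 is 3^2 * 2^2, from the gradient bound \<open>3 * N\<close> of the cutoff and
    the layer width \<open>2 / N\<close>.\<close>
  have "(\<lambda>n. 36 * C * ?J n) \<longlonglongrightarrow> 36 * C * 0" by (intro tendsto_intros layer_integral_tendsto)
  then have 1: "\<forall>\<^sub>F n in sequentially. 36 * C * ?J n < e\<^sup>2" using e by (intro order_tendstoD) auto
  have 2: "\<forall>\<^sub>F n in sequentially. 1 / real (Suc n) < \<delta> / 2"
    using order_tendstoD(2)[OF LIMSEQ_inverse_real_of_nat, of "\<delta>/2"] C(2) by (simp add: inverse_eq_divide del: of_nat_Suc)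
  from 1 2 show ?thesis
  proof eventually_elim
    case (elim n)
    define N where "N = real (Suc n)"
    have N: "0 < N" by (simp add: N_def)
    let ?L = "layer \<Omega> (2 / N)"
    let ?a = "\<lambda>x. indicator ?L x * ennreal (max 0 (u x - s))"
    let ?b = "\<lambda>x. indicator ?L x * ennreal (3 * N * (1 + norm (gr x)))"
    have "(\<integral>\<^sup>+x. ennreal (bd s n x) \<partial>lborel) \<le> (\<integral>\<^sup>+x. ?a x * ?b x \<partial>lborel)"
    proof (rule nn_integral_mono)
      fix x
      have k: "norm (\<kappa>' n x) \<le> 3 * N * indicator ?L x" using \<kappa>'_le[of n x] by (simp add: N_def)
      show "ennreal (bd s n x) \<le> ?a x * ?b x"
      proof (cases "x \<in> ?L")
        case True
        have "max 0 (u x - s) * norm (\<kappa>' n x) * (1 + norm (gr x)) \<le> max 0 (u x - s) * (3 * N) * (1 + norm (gr x))"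
          using k True by (intro mult_right_mono mult_left_mono) auto
        then have "ennreal (bd s n x) \<le> ennreal (max 0 (u x - s) * (3 * N * (1 + norm (gr x))))"
          unfolding bd_def by (intro ennreal_leI) (simp only: mult.assoc)
        also have "\<dots> = ?a x * ?b x" using True N by (simp add: ennreal_mult)
        finally show ?thesis .
      next
        case False
        then show ?thesis using k by (simp add: bd_def)
      qed
    qed
    then have "(\<integral>\<^sup>+x. ennreal (bd s n x) \<partial>lborel)\<^sup>2 \<le> (\<integral>\<^sup>+x. ?a x * ?b x \<partial>lborel)\<^sup>2" by (rule power_mono) simp
    also have "\<dots> \<le> (\<integral>\<^sup>+x. (?a x)\<^sup>2 \<partial>lborel) * (\<integral>\<^sup>+x. (?b x)\<^sup>2 \<partial>lborel)"
      by (rule Cauchy_Schwarz_nn_integral) measurable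
    also have "(\<integral>\<^sup>+x. (?a x)\<^sup>2 \<partial>lborel) = (\<integral>\<^sup>+x. indicator ?L x * ennreal ((max 0 (u x - s))\<^sup>2) \<partial>lborel)"
      by (intro nn_integral_cong) (auto simp: indicator_def ennreal_power)
    also have "(\<integral>\<^sup>+x. (?b x)\<^sup>2 \<partial>lborel) = (\<integral>\<^sup>+x. ennreal (9 * N\<^sup>2 * (indicator ?L x * (1 + norm (gr x))\<^sup>2)) \<partial>lborel)"
      using N by (intro nn_integral_cong) (auto simp: indicator_def ennreal_power power_mult_distrib)
    also have "\<dots> = ennreal (9 * N\<^sup>2 * ?J n)"
    proof -
      have "integrable lborel (\<lambda>x. indicator ?L x * (1 + norm (gr x))\<^sup>2)"
      proof (rule integrable_dominated[of "\<lambda>x. 2 * (indicator \<Omega> x + (norm (gr x))\<^sup>2)"])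
        show "integrable lborel (\<lambda>x. 2 * (indicator \<Omega> x + (norm (gr x))\<^sup>2))" using ind_integrable gr2 by simp
        fix x
        have "(1 + norm (gr x))\<^sup>2 \<le> 2 * (1 + (norm (gr x))\<^sup>2)"
          using zero_le_power2[of "1 - norm (gr x)"] by (simp add: power2_eq_square algebra_simps)
        then show "norm (indicator ?L x * (1 + norm (gr x))\<^sup>2) \<le> norm (2 * (indicator \<Omega> x + (norm (gr x))\<^sup>2))"
          by (auto simp: indicator_def layer_def)
      qed measurable
      then show ?thesis by (subst nn_integral_eq_integral) (auto simp: N_def del: of_nat_Suc)
    qed
    also have "(\<integral>\<^sup>+x. indicator ?L x * ennreal ((max 0 (u x - s))\<^sup>2) \<partial>lborel) * ennreal (9 * N\<^sup>2 * ?J n)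
      \<le> ennreal (C * (2 / N)\<^sup>2) * ennreal (9 * N\<^sup>2 * ?J n)"
      using elim(2) N by (intro mult_right_mono C(3)) (auto simp: N_def field_simps)
    also have "\<dots> = ennreal ((C * (2 / N)\<^sup>2) * (9 * N\<^sup>2 * ?J n))" using C N by (subst ennreal_mult) auto
    also have "(C * (2 / N)\<^sup>2) * (9 * N\<^sup>2 * ?J n) = 36 * C * ?J n" using N by (simp add: power_divide)
    also have "ennreal (36 * C * ?J n) \<le> ennreal (e\<^sup>2)" using elim(1) by (intro ennreal_leI) simp
    finally have "(\<integral>\<^sup>+x. ennreal (bd s n x) \<partial>lborel)\<^sup>2 \<le> ennreal (e\<^sup>2)" .
    from ennreal_square_le[OF this less_imp_le[OF e]]
    have le: "(\<integral>\<^sup>+x. ennreal (bd s n x) \<partial>lborel) \<le> ennreal e" .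
    have i: "integrable lborel (bd s n)"
    proof (rule integrableI_nonneg)
      show "(\<integral>\<^sup>+x. ennreal (bd s n x) \<partial>lborel) < \<infinity>" using le by (auto simp: less_top[symmetric] top_unique)
    qed (auto simp: bd_nonneg)
    moreover have "(LBINT x. bd s n x) \<le> e"
    proof -
      have "(\<integral>\<^sup>+x. ennreal (bd s n x) \<partial>lborel) = ennreal (LBINT x. bd s n x)"
        by (rule nn_integral_eq_integral[OF i]) (simp add: bd_nonneg)
      with le have "ennreal (LBINT x. bd s n x) \<le> ennreal e" by (simp only:)
      then show ?thesis using e by (subst (asm) ennreal_le_iff) auto
    qed
    ultimately show ?case by simp
  qed
qed

end

context sobolev_graph
begin

lemma R_Fg_bounds: "0 \<le> Rf (gr x) + Ff j (gr x) * gr x $ j" "Rf (gr x) + Ff j (gr x) * gr x $ j \<le> 1 + norm (gr x)"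
proof -
  have "Ff j (gr x) * gr x $ j = Rf (gr x) * (gr x $ j)\<^sup>2" by (simp add: Ff_def power2_eq_square)
  then show "0 \<le> Rf (gr x) + Ff j (gr x) * gr x $ j" by (auto intro!: add_nonneg_nonneg mult_nonneg_nonneg less_imp_le[OF Rf_pos])
  have "\<bar>Ff j (gr x) * gr x $ j\<bar> \<le> 1 * norm (gr x)"
    unfolding abs_mult by (intro mult_mono Ff_le component_le_norm_cart) auto
  then show "Rf (gr x) + Ff j (gr x) * gr x $ j \<le> 1 + norm (gr x)" using Rf_le[of "gr x"] by linarith
qed

lemma Fg_bound: "\<bar>Ff i (gr x) * gr x $ j\<bar> \<le> 1 + norm (gr x)"
proof -
  have "\<bar>Ff i (gr x) * gr x $ j\<bar> \<le> 1 * norm (gr x)"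
    unfolding abs_mult by (intro mult_mono Ff_le component_le_norm_cart) auto
  then show ?thesis by simp
qed

lemma C1b_meas:
  assumes "C1b \<theta> \<theta>'"
  shows "(\<lambda>x. \<theta> (u x)) \<in> borel_measurable borel" "(\<lambda>x. \<theta>' (u x)) \<in> borel_measurable borel"
  using measurable_compose[OF u_meas borel_measurable_continuous_onI[OF C1bD(3)[OF assms]]]
    measurable_compose[OF u_meas borel_measurable_continuous_onI[OF C1bD(2)[OF assms]]] by auto

lemma Ff_integrable: "integrable lborel (\<lambda>x. Ff i (gr x))"
  by (rule Bochner_Integration.integrable_bound[OF ind_integrable])
    (use Ff_le zero_outside(1) in \<open>auto simp: indicator_def intro!: AE_I2\<close>)

lemma gr_mc_integrable: "integrable lborel (\<lambda>x. gr x $ i * mc x)"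
proof (rule integrable_dominated[OF ar_mc_integrable])
  fix x
  have "\<bar>gr x $ i\<bar> \<le> ar x" using component_le_norm_cart[of "gr x" i] norm_le_ar[of x] by linarith
  then show "norm (gr x $ i * mc x) \<le> norm (ar x * mc x)" using ar_ge_1[of x] by (simp add: abs_mult mult_right_mono)
qed measurable

lemma coord_meas [measurable]: "(\<lambda>x::real^2. x $ i) \<in> borel_measurable borel"
  by (intro borel_measurable_continuous_onI continuous_intros)

end

context cutoff_graph
begin

text \<open>In the horizontal identity the two terms with the gradient of the cutoff are absorbed by
  \<open>bd\<close>, and the two terms with \<theta>' and with the curvature carry \<open>X\<close>
  undifferentiated, hence the factor \<open>D\<close>. The term with X' has a sign and is kept on
  the left.\<close>

lemma horizontal_inequality:
  assumes s: "m < s" and th: "C1b \<theta> \<theta>'" and pos: "\<And>r. 0 \<le> \<theta> r" "\<And>r. 0 \<le> \<theta>' r" and M: "0 \<le> M" "\<And>r. \<theta> r \<le> M * max 0 (r - s)"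
    and ij: "i \<noteq> j" and X: "\<And>t. (X has_real_derivative X' t) (at t)" "continuous_on UNIV X'"
    and X': "\<And>t. 0 \<le> X' t" "\<And>t. X' t \<le> 1" and D: "0 \<le> D" "\<And>x. x \<in> \<Omega> \<Longrightarrow> \<bar>X (x $ i)\<bar> \<le> D"
  shows "(LBINT x. X' (x $ i) * \<theta> (u x) * (Rf (gr x) + Ff j (gr x) * gr x $ j))
    \<le> D * (LBINT x. \<theta>' (u x) * \<bar>Ff i (gr x)\<bar>) + D * (LBINT x. \<theta> (u x) * \<bar>gr x $ i * mc x\<bar>)"
proof -
  note [measurable] = C1b_meas[OF th]
  have [measurable]: "X \<in> borel_measurable borel" "X' \<in> borel_measurable borel"
    using X(2) X(1) by (auto intro!: borel_measurable_continuous_onI continuous_at_imp_continuous_on DERIV_isCont)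
  obtain B where B: "\<And>t. \<bar>\<theta> t\<bar> \<le> B" using C1bD(4)[OF th] by blast
  obtain B' where B': "\<And>t. \<bar>\<theta>' t\<bar> \<le> B'" using C1bD(5)[OF th] by blast
  \<comment> \<open>Here \<open>0 \<le> m\<close> is used: the extension of \<open>u\<close> by zero
    stays below the level \<open>s\<close>, so \<theta> vanishes outside \<Omega>.\<close>
  have th0: "\<theta> (u x) = 0" if "x \<notin> \<Omega>" for x using pos(1)[of 0] M(2)[of 0] u(3)[OF that] s m0 by simp
  let ?A = "\<lambda>x. Rf (gr x) + Ff j (gr x) * gr x $ j"
  define P where "P x = X' (x $ i) * \<theta> (u x) * ?A x" for x
  define T1 where "T1 x = \<theta>' (u x) * \<bar>Ff i (gr x)\<bar>" for x
  define T2 where "T2 x = \<theta> (u x) * \<bar>gr x $ i * mc x\<bar>" for x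
  have iT1: "integrable lborel T1" unfolding T1_def using Ff_integrable B' by (intro bounded_mult_integrable) auto
  have iT2: "integrable lborel T2" unfolding T2_def using gr_mc_integrable B by (intro bounded_mult_integrable) auto
  have P0: "P x = 0" if "x \<notin> \<Omega>" for x using th0[OF that] by (simp add: P_def)
  have iP: "integrable lborel P"
  proof (rule integrable_dominated[of "\<lambda>x. B * (indicator \<Omega> x + norm (gr x))"])
    show "integrable lborel (\<lambda>x. B * (indicator \<Omega> x + norm (gr x)))" using ind_integrable norm_gr_integrable by simp
    show "P \<in> borel_measurable lborel" unfolding P_def[abs_def] by measurable
    fix x
    have B0: "0 \<le> B" using B[of 0] by linarith
    show "norm (P x) \<le> norm (B * (indicator \<Omega> x + norm (gr x)))"
    proof (cases "x \<in> \<Omega>")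
      case True
      have "X' (x $ i) * \<theta> (u x) \<le> 1 * B" using X' pos B[of "u x"] by (intro mult_mono) auto
      then have "X' (x $ i) * \<theta> (u x) * ?A x \<le> B * (1 + norm (gr x))"
        using R_Fg_bounds[of x j] B0 X' pos by (intro mult_mono) auto
      moreover have "0 \<le> P x" unfolding P_def using R_Fg_bounds(1) X' pos by (intro mult_nonneg_nonneg) auto
      ultimately show ?thesis using True B0 by (simp add: P_def)
    qed (simp add: P0)
  qed
  have main: "(LBINT x. P x) \<le> D * (LBINT x. T1 x) + D * (LBINT x. T2 x)"
  proof (rule \<kappa>_integral_le[OF iP P0])
    fix e :: real assume e: "0 < e"
    \<comment> \<open>Two boundary terms, each at most \<open>D * M * bd s n x\<close>; the
      \<open>+ 1\<close> keeps the divisor positive.\<close>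
    define c where "c = 2 * D * M + 1"
    have c: "0 < c" using D M by (simp add: c_def add_nonneg_pos)
    have "0 < e / c" using e c by simp
    from bd_small[OF s this]
    show "\<forall>\<^sub>F n in sequentially. (LBINT x. \<kappa> n x * P x) \<le> D * (LBINT x. T1 x) + D * (LBINT x. T2 x) + e"
    proof eventually_elim
      case (elim n)
      note cn = cutoffD[OF cut[of n]]
      note HI = horizontal_identity[OF cut[of n] th ij X]
      define E where "E x = \<kappa>' n x $ i * X (x $ i) * \<theta> (u x) * ?A x - \<kappa>' n x $ j * X (x $ i) * \<theta> (u x) * (Ff i (gr x) * gr x $ j)
         + \<kappa> n x * X (x $ i) * \<theta>' (u x) * Ff i (gr x) + \<kappa> n x * X' (x $ i) * \<theta> (u x) * ?A x
         - \<kappa> n x * X (x $ i) * \<theta> (u x) * (gr x $ i * mc x)" for x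
      have E: "integrable lborel E" "(LBINT x. E x) = 0" using HI unfolding E_def by auto
      have "(LBINT x. \<kappa> n x * P x) \<le> (LBINT x. E x + (2 * D * M * bd s n x + (D * T1 x + D * T2 x)))"
      proof (rule integral_mono)
        show "integrable lborel (\<lambda>x. \<kappa> n x * P x)" by (rule \<kappa>_mult_integrable[OF iP])
        show "integrable lborel (\<lambda>x. E x + (2 * D * M * bd s n x + (D * T1 x + D * T2 x)))"
          using E(1) elim iT1 iT2 by simp
        fix x
        show "\<kappa> n x * P x \<le> E x + (2 * D * M * bd s n x + (D * T1 x + D * T2 x))"
        proof (cases "x \<in> \<Omega>")
          case False
          then have "x \<notin> K n" using cn(2) by blast
          then have "\<kappa> n x = 0" "\<kappa>' n x = 0" using cn(5,7) by auto
          then have "\<kappa> n x * P x = 0" "E x = 0" by (simp_all add: E_def del: mult_eq_0_iff)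
          moreover have "0 \<le> 2 * D * M * bd s n x + (D * T1 x + D * T2 x)"
            using D M bd_nonneg pos by (simp add: T1_def T2_def)
          ultimately show ?thesis by linarith
        next
          case True
          note XD = D(2)[OF True]
          have k: "\<bar>\<kappa>' n x $ l\<bar> \<le> norm (\<kappa>' n x)" for l by (rule component_le_norm_cart)
          have b: "\<bar>\<kappa>' n x $ l * X (x $ i) * \<theta> (u x) * a\<bar> \<le> D * M * bd s n x" if a: "\<bar>a\<bar> \<le> 1 + norm (gr x)" for l a
          proof -
            have "\<bar>\<kappa>' n x $ l * X (x $ i) * \<theta> (u x) * a\<bar> = \<bar>\<kappa>' n x $ l\<bar> * \<bar>X (x $ i)\<bar> * \<theta> (u x) * \<bar>a\<bar>"
              using pos by (simp add: abs_mult)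
            also have "\<dots> \<le> norm (\<kappa>' n x) * D * (M * max 0 (u x - s)) * (1 + norm (gr x))"
              using k XD M pos D a by (intro mult_mono mult_nonneg_nonneg) auto
            also have "\<dots> = D * M * bd s n x" by (simp add: bd_def mult_ac)
            finally show ?thesis .
          qed
          have b1: "\<bar>\<kappa>' n x $ i * X (x $ i) * \<theta> (u x) * ?A x\<bar> \<le> D * M * bd s n x"
            using R_Fg_bounds[of x j] by (intro b) auto
          have b2: "\<bar>\<kappa>' n x $ j * X (x $ i) * \<theta> (u x) * (Ff i (gr x) * gr x $ j)\<bar> \<le> D * M * bd s n x"
            by (intro b Fg_bound)
          have b3: "\<bar>\<kappa> n x * X (x $ i) * \<theta>' (u x) * Ff i (gr x)\<bar> \<le> D * T1 x"
          proof -
            have "\<bar>\<kappa> n x * X (x $ i) * \<theta>' (u x) * Ff i (gr x)\<bar> = \<kappa> n x * \<bar>X (x $ i)\<bar> * T1 x"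
              using pos \<kappa>0 by (simp add: abs_mult T1_def mult_ac)
            also have "\<dots> \<le> 1 * D * T1 x" using XD \<kappa>0 \<kappa>1 pos D by (intro mult_mono mult_nonneg_nonneg) (auto simp: T1_def)
            finally show ?thesis by simp
          qed
          have b4: "\<bar>\<kappa> n x * X (x $ i) * \<theta> (u x) * (gr x $ i * mc x)\<bar> \<le> D * T2 x"
          proof -
            have "\<bar>\<kappa> n x * X (x $ i) * \<theta> (u x) * (gr x $ i * mc x)\<bar> = \<kappa> n x * \<bar>X (x $ i)\<bar> * T2 x"
              using pos \<kappa>0 by (simp add: abs_mult T2_def mult_ac)
            also have "\<dots> \<le> 1 * D * T2 x" using XD \<kappa>0 \<kappa>1 pos D by (intro mult_mono mult_nonneg_nonneg) (auto simp: T2_def)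
            finally show ?thesis by simp
          qed
          have "\<kappa> n x * P x = \<kappa> n x * X' (x $ i) * \<theta> (u x) * ?A x" by (simp add: P_def mult_ac)
          moreover have "2 * D * M * bd s n x = D * M * bd s n x + D * M * bd s n x" by simp
          ultimately show ?thesis using b1 b2 b3 b4 unfolding E_def by linarith
        qed
      qed
      also have "\<dots> = 2 * D * M * (LBINT x. bd s n x) + (D * (LBINT x. T1 x) + D * (LBINT x. T2 x))"
        using E elim iT1 iT2 by simp
      also have "2 * D * M * (LBINT x. bd s n x) \<le> c * (e / c)"
        using elim D M e c by (intro mult_mono) (auto simp: c_def intro!: integral_nonneg_AE AE_I2 bd_nonneg)
      finally show ?case using c by simp
    qed
  qed
  then show ?thesis unfolding P_def T1_def T2_def .
qed

text \<open>\<open>projection_estimate\<close> applies where the cutoff equals 1, hence to the open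
  sets \<open>D n\<close> at positive distance from the boundary. Their projections increase to that
  of the superlevel set.\<close>

lemma projection_inequality:
  assumes s: "m < s" and th: "C1b \<theta> \<theta>'" and pos: "\<And>r. 0 \<le> \<theta> r" "\<And>r. 0 \<le> \<theta>' r" and M: "0 \<le> M" "\<And>r. \<theta> r \<le> M * max 0 (r - s)"
    and t: "\<And>r. t < r \<Longrightarrow> 1 \<le> \<theta> r" and ij: "i \<noteq> j"
  shows "measure lborel ((\<lambda>x. x $ i) ` {x\<in>\<Omega>. t < u x}) \<le> (LBINT x. \<theta>' (u x) * \<bar>gr x $ j\<bar>)"
proof -
  note [measurable] = C1b_meas[OF th]
  obtain B' where B': "\<And>t. \<bar>\<theta>' t\<bar> \<le> B'" using C1bD(5)[OF th] by blast
  let ?T = "\<lambda>x. \<theta>' (u x) * \<bar>gr x $ j\<bar>"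
  have iT: "integrable lborel ?T" using gr_integrable B' by (intro bounded_mult_integrable) auto
  define D where "D n = {x\<in>\<Omega>. 1 / real (Suc n) < infdist x (- \<Omega>) \<and> t < u x}" for n
  let ?p = "\<lambda>x::real^2. x $ i"
  have oE: "open {x\<in>\<Omega>. t < u x}" and oD: "open (D n)" for n
  proof -
    have "open {x\<in>\<Omega>. u x \<in> {t<..}}" using continuous_open_preimage[OF u(1) open_\<Omega> open_greaterThan, of t] by (simp add: vimage_def Int_def)
    then show 1: "open {x\<in>\<Omega>. t < u x}" by simp
    have "open {x. 1 / real (Suc n) < infdist x (- \<Omega>)}" by (intro open_Collect_less continuous_intros)
    with 1 have "open ({x\<in>\<Omega>. t < u x} \<inter> {x. 1 / real (Suc n) < infdist x (- \<Omega>)})" by (rule open_Int)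
    moreover have "D n = {x\<in>\<Omega>. t < u x} \<inter> {x. 1 / real (Suc n) < infdist x (- \<Omega>)}" by (auto simp: D_def)
    ultimately show "open (D n)" by simp
  qed
  have bP: "bounded (?p ` {x\<in>\<Omega>. t < u x})" by (rule bounded_component_cart) (rule bounded_subset[OF bdd], auto)
  have fP: "emeasure lborel (?p ` {x\<in>\<Omega>. t < u x}) \<noteq> \<infinity>" using emeasure_bounded_finite[OF bP] by simp
  have U: "(\<Union>n. ?p ` D n) = ?p ` {x\<in>\<Omega>. t < u x}"
  proof -
    have "- \<Omega> \<noteq> {}"
    proof
      assume "- \<Omega> = {}"
      then have "\<Omega> = UNIV" by blast
      then show False using bdd not_bounded_UNIV by simp
    qed
    then have "0 < infdist x (- \<Omega>)" if "x \<in> \<Omega>" for x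
      using that open_\<Omega> by (simp add: infdist_pos_not_in_closed closed_Compl)
    then have "\<exists>n. x \<in> D n" if "x \<in> \<Omega>" "t < u x" for x
      using that reals_Archimedean[of "infdist x (- \<Omega>)"] by (auto simp: D_def inverse_eq_divide)
    then show ?thesis by (auto simp: D_def image_iff) (metis (mono_tags, lifting) D_def mem_Collect_eq)
  qed
  have inc: "incseq (\<lambda>n. ?p ` D n)"
  proof (rule incseq_SucI, rule image_mono)
    fix n
    have "1 / real (Suc (Suc n)) \<le> 1 / real (Suc n)" by (simp add: field_simps)
    then show "D n \<subseteq> D (Suc n)" by (auto simp: D_def)
  qed
  have lim: "(\<lambda>n. measure lborel (?p ` D n)) \<longlonglongrightarrow> measure lborel (?p ` {x\<in>\<Omega>. t < u x})"
    unfolding U[symmetric]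
  proof (rule Lim_measure_incseq[OF _ inc])
    show "range (\<lambda>n. ?p ` D n) \<subseteq> sets lborel" using open_image_vec_nth[OF oD] by auto
  qed (use fP U in simp)
  show ?thesis
  proof (rule field_le_epsilon)
    fix e :: real assume e: "0 < e"
    then have "0 < e / (M + 1)" using M by simp
    from bd_small[OF s this]
    have "\<forall>\<^sub>F n in sequentially. measure lborel (?p ` D n) \<le> (LBINT x. ?T x) + e"
    proof eventually_elim
      case (elim n)
      note cn = cutoffD[OF cut[of n]]
      have DK: "\<kappa> n x = 1 \<and> 1 \<le> \<theta> (u x)" if "x \<in> D n" for x
        using that \<kappa>eq1[of n x] t by (auto simp: D_def simp del: of_nat_Suc)
      have "D n \<subseteq> K n"
      proof
        fix x assume "x \<in> D n"
        then have "\<kappa> n x = 1" using DK by blast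
        then show "x \<in> K n" using cn(5)[of x] by (cases "x \<in> K n") auto
      qed
      then have "measure lborel (?p ` D n) \<le> (LBINT x. \<bar>\<kappa>' n x $ j\<bar> * \<theta> (u x) + \<kappa> n x * \<theta>' (u x) * \<bar>gr x $ j\<bar>)"
        using DK by (intro projection_estimate[OF cut th ij \<kappa>0 pos oD]) auto
      also have "\<dots> \<le> (LBINT x. M * bd s n x + ?T x)"
      proof (rule integral_mono_AE')
        show "integrable lborel (\<lambda>x. M * bd s n x + ?T x)" using elim iT by simp
        show "AE x in lborel. \<bar>\<kappa>' n x $ j\<bar> * \<theta> (u x) + \<kappa> n x * \<theta>' (u x) * \<bar>gr x $ j\<bar> \<le> M * bd s n x + ?T x"
        proof (intro AE_I2 add_mono)
          fix x
          have "\<bar>\<kappa>' n x $ j\<bar> * \<theta> (u x) \<le> norm (\<kappa>' n x) * (M * max 0 (u x - s))"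
            using M pos component_le_norm_cart by (intro mult_mono) auto
          also have "\<dots> \<le> norm (\<kappa>' n x) * (M * max 0 (u x - s)) * (1 + norm (gr x))"
            using M mult_left_mono[of 1 "1 + norm (gr x)" "norm (\<kappa>' n x) * (M * max 0 (u x - s))"] by simp
          also have "\<dots> = M * bd s n x" by (simp add: bd_def mult_ac)
          finally show "\<bar>\<kappa>' n x $ j\<bar> * \<theta> (u x) \<le> M * bd s n x" .
          have "\<kappa> n x * ?T x \<le> 1 * ?T x" using \<kappa>1 pos by (intro mult_right_mono) auto
          then show "\<kappa> n x * \<theta>' (u x) * \<bar>gr x $ j\<bar> \<le> ?T x" by (simp add: mult_ac)
        qed
        show "AE x in lborel. 0 \<le> M * bd s n x + ?T x" using M bd_nonneg pos by simp
      qed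
      also have "\<dots> = M * (LBINT x. bd s n x) + (LBINT x. ?T x)" using elim iT by simp
      also have "M * (LBINT x. bd s n x) \<le> (M + 1) * (e / (M + 1))"
        using elim M by (intro mult_mono) (auto intro!: integral_nonneg_AE AE_I2 bd_nonneg)
      also have "\<dots> = e" using M by simp
      finally show ?case by linarith
    qed
    then show "measure lborel (?p ` {x\<in>\<Omega>. t < u x}) \<le> (LBINT x. ?T x) + e"
      by (rule tendsto_upperbound[OF lim]) simp
  qed
qed

lemma C1b_arctan: "C1b arctan (\<lambda>t. inverse (1 + t\<^sup>2))"
  unfolding C1b_def
proof (intro conjI allI exI[of _ "pi / 2"])
  have "(1::real) + t\<^sup>2 \<noteq> 0" for t using zero_le_power2[of t] by linarith
  then show "continuous_on UNIV (\<lambda>t::real. inverse (1 + t\<^sup>2))" by (intro continuous_intros) auto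
  show "(arctan has_real_derivative inverse (1 + t\<^sup>2)) (at t)" for t by (rule DERIV_arctan)
  show "\<bar>arctan t\<bar> \<le> pi / 2" for t using arctan_bounded[of t] by linarith
  show "\<bar>inverse (1 + t\<^sup>2)\<bar> \<le> pi / 2" for t :: real
  proof -
    have "inverse (1 + t\<^sup>2) \<le> 1" "0 \<le> inverse (1 + t\<^sup>2)" by (simp_all add: inverse_le_1_iff)
    then show ?thesis using pi_ge_two by linarith
  qed
qed

text \<open>arctan is bounded and strictly increasing, so testing with it yields |grad u|^2 / Q with
  weight 1 / (1 + u^2). The boundary term is merely bounded here: the cutoff gradient is at most
  \<open>3 * N\<close> on a layer of measure at most \<open>C\<Omega> * (2 / N)\<close>, once for
  each of the two coordinates, which gives \<open>12 * C\<Omega>\<close>.\<close>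

lemma vertical_inequality:
  "(LBINT x. inverse (1 + (u x)\<^sup>2) * ((norm (gr x))\<^sup>2 * Rf (gr x))) \<le> pi / 2 * ((LBINT x. \<bar>mc x\<bar>) + 12 * C\<Omega>)"
proof -
  have [measurable]: "layer \<Omega> a \<in> sets borel" for a by (rule layer_borel[OF open_\<Omega>])
  have FG: "Ff 1 (gr x) * gr x $ 1 + Ff 2 (gr x) * gr x $ 2 = (norm (gr x))\<^sup>2 * Rf (gr x)" for x
    using norm_2_neq[of 1 2 "gr x"] by (simp add: Ff_def power2_eq_square algebra_simps)
  define P where "P x = inverse (1 + (u x)\<^sup>2) * ((norm (gr x))\<^sup>2 * Rf (gr x))" for x
  have i1: "0 \<le> inverse (1 + (u x)\<^sup>2)" "inverse (1 + (u x)\<^sup>2) \<le> 1" for x by (auto simp: inverse_le_1_iff)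
  have gR: "(norm (gr x))\<^sup>2 * Rf (gr x) \<le> norm (gr x)" "0 \<le> (norm (gr x))\<^sup>2 * Rf (gr x)" for x
  proof -
    have "norm (gr x) * Rf (gr x) \<le> ar x * Rf (gr x)" using norm_le_ar less_imp_le[OF Rf_pos] by (intro mult_right_mono)
    also have "\<dots> = 1" using ar_Rf(1)[of x] by (simp add: mult.commute)
    finally have "norm (gr x) * (norm (gr x) * Rf (gr x)) \<le> norm (gr x) * 1" by (intro mult_left_mono) auto
    then show "(norm (gr x))\<^sup>2 * Rf (gr x) \<le> norm (gr x)" by (simp add: power2_eq_square mult_ac)
    show "0 \<le> (norm (gr x))\<^sup>2 * Rf (gr x)" using less_imp_le[OF Rf_pos] by simp
  qed
  have iP: "integrable lborel P"
  proof (rule integrable_dominated[OF norm_gr_integrable])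
    show "P \<in> borel_measurable lborel" unfolding P_def[abs_def] by measurable
    fix x
    have "P x \<le> 1 * norm (gr x)" unfolding P_def by (rule mult_mono[OF i1(2) gR(1) _ gR(2)]) simp
    moreover have "0 \<le> P x" unfolding P_def by (rule mult_nonneg_nonneg[OF i1(1) gR(2)])
    ultimately show "norm (P x) \<le> norm (norm (gr x))" by simp
  qed
  have "(LBINT x. P x) \<le> pi / 2 * ((LBINT x. \<bar>mc x\<bar>) + 12 * C\<Omega>)"
  proof (rule \<kappa>_integral_le[OF iP])
    show "P x = 0" if "x \<notin> \<Omega>" for x using gr0[OF that] by (simp add: P_def)
    fix e :: real assume e: "0 < e"
    have "\<forall>\<^sub>F n in sequentially. 1 / real (Suc n) < \<epsilon>0 / 2"
      using order_tendstoD(2)[OF LIMSEQ_inverse_real_of_nat, of "\<epsilon>0/2"] C\<Omega>(2) by (simp add: inverse_eq_divide del: of_nat_Suc)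
    then show "\<forall>\<^sub>F n in sequentially. (LBINT x. \<kappa> n x * P x) \<le> pi / 2 * ((LBINT x. \<bar>mc x\<bar>) + 12 * C\<Omega>) + e"
    proof eventually_elim
      case (elim n)
      define N where "N = real (Suc n)"
      have N: "0 < N" by (simp add: N_def)
      let ?L = "layer \<Omega> (2 / N)"
      have eL: "emeasure lborel ?L \<le> ennreal (C\<Omega> * (2 / N))"
        using elim N by (intro layer_measure) (auto simp: N_def field_simps)
      then have iL: "integrable lborel (indicator ?L :: real^2 \<Rightarrow> real)"
        by (intro integrable_real_indicator) (auto simp: less_top[symmetric] top_unique)
      have mL: "measure lborel ?L \<le> C\<Omega> * (2 / N)"
        unfolding measure_def using eL C\<Omega> N by (intro enn2real_leI) auto
      note V = vertical_identity[OF cut[of n] C1b_arctan]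
      define E where "E k x = \<kappa> n x * arctan (u x) * fdiv k x + \<kappa> n x * inverse (1 + (u x)\<^sup>2) * (Ff k (gr x) * gr x $ k)
         + \<kappa>' n x $ k * arctan (u x) * Ff k (gr x)" for k x
      have E: "integrable lborel (E k)" "(LBINT x. E k x) = 0" for k using V[of k] unfolding E_def by auto
      have "(LBINT x. \<kappa> n x * P x) \<le> (LBINT x. (E 1 x + E 2 x) + (pi / 2 * \<bar>mc x\<bar> + pi / 2 * (6 * N * indicator ?L x)))"
      proof (rule integral_mono)
        show "integrable lborel (\<lambda>x. \<kappa> n x * P x)" by (rule \<kappa>_mult_integrable[OF iP])
        show "integrable lborel (\<lambda>x. (E 1 x + E 2 x) + (pi / 2 * \<bar>mc x\<bar> + pi / 2 * (6 * N * indicator ?L x)))"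
          using E(1) mc_integrable iL by simp
        fix x
        have at: "\<bar>arctan (u x)\<bar> \<le> pi / 2" using arctan_bounded[of "u x"] by linarith
        have k: "\<bar>\<kappa>' n x $ l * arctan (u x) * Ff l (gr x)\<bar> \<le> pi / 2 * (3 * N * indicator ?L x)" for l
        proof -
          have "\<bar>\<kappa>' n x $ l\<bar> \<le> 3 * N * indicator ?L x"
            using component_le_norm_cart[of "\<kappa>' n x" l] \<kappa>'_le[of n x] unfolding N_def by linarith
          then have "\<bar>\<kappa>' n x $ l\<bar> * \<bar>arctan (u x)\<bar> * \<bar>Ff l (gr x)\<bar> \<le> (3 * N * indicator ?L x) * (pi / 2) * 1"
            using at N by (intro mult_mono Ff_le) auto
          then show ?thesis by (simp add: abs_mult mult_ac)
        qed
        have m: "\<bar>\<kappa> n x * arctan (u x) * mc x\<bar> \<le> pi / 2 * \<bar>mc x\<bar>"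
        proof -
          have "\<kappa> n x * \<bar>arctan (u x)\<bar> * \<bar>mc x\<bar> \<le> 1 * (pi / 2) * \<bar>mc x\<bar>"
            using at \<kappa>0 \<kappa>1 by (intro mult_mono) auto
          then show ?thesis using \<kappa>0 by (simp add: abs_mult)
        qed
        have "E 1 x + E 2 x = \<kappa> n x * arctan (u x) * mc x
           + \<kappa> n x * (inverse (1 + (u x)\<^sup>2) * (Ff 1 (gr x) * gr x $ 1 + Ff 2 (gr x) * gr x $ 2))
           + \<kappa>' n x $ 1 * arctan (u x) * Ff 1 (gr x) + \<kappa>' n x $ 2 * arctan (u x) * Ff 2 (gr x)"
          unfolding E_def mc_def by (simp only: distrib_left distrib_right mult_ac add_ac)
        then have "E 1 x + E 2 x = \<kappa> n x * arctan (u x) * mc x + \<kappa> n x * P x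
           + \<kappa>' n x $ 1 * arctan (u x) * Ff 1 (gr x) + \<kappa>' n x $ 2 * arctan (u x) * Ff 2 (gr x)"
          unfolding FG P_def .
        moreover have "pi / 2 * (6 * N * indicator ?L x) = pi / 2 * (3 * N * indicator ?L x) + pi / 2 * (3 * N * indicator ?L x)" by simp
        ultimately show "\<kappa> n x * P x \<le> (E 1 x + E 2 x) + (pi / 2 * \<bar>mc x\<bar> + pi / 2 * (6 * N * indicator ?L x))"
          using m k[of 1] k[of 2] by linarith
      qed
      also have "\<dots> = pi / 2 * (LBINT x. \<bar>mc x\<bar>) + pi / 2 * (6 * N * measure lborel ?L)"
        using E mc_integrable iL by simp
      also have "\<dots> \<le> pi / 2 * (LBINT x. \<bar>mc x\<bar>) + pi / 2 * (6 * N * (C\<Omega> * (2 / N)))"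
        using mL N by (intro add_left_mono mult_left_mono) auto
      also have "\<dots> = pi / 2 * ((LBINT x. \<bar>mc x\<bar>) + 12 * C\<Omega>)" using N by (simp add: algebra_simps)
      finally show ?case using e by linarith
    qed
  qed
  then show ?thesis unfolding P_def .
qed

end

lemma integral_Cauchy_Schwarz:
  fixes f g :: "'a \<Rightarrow> real"
  assumes m: "f \<in> borel_measurable M" "g \<in> borel_measurable M" and nn: "\<And>x. 0 \<le> f x" "\<And>x. 0 \<le> g x"
    and i: "integrable M (\<lambda>x. (f x)\<^sup>2)" "integrable M (\<lambda>x. (g x)\<^sup>2)"
  shows "(\<integral>x. f x * g x \<partial>M) \<le> sqrt (\<integral>x. (f x)\<^sup>2 \<partial>M) * sqrt (\<integral>x. (g x)\<^sup>2 \<partial>M)"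
proof -
  let ?F = "\<integral>x. (f x)\<^sup>2 \<partial>M" and ?G = "\<integral>x. (g x)\<^sup>2 \<partial>M"
  have F0: "0 \<le> ?F" "0 \<le> ?G" by auto
  have "(\<integral>\<^sup>+x. ennreal (f x) * ennreal (g x) \<partial>M)\<^sup>2 \<le> (\<integral>\<^sup>+x. (ennreal (f x))\<^sup>2 \<partial>M) * (\<integral>\<^sup>+x. (ennreal (g x))\<^sup>2 \<partial>M)"
    using m by (intro Cauchy_Schwarz_nn_integral measurable_compose[OF _ measurable_ennreal])
  also have "(\<integral>\<^sup>+x. (ennreal (f x))\<^sup>2 \<partial>M) = ennreal ?F"
    using nn i by (simp add: ennreal_power nn_integral_eq_integral)
  also have "(\<integral>\<^sup>+x. (ennreal (g x))\<^sup>2 \<partial>M) = ennreal ?G"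
    using nn i by (simp add: ennreal_power nn_integral_eq_integral)
  also have "ennreal ?F * ennreal ?G = ennreal ((sqrt ?F * sqrt ?G)\<^sup>2)"
    using F0 by (simp add: ennreal_mult power_mult_distrib)
  finally have "(\<integral>\<^sup>+x. ennreal (f x) * ennreal (g x) \<partial>M) \<le> ennreal (sqrt ?F * sqrt ?G)"
    by (rule ennreal_square_le) (use F0 in simp)
  moreover have "(\<integral>\<^sup>+x. ennreal (f x) * ennreal (g x) \<partial>M) = ennreal (\<integral>x. f x * g x \<partial>M)"
  proof -
    have "integrable M (\<lambda>x. f x * g x)"
    proof (rule Bochner_Integration.integrable_bound[of M "\<lambda>x. (f x)\<^sup>2 + (g x)\<^sup>2"])
      show "AE x in M. norm (f x * g x) \<le> norm ((f x)\<^sup>2 + (g x)\<^sup>2)"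
      proof (rule AE_I2)
        fix x
        have "0 \<le> (f x - g x)\<^sup>2" "0 \<le> f x * g x" using nn by auto
        then show "norm (f x * g x) \<le> norm ((f x)\<^sup>2 + (g x)\<^sup>2)" by (simp add: power2_eq_square algebra_simps)
      qed
    qed (use i m in auto)
    then show ?thesis using nn by (subst nn_integral_eq_integral[symmetric]) (auto simp: ennreal_mult)
  qed
  ultimately show ?thesis using F0 by (simp add: ennreal_le_iff)
qed

text \<open>A continuously differentiable substitute for the antiderivative of the indicator of
  \<open>P\<close>. X' stays below the indicator and, since \<open>P\<close> is open, increases to
  it as \<open>n\<close> grows; starting the antiderivative at \<open>- R\<close> keeps it at most
  the measure of \<open>P\<close>.\<close>

lemma open_set_ramp:
  assumes P: "open P" "P \<subseteq> {-R..R}" and n: "0 \<le> (n::real)"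
  obtains X X' where "\<And>t. (X has_real_derivative X' t) (at t)" "continuous_on UNIV X'" "\<And>t. 0 \<le> X' t" "\<And>t. X' t \<le> 1"
    "\<And>t. X' t = min 1 (n * infdist t (- P))" "\<And>t. t \<in> {-R..R} \<Longrightarrow> \<bar>X t\<bar> \<le> measure lborel P"
proof -
  define X' where "X' t = min 1 (n * infdist t (- P))" for t
  have c: "continuous_on UNIV X'" unfolding X'_def by (intro continuous_intros)
  have b: "0 \<le> X' t" "X' t \<le> 1" for t using n by (auto simp: X'_def infdist_nonneg)
  have "\<exists>F. \<forall>x::real. -\<infinity> < ereal x \<longrightarrow> ereal x < \<infinity> \<longrightarrow> (F has_vector_derivative X' x) (at x)"
    using c by (intro einterval_antiderivative) (auto simp: continuous_on_eq_continuous_at)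
  then obtain F where F: "\<And>x. (F has_real_derivative X' x) (at x)"
    by (auto simp: has_real_derivative_iff_has_vector_derivative)
  have oP: "P \<in> sets borel" using P(1) by simp
  have bP: "bounded P" using P(2) bounded_closed_interval bounded_subset by blast
  have fP: "emeasure lborel P < \<infinity>" using bP by (rule emeasure_bounded_finite)
  have iP: "integrable lborel (indicator P :: real \<Rightarrow> real)" using oP fP by (simp add: integrable_indicator_iff)
  have X'P: "X' t \<le> indicator P t" for t
    using b(2)[of t] by (cases "t \<in> P") (auto simp: X'_def)
  show ?thesis
  proof (rule that[of "\<lambda>t. F t - F (- R)" X'])
    show "((\<lambda>t. F t - F (- R)) has_real_derivative X' t) (at t)" for t
      using F[of t] by (auto intro!: derivative_eq_intros)
    fix t assume t: "t \<in> {-R..R}"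
    have *: "has_bochner_integral lborel (\<lambda>x. indicator {-R..t} x *\<^sub>R X' x) (F t - F (- R))"
      by (rule has_bochner_integral_FTC_Icc)
        (use t F c in \<open>auto simp: has_real_derivative_iff_has_vector_derivative[symmetric] intro: has_field_derivative_at_within continuous_on_subset\<close>)
    then have eq: "F t - F (- R) = (LBINT x. indicator {-R..t} x *\<^sub>R X' x)" and i: "integrable lborel (\<lambda>x. indicator {-R..t} x *\<^sub>R X' x)"
      by (auto simp: has_bochner_integral_iff)
    have "0 \<le> (LBINT x. indicator {-R..t} x *\<^sub>R X' x)" using b by (intro integral_nonneg_AE) auto
    moreover have "(LBINT x. indicator {-R..t} x *\<^sub>R X' x) \<le> (LBINT x. indicator P x)"
    proof (rule integral_mono[OF i iP])
      fix x show "indicator {-R..t} x *\<^sub>R X' x \<le> indicator P x"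
        using X'P[of x] b(1)[of x] by (cases "x \<in> {-R..t}") (auto simp: indicator_def)
    qed
    ultimately show "\<bar>F t - F (- R)\<bar> \<le> measure lborel P" unfolding eq by simp
  qed (use c b X'_def in auto)
qed

section \<open>Area above a level\<close>

context sobolev_graph
begin

definition Ws :: real where "Ws = (LBINT x. (mc x)\<^sup>2 * ar x)"
definition area_above :: "real \<Rightarrow> real" where
  "area_above s = (LBINT x. indicator {x\<in>\<Omega>. s < u x} x * ar x)"
definition area :: real where "area = (LBINT x. indicator \<Omega> x * ar x)"

lemma Ws_nonneg: "0 \<le> Ws" unfolding Ws_def using ar_ge_1 by (intro integral_nonneg_AE AE_I2 mult_nonneg_nonneg) (auto intro: order_trans[OF zero_le_one])

lemma superlevel_open: "open {x\<in>\<Omega>. s < u x}"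
proof -
  have "open {x\<in>\<Omega>. u x \<in> {s<..}}" using continuous_open_preimage[OF u(1) open_\<Omega> open_greaterThan, of s] by (simp add: vimage_def Int_def)
  then show ?thesis by simp
qed

lemma superlevel_meas [measurable]: "{x\<in>\<Omega>. s < u x} \<in> sets borel"
  using superlevel_open by simp

lemma area_above_integrable: "integrable lborel (\<lambda>x. indicator {x\<in>\<Omega>. s < u x} x * ar x)"
proof (rule Bochner_Integration.integrable_bound[OF ar_integrable])
  show "AE x in lborel. norm (indicator {x\<in>\<Omega>. s < u x} x * ar x) \<le> norm (indicator \<Omega> x * ar x)"
    by (auto simp: indicator_def)
qed measurable

lemma area_above_mono: "s \<le> t \<Longrightarrow> area_above t \<le> area_above s"
  unfolding area_above_def using ar_ge_1
  by (intro integral_mono area_above_integrable) (auto simp: indicator_def intro: order_trans[OF zero_le_one])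

lemma area_above_nonneg: "0 \<le> area_above s"
  unfolding area_above_def using ar_ge_1
  by (intro integral_nonneg_AE AE_I2) (auto simp: indicator_def intro: order_trans[OF zero_le_one])

lemma area_above_le_area: "area_above s \<le> area"
  unfolding area_above_def area_def using ar_ge_1
  by (intro integral_mono area_above_integrable ar_integrable) (auto simp: indicator_def intro: order_trans[OF zero_le_one])

lemma area_nonneg: "0 \<le> area" using area_above_nonneg area_above_le_area order_trans by blast

lemma superlevel_measure_le: "measure lborel {x\<in>\<Omega>. s < u x} \<le> area_above s" "measure lborel {x\<in>\<Omega>. s < u x} \<le> measure lborel \<Omega>"
proof -
  have fE: "emeasure lborel {x\<in>\<Omega>. s < u x} < \<infinity>" by (rule emeasure_bounded_finite) (rule bounded_subset[OF bdd], auto)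
  have i: "integrable lborel (indicator {x\<in>\<Omega>. s < u x} :: real^2 \<Rightarrow> real)" using fE by (simp add: integrable_indicator_iff)
  have "measure lborel {x\<in>\<Omega>. s < u x} = (LBINT x. indicator {x\<in>\<Omega>. s < u x} x)" by simp
  also have "\<dots> \<le> area_above s" unfolding area_above_def
    using ar_ge_1 by (intro integral_mono i area_above_integrable) (auto simp: indicator_def)
  finally show "measure lborel {x\<in>\<Omega>. s < u x} \<le> area_above s" .
  show "measure lborel {x\<in>\<Omega>. s < u x} \<le> measure lborel \<Omega>"
    using emeasure_\<Omega> open_\<Omega> by (intro measure_mono_fmeasurable) (auto simp: fmeasurable_def)
qed

text \<open>\<open>ar\<close> is split into two square roots, one of which joins the curvature and
  produces \<open>Ws\<close>.\<close>

lemma mc_CS: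
  assumes E: "E \<in> sets borel" "E \<subseteq> \<Omega>"
  shows "(LBINT x. indicator E x * (ar x * \<bar>mc x\<bar>)) \<le> sqrt (LBINT x. indicator E x * ar x) * sqrt Ws"
proof -
  have a0: "0 \<le> ar x" for x using ar_ge_1[of x] by linarith
  have [measurable]: "E \<in> sets borel" by fact
  let ?f = "\<lambda>x. indicator E x * sqrt (ar x)" and ?g = "\<lambda>x. sqrt (ar x) * \<bar>mc x\<bar>"
  have f2: "(?f x)\<^sup>2 = indicator E x * ar x" for x using a0 by (simp add: indicator_def)
  have g2: "(?g x)\<^sup>2 = (mc x)\<^sup>2 * ar x" for x using a0 by (simp add: power_mult_distrib)
  have i: "integrable lborel (\<lambda>x. indicator E x * ar x)"
  proof (rule Bochner_Integration.integrable_bound[OF ar_integrable])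
    show "AE x in lborel. norm (indicator E x * ar x) \<le> norm (indicator \<Omega> x * ar x)"
      using E(2) by (auto simp: indicator_def)
  qed measurable
  have "(LBINT x. ?f x * ?g x) \<le> sqrt (LBINT x. (?f x)\<^sup>2) * sqrt (LBINT x. (?g x)\<^sup>2)"
  proof (rule integral_Cauchy_Schwarz)
    show "integrable lborel (\<lambda>x. (?f x)\<^sup>2)" "integrable lborel (\<lambda>x. (?g x)\<^sup>2)"
      unfolding f2 g2 using i mc_sq_integrable by auto
    show "?f \<in> borel_measurable lborel" "?g \<in> borel_measurable lborel" by measurable
  qed (auto simp: a0)
  also have "(LBINT x. ?f x * ?g x) = (LBINT x. indicator E x * (ar x * \<bar>mc x\<bar>))"
  proof (rule Bochner_Integration.integral_cong)
    fix x have "sqrt (ar x) * sqrt (ar x) = ar x" using a0 by simp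
    then show "?f x * ?g x = indicator E x * (ar x * \<bar>mc x\<bar>)" by (simp only: mult.assoc[symmetric]) (simp add: mult.assoc)
  qed simp
  finally show ?thesis unfolding f2 g2 Ws_def .
qed

end

section \<open>Slab estimates and iteration over levels\<close>

context cutoff_graph
begin

text \<open>The field is the ramp over the projection \<open>?P\<close>: it is bounded by the length
  of \<open>?P\<close>, and its derivative tends to 1 on \<open>?P\<close> as the slope parameter
  \<open>n\<close> tends to infinity. On the right, the first term comes from the step in the
  \<open>u\<close> direction between \<open>s\<close> and \<open>t\<close>, the second from the
  curvature by Cauchy-Schwarz.\<close>

lemma slab_estimate:
  assumes s: "m < s" "s < t" and ij: "i \<noteq> j"
  shows "(LBINT x. indicator {x\<in>\<Omega>. t < u x} x * (Rf (gr x) + Ff j (gr x) * gr x $ j))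
    \<le> measure lborel ((\<lambda>x. x $ i) ` {x\<in>\<Omega>. s < u x})
       * (2 / (t - s) * measure lborel {x\<in>\<Omega>. s < u x} + sqrt Ws * sqrt (area_above s))"
proof -
  let ?E = "{x\<in>\<Omega>. s < u x}" and ?A = "\<lambda>x. Rf (gr x) + Ff j (gr x) * gr x $ j"
  let ?P = "(\<lambda>x. x $ i) ` ?E"
  let ?l = "measure lborel ?P"
  obtain \<theta> \<theta>' where th: "C1b \<theta> \<theta>'" and th': "\<And>r. 0 \<le> \<theta> r" "\<And>r. \<theta> r \<le> 1" "\<And>r. 0 \<le> \<theta>' r" "\<And>r. \<theta>' r \<le> 2 / (t - s)"
    "\<And>r. \<theta> r \<le> 2 / (t - s) * max 0 (r - s)" "\<And>r. r \<le> s \<Longrightarrow> \<theta> r = 0" "\<And>r. r \<le> s \<Longrightarrow> \<theta>' r = 0" "\<And>r. t \<le> r \<Longrightarrow> \<theta> r = 1"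
    using step_exists[OF s(2)] by blast
  note [measurable] = C1b_meas[OF th]
  have out: "u x \<le> s" if "x \<notin> \<Omega>" for x using u(3)[OF that] m0 s by simp
  have oP: "open ?P" by (rule open_image_vec_nth[OF superlevel_open])
  obtain R where R: "\<Omega> \<subseteq> ball 0 R" using bounded_subset_ballD[OF bdd, of 0] by blast
  have xR: "x $ i \<in> {-R..R}" if "x \<in> \<Omega>" for x
    using component_le_norm_cart[of x i] R that by (force simp: abs_le_iff)
  have PR: "?P \<subseteq> {-R..R}" using xR by blast
  have a0: "0 \<le> ar x" for x using ar_ge_1[of x] by linarith
  have t2: "0 \<le> 2 / (t - s)" using s by simp
  define T where "T = 2 / (t - s) * measure lborel ?E + sqrt Ws * sqrt (area_above s)"
  have fE: "emeasure lborel ?E < \<infinity>" by (rule emeasure_bounded_finite) (rule bounded_subset[OF bdd], auto)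
  have iE: "integrable lborel (indicator ?E :: real^2 \<Rightarrow> real)" using fE by (simp add: integrable_indicator_iff)
  have T1: "(LBINT x. \<theta>' (u x) * \<bar>Ff i (gr x)\<bar>) \<le> 2 / (t - s) * measure lborel ?E"
  proof -
    have "(LBINT x. \<theta>' (u x) * \<bar>Ff i (gr x)\<bar>) \<le> (LBINT x. 2 / (t - s) * indicator ?E x)"
    proof (rule integral_mono_AE')
      show "AE x in lborel. \<theta>' (u x) * \<bar>Ff i (gr x)\<bar> \<le> 2 / (t - s) * indicator ?E x"
      proof (rule AE_I2)
        fix x
        have "\<theta>' (u x) * \<bar>Ff i (gr x)\<bar> \<le> 2 / (t - s) * 1" using th' t2 Ff_le by (intro mult_mono) auto
        moreover have "\<theta>' (u x) = 0" if "x \<notin> ?E" using that out[of x] th'(7)[of "u x"] by (cases "x \<in> \<Omega>") auto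
        ultimately show "\<theta>' (u x) * \<bar>Ff i (gr x)\<bar> \<le> 2 / (t - s) * indicator ?E x" by (cases "x \<in> ?E") auto
      qed
    qed (use iE t2 in auto)
    then show ?thesis by simp
  qed
  have iEmc: "integrable lborel (\<lambda>x. indicator ?E x * (ar x * \<bar>mc x\<bar>))"
    using bounded_mult_integrable[OF integrable_abs[OF ar_mc_integrable], of "indicator ?E" 1] a0 by (simp add: abs_mult)
  have T2: "(LBINT x. \<theta> (u x) * \<bar>gr x $ i * mc x\<bar>) \<le> sqrt Ws * sqrt (area_above s)"
  proof -
    have "(LBINT x. \<theta> (u x) * \<bar>gr x $ i * mc x\<bar>) \<le> (LBINT x. indicator ?E x * (ar x * \<bar>mc x\<bar>))"
    proof (rule integral_mono_AE'[OF iEmc])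
      show "AE x in lborel. \<theta> (u x) * \<bar>gr x $ i * mc x\<bar> \<le> indicator ?E x * (ar x * \<bar>mc x\<bar>)"
      proof (rule AE_I2)
        fix x
        have "\<bar>gr x $ i\<bar> \<le> ar x" using component_le_norm_cart[of "gr x" i] norm_le_ar[of x] by linarith
        then have "\<bar>gr x $ i * mc x\<bar> \<le> ar x * \<bar>mc x\<bar>" unfolding abs_mult by (intro mult_right_mono) auto
        then have "\<theta> (u x) * \<bar>gr x $ i * mc x\<bar> \<le> 1 * (ar x * \<bar>mc x\<bar>)" using th' by (intro mult_mono) auto
        moreover have "\<theta> (u x) = 0" if "x \<notin> ?E" using that out[of x] th'(6)[of "u x"] by (cases "x \<in> \<Omega>") auto
        ultimately show "\<theta> (u x) * \<bar>gr x $ i * mc x\<bar> \<le> indicator ?E x * (ar x * \<bar>mc x\<bar>)" by (cases "x \<in> ?E") auto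
      qed
      show "AE x in lborel. 0 \<le> indicator ?E x * (ar x * \<bar>mc x\<bar>)" using a0 by (auto simp: indicator_def)
    qed
    also have "\<dots> \<le> sqrt (area_above s) * sqrt Ws" unfolding area_above_def by (rule mc_CS) auto
    finally show ?thesis by (simp add: mult.commute)
  qed
  define Pn where "Pn n x = min 1 (real n * infdist (x $ i) (- ?P)) * \<theta> (u x) * ?A x" for n and x :: "real^2"
  have B0: "?l * T \<ge> (LBINT x. Pn n x)" for n
  proof -
    have n0: "0 \<le> real n" by simp
    obtain X X' where X: "\<And>t. (X has_real_derivative X' t) (at t)" "continuous_on UNIV X'" "\<And>t. 0 \<le> X' t" "\<And>t. X' t \<le> 1"
      and X': "\<And>t. X' t = min 1 (real n * infdist t (- ?P))" and Xb: "\<And>t. t \<in> {-R..R} \<Longrightarrow> \<bar>X t\<bar> \<le> ?l"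
      using open_set_ramp[OF oP PR n0] by blast
    have "(LBINT x. X' (x $ i) * \<theta> (u x) * ?A x) \<le> ?l * (LBINT x. \<theta>' (u x) * \<bar>Ff i (gr x)\<bar>) + ?l * (LBINT x. \<theta> (u x) * \<bar>gr x $ i * mc x\<bar>)"
      by (rule horizontal_inequality[OF s(1) th th'(1,3) t2 th'(5) ij X measure_nonneg]) (use Xb xR in blast)
    also have "\<dots> \<le> ?l * (2 / (t - s) * measure lborel ?E) + ?l * (sqrt Ws * sqrt (area_above s))"
      using T1 T2 by (intro add_mono mult_left_mono) auto
    also have "\<dots> = ?l * T" by (simp add: T_def distrib_left)
    finally show ?thesis unfolding Pn_def X' .
  qed
  have A0: "0 \<le> ?A x" for x by (rule R_Fg_bounds)
  let ?dom = "\<lambda>x. indicator \<Omega> x + norm (gr x)"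
  have idom: "integrable lborel ?dom" using ind_integrable norm_gr_integrable by simp
  have thA: "\<theta> (u x) * ?A x \<le> ?dom x" "0 \<le> \<theta> (u x) * ?A x" for x
  proof -
    have "\<theta> (u x) * ?A x \<le> 1 * (1 + norm (gr x))" using th' R_Fg_bounds[of x j] by (intro mult_mono) auto
    moreover have "\<theta> (u x) = 0" if "x \<notin> \<Omega>" using out[OF that] th'(6) by blast
    ultimately show "\<theta> (u x) * ?A x \<le> ?dom x" by (cases "x \<in> \<Omega>") auto
    show "0 \<le> \<theta> (u x) * ?A x" using th' A0 by simp
  qed
  have inf_meas: "(\<lambda>x::real^2. infdist (x $ i) (- ?P)) \<in> borel_measurable borel"
    by (intro borel_measurable_continuous_onI continuous_intros)
  have "(\<lambda>n. \<integral>x. Pn n x \<partial>lborel) \<longlonglongrightarrow> (LBINT x. \<theta> (u x) * ?A x)"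
  proof (rule integral_dominated_convergence[where w = ?dom])
    show "Pn n \<in> borel_measurable lborel" for n unfolding Pn_def[abs_def] using inf_meas by measurable
    show "AE x in lborel. norm (Pn n x) \<le> ?dom x" for n
    proof (rule AE_I2)
      fix x
      let ?r = "min 1 (real n * infdist (x $ i) (- ?P))"
      have "0 \<le> ?r" "?r \<le> 1" by (auto simp: infdist_nonneg)
      then have "?r * (\<theta> (u x) * ?A x) \<le> 1 * ?dom x" "0 \<le> ?r * (\<theta> (u x) * ?A x)"
        by (intro mult_mono[OF _ thA(1) _ thA(2)] mult_nonneg_nonneg[OF _ thA(2)]; simp)+
      then show "norm (Pn n x) \<le> ?dom x" unfolding Pn_def by (simp add: mult.assoc)
    qed
    show "AE x in lborel. (\<lambda>n. Pn n x) \<longlonglongrightarrow> \<theta> (u x) * ?A x"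
    proof (rule AE_I2)
      fix x
      show "(\<lambda>n. Pn n x) \<longlonglongrightarrow> \<theta> (u x) * ?A x"
      proof (cases "x \<in> ?E")
        case False
        then have "\<theta> (u x) = 0" using out[of x] th'(6)[of "u x"] by (cases "x \<in> \<Omega>") auto
        then show ?thesis by (simp add: Pn_def)
      next
        case True
        then have xP: "x $ i \<in> ?P" by blast
        have "- ?P \<noteq> {}"
        proof
          assume "- ?P = {}"
          then have "R + 1 \<in> ?P" by blast
          then show False using PR by auto
        qed
        then have d: "0 < infdist (x $ i) (- ?P)" using xP oP by (simp add: infdist_pos_not_in_closed closed_Compl)
        obtain N :: nat where N: "1 / infdist (x $ i) (- ?P) < real N" using reals_Archimedean2 by blast
        have "\<forall>\<^sub>F n in sequentially. Pn n x = \<theta> (u x) * ?A x"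
          using eventually_ge_at_top[of N]
        proof eventually_elim
          case (elim n)
          have "1 / infdist (x $ i) (- ?P) < real n" using N elim by linarith
          then have "1 \<le> real n * infdist (x $ i) (- ?P)" using d by (simp add: field_simps)
          then show ?case by (simp add: Pn_def min_def)
        qed
        then show ?thesis by (rule tendsto_eventually)
      qed
    qed
  qed (use idom in measurable)
  then have "(LBINT x. \<theta> (u x) * ?A x) \<le> ?l * T"
    by (rule LIMSEQ_le_const2) (use B0 in blast)
  moreover have "(LBINT x. indicator {x\<in>\<Omega>. t < u x} x * ?A x) \<le> (LBINT x. \<theta> (u x) * ?A x)"
  proof (rule integral_mono_AE')
    show "integrable lborel (\<lambda>x. \<theta> (u x) * ?A x)"
      by (rule Bochner_Integration.integrable_bound[OF idom]) (use thA in \<open>auto intro!: AE_I2\<close>)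
    show "AE x in lborel. indicator {x\<in>\<Omega>. t < u x} x * ?A x \<le> \<theta> (u x) * ?A x"
      using thA(2) th'(8) by (intro AE_I2) (auto simp: indicator_def)
  qed (use thA in auto)
  ultimately show ?thesis unfolding T_def by linarith
qed

text \<open>Over each point of the projection, a step between the levels \<open>s\<close> and
  \<open>t\<close> has variation at least 1 along the line in direction \<open>j\<close>. Its slope
  is at most \<open>2 / (t - s)\<close>, so the length of the projection is charged to the area
  above \<open>s\<close>.\<close>

lemma superlevel_width:
  assumes s: "m < s" "s < t"
  shows "measure lborel ((\<lambda>x. x $ i) ` {x\<in>\<Omega>. t < u x}) \<le> 2 / (t - s) * area_above s"
proof -
  obtain j where ij: "i \<noteq> j" using ex_neq_2[of i] by metis
  obtain \<theta> \<theta>' where th: "C1b \<theta> \<theta>'" and th': "\<And>r. 0 \<le> \<theta> r" "\<And>r. 0 \<le> \<theta>' r" "\<And>r. \<theta>' r \<le> 2 / (t - s)"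
    "\<And>r. \<theta> r \<le> 2 / (t - s) * max 0 (r - s)" "\<And>r. r \<le> s \<Longrightarrow> \<theta>' r = 0" "\<And>r. t < r \<Longrightarrow> 1 \<le> \<theta> r"
    using step_exists[OF s(2)] by (metis less_imp_le order_refl)
  have t2: "0 \<le> 2 / (t - s)" using s by simp
  have a0: "0 \<le> ar x" for x using ar_ge_1[of x] by linarith
  have "measure lborel ((\<lambda>x. x $ i) ` {x\<in>\<Omega>. t < u x}) \<le> (LBINT x. \<theta>' (u x) * \<bar>gr x $ j\<bar>)"
    by (rule projection_inequality[OF s(1) th th'(1,2) t2 th'(4,6) ij])
  also have "\<dots> \<le> (LBINT x. 2 / (t - s) * (indicator {x\<in>\<Omega>. s < u x} x * ar x))"
  proof (rule integral_mono_AE')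
    show "AE x in lborel. \<theta>' (u x) * \<bar>gr x $ j\<bar> \<le> 2 / (t - s) * (indicator {x\<in>\<Omega>. s < u x} x * ar x)"
    proof (rule AE_I2)
      fix x
      have "\<bar>gr x $ j\<bar> \<le> ar x" using component_le_norm_cart[of "gr x" j] norm_le_ar[of x] by linarith
      then have "\<theta>' (u x) * \<bar>gr x $ j\<bar> \<le> 2 / (t - s) * ar x" using th' t2 by (intro mult_mono) auto
      moreover have "\<theta>' (u x) * \<bar>gr x $ j\<bar> = 0" if "x \<notin> {x\<in>\<Omega>. s < u x}"
        using that th'(5)[of "u x"] zero_outside(4)[of x j] by (cases "x \<in> \<Omega>") auto
      ultimately show "\<theta>' (u x) * \<bar>gr x $ j\<bar> \<le> 2 / (t - s) * (indicator {x\<in>\<Omega>. s < u x} x * ar x)"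
        by (cases "x \<in> {x\<in>\<Omega>. s < u x}") auto
    qed
  qed (use area_above_integrable a0 t2 in \<open>auto simp: indicator_def\<close>)
  also have "\<dots> = 2 / (t - s) * area_above s" unfolding area_above_def by simp
  finally show ?thesis .
qed

text \<open>The integrands of the two slab estimates add up to Q + 1/Q, so both coordinate
  directions together bound the area.\<close>

lemma area_above_slab:
  assumes s: "m < s" "s < t" and l: "\<And>i. measure lborel ((\<lambda>x. x $ i) ` {x\<in>\<Omega>. s < u x}) \<le> l"
  shows "area_above t \<le> 2 * l * (2 / (t - s) * measure lborel {x\<in>\<Omega>. s < u x} + sqrt Ws * sqrt (area_above s))"
proof -
  let ?E = "{x\<in>\<Omega>. t < u x}"
  let ?A = "\<lambda>j x. Rf (gr x) + Ff j (gr x) * gr x $ j"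
  define T where "T = 2 / (t - s) * measure lborel {x\<in>\<Omega>. s < u x} + sqrt Ws * sqrt (area_above s)"
  have T0: "0 \<le> T" using s Ws_nonneg area_above_nonneg by (simp add: T_def)
  have b: "(LBINT x. indicator ?E x * ?A j x) \<le> l * T" if "i \<noteq> j" for i j
  proof -
    have "(LBINT x. indicator ?E x * ?A j x) \<le> measure lborel ((\<lambda>x. x $ i) ` {x\<in>\<Omega>. s < u x}) * T"
      unfolding T_def by (rule slab_estimate[OF s that])
    also have "\<dots> \<le> l * T" using l T0 by (intro mult_right_mono)
    finally show ?thesis .
  qed
  have i: "integrable lborel (\<lambda>x. indicator ?E x * ?A j x)" for j
  proof (rule Bochner_Integration.integrable_bound[of lborel "\<lambda>x. indicator \<Omega> x + norm (gr x)"])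
    show "integrable lborel (\<lambda>x. indicator \<Omega> x + norm (gr x))" using ind_integrable norm_gr_integrable by simp
    show "AE x in lborel. norm (indicator ?E x * ?A j x) \<le> norm (indicator \<Omega> x + norm (gr x))"
      using R_Fg_bounds[of _ j] by (intro AE_I2) (auto simp: indicator_def)
  qed measurable
  have "area_above t \<le> (LBINT x. indicator ?E x * ?A 1 x + indicator ?E x * ?A 2 x)"
    unfolding area_above_def
  proof (rule integral_mono[OF area_above_integrable])
    show "integrable lborel (\<lambda>x. indicator ?E x * ?A 1 x + indicator ?E x * ?A 2 x)" using i by simp
    fix x
    have "ar x = Rf (gr x) * (1 + (norm (gr x))\<^sup>2)"

      by (simp add: ar_def Rf_def real_div_sqrt)
    also have "\<dots> = Rf (gr x) + (Ff 1 (gr x) * gr x $ 1 + Ff 2 (gr x) * gr x $ 2)"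
      using norm_2_neq[of 1 2 "gr x"] by (simp add: Ff_def power2_eq_square algebra_simps)
    finally have "ar x \<le> ?A 1 x + ?A 2 x" using Rf_pos[of "gr x"] by linarith
    then show "indicator ?E x * ar x \<le> indicator ?E x * ?A 1 x + indicator ?E x * ?A 2 x" by (auto simp: indicator_def)
  qed
  also have "\<dots> = (LBINT x. indicator ?E x * ?A 1 x) + (LBINT x. indicator ?E x * ?A 2 x)" using i by simp
  also have "\<dots> \<le> l * T + l * T" using b[of 2 1] b[of 1 2] by (intro add_mono) auto
  finally show ?thesis unfolding T_def by simp
qed

text \<open>The numbers 16 and 64 are what \<open>area_above_decay\<close> asks for: each of its two
  error terms then becomes at most an eighth of the area.\<close>

definition decay_rate :: real where "decay_rate = 64 * sqrt Ws + 16"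

text \<open>The slab of height \<open>L\<close> is used in two halves: the lower one bounds the
  width of the superlevel set at mid-height by \<open>4 * a / L\<close>, the upper one converts this
  width into area. With \<open>L\<close> proportional to \<open>sqrt a\<close> both resulting terms
  are multiples of \<open>a\<close>.\<close>

lemma area_above_decay:
  assumes s: "m < s"
  shows "area_above (s + decay_rate * sqrt (area_above s)) \<le> area_above s / 4"
proof (cases "area_above s = 0")
  case True
  then show ?thesis by simp
next
  case False
  define a where "a = area_above s"
  define K where "K = decay_rate"
  define L where "L = K * sqrt a"
  have a: "0 < a" using False area_above_nonneg[of s] by (simp add: a_def)
  have K: "16 \<le> K" "64 * sqrt Ws \<le> K" using Ws_nonneg by (auto simp: K_def decay_rate_def)
  have L: "0 < L" using K a by (simp add: L_def)
  have L2: "L * L = K * K * a"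
  proof -
    have "L * L = K * K * (sqrt a * sqrt a)" unfolding L_def by (simp only: mult_ac)
    then show ?thesis using a by simp
  qed
  let ?l = "4 * a / L"
  have l: "measure lborel ((\<lambda>x. x $ i) ` {x\<in>\<Omega>. s + L / 2 < u x}) \<le> ?l" for i
    using superlevel_width[OF s, of "s + L/2" i] L by (simp add: a_def field_simps)
  have A1: "area_above (s + L / 2) \<le> a" unfolding a_def using L by (intro area_above_mono) simp
  have "area_above (s + L) \<le> 2 * ?l * (2 / (s + L - (s + L / 2)) * measure lborel {x\<in>\<Omega>. s + L / 2 < u x} + sqrt Ws * sqrt (area_above (s + L / 2)))"
    using s L by (intro area_above_slab l) auto
  also have "\<dots> \<le> 2 * ?l * (4 / L * a + sqrt Ws * sqrt a)"
  proof (intro mult_left_mono add_mono)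
    have "2 / (s + L - (s + L / 2)) = 4 / L" using L by (simp add: field_simps)
    moreover have "measure lborel {x\<in>\<Omega>. s + L / 2 < u x} \<le> a" using superlevel_measure_le(1)[of "s + L/2"] A1 by linarith
    ultimately show "2 / (s + L - (s + L / 2)) * measure lborel {x\<in>\<Omega>. s + L / 2 < u x} \<le> 4 / L * a"
      using L by (simp add: divide_right_mono)
    show "sqrt (area_above (s + L / 2)) \<le> sqrt a" using A1 by simp
  qed (use Ws_nonneg a L in auto)
  also have "\<dots> = 32 * a * a / (L * L) + 8 * (sqrt Ws * a * sqrt a / L)" using L by (simp add: field_simps)
  also have "32 * a * a / (L * L) = 32 * a / (K * K)" unfolding L2 using a K by simp
  also have "sqrt Ws * a * sqrt a / L = sqrt Ws * a / K" using a K by (simp add: L_def)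
  also have "32 * a / (K * K) \<le> 32 * a / (16 * 16)" using K a by (intro divide_left_mono mult_mono) auto
  also have "32 * a / (16 * 16) + 8 * (sqrt Ws * a / K) \<le> a / 8 + a / 8"
  proof -
    have "64 * sqrt Ws * a \<le> K * a" using K a by (intro mult_right_mono) auto
    then have "8 * (sqrt Ws * a / K) \<le> a / 8" using K by (simp add: field_simps)
    then show ?thesis by simp
  qed
  finally show ?thesis by (simp add: a_def L_def K_def)
qed

lemma sup_bound:
  assumes s: "m < s" and x: "x \<in> \<Omega>"
  shows "u x \<le> s + 2 * decay_rate * sqrt (area_above s)"
proof (rule ccontr)
  assume c: "\<not> ?thesis"
  define a where "a = area_above s"
  define K where "K = decay_rate"
  have K: "0 < K" using Ws_nonneg by (simp add: K_def decay_rate_def add_nonneg_pos)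
  have a: "0 \<le> a" by (simp add: a_def area_above_nonneg)
  \<comment> \<open>The level after \<open>k\<close> slabs. The area drops by a factor 4 each time,
    so the allowed slab height \<open>K * sqrt a / 2 ^ k\<close> halves, and the heights sum to
    \<open>2 * K * sqrt a\<close>.\<close>
  define S where "S k = s + K * sqrt a * (2 - 2 / 2 ^ k)" for k :: nat
  have S1: "s \<le> S k" "S k \<le> s + 2 * K * sqrt a" for k
  proof -
    have "2 / 2 ^ k \<le> (2::real)" "0 \<le> 2 / (2::real) ^ k" by (auto simp: field_simps)
    then have "0 \<le> K * sqrt a * (2 - 2 / 2 ^ k)" "K * sqrt a * (2 - 2 / 2 ^ k) \<le> K * sqrt a * 2"
      using K a by (auto intro!: mult_nonneg_nonneg mult_left_mono)
    then show "s \<le> S k" "S k \<le> s + 2 * K * sqrt a" by (auto simp: S_def mult_ac)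
  qed
  have "area_above (S k) \<le> a / 4 ^ k" for k
  proof (induction k)
    case 0 then show ?case by (simp add: S_def a_def)
  next
    case (Suc k)
    have "sqrt (area_above (S k)) \<le> sqrt (a / 4 ^ k)" using Suc by simp
    also have "\<dots> = sqrt a / 2 ^ k"
    proof -
      have "(4::real) ^ k = (2 ^ k)\<^sup>2" by (simp add: power2_eq_square flip: power_mult_distrib)
      then show ?thesis by (simp add: real_sqrt_divide)
    qed
    finally have "K * sqrt (area_above (S k)) \<le> K * (sqrt a / 2 ^ k)" using K by (intro mult_left_mono) auto
    moreover have "S (Suc k) = S k + K * (sqrt a / 2 ^ k)" by (simp add: S_def field_simps)
    ultimately have "S k + K * sqrt (area_above (S k)) \<le> S (Suc k)" by linarith
    then have "area_above (S (Suc k)) \<le> area_above (S k + K * sqrt (area_above (S k)))" by (rule area_above_mono)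
    also have "\<dots> \<le> area_above (S k) / 4" unfolding K_def using s S1(1)[of k] by (intro area_above_decay) simp
    also have "\<dots> \<le> a / 4 ^ Suc k" using Suc by simp
    finally show ?case .
  qed
  then have le: "area_above (s + 2 * K * sqrt a) \<le> a / 4 ^ k" for k
    using area_above_mono[OF S1(2)[of k]] order_trans by blast
  have "(\<lambda>k. a * (1 / 4) ^ k) \<longlonglongrightarrow> a * 0" by (intro tendsto_intros LIMSEQ_power_zero) simp
  then have lim: "(\<lambda>k. a * (1 / 4) ^ k) \<longlonglongrightarrow> 0" by simp
  have "area_above (s + 2 * K * sqrt a) \<le> a * (1 / 4) ^ k" for k using le[of k] by (simp add: power_one_over)
  then have A0: "area_above (s + 2 * K * sqrt a) \<le> 0" by (intro LIMSEQ_le_const[OF lim]) auto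
  let ?E = "{x\<in>\<Omega>. s + 2 * K * sqrt a < u x}"
  \<comment> \<open>Zero area forces zero measure, whereas a nonempty open superlevel set contains a
    ball.\<close>
  have "measure lborel ?E \<le> 0" using superlevel_measure_le(1)[of "s + 2 * K * sqrt a"] A0 by linarith
  moreover have "x \<in> ?E" using c x by (simp add: K_def a_def)
  moreover obtain r where r: "0 < r" "ball x r \<subseteq> ?E" using superlevel_open[of "s + 2 * K * sqrt a"] \<open>x \<in> ?E\<close> open_contains_ball by blast
  moreover have "measure lborel (ball x r) \<le> measure lborel ?E"
  proof (rule measure_mono_fmeasurable[OF r(2)])
    have "emeasure lborel ?E < \<infinity>" by (rule emeasure_bounded_finite) (rule bounded_subset[OF bdd], auto)
    then show "?E \<in> fmeasurable lborel" by (simp add: fmeasurable_def)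
  qed simp
  ultimately show False using content_ball_pos[OF r(1), of x] by simp
qed

text \<open>The slab between \<open>m + 1\<close> and \<open>m + 2\<close> has height 1, and the
  projections have length at most \<open>2 * R\<close>. The total area reappears on the right, but
  only under a square root, so that \<open>two_sided_bound\<close> can absorb it.\<close>

lemma area_high:
  assumes R: "\<Omega> \<subseteq> ball 0 R" "0 \<le> R"
  shows "area_above (m + 2) \<le> 4 * R * (2 * measure lborel \<Omega> + sqrt Ws * sqrt area)"
proof -
  have l: "measure lborel ((\<lambda>x. x $ i) ` {x\<in>\<Omega>. m + 1 < u x}) \<le> 2 * R" for i
  proof -
    have sub: "(\<lambda>x. x $ i) ` {x\<in>\<Omega>. m + 1 < u x} \<subseteq> {-R..R}"
    proof
      fix y assume "y \<in> (\<lambda>x. x $ i) ` {x\<in>\<Omega>. m + 1 < u x}"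
      then obtain x where x: "x \<in> \<Omega>" "y = x $ i" by blast
      then have "norm x < R" using R(1) by auto
      then show "y \<in> {-R..R}" using component_le_norm_cart[of x i] x(2) by auto
    qed
    have "measure lborel ((\<lambda>x. x $ i) ` {x\<in>\<Omega>. m + 1 < u x}) \<le> measure lborel {-R..R}"
      by (rule measure_mono_fmeasurable[OF sub _ fmeasurable_compact]) (use open_image_vec_nth[OF superlevel_open] in auto)
    then show ?thesis using R(2) by simp
  qed
  have "area_above (m + 2) \<le> 2 * (2 * R) * (2 / (m + 2 - (m + 1)) * measure lborel {x\<in>\<Omega>. m + 1 < u x} + sqrt Ws * sqrt (area_above (m + 1)))"
    by (intro area_above_slab l) auto
  also have "\<dots> \<le> 2 * (2 * R) * (2 * measure lborel \<Omega> + sqrt Ws * sqrt area)"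
    using superlevel_measure_le(2)[of "m + 1"] area_above_le_area[of "m + 1"] R Ws_nonneg
    by (intro mult_left_mono add_mono) auto
  finally show ?thesis by simp
qed

text \<open>Where |u| is at most \<open>t\<close>, the weight in \<open>vertical_inequality\<close>
  is at least 1 / (1 + t^2); and Q = 1/Q + |grad u|^2 / Q, whose first summand is at most 1.\<close>

lemma area_low:
  "(LBINT x. indicator {x\<in>\<Omega>. \<bar>u x\<bar> \<le> t} x * ar x)
    \<le> measure lborel \<Omega> + (1 + t\<^sup>2) * (pi / 2 * (sqrt (measure lborel \<Omega>) * sqrt Ws + 12 * C\<Omega>))"
proof -
  let ?E = "{x\<in>\<Omega>. \<bar>u x\<bar> \<le> t}"
  have a0: "0 \<le> ar x" for x using ar_ge_1[of x] by linarith
  let ?P = "\<lambda>x. inverse (1 + (u x)\<^sup>2) * ((norm (gr x))\<^sup>2 * Rf (gr x))"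
  have mcb: "(LBINT x. \<bar>mc x\<bar>) \<le> sqrt (measure lborel \<Omega>) * sqrt Ws"
  proof -
    have "(LBINT x. indicator \<Omega> x * \<bar>mc x\<bar>) \<le> sqrt (LBINT x. (indicator \<Omega> x)\<^sup>2) * sqrt (LBINT x. (\<bar>mc x\<bar>)\<^sup>2)"
    proof (rule integral_Cauchy_Schwarz)
      show "integrable lborel (\<lambda>x. (\<bar>mc x\<bar>)\<^sup>2)"
        by (rule Bochner_Integration.integrable_bound[OF mc_sq_integrable])
          (use ar_ge_1 in \<open>auto intro!: AE_I2 simp: abs_mult mult_le_cancel_left1 order_trans[OF zero_le_one]\<close>)
      show "integrable lborel (\<lambda>x. (indicator \<Omega> x :: real)\<^sup>2)"
      proof -
        have "(\<lambda>x. (indicator \<Omega> x :: real)\<^sup>2) = indicator \<Omega>" by (auto simp: indicator_def)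
        then show ?thesis using ind_integrable by simp
      qed
    qed (use open_\<Omega> in auto)
    also have "(LBINT x. (indicator \<Omega> x :: real)\<^sup>2) = measure lborel \<Omega>"
    proof -
      have "(LBINT x. (indicator \<Omega> x :: real)\<^sup>2) = (LBINT x. indicator \<Omega> x)"
        by (rule Bochner_Integration.integral_cong) (auto simp: indicator_def)
      then show ?thesis by simp
    qed
    also have "sqrt (LBINT x. (\<bar>mc x\<bar>)\<^sup>2) \<le> sqrt Ws"
      unfolding Ws_def real_sqrt_le_iff
    proof (rule integral_mono_AE'[OF mc_sq_integrable])
      show "AE x in lborel. (\<bar>mc x\<bar>)\<^sup>2 \<le> (mc x)\<^sup>2 * ar x"
        using mult_left_mono[OF ar_ge_1, of "(mc _)\<^sup>2"] by (intro AE_I2) simp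
    qed (use a0 in auto)
    also have "(LBINT x. indicator \<Omega> x * \<bar>mc x\<bar>) = (LBINT x. \<bar>mc x\<bar>)"
      by (rule Bochner_Integration.integral_cong) (auto simp: indicator_def zero_outside)
    finally show ?thesis by (simp add: mult_left_mono)
  qed
  have iP: "integrable lborel ?P"
  proof (rule integrable_dominated[OF norm_gr_integrable])
    fix x
    have "norm (gr x) * Rf (gr x) \<le> ar x * Rf (gr x)" using norm_le_ar less_imp_le[OF Rf_pos] by (intro mult_right_mono)
    also have "\<dots> = 1" using ar_Rf(1)[of x] by (simp add: mult.commute)
    finally have "norm (gr x) * (norm (gr x) * Rf (gr x)) \<le> norm (gr x) * 1" by (intro mult_left_mono) auto
    then have 1: "(norm (gr x))\<^sup>2 * Rf (gr x) \<le> norm (gr x)" by (simp add: power2_eq_square mult_ac)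
    have 2: "0 \<le> (norm (gr x))\<^sup>2 * Rf (gr x)" using less_imp_le[OF Rf_pos] by simp
    have 3: "0 \<le> inverse (1 + (u x)\<^sup>2)" "inverse (1 + (u x)\<^sup>2) \<le> 1" by (auto simp: inverse_le_1_iff)
    have "?P x \<le> 1 * norm (gr x)" by (rule mult_mono[OF 3(2) 1 _ 2]) simp
    moreover have "0 \<le> ?P x" by (rule mult_nonneg_nonneg[OF 3(1) 2])
    ultimately show "norm (?P x) \<le> norm (norm (gr x))" by simp
  qed measurable
  have "(LBINT x. indicator ?E x * ar x) \<le> (LBINT x. indicator \<Omega> x + (1 + t\<^sup>2) * ?P x)"
  proof (rule integral_mono_AE')
    show "integrable lborel (\<lambda>x. indicator \<Omega> x + (1 + t\<^sup>2) * ?P x)" using ind_integrable iP by simp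
    have P0: "0 \<le> ?P x" for x using less_imp_le[OF Rf_pos[of "gr x"]] by (intro mult_nonneg_nonneg) auto
    show "AE x in lborel. indicator ?E x * ar x \<le> indicator \<Omega> x + (1 + t\<^sup>2) * ?P x"
    proof (rule AE_I2)
      fix x
      have nn: "0 \<le> (1 + t\<^sup>2) * ?P x" by (intro mult_nonneg_nonneg[OF _ P0]) auto
      show "indicator ?E x * ar x \<le> indicator \<Omega> x + (1 + t\<^sup>2) * ?P x"
      proof (cases "x \<in> ?E")
        case True
        then have "(u x)\<^sup>2 \<le> t\<^sup>2" by (metis (mono_tags, lifting) abs_ge_zero mem_Collect_eq power2_abs power_mono)
        then have "1 \<le> (1 + t\<^sup>2) * inverse (1 + (u x)\<^sup>2)" by (simp add: field_simps add_pos_nonneg)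
        then have "1 * ((norm (gr x))\<^sup>2 * Rf (gr x)) \<le> ((1 + t\<^sup>2) * inverse (1 + (u x)\<^sup>2)) * ((norm (gr x))\<^sup>2 * Rf (gr x))"
          using less_imp_le[OF Rf_pos[of "gr x"]] by (intro mult_right_mono) auto
        moreover have "ar x = Rf (gr x) + (norm (gr x))\<^sup>2 * Rf (gr x)"
        proof -
          have "ar x = Rf (gr x) * (1 + (norm (gr x))\<^sup>2)" by (simp add: ar_def Rf_def real_div_sqrt)
          then show ?thesis by (simp add: algebra_simps)
        qed
        ultimately show ?thesis using True Rf_le[of "gr x"] by (simp add: mult.assoc)
      qed (use nn in \<open>auto simp: indicator_def\<close>)
    qed
    show "AE x in lborel. 0 \<le> indicator \<Omega> x + (1 + t\<^sup>2) * ?P x"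
      by (intro AE_I2 add_nonneg_nonneg mult_nonneg_nonneg[OF _ P0]) auto
  qed
  also have "\<dots> = measure lborel \<Omega> + (1 + t\<^sup>2) * (LBINT x. ?P x)" using ind_integrable iP by simp
  also have "\<dots> \<le> measure lborel \<Omega> + (1 + t\<^sup>2) * (pi / 2 * ((LBINT x. \<bar>mc x\<bar>) + 12 * C\<Omega>))"
    using vertical_inequality by (intro add_left_mono mult_left_mono) auto
  also have "\<dots> \<le> measure lborel \<Omega> + (1 + t\<^sup>2) * (pi / 2 * (sqrt (measure lborel \<Omega>) * sqrt Ws + 12 * C\<Omega>))"
    using mcb by (intro add_left_mono mult_left_mono) auto
  finally show ?thesis .
qed

end

section \<open>Sobolev functions and their Borel representatives\<close>

text \<open>Square integrable functions are given Lebesgue measurable on \<Omega>, while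
  convolutions and iterated integrals are taken of Borel functions on the whole space;
  \<open>g\<close> is such a version of \<open>f\<close>, extended by zero.\<close>

definition rep :: "'a::euclidean_space set \<Rightarrow> ('a \<Rightarrow> real) \<Rightarrow> ('a \<Rightarrow> real) \<Rightarrow> bool" where
  "rep \<Omega> f g \<longleftrightarrow> g \<in> borel_measurable borel \<and> (\<forall>x. x \<notin> \<Omega> \<longrightarrow> g x = 0) \<and> (AE x in lebesgue. x \<in> \<Omega> \<longrightarrow> f x = g x)"

lemma rep_exists:
  assumes S: "\<Omega> \<in> sets borel" and f: "f \<in> borel_measurable (lebesgue_on \<Omega>)"
  shows "\<exists>g. rep \<Omega> f g"
proof -
  have "(\<lambda>x. indicator \<Omega> x *\<^sub>R f x) \<in> borel_measurable lebesgue"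
    using f S by (subst borel_measurable_restrict_space_iff[symmetric]) auto
  then obtain g where g: "g \<in> borel_measurable borel" "AE x in lebesgue. indicator \<Omega> x *\<^sub>R f x = g x"
    by (rule borel_representative)
  have "rep \<Omega> f (\<lambda>x. indicator \<Omega> x * g x)" unfolding rep_def
  proof (intro conjI)
    show "(\<lambda>x. indicator \<Omega> x * g x) \<in> borel_measurable borel" using g(1) S by measurable
    show "AE x in lebesgue. x \<in> \<Omega> \<longrightarrow> f x = indicator \<Omega> x * g x" using g(2) by eventually_elim auto
  qed simp
  then show ?thesis by blast
qed

lemma rep_AE: "rep \<Omega> f g \<Longrightarrow> AE x in lebesgue. indicator \<Omega> x * f x = g x"
  unfolding rep_def by (elim conjE, erule AE_mp, intro AE_I2) (auto simp: indicator_def)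

lemma rep_measurable:
  assumes S: "\<Omega> \<in> sets borel" and r: "rep \<Omega> f g"
  shows "f \<in> borel_measurable (lebesgue_on \<Omega>)" "(\<lambda>x. indicator \<Omega> x * f x) \<in> borel_measurable lebesgue"
proof -
  have "g \<in> borel_measurable lebesgue" using r by (auto simp: rep_def intro: measurable_completion)
  then show 1: "(\<lambda>x. indicator \<Omega> x * f x) \<in> borel_measurable lebesgue"
    by (rule borel_measurable_AE) (use rep_AE[OF r] in \<open>auto elim: AE_mp\<close>)
  then show "f \<in> borel_measurable (lebesgue_on \<Omega>)"
    using S by (subst borel_measurable_restrict_space_iff) auto
qed

lemma rep_integral:
  assumes S: "\<Omega> \<in> sets borel" and r: "rep \<Omega> f g"
  shows "(\<integral>x. f x \<partial>(lebesgue_on \<Omega>)) = (LBINT x. g x)" "integrable (lebesgue_on \<Omega>) f \<longleftrightarrow> integrable lborel g"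
proof -
  have S': "\<Omega> \<in> sets lebesgue" using S by auto
  have g: "g \<in> borel_measurable borel" using r by (simp add: rep_def)
  note * = lebesgue_eq_lborel_integral[OF rep_AE[OF r] g rep_measurable(2)[OF S r]]
  show "(\<integral>x. f x \<partial>(lebesgue_on \<Omega>)) = (LBINT x. g x)" "integrable (lebesgue_on \<Omega>) f \<longleftrightarrow> integrable lborel g"
    using * lebesgue_on_integral_eq[OF S', of f] by simp_all
qed

lemma rep_mult:
  assumes "rep \<Omega> f g" "rep \<Omega> f' g'"
  shows "rep \<Omega> (\<lambda>x. f x * f' x) (\<lambda>x. g x * g' x)"
  using assms unfolding rep_def by (auto elim!: AE_mp)

lemma rep_mult_borel:
  assumes "rep \<Omega> f g" "k \<in> borel_measurable borel"
  shows "rep \<Omega> (\<lambda>x. f x * k x) (\<lambda>x. g x * k x)"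
  using assms unfolding rep_def by (auto elim!: AE_mp)

lemma rep_diff:
  assumes "rep \<Omega> f g" "rep \<Omega> f' g'"
  shows "rep \<Omega> (\<lambda>x. f x - f' x) (\<lambda>x. g x - g' x)"
  using assms unfolding rep_def by (auto elim!: AE_mp)

lemma rep_L2: "\<Omega> \<in> sets borel \<Longrightarrow> f \<in> L2 \<Omega> \<Longrightarrow> \<exists>g. rep \<Omega> f g \<and> integrable lborel (\<lambda>x. (g x)\<^sup>2)"
proof -
  assume S: "\<Omega> \<in> sets borel" and f: "f \<in> L2 \<Omega>"
  then obtain g where g: "rep \<Omega> f g" using rep_exists by (auto simp: L2_def)
  from rep_integral(2)[OF S rep_mult[OF g g]] f have "integrable lborel (\<lambda>x. (g x)\<^sup>2)"
    by (simp add: L2_def power2_eq_square)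
  with g show ?thesis by blast
qed

lemma test_function_borel: "test_function \<Omega> \<eta> \<Longrightarrow> \<eta> \<in> borel_measurable borel"
  by (intro borel_measurable_continuous_onI test_function_continuous)

lemma rep_wder:
  assumes S: "\<Omega> \<in> sets borel" and w: "has_weak_partial \<Omega> b f g" and r: "rep \<Omega> f f'" "rep \<Omega> g g'" and b: "b \<in> Basis"
  shows "wder \<Omega> b f' g'"
  unfolding wder_def
proof (intro allI impI)
  fix \<eta> assume t: "test_function \<Omega> \<eta>"
  have "(\<integral>x. f x * frechet_derivative \<eta> (at x) b \<partial>(lebesgue_on \<Omega>)) = - (\<integral>x. g x * \<eta> x \<partial>(lebesgue_on \<Omega>))"
    using w t by (auto simp: has_weak_partial_def)
  then show "(LBINT x. f' x * frechet_derivative \<eta> (at x) b) = - (LBINT x. g' x * \<eta> x)"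
    using rep_integral(1)[OF S rep_mult_borel[OF r(1) test_function_borel[OF test_function_pd[OF t b]]]]
      rep_integral(1)[OF S rep_mult_borel[OF r(2) test_function_borel[OF t]]] by simp
qed

lemma rep_subset:
  assumes "rep \<Omega> f g" "S \<subseteq> \<Omega>" "S \<in> sets borel"
  shows "rep S f (\<lambda>x. indicator S x * g x)"
  using assms unfolding rep_def by (auto elim!: AE_mp)

lemma rep_locally_integrable:
  assumes r: "rep \<Omega> f g" and g: "integrable lborel g"
  shows "locally_integrable_on f \<Omega>"
  unfolding locally_integrable_on_def
proof (intro allI impI)
  fix K assume K: "compact K \<and> K \<subseteq> \<Omega>"
  then have K': "K \<in> sets borel" by (auto intro: borel_compact)
  have "integrable lborel (\<lambda>x. indicator K x *\<^sub>R g x)" using g K' by (intro integrable_mult_indicator) auto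
  then show "integrable (lebesgue_on K) f"
    using rep_integral(2)[OF K' rep_subset[OF r _ K']] K by simp
qed

lemma rep_weak:
  assumes S: "\<Omega> \<in> sets borel" and w: "wder \<Omega> b f' g'" and r: "rep \<Omega> f f'" "rep \<Omega> g g'"
    and i: "integrable lborel f'" "integrable lborel g'" and b: "b \<in> Basis"
  shows "has_weak_partial \<Omega> b f g"
  unfolding has_weak_partial_def
proof (intro conjI allI impI)
  show "locally_integrable_on f \<Omega>" "locally_integrable_on g \<Omega>"
    using rep_locally_integrable r i by blast+
  fix \<eta> assume t: "test_function \<Omega> \<eta>"
  have "(LBINT x. f' x * frechet_derivative \<eta> (at x) b) = - (LBINT x. g' x * \<eta> x)"
    using w t by (auto simp: wder_def)
  then show "(\<integral>x. f x * frechet_derivative \<eta> (at x) b \<partial>(lebesgue_on \<Omega>)) = - (\<integral>x. g x * \<eta> x \<partial>(lebesgue_on \<Omega>))"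
    using rep_integral(1)[OF S rep_mult_borel[OF r(1) test_function_borel[OF test_function_pd[OF t b]]]]
      rep_integral(1)[OF S rep_mult_borel[OF r(2) test_function_borel[OF t]]] by simp
qed

text \<open>Continuity makes the extension of \<open>u\<close> by zero a Borel function, so the
  values of \<open>u\<close> are kept on all of \<Omega>; only its derivatives are replaced by Borel
  versions.\<close>

lemma sobolev_graph_exists:
  fixes u :: "real^2 \<Rightarrow> real"
  assumes \<Omega>: "open \<Omega>" "bounded \<Omega>" and u: "u \<in> Hsob 2 \<Omega>" "continuous_on \<Omega> u"
  shows "\<exists>gr h. sobolev_graph \<Omega> (\<lambda>x. indicator \<Omega> x * u x) gr h"
proof -
  have S: "\<Omega> \<in> sets borel" using \<Omega>(1) by simp
  have ax: "axis i (1::real) \<in> (Basis :: (real^2) set)" for i by (rule axis_in_Basis2)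
  have H: "u \<in> L2 \<Omega>" "\<And>i. \<exists>g. g \<in> L2 \<Omega> \<and> has_weak_partial \<Omega> (axis i 1) u g \<and>
      (\<forall>j. \<exists>h. h \<in> L2 \<Omega> \<and> has_weak_partial \<Omega> (axis j 1) g h)"
  proof -
    have H2: "u \<in> L2 \<Omega>" "\<forall>b\<in>Basis. \<exists>g. (g \<in> L2 \<Omega> \<and> (\<forall>b\<in>Basis. \<exists>h\<in>L2 \<Omega>. has_weak_partial \<Omega> b g h)) \<and> has_weak_partial \<Omega> b u g"
      using u(1) by (simp_all add: numeral_2_eq_2 Bex_def)
    show "u \<in> L2 \<Omega>" by (rule H2(1))
    fix i :: 2
    obtain g where g: "g \<in> L2 \<Omega>" "\<forall>b\<in>Basis. \<exists>h\<in>L2 \<Omega>. has_weak_partial \<Omega> b g h" "has_weak_partial \<Omega> (axis i 1) u g"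
      using bspec[OF H2(2) ax[of i]] by (elim exE conjE)
    have "\<exists>h. h \<in> L2 \<Omega> \<and> has_weak_partial \<Omega> (axis j 1) g h" for j :: 2 using bspec[OF g(2) ax[of j]] by (simp add: Bex_def)
    then have "g \<in> L2 \<Omega> \<and> has_weak_partial \<Omega> (axis i 1) u g \<and>
      (\<forall>j. \<exists>h. h \<in> L2 \<Omega> \<and> has_weak_partial \<Omega> (axis j 1) g h)" using g(1,3) by simp
    then show "\<exists>g. g \<in> L2 \<Omega> \<and> has_weak_partial \<Omega> (axis i 1) u g \<and>
      (\<forall>j. \<exists>h. h \<in> L2 \<Omega> \<and> has_weak_partial \<Omega> (axis j 1) g h)" by - (rule exI[of _ g])
  qed
  let ?u = "\<lambda>x. indicator \<Omega> x * u x"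
  have ub: "?u \<in> borel_measurable borel"
    using borel_measurable_continuous_on_indicator[OF _ u(2)] S by simp
  have ru: "rep \<Omega> u ?u" unfolding rep_def using ub by auto
  have iu2: "integrable lborel (\<lambda>x. (?u x)\<^sup>2)"
    using rep_integral(2)[OF S rep_mult[OF ru ru]] H(1) by (simp add: L2_def power2_eq_square)
  have "\<exists>G. \<forall>i. G i \<in> L2 \<Omega> \<and> has_weak_partial \<Omega> (axis i 1) u (G i) \<and>
      (\<forall>j. \<exists>h. h \<in> L2 \<Omega> \<and> has_weak_partial \<Omega> (axis j 1) (G i) h)" using H(2) by (intro choice allI)
  then obtain G where G: "\<And>i. G i \<in> L2 \<Omega>" "\<And>i. has_weak_partial \<Omega> (axis i 1) u (G i)"
    "\<And>i j. \<exists>h. h \<in> L2 \<Omega> \<and> has_weak_partial \<Omega> (axis j 1) (G i) h" by blast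
  define HH where "HH i j = (SOME h. h \<in> L2 \<Omega> \<and> has_weak_partial \<Omega> (axis j 1) (G i) h)" for i j
  have HH: "HH i j \<in> L2 \<Omega>" "has_weak_partial \<Omega> (axis j 1) (G i) (HH i j)" for i j
    unfolding HH_def using someI_ex[OF G(3)[of j i]] by blast+
  obtain g where g: "\<And>i. rep \<Omega> (G i) (g i)" "\<And>i. integrable lborel (\<lambda>x. (g i x)\<^sup>2)"
    using rep_L2[OF S G(1)] by metis
  obtain h where h: "\<And>i j. rep \<Omega> (HH i j) (h i j)" "\<And>i j. integrable lborel (\<lambda>x. (h i j x)\<^sup>2)"
    using rep_L2[OF S HH(1)] by metis
  have g': "g i \<in> borel_measurable borel" "\<And>x. x \<notin> \<Omega> \<Longrightarrow> g i x = 0" for i using g(1)[of i] by (auto simp: rep_def)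
  have "sobolev_graph \<Omega> ?u (\<lambda>x. \<chi> i. g i x) h"
  proof
    show "continuous_on \<Omega> ?u" using u(2) by (subst continuous_on_cong[where g = u]) auto
    show "integrable lborel ?u" by (rule square_integrable_integrable[OF \<Omega>(2) S ub _ iu2]) simp
    show "(\<lambda>x. \<chi> i. g i x) \<in> borel_measurable borel"
      using g'(1) by (subst borel_measurable_euclidean_space) (auto simp: Basis_2 inner_axis)
    show "(\<chi> i. g i x) = 0" if "x \<notin> \<Omega>" for x using g'(2)[OF that] by (simp add: vec_eq_iff)
    have "(norm (\<chi> i. g i x :: real^2))\<^sup>2 = (g 1 x)\<^sup>2 + (g 2 x)\<^sup>2" for x
      using norm_2_neq[of 1 2 "\<chi> i. g i x"] by simp
    then show "integrable lborel (\<lambda>x. (norm (\<chi> i. g i x :: real^2))\<^sup>2)" using g(2) by simp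
    show "h i j \<in> borel_measurable borel" "\<And>x. x \<notin> \<Omega> \<Longrightarrow> h i j x = 0" for i j using h(1)[of i j] by (auto simp: rep_def)
    show "wder \<Omega> (axis i 1) ?u (\<lambda>x. (\<chi> i. g i x) $ i)" for i
      using rep_wder[OF S G(2) ru g(1) ax] by simp
    show "wder \<Omega> (axis j 1) (\<lambda>x. (\<chi> i. g i x) $ i) (h i j)" for i j
      using rep_wder[OF S HH(2) g(1) h(1) ax] by simp
  qed (use \<Omega> h(2) in auto)
  then show ?thesis by blast
qed

section \<open>Identification with the weak gradient, the mean curvature and the energy\<close>

context sobolev_graph
begin

lemma fdiv_integrable: "integrable lborel (fdiv k)"
proof (rule integrable_dominated[of "\<lambda>x. 2 * hsum x"])
  show "integrable lborel (\<lambda>x. 2 * hsum x)" using hsum_integrable by simp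
  fix x
  have hs: "\<bar>h i j x\<bar> \<le> hsum x" "\<bar>h 1 k x\<bar> + \<bar>h 2 k x\<bar> \<le> hsum x" for i j
    using exhaust_2[of i] exhaust_2[of j] exhaust_2[of k] by (auto simp: hsum_def sum_2)
  have m1: "\<bar>a * b\<bar> \<le> \<bar>b\<bar>" if "\<bar>a\<bar> \<le> 1" for a b :: real using that by (simp add: abs_mult mult_left_le_one_le)
  have F: "\<bar>Ff i (gr x)\<bar> \<le> 1" "\<bar>Rf (gr x)\<bar> \<le> 1" for i by (rule Ff_le) (use Rf_le[of "gr x"] Rf_pos[of "gr x"] in linarith)
  have "\<bar>Rf (gr x) * h k k x\<bar> \<le> hsum x" using m1[OF F(2)] hs(1) order_trans by blast
  moreover have "\<bar>Rf (gr x) * Ff k (gr x) * (Ff 1 (gr x) * h 1 k x + Ff 2 (gr x) * h 2 k x)\<bar> \<le> hsum x"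
  proof -
    have "\<bar>Rf (gr x) * (Ff k (gr x) * (Ff 1 (gr x) * h 1 k x + Ff 2 (gr x) * h 2 k x))\<bar>
        \<le> \<bar>Ff 1 (gr x) * h 1 k x + Ff 2 (gr x) * h 2 k x\<bar>"
      using m1[OF F(2)] m1[OF F(1)] order_trans by blast
    also have "\<dots> \<le> \<bar>h 1 k x\<bar> + \<bar>h 2 k x\<bar>"
      using m1[OF F(1), of 1 "h 1 k x"] m1[OF F(1), of 2 "h 2 k x"] by linarith
    finally show ?thesis using hs(2) by (simp add: mult.assoc)
  qed
  ultimately show "norm (fdiv k x) \<le> norm (2 * hsum x)"
    using hsum_nonneg[of x] unfolding fdiv_def real_norm_def by linarith
qed (use fdiv_meas in simp)

text \<open>The vertical identity with \<theta> = 1 and the test function itself as cutoff is the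
  weak chain rule for the normalised gradient.\<close>

lemma wder_Ff: "wder \<Omega> (axis k 1) (\<lambda>x. Ff k (gr x)) (fdiv k)"
  unfolding wder_def
proof (intro allI impI)
  fix \<eta> assume t: "test_function \<Omega> \<eta>"
  obtain \<eta>' where \<eta>': "\<And>x. GDERIV \<eta> x :> \<eta>' x" using test_function_GDERIV[OF t] by blast
  have fr: "frechet_derivative \<eta> (at x) (axis i 1) = \<eta>' x $ i" for x i
    using GDERIV_frechet[OF \<eta>'] by (simp add: inner_axis)
  have ax: "axis i (1::real) \<in> (Basis :: (real^2) set)" for i by (rule axis_in_Basis2)
  have c': "continuous_on UNIV \<eta>'"
  proof -
    have "continuous_on UNIV (\<lambda>x. \<eta>' x $ i)" for i
      using test_function_continuous[OF test_function_pd[OF t ax], of UNIV i] by (simp add: fr)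
    then have "continuous_on UNIV (\<lambda>x. \<chi> i. \<eta>' x $ i)" by (intro continuous_on_vec_lambda)
    then show ?thesis by simp
  qed
  have K: "compact (closure {x. \<eta> x \<noteq> 0})" "closure {x. \<eta> x \<noteq> 0} \<subseteq> \<Omega>" using t by (auto simp: test_function_def)
  have "\<eta> x = 0" if "x \<notin> closure {x. \<eta> x \<noteq> 0}" for x using that closure_subset[of "{x. \<eta> x \<noteq> 0}"] by auto
  then have cut: "cutoff \<Omega> (closure {x. \<eta> x \<noteq> 0}) \<eta> \<eta>'" unfolding cutoff_def using K \<eta>' c' by blast
  have th: "C1b (\<lambda>_. 1) (\<lambda>_. 0)" by (auto simp: C1b_def intro!: exI[of _ 1])
  have 0: "(LBINT x. \<eta> x * fdiv k x + \<eta>' x $ k * Ff k (gr x)) = 0"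
    using vertical_identity(1)[OF cut th, of k] by simp
  obtain B where B: "\<And>x. \<bar>\<eta> x\<bar> \<le> B" using test_function_uniform(2)[OF t] by blast
  have i1: "integrable lborel (\<lambda>x. \<eta> x * fdiv k x)"
    by (rule bounded_mult_integrable[OF fdiv_integrable test_function_borel[OF t] B])
  have "integrable lborel (\<lambda>x. (\<eta> x * fdiv k x + \<eta>' x $ k * Ff k (gr x)) - \<eta> x * fdiv k x)"
    using vertical_identity(2)[OF cut th, of k] by (intro Bochner_Integration.integrable_diff i1) simp
  then have i2: "integrable lborel (\<lambda>x. \<eta>' x $ k * Ff k (gr x))" by simp
  show "(LBINT x. Ff k (gr x) * frechet_derivative \<eta> (at x) (axis k 1)) = - (LBINT x. fdiv k x * \<eta> x)"
    using 0 Bochner_Integration.integral_add[OF i1 i2] by (simp add: fr mult.commute)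
qed

text \<open>\<open>v\<close> is the function as given, equal to the extended \<open>u\<close> on
  \<Omega>. Its weak gradient and mean curvature are defined by a choice, so they can be compared
  with the Borel data only almost everywhere.\<close>

context
  fixes v :: "real^2 \<Rightarrow> real" assumes v: "\<And>x. x \<in> \<Omega> \<Longrightarrow> v x = u x"
begin

lemma weak_grad_AE: "AE x in lebesgue. x \<in> \<Omega> \<longrightarrow> weak_grad \<Omega> v x = gr x"
proof -
  have S: "\<Omega> \<in> sets borel" using open_\<Omega> by simp
  have ax: "axis i (1::real) \<in> (Basis :: (real^2) set)" for i by (rule axis_in_Basis2)
  have r: "rep \<Omega> v u" using v u_meas u(3) by (auto simp: rep_def)
  have rg: "rep \<Omega> (\<lambda>x. gr x $ i) (\<lambda>x. gr x $ i)" for i using grj_meas gr0 by (auto simp: rep_def)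
  have "has_weak_partial \<Omega> (axis i 1) v (\<lambda>x. gr x $ i)" for i
    by (rule rep_weak[OF S wgr r rg u(2) gr_integrable ax])
  from weak_partial_AE[OF open_\<Omega> this]
  have "AE x in lebesgue. x \<in> \<Omega> \<longrightarrow> weak_partial \<Omega> (axis i 1) v x = gr x $ i" for i .
  from this[of 1] this[of 2] show ?thesis
  proof eventually_elim
    case (elim x)
    show ?case
    proof
      assume "x \<in> \<Omega>"
      then have "weak_partial \<Omega> (axis i 1) v x = gr x $ i" for i using elim exhaust_2[of i] by auto
      then show "weak_grad \<Omega> v x = gr x" by (simp add: weak_grad_def sum_Basis_2 vec_eq_iff)
    qed
  qed
qed

lemma area_element_AE: "AE x in lebesgue. x \<in> \<Omega> \<longrightarrow> area_element \<Omega> v x = ar x"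
  using weak_grad_AE by eventually_elim (simp add: area_element_def ar_def)

lemma mean_curvature_AE: "AE x in lebesgue. x \<in> \<Omega> \<longrightarrow> mean_curvature \<Omega> v x = mc x"
proof -
  have S: "\<Omega> \<in> sets borel" using open_\<Omega> by simp
  have ax: "axis i (1::real) \<in> (Basis :: (real^2) set)" for i by (rule axis_in_Basis2)
  let ?F = "\<lambda>i x. (weak_grad \<Omega> v x /\<^sub>R area_element \<Omega> v x) \<bullet> axis i 1"
  have "rep \<Omega> (?F i) (\<lambda>x. Ff i (gr x))" for i
    unfolding rep_def
  proof (intro conjI allI impI)
    show "Ff i (gr x) = 0" if "x \<notin> \<Omega>" for x using gr0[OF that] by (simp add: Ff_def)
    show "AE x in lebesgue. x \<in> \<Omega> \<longrightarrow> ?F i x = Ff i (gr x)"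
      using weak_grad_AE area_element_AE
      by eventually_elim (auto simp: Ff_def Rf_def ar_def inner_axis divide_inverse)
  qed (rule Ff_meas)
  moreover have "rep \<Omega> (fdiv i) (fdiv i)" for i using fdiv_meas h0 by (auto simp: rep_def fdiv_def)
  ultimately have "has_weak_partial \<Omega> (axis i 1) (?F i) (fdiv i)" for i
    by (rule rep_weak[OF S wder_Ff _ _ Ff_integrable fdiv_integrable ax])
  from weak_partial_AE[OF open_\<Omega> this]
  have "AE x in lebesgue. x \<in> \<Omega> \<longrightarrow> weak_partial \<Omega> (axis i 1) (?F i) x = fdiv i x" for i .
  from this[of 1] this[of 2] show ?thesis
  proof eventually_elim
    case (elim x)
    have "inj (\<lambda>i::2. axis i (1::real) :: real^2)" by (auto simp: inj_def axis_eq_axis)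
    then show ?case using elim by (auto simp: mean_curvature_def weak_div_def Basis_2 sum.reindex sum_2 mc_def)
  qed
qed

lemma area_transfer: "(\<integral>x. area_element \<Omega> v x \<partial>(lebesgue_on \<Omega>)) = area"
  unfolding area_def
proof (rule rep_integral(1))
  show "rep \<Omega> (area_element \<Omega> v) (\<lambda>x. indicator \<Omega> x * ar x)"
    unfolding rep_def
  proof (intro conjI)
    show "(\<lambda>x. indicator \<Omega> x * ar x) \<in> borel_measurable borel" using open_\<Omega> by (intro borel_measurable_times borel_measurable_indicator ar_meas) simp
    show "AE x in lebesgue. x \<in> \<Omega> \<longrightarrow> area_element \<Omega> v x = indicator \<Omega> x * ar x"
      using area_element_AE by eventually_elim simp
  qed simp
qed (use open_\<Omega> in simp)

lemma W0_transfer: "W0 \<Omega> v = Ws / 4"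
proof -
  have "rep \<Omega> (\<lambda>x. (mean_curvature \<Omega> v x)\<^sup>2 * area_element \<Omega> v x) (\<lambda>x. (mc x)\<^sup>2 * ar x)"
    unfolding rep_def
  proof (intro conjI allI impI)
    show "(mc x)\<^sup>2 * ar x = 0" if "x \<notin> \<Omega>" for x using h0[OF that] by (simp add: mc_def fdiv_def)
    show "AE x in lebesgue. x \<in> \<Omega> \<longrightarrow> (mean_curvature \<Omega> v x)\<^sup>2 * area_element \<Omega> v x = (mc x)\<^sup>2 * ar x"
      using mean_curvature_AE area_element_AE by eventually_elim simp
  qed simp
  from rep_integral(1)[OF _ this] show ?thesis using open_\<Omega> by (simp add: W0_def Ws_def)
qed

end

text \<open>Reflection of the graph, which turns upper bounds into lower bounds.\<close>

lemma neg_graph: "sobolev_graph \<Omega> (\<lambda>x. - u x) (\<lambda>x. - gr x) (\<lambda>i j x. - h i j x)"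
proof
  show "wder \<Omega> (axis i 1) (\<lambda>x. - u x) (\<lambda>x. (- gr x) $ i)" for i using wgr[of i] by (simp add: wder_def)
  show "wder \<Omega> (axis j 1) (\<lambda>x. (- gr x) $ i) (\<lambda>x. - h i j x)" for i j using wh[of j i] by (simp add: wder_def)
  show "(\<lambda>x. - gr x) \<in> borel_measurable borel" using gr_meas by measurable
  show "continuous_on \<Omega> (\<lambda>x. - u x)" using u(1) by (intro continuous_intros)
qed (use open_\<Omega> bdd u gr0 gr2 h_meas h0 h2 in auto)

end

section \<open>From the boundary condition to decay in the boundary layer\<close>

lemma test_function_weak_partial:
  fixes \<eta> :: "'a::euclidean_space \<Rightarrow> real"
  assumes S: "\<Omega> \<in> sets borel" and t: "test_function \<Omega> \<eta>" and b: "b \<in> Basis"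
  shows "has_weak_partial \<Omega> b \<eta> (\<lambda>x. frechet_derivative \<eta> (at x) b)"
proof -
  have supp: "\<zeta> x = 0" if "test_function \<Omega> \<zeta>" "x \<notin> \<Omega>" for \<zeta> :: "'a \<Rightarrow> real" and x
    using that closure_subset[of "{x. \<zeta> x \<noteq> 0}"] by (auto simp: test_function_def)
  have r: "rep \<Omega> \<zeta> \<zeta>" if "test_function \<Omega> \<zeta>" for \<zeta>
    using test_function_borel[OF that] supp[OF that] by (auto simp: rep_def)
  note t' = test_function_pd[OF t b]
  have "wder \<Omega> b \<eta> (\<lambda>x. frechet_derivative \<eta> (at x) b)"
    unfolding wder_def
  proof (intro allI impI)
    fix \<zeta> assume z: "test_function \<Omega> \<zeta>"
    obtain \<eta>' where \<eta>': "\<And>x. GDERIV \<eta> x :> \<eta>' x" using test_function_GDERIV[OF t] by blast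
    obtain \<zeta>' where \<zeta>': "\<And>x. GDERIV \<zeta> x :> \<zeta>' x" using test_function_GDERIV[OF z] by blast
    note fr = GDERIV_frechet[OF \<eta>'] GDERIV_frechet[OF \<zeta>']
    note z' = test_function_pd[OF z b]
    let ?K = "closure {x. \<eta> x \<noteq> 0}"
    have K: "compact ?K" using t by (auto simp: test_function_def)
    have K0: "\<eta> x = 0" if "x \<notin> ?K" for x using that closure_subset[of "{x. \<eta> x \<noteq> 0}"] by auto
    have K0': "frechet_derivative \<eta> (at x) b = 0" if "x \<notin> ?K" for x
      using GDERIV_frechet[OF support_pd[OF that], of b] by simp
    have A1: "GDERIV (\<lambda>x. \<eta> x * \<zeta> x) x :> \<eta> x *\<^sub>R \<zeta>' x + \<zeta> x *\<^sub>R \<eta>' x" for x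
      by (rule GDERIV_mult[OF \<eta>' \<zeta>'])
    have A2: "continuous_on UNIV (\<lambda>x. (\<eta> x *\<^sub>R \<zeta>' x + \<zeta> x *\<^sub>R \<eta>' x) \<bullet> b)"
      unfolding inner_add_left inner_scaleR_left fr[symmetric]
      by (intro continuous_on_add continuous_on_mult test_function_continuous[OF t] test_function_continuous[OF z]
          test_function_continuous[OF t'] test_function_continuous[OF z'])
    have A3: "\<eta> x * \<zeta> x = 0" if "x \<notin> ?K" for x by (rule disjE[OF disjI1[OF K0[OF that]]]) simp_all
    have 0: "(LBINT x. (\<eta> x *\<^sub>R \<zeta>' x + \<zeta> x *\<^sub>R \<eta>' x) \<bullet> b) = 0"
      using integral_pd_zero(2)[OF K open_UNIV subset_UNIV A3 A1 b A2]
      by simp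
    have i: "integrable lborel (\<lambda>x. \<eta> x * frechet_derivative \<zeta> (at x) b)"
      by (rule integrable_continuous_compact_support[OF continuous_on_mult[OF test_function_continuous[OF t] test_function_continuous[OF z']] compact_imp_bounded[OF K]])
         (drule K0, erule ssubst, rule mult_zero_left)
    have i': "integrable lborel (\<lambda>x. frechet_derivative \<eta> (at x) b * \<zeta> x)"
      by (rule integrable_continuous_compact_support[OF continuous_on_mult[OF test_function_continuous[OF t'] test_function_continuous[OF z]] compact_imp_bounded[OF K]])
         (drule K0', simp)
    show "(LBINT x. \<eta> x * frechet_derivative \<zeta> (at x) b) = - (LBINT x. frechet_derivative \<eta> (at x) b * \<zeta> x)"
      using 0 Bochner_Integration.integral_add[OF i i'] by (simp add: fr inner_add_left mult.commute)
  qed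
  then show ?thesis
    by (rule rep_weak[OF S _ r[OF t] r[OF t'] test_function_uniform(3)[OF t] test_function_uniform(3)[OF t'] b])
qed

lemma has_weak_partial_diff:
  fixes f g :: "'a::euclidean_space \<Rightarrow> real"
  assumes \<Omega>: "open \<Omega>" and f: "has_weak_partial \<Omega> b f f'" and g: "has_weak_partial \<Omega> b g g'" and b: "b \<in> Basis"
  shows "has_weak_partial \<Omega> b (\<lambda>x. f x - g x) (\<lambda>x. f' x - g' x)"
  unfolding has_weak_partial_def
proof (intro conjI allI impI)
  have l: "locally_integrable_on f \<Omega>" "locally_integrable_on f' \<Omega>" "locally_integrable_on g \<Omega>" "locally_integrable_on g' \<Omega>"
    using f g by (auto simp: has_weak_partial_def)
  then show "locally_integrable_on (\<lambda>x. f x - g x) \<Omega>" "locally_integrable_on (\<lambda>x. f' x - g' x) \<Omega>"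
    by (auto simp: locally_integrable_on_def)
  fix \<eta> assume t: "test_function \<Omega> \<eta>"
  note i = locally_integrable_test[OF \<Omega> l(1) test_function_pd[OF t b]] locally_integrable_test[OF \<Omega> l(3) test_function_pd[OF t b]]
    locally_integrable_test[OF \<Omega> l(2) t] locally_integrable_test[OF \<Omega> l(4) t]
  show "(\<integral>x. (f x - g x) * frechet_derivative \<eta> (at x) b \<partial>(lebesgue_on \<Omega>)) = - (\<integral>x. (f' x - g' x) * \<eta> x \<partial>(lebesgue_on \<Omega>))"
    using f g t i by (simp add: left_diff_distrib has_weak_partial_def)
qed

text \<open>The Hardy inequality is available for test functions and is transferred with a test
  function chosen depending on \<epsilon>: an L2 distance below \<epsilon> is an error of the
  desired order \<epsilon>^2, and an H1 distance below 1 keeps the gradient norms bounded.\<close>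

lemma H10_layer:
  assumes \<Omega>: "bounded_C2_domain \<Omega>" and w: "w \<in> H10 \<Omega>"
  shows "\<exists>w' C \<epsilon>0. rep \<Omega> w w' \<and> 0 \<le> C \<and> 0 < \<epsilon>0 \<and> (\<forall>\<epsilon>. 0 < \<epsilon> \<longrightarrow> \<epsilon> < \<epsilon>0 \<longrightarrow>
    (\<integral>\<^sup>+x. indicator (layer \<Omega> \<epsilon>) x * ennreal ((w' x)\<^sup>2) \<partial>lborel) \<le> ennreal (C * \<epsilon>\<^sup>2))"
proof -
  have op: "open \<Omega>" and S: "\<Omega> \<in> sets borel" using \<Omega> by (auto simp: bounded_C2_domain_def)
  have ax: "axis i (1::real) \<in> (Basis :: (real^2) set)" for i by (rule axis_in_Basis2)
  obtain Ch \<epsilon>0 where Ch: "0 < Ch" "0 < \<epsilon>0"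
    "\<And>\<epsilon> \<eta> \<eta>'. 0 < \<epsilon> \<Longrightarrow> \<epsilon> < \<epsilon>0 \<Longrightarrow> (\<And>x. GDERIV \<eta> x :> \<eta>' x) \<Longrightarrow> continuous_on UNIV \<eta>' \<Longrightarrow> (\<And>x. x \<notin> \<Omega> \<Longrightarrow> \<eta> x = 0) \<Longrightarrow>
      (\<integral>\<^sup>+x. indicator (layer \<Omega> \<epsilon>) x * ennreal ((\<eta> x)\<^sup>2) \<partial>lborel)
        \<le> ennreal (Ch * \<epsilon>\<^sup>2) * (\<integral>\<^sup>+x. ennreal ((norm (\<eta>' x))\<^sup>2) \<partial>lborel)"
  proof (rule layer_estimates[OF \<Omega>, folded layer_def])
    fix C e assume h: "0 < C" "0 < e" "\<And>\<epsilon> \<eta> \<eta>'. 0 < \<epsilon> \<Longrightarrow> \<epsilon> < e \<Longrightarrow> (\<And>x. GDERIV \<eta> x :> \<eta>' x) \<Longrightarrow> continuous_on UNIV \<eta>' \<Longrightarrow> (\<And>x. x \<notin> \<Omega> \<Longrightarrow> \<eta> x = 0) \<Longrightarrow>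
      (\<integral>\<^sup>+x. indicator (layer \<Omega> \<epsilon>) x * ennreal ((\<eta> x)\<^sup>2) \<partial>lborel)
        \<le> ennreal (C * \<epsilon>\<^sup>2) * (\<integral>\<^sup>+x. ennreal ((norm (\<eta>' x))\<^sup>2) \<partial>lborel)"
    show thesis by (rule that[OF h])
  qed
  have H: "w \<in> L2 \<Omega>" "\<forall>b\<in>Basis. \<exists>g\<in>L2 \<Omega>. has_weak_partial \<Omega> b w g" using w by (auto simp: H10_def)
  obtain w' where w': "rep \<Omega> w w'" "integrable lborel (\<lambda>x. (w' x)\<^sup>2)" using rep_L2[OF S H(1)] by blast
  define G where "G i = (SOME g. g \<in> L2 \<Omega> \<and> has_weak_partial \<Omega> (axis i 1) w g)" for i :: 2
  have G: "G i \<in> L2 \<Omega>" "has_weak_partial \<Omega> (axis i 1) w (G i)" for i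
  proof -
    have "\<exists>g. g \<in> L2 \<Omega> \<and> has_weak_partial \<Omega> (axis i 1) w g" using H(2) ax[of i] by (simp add: Bex_def)
    from someI_ex[OF this] show "G i \<in> L2 \<Omega>" "has_weak_partial \<Omega> (axis i 1) w (G i)" by (auto simp: G_def)
  qed
  define g where "g i = (SOME g. rep \<Omega> (G i) g \<and> integrable lborel (\<lambda>x. (g x)\<^sup>2))" for i
  have g: "rep \<Omega> (G i) (g i)" "integrable lborel (\<lambda>x. (g i x)\<^sup>2)" for i
    using someI_ex[OF rep_L2[OF S G(1)[of i]]] by (auto simp: g_def)
  have gm [measurable]: "g i \<in> borel_measurable borel" and [measurable]: "w' \<in> borel_measurable borel" for i
    using g(1) w'(1) by (auto simp: rep_def)
  define Gn where "Gn = (LBINT x. (g 1 x)\<^sup>2 + (g 2 x)\<^sup>2)"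
  have Gn0: "0 \<le> Gn" unfolding Gn_def by (rule integral_nonneg_AE) simp
  obtain \<eta> where \<eta>: "\<And>n::nat. test_function \<Omega> (\<eta> n)" "(\<lambda>n. H1_norm \<Omega> (\<lambda>x. \<eta> n x - w x)) \<longlonglongrightarrow> 0"
    using w by (auto simp: H10_def)
  \<comment> \<open>\<open>2 + 2 * Gn\<close> bounds the squared gradient norm of the approximating
    test function; the outer 2 comes from the inequality for the square of a sum.\<close>
  define C where "C = 2 * (1 + Ch * (2 + 2 * Gn))"
  have "(\<integral>\<^sup>+x. indicator (layer \<Omega> \<epsilon>) x * ennreal ((w' x)\<^sup>2) \<partial>lborel) \<le> ennreal (C * \<epsilon>\<^sup>2)" if \<epsilon>: "0 < \<epsilon>" "\<epsilon> < \<epsilon>0" for \<epsilon>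
  proof -
    have "\<forall>\<^sub>F n in sequentially. H1_norm \<Omega> (\<lambda>x. \<eta> n x - w x) < min \<epsilon> 1"
      using order_tendstoD(2)[OF \<eta>(2), of "min \<epsilon> 1"] \<epsilon> by simp
    then obtain n where n: "H1_norm \<Omega> (\<lambda>x. \<eta> n x - w x) < min \<epsilon> 1"
      unfolding eventually_sequentially by auto
    define e where "e = \<eta> n"
    have te: "test_function \<Omega> e" using \<eta>(1) by (simp add: e_def)
    obtain e' where e': "\<And>x. GDERIV e x :> e' x" using test_function_GDERIV[OF te] by blast
    have fr: "frechet_derivative e (at x) (axis i 1) = e' x $ i" for x i
      using GDERIV_frechet[OF e'] by (simp add: inner_axis)
    have ce: "continuous_on UNIV (\<lambda>x. e' x $ i)" for i
      using test_function_continuous[OF test_function_pd[OF te ax], of UNIV i] by (simp add: fr)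
    have ce': "continuous_on UNIV e'"
    proof -
      have "continuous_on UNIV (\<lambda>x. \<chi> i. e' x $ i)" using ce by (intro continuous_on_vec_lambda)
      then show ?thesis by simp
    qed
    have [measurable]: "e \<in> borel_measurable borel" "\<And>i. (\<lambda>x. e' x $ i) \<in> borel_measurable borel"
      using test_function_borel[OF te] borel_measurable_continuous_onI[OF ce] by auto
    have K0: "e x = 0" "e' x = 0" if "x \<notin> closure {x. e x \<noteq> 0}" for x
      using that closure_subset[of "{x. e x \<noteq> 0}"] GDERIV_unique[OF e' support_pd[OF that]] by auto
    have e0: "e x = 0" "e' x = 0" if "x \<notin> \<Omega>" for x using K0[of x] te that by (auto simp: test_function_def)
    have re: "rep \<Omega> e e" using e0 by (auto simp: rep_def)
    let ?d = "\<lambda>x. e x - w x"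
    have "has_weak_partial \<Omega> (axis i 1) ?d (\<lambda>x. e' x $ i - G i x)" for i
      using has_weak_partial_diff[OF op test_function_weak_partial[OF S te ax] G(2) ax, of i] by (simp add: fr)
    note wp = weak_partial_AE[OF op this]
    \<comment> \<open>\<open>H1_norm\<close> refers to chosen weak derivatives; a.e. uniqueness
      replaces them by explicit Borel functions.\<close>
    have "rep \<Omega> (\<lambda>x. (norm (weak_grad \<Omega> ?d x))\<^sup>2) (\<lambda>x. (e' x $ 1 - g 1 x)\<^sup>2 + (e' x $ 2 - g 2 x)\<^sup>2)"
      unfolding rep_def
    proof (intro conjI allI impI)
      have "AE x in lebesgue. x \<in> \<Omega> \<longrightarrow> G i x = g i x" for i using g(1)[of i] by (simp add: rep_def)
      from this[of 1] this[of 2] wp[of 1] wp[of 2]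
      show "AE x in lebesgue. x \<in> \<Omega> \<longrightarrow> (norm (weak_grad \<Omega> ?d x))\<^sup>2 = (e' x $ 1 - g 1 x)\<^sup>2 + (e' x $ 2 - g 2 x)\<^sup>2"
        by eventually_elim (auto simp: weak_grad_def sum_Basis_2 norm_2_neq[of 1 2])
      show "(e' x $ 1 - g 1 x)\<^sup>2 + (e' x $ 2 - g 2 x)\<^sup>2 = 0" if "x \<notin> \<Omega>" for x
        using that g(1) e0[OF that] by (auto simp: rep_def)
    qed measurable
    note 1 = rep_integral(1)[OF S this]
    have "rep \<Omega> (\<lambda>x. (?d x)\<^sup>2) (\<lambda>x. (e x - w' x)\<^sup>2)"
      unfolding power2_eq_square by (intro rep_mult rep_diff re w'(1))
    note 2 = rep_integral(1)[OF S this]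
    define A where "A = (LBINT x. (e x - w' x)\<^sup>2)"
    define B where "B = (LBINT x. (e' x $ 1 - g 1 x)\<^sup>2 + (e' x $ 2 - g 2 x)\<^sup>2)"
    have AB0: "0 \<le> A" "0 \<le> B" unfolding A_def B_def by (rule integral_nonneg_AE, simp)+
    have "sqrt (A + B) < min \<epsilon> 1" using n 1 2 by (simp add: H1_norm_def A_def B_def e_def)
    then have "sqrt A < \<epsilon>" "sqrt B < 1" using AB0 real_sqrt_le_mono[of A "A + B"] real_sqrt_le_mono[of B "A + B"] by linarith+
    then have AB: "A \<le> \<epsilon>\<^sup>2" "B \<le> 1"
      using AB0 \<epsilon>(1) power_mono[of "sqrt A" \<epsilon> 2] by auto
    have c2: "continuous_on UNIV e" by (rule test_function_continuous[OF te])
    have bK: "bounded (closure {x. e x \<noteq> 0})" using te by (auto simp: test_function_def compact_imp_bounded)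
    have ie: "integrable lborel (\<lambda>x. (e x)\<^sup>2)"
      by (rule integrable_continuous_compact_support[OF continuous_on_power[OF c2] bK]) (drule K0(1), simp)
    have ie': "integrable lborel (\<lambda>x. (e' x $ i)\<^sup>2)" for i
      by (rule integrable_continuous_compact_support[OF continuous_on_power[OF ce] bK]) (drule K0(2), simp)
    have sq: "integrable lborel (\<lambda>x. (a x - b x)\<^sup>2)" if "integrable lborel (\<lambda>x. (a x)\<^sup>2)" "integrable lborel (\<lambda>x. (b x)\<^sup>2)"
      "a \<in> borel_measurable borel" "b \<in> borel_measurable borel" for a b :: "real^2 \<Rightarrow> real"
    proof (rule integrable_dominated[of "\<lambda>x. 2 * (a x)\<^sup>2 + 2 * (b x)\<^sup>2"])
      show "integrable lborel (\<lambda>x. 2 * (a x)\<^sup>2 + 2 * (b x)\<^sup>2)" using that by simp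
      show "(\<lambda>x. (a x - b x)\<^sup>2) \<in> borel_measurable lborel" using that(3,4) by simp
      fix x
      have "(a x - b x)\<^sup>2 \<le> 2 * (a x)\<^sup>2 + 2 * (b x)\<^sup>2"
        using zero_le_power2[of "a x + b x"] by (simp add: power2_eq_square algebra_simps)
      then show "norm ((a x - b x)\<^sup>2) \<le> norm (2 * (a x)\<^sup>2 + 2 * (b x)\<^sup>2)" by simp
    qed
    have iB: "integrable lborel (\<lambda>x. (e' x $ i - g i x)\<^sup>2)" for i by (rule sq[OF ie' g(2)]) measurable
    have iA: "integrable lborel (\<lambda>x. (e x - w' x)\<^sup>2)" by (rule sq[OF ie w'(2)]) measurable
    have in': "integrable lborel (\<lambda>x. (norm (e' x))\<^sup>2)" using ie' by (simp add: norm_2_neq[of 1 2])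
    have "(LBINT x. (norm (e' x))\<^sup>2) \<le> (LBINT x. 2 * ((e' x $ 1 - g 1 x)\<^sup>2 + (e' x $ 2 - g 2 x)\<^sup>2) + 2 * ((g 1 x)\<^sup>2 + (g 2 x)\<^sup>2))"
    proof (rule integral_mono[OF in'])
      show "integrable lborel (\<lambda>x. 2 * ((e' x $ 1 - g 1 x)\<^sup>2 + (e' x $ 2 - g 2 x)\<^sup>2) + 2 * ((g 1 x)\<^sup>2 + (g 2 x)\<^sup>2))"
        using iB g(2) by simp
      fix x
      have "a\<^sup>2 \<le> 2 * (a - b)\<^sup>2 + 2 * b\<^sup>2" for a b :: real using zero_le_power2[of "a - 2 * b"] by (simp add: power2_eq_square algebra_simps)
      from this[of "e' x $ 1" "g 1 x"] this[of "e' x $ 2" "g 2 x"]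
      show "(norm (e' x))\<^sup>2 \<le> 2 * ((e' x $ 1 - g 1 x)\<^sup>2 + (e' x $ 2 - g 2 x)\<^sup>2) + 2 * ((g 1 x)\<^sup>2 + (g 2 x)\<^sup>2)"
        by (simp add: norm_2_neq[of 1 2])
    qed
    also have "\<dots> = 2 * B + 2 * Gn" using iB g(2) by (simp add: B_def Gn_def)
    finally have En: "(LBINT x. (norm (e' x))\<^sup>2) \<le> 2 + 2 * Gn" using AB by simp
    have "(\<integral>\<^sup>+x. ennreal ((norm (e' x))\<^sup>2) \<partial>lborel) = ennreal (LBINT x. (norm (e' x))\<^sup>2)"
      by (rule nn_integral_eq_integral[OF in']) simp
    also have "\<dots> \<le> ennreal (2 + 2 * Gn)" using En by (rule ennreal_leI)
    finally have En': "(\<integral>\<^sup>+x. ennreal ((norm (e' x))\<^sup>2) \<partial>lborel) \<le> ennreal (2 + 2 * Gn)" .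
    have lay [measurable]: "layer \<Omega> \<epsilon> \<in> sets borel" by (rule layer_borel[OF op])
    have "(\<integral>\<^sup>+x. indicator (layer \<Omega> \<epsilon>) x * ennreal ((e x)\<^sup>2) \<partial>lborel) \<le> ennreal (Ch * \<epsilon>\<^sup>2) * (\<integral>\<^sup>+x. ennreal ((norm (e' x))\<^sup>2) \<partial>lborel)"
      by (rule Ch(3)[OF \<epsilon> e' ce' e0(1)])
    also have "\<dots> \<le> ennreal (Ch * \<epsilon>\<^sup>2) * ennreal (2 + 2 * Gn)" using En' by (rule mult_left_mono) simp
    also have "\<dots> = ennreal (Ch * \<epsilon>\<^sup>2 * (2 + 2 * Gn))" using Gn0 Ch(1) by (subst ennreal_mult) auto
    finally have E1: "(\<integral>\<^sup>+x. indicator (layer \<Omega> \<epsilon>) x * ennreal ((e x)\<^sup>2) \<partial>lborel) \<le> ennreal (Ch * \<epsilon>\<^sup>2 * (2 + 2 * Gn))" .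
    have "(\<integral>\<^sup>+x. ennreal ((e x - w' x)\<^sup>2) \<partial>lborel) = ennreal A"
      unfolding A_def by (rule nn_integral_eq_integral[OF iA]) simp
    also have "\<dots> \<le> ennreal (\<epsilon>\<^sup>2)" using AB(1) by (rule ennreal_leI)
    finally have E2: "(\<integral>\<^sup>+x. ennreal ((e x - w' x)\<^sup>2) \<partial>lborel) \<le> ennreal (\<epsilon>\<^sup>2)" .
    have "(\<integral>\<^sup>+x. indicator (layer \<Omega> \<epsilon>) x * ennreal ((w' x)\<^sup>2) \<partial>lborel)
        \<le> (\<integral>\<^sup>+x. 2 * (indicator (layer \<Omega> \<epsilon>) x * ennreal ((e x)\<^sup>2)) + 2 * ennreal ((e x - w' x)\<^sup>2) \<partial>lborel)"
    proof (rule nn_integral_mono)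
      fix x
      have "(w' x)\<^sup>2 \<le> 2 * (e x)\<^sup>2 + 2 * (e x - w' x)\<^sup>2"
        using zero_le_power2[of "2 * e x - w' x"] by (simp add: power2_eq_square algebra_simps)
      then have "ennreal ((w' x)\<^sup>2) \<le> ennreal (2 * (e x)\<^sup>2 + 2 * (e x - w' x)\<^sup>2)" by (rule ennreal_leI)
      also have "\<dots> = 2 * ennreal ((e x)\<^sup>2) + 2 * ennreal ((e x - w' x)\<^sup>2)" by (simp add: ennreal_mult)
      finally show "indicator (layer \<Omega> \<epsilon>) x * ennreal ((w' x)\<^sup>2) \<le> 2 * (indicator (layer \<Omega> \<epsilon>) x * ennreal ((e x)\<^sup>2)) + 2 * ennreal ((e x - w' x)\<^sup>2)"
        by (simp add: indicator_def)
    qed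
    also have "\<dots> = 2 * (\<integral>\<^sup>+x. indicator (layer \<Omega> \<epsilon>) x * ennreal ((e x)\<^sup>2) \<partial>lborel) + 2 * (\<integral>\<^sup>+x. ennreal ((e x - w' x)\<^sup>2) \<partial>lborel)"
      by (simp add: nn_integral_add nn_integral_cmult)
    also have "\<dots> \<le> 2 * ennreal (Ch * \<epsilon>\<^sup>2 * (2 + 2 * Gn)) + 2 * ennreal (\<epsilon>\<^sup>2)"
      using E1 E2 by (intro add_mono mult_left_mono) auto
    also have "\<dots> = ennreal (2 * (Ch * \<epsilon>\<^sup>2 * (2 + 2 * Gn)) + 2 * \<epsilon>\<^sup>2)" using Gn0 Ch(1) by (simp add: ennreal_mult)
    also have "\<dots> = ennreal (C * \<epsilon>\<^sup>2)" by (simp add: C_def algebra_simps)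
    finally show ?thesis .
  qed
  moreover have "0 \<le> C" using Ch(1) Gn0 by (simp add: C_def)
  ultimately show ?thesis using w'(1) Ch(2) by blast
qed

text \<open>The set where \<phi> is at least \<open>s\<close> is compact inside \<Omega>, so in thin
  layers \<phi> < s and the positive part of \<open>u - s\<close> is at most |u - \<phi>|, whose
  decay is known. Absolute values in the hypothesis on \<open>w\<close> make it serve
  \<open>u\<close> and \<open>- u\<close> alike.\<close>

lemma trace_from_layer:
  fixes u \<phi> w :: "real^2 \<Rightarrow> real"
  assumes \<Omega>: "open \<Omega>" "bounded \<Omega>" and \<phi>: "continuous_on (closure \<Omega>) \<phi>" "\<And>p. p \<in> frontier \<Omega> \<Longrightarrow> \<phi> p \<le> m"
    and w: "AE x in lborel. x \<in> \<Omega> \<longrightarrow> \<bar>u x - \<phi> x\<bar> = \<bar>w x\<bar>"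
    and layer: "0 \<le> C" "0 < \<epsilon>0" "\<And>\<epsilon>. 0 < \<epsilon> \<Longrightarrow> \<epsilon> < \<epsilon>0 \<Longrightarrow>
      (\<integral>\<^sup>+x. indicator (layer \<Omega> \<epsilon>) x * ennreal ((w x)\<^sup>2) \<partial>lborel) \<le> ennreal (C * \<epsilon>\<^sup>2)"
    and s: "m < s"
  shows "\<exists>C \<delta>. 0 \<le> C \<and> 0 < \<delta> \<and> (\<forall>\<epsilon>. 0 < \<epsilon> \<longrightarrow> \<epsilon> < \<delta> \<longrightarrow>
      (\<integral>\<^sup>+x. indicator (layer \<Omega> \<epsilon>) x * ennreal ((max 0 (u x - s))\<^sup>2) \<partial>lborel) \<le> ennreal (C * \<epsilon>\<^sup>2))"
proof -
  define P where "P = {x \<in> closure \<Omega>. s \<le> \<phi> x}"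
  have "closed P" using continuous_closed_preimage[OF \<phi>(1) closed_closure closed_atLeast, of s]
    by (simp add: P_def vimage_def Int_def)
  then have P: "compact P" using \<Omega>(2) by (auto simp: compact_eq_bounded_closed P_def intro: bounded_subset[OF bounded_closure[OF \<Omega>(2)]])
  have P\<Omega>: "P \<subseteq> \<Omega>"
  proof
    fix x assume "x \<in> P"
    then have "x \<in> closure \<Omega>" "\<not> \<phi> x \<le> m" using s by (auto simp: P_def)
    then show "x \<in> \<Omega>" using \<phi>(2) \<Omega>(1) by (auto simp: frontier_def interior_open)
  qed
  have ne: "- \<Omega> \<noteq> {}" using \<Omega>(2) not_bounded_UNIV by (metis Compl_empty_eq double_complement)
  obtain \<delta>1 where \<delta>1: "0 < \<delta>1" "\<And>x. x \<in> P \<Longrightarrow> \<delta>1 \<le> infdist x (- \<Omega>)"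
  proof (cases "P = {}")
    case True
    then show ?thesis using that[of 1] by simp
  next
    case False
    have "continuous_on P (\<lambda>x. infdist x (- \<Omega>))" by (intro continuous_intros)
    from continuous_attains_inf[OF P False this]
    obtain y where y: "y \<in> P" "\<And>x. x \<in> P \<Longrightarrow> infdist y (- \<Omega>) \<le> infdist x (- \<Omega>)" by blast
    have "infdist y (- \<Omega>) \<noteq> 0"
      using in_closed_iff_infdist_zero[of "- \<Omega>" y] \<Omega>(1) ne y(1) P\<Omega> by auto
    then have "0 < infdist y (- \<Omega>)" using infdist_nonneg[of y "- \<Omega>"] by linarith
    then show ?thesis by (rule that[OF _ y(2)])
  qed
  have "(\<integral>\<^sup>+x. indicator (layer \<Omega> \<epsilon>) x * ennreal ((max 0 (u x - s))\<^sup>2) \<partial>lborel) \<le> ennreal (C * \<epsilon>\<^sup>2)"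
    if \<epsilon>: "0 < \<epsilon>" "\<epsilon> < min \<epsilon>0 \<delta>1" for \<epsilon>
  proof -
    have "(\<integral>\<^sup>+x. indicator (layer \<Omega> \<epsilon>) x * ennreal ((max 0 (u x - s))\<^sup>2) \<partial>lborel)
        \<le> (\<integral>\<^sup>+x. indicator (layer \<Omega> \<epsilon>) x * ennreal ((w x)\<^sup>2) \<partial>lborel)"
    proof (rule nn_integral_mono_AE)
      show "AE x in lborel. indicator (layer \<Omega> \<epsilon>) x * ennreal ((max 0 (u x - s))\<^sup>2) \<le> indicator (layer \<Omega> \<epsilon>) x * ennreal ((w x)\<^sup>2)"
        using w
      proof eventually_elim
        case (elim x)
        show ?case
        proof (cases "x \<in> layer \<Omega> \<epsilon>")
          case True
          then have x: "x \<in> \<Omega>" "infdist x (- \<Omega>) < \<delta>1" using \<epsilon> by (auto simp: layer_def)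
          then have "x \<notin> P" using \<delta>1(2)[of x] by auto
          then have "\<phi> x < s" using x closure_subset[of \<Omega>] by (auto simp: P_def)
          then have "max 0 (u x - s) \<le> \<bar>w x\<bar>" using elim x by linarith
          then have "(max 0 (u x - s))\<^sup>2 \<le> (w x)\<^sup>2" using power_mono[of "max 0 (u x - s)" "\<bar>w x\<bar>" 2] by simp
          then show ?thesis by (intro mult_left_mono ennreal_leI) auto
        qed simp
      qed
    qed
    also have "\<dots> \<le> ennreal (C * \<epsilon>\<^sup>2)" using layer(3) \<epsilon> by simp
    finally show ?thesis .
  qed
  then show ?thesis using layer(1,2) \<delta>1(1) by (intro exI[of _ C] exI[of _ "min \<epsilon>0 \<delta>1"]) simp
qed

text \<open>A concrete cutoff sequence interprets \<open>cutoff_graph\<close>. The supremum bound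
  starts at level \<open>m + 1\<close> because positive parts decay in the layer only above levels
  strictly larger than \<open>m\<close>.\<close>

lemma (in trace_graph) one_sided_bounds:
  assumes R: "\<Omega> \<subseteq> ball 0 R" "0 \<le> R"
  shows "area_above (m + 2) \<le> 4 * R * (2 * measure lborel \<Omega> + sqrt Ws * sqrt area)"
    "(LBINT x. indicator {x\<in>\<Omega>. \<bar>u x\<bar> \<le> t} x * ar x)
      \<le> measure lborel \<Omega> + (1 + t\<^sup>2) * (pi / 2 * (sqrt (measure lborel \<Omega>) * sqrt Ws + 12 * C\<Omega>))"
    "x \<in> \<Omega> \<Longrightarrow> u x \<le> m + 1 + 2 * (64 * sqrt Ws + 16) * sqrt area"
proof -
  obtain K \<kappa> \<kappa>' where "\<And>n::nat. cutoff \<Omega> (K n) (\<kappa> n) (\<kappa>' n)" "\<And>n x. 0 \<le> \<kappa> n x" "\<And>n x. \<kappa> n x \<le> 1"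
    "\<And>n x. 1 / Suc n \<le> infdist x (- \<Omega>) \<Longrightarrow> \<kappa> n x = 1"
    "\<And>n x. norm (\<kappa>' n x) \<le> 3 * real (Suc n) * indicator (layer \<Omega> (2 / Suc n)) x"
    using cutoff_sequence[OF open_\<Omega> bdd] by blast
  then interpret cutoff_graph \<Omega> u gr h m C\<Omega> \<epsilon>0 K \<kappa> \<kappa>' by unfold_locales
  show "area_above (m + 2) \<le> 4 * R * (2 * measure lborel \<Omega> + sqrt Ws * sqrt area)" by (rule area_high[OF R])
  show "(LBINT x. indicator {x\<in>\<Omega>. \<bar>u x\<bar> \<le> t} x * ar x)
      \<le> measure lborel \<Omega> + (1 + t\<^sup>2) * (pi / 2 * (sqrt (measure lborel \<Omega>) * sqrt Ws + 12 * C\<Omega>))" by (rule area_low)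
  show "u x \<le> m + 1 + 2 * (64 * sqrt Ws + 16) * sqrt area" if "x \<in> \<Omega>"
  proof -
    have "u x \<le> m + 1 + 2 * decay_rate * sqrt (area_above (m + 1))" using that by (intro sup_bound) auto
    also have "\<dots> \<le> m + 1 + 2 * decay_rate * sqrt area"
      using area_above_le_area Ws_nonneg by (intro add_left_mono mult_left_mono real_sqrt_le_mono) (auto simp: decay_rate_def)
    finally show ?thesis by (simp add: decay_rate_def)
  qed
qed

lemma two_sided_bound:
  assumes P: "trace_graph \<Omega> u gr h m C\<Omega> \<epsilon>0"
    and N: "trace_graph \<Omega> (\<lambda>x. - u x) (\<lambda>x. - gr x) (\<lambda>i j x. - h i j x) m C\<Omega> \<epsilon>0"
    and R: "\<Omega> \<subseteq> ball 0 R" "0 \<le> R" and x: "x \<in> \<Omega>"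
    and c: "c = 2 * (16 * R * measure lborel \<Omega> + measure lborel \<Omega>
      + (1 + (m + 2)\<^sup>2) * (pi / 2 * (sqrt (measure lborel \<Omega>) + 12 * C\<Omega>)) + 32 * R\<^sup>2)"
  shows "\<bar>u x\<bar> + sobolev_graph.area \<Omega> gr \<le> (m + 9000 + 2 * c) * (1 + sobolev_graph.Ws gr h)"
proof -
  interpret P: trace_graph \<Omega> u gr h m C\<Omega> \<epsilon>0 by (rule P)
  interpret N: trace_graph \<Omega> "\<lambda>x. - u x" "\<lambda>x. - gr x" "\<lambda>i j x. - h i j x" m C\<Omega> \<epsilon>0 by (rule N)
  have ar: "N.ar = P.ar" by (simp add: fun_eq_iff N.ar_def P.ar_def)
  have fd: "N.fdiv k y = - P.fdiv k y" for k y
    unfolding N.fdiv_def P.fdiv_def Ff_def Rf_def by (simp add: algebra_simps)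
  have W: "N.Ws = P.Ws" by (simp add: N.Ws_def P.Ws_def ar N.mc_def P.mc_def fd power2_eq_square algebra_simps)
  have A: "N.area = P.area" by (simp add: N.area_def P.area_def ar)
  define a W V where "a = P.area" and "W = P.Ws" and "V = measure lborel \<Omega>"
  define k where "k = (1 + (m + 2)\<^sup>2) * (pi / 2)"
  have nn: "0 \<le> a" "0 \<le> W" "0 \<le> V" "0 \<le> k" "0 < C\<Omega>" "0 \<le> m"
    using P.area_nonneg P.Ws_nonneg P.C\<Omega> P.m0 by (auto simp: a_def W_def V_def k_def)
  have sW: "sqrt W \<le> 1 + W" using real_le_lsqrt[of "1 + W" W] nn by (simp add: power2_eq_square algebra_simps)
  have low: "integrable lborel (\<lambda>x. indicator {x\<in>\<Omega>. \<bar>u x\<bar> \<le> m + 2} x * P.ar x)"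
  proof (rule Bochner_Integration.integrable_bound[OF P.ar_integrable])
    have [measurable]: "\<Omega> \<in> sets borel" using P.open_\<Omega> by simp
    show "(\<lambda>x. indicator {x\<in>\<Omega>. \<bar>u x\<bar> \<le> m + 2} x * P.ar x) \<in> borel_measurable lborel"
      by (intro borel_measurable_times borel_measurable_indicator) measurable
    show "AE x in lborel. norm (indicator {x\<in>\<Omega>. \<bar>u x\<bar> \<le> m + 2} x * P.ar x) \<le> norm (indicator \<Omega> x * P.ar x)"
      by (intro AE_I2) (auto simp: indicator_def)
  qed
  have "a \<le> (LBINT x. indicator {x\<in>\<Omega>. m + 2 < u x} x * P.ar x + indicator {x\<in>\<Omega>. m + 2 < - u x} x * P.ar x
      + indicator {x\<in>\<Omega>. \<bar>u x\<bar> \<le> m + 2} x * P.ar x)"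
    unfolding a_def P.area_def
  proof (rule integral_mono[OF P.ar_integrable])
    show "integrable lborel (\<lambda>x. indicator {x\<in>\<Omega>. m + 2 < u x} x * P.ar x + indicator {x\<in>\<Omega>. m + 2 < - u x} x * P.ar x
      + indicator {x\<in>\<Omega>. \<bar>u x\<bar> \<le> m + 2} x * P.ar x)"
      using P.area_above_integrable N.area_above_integrable low by (simp add: ar)
    fix x
    have "0 \<le> P.ar x" using P.ar_ge_1[of x] by linarith
    then show "indicator \<Omega> x * P.ar x \<le> indicator {x\<in>\<Omega>. m + 2 < u x} x * P.ar x + indicator {x\<in>\<Omega>. m + 2 < - u x} x * P.ar x
      + indicator {x\<in>\<Omega>. \<bar>u x\<bar> \<le> m + 2} x * P.ar x" by (auto simp: indicator_def)
  qed
  also have "\<dots> = P.area_above (m + 2) + N.area_above (m + 2) + (LBINT x. indicator {x\<in>\<Omega>. \<bar>u x\<bar> \<le> m + 2} x * P.ar x)"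
    using P.area_above_integrable N.area_above_integrable low by (simp add: ar P.area_above_def N.area_above_def)
  also have "\<dots> \<le> 4 * R * (2 * V + sqrt W * sqrt a) + 4 * R * (2 * V + sqrt W * sqrt a)
      + (V + k * (sqrt V * sqrt W + 12 * C\<Omega>))"
    using P.one_sided_bounds(1)[OF R] N.one_sided_bounds(1)[OF R] P.one_sided_bounds(2)[OF R, of "m + 2"]
    by (intro add_mono) (simp_all add: A W a_def W_def V_def k_def mult_ac)
  finally have 1: "a \<le> 8 * R * (2 * V + sqrt W * sqrt a) + (V + k * (sqrt V * sqrt W + 12 * C\<Omega>))" by simp
  \<comment> \<open>Young's inequality: half of the area is absorbed on the left, and the rest is
    linear in \<open>W\<close>.\<close>
  have "0 \<le> (sqrt a - 8 * R * sqrt W)\<^sup>2" by simp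
  also have "\<dots> = (sqrt a)\<^sup>2 + 64 * R\<^sup>2 * (sqrt W)\<^sup>2 - 16 * R * (sqrt W * sqrt a)"
    by (simp add: power2_eq_square algebra_simps)
  finally have 2: "8 * R * (sqrt W * sqrt a) \<le> a / 2 + 32 * R\<^sup>2 * W" using nn by simp
  have 3: "sqrt V * sqrt W + 12 * C\<Omega> \<le> (sqrt V + 12 * C\<Omega>) * (1 + W)"
    using mult_left_mono[OF sW, of "sqrt V"] mult_nonneg_nonneg[OF less_imp_le[OF nn(5)] nn(2)] nn(1-4) by (simp add: algebra_simps)
  have "k * (sqrt V * sqrt W + 12 * C\<Omega>) \<le> k * (sqrt V + 12 * C\<Omega>) * (1 + W)"
    using mult_left_mono[OF 3 nn(4)] by (simp add: mult.assoc)
  then have "a \<le> 2 * (16 * R * V + V + k * (sqrt V + 12 * C\<Omega>) * (1 + W) + 32 * R\<^sup>2 * W)" using 1 2 by (simp add: algebra_simps)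
  also have "\<dots> \<le> 2 * (16 * R * V * (1 + W) + V * (1 + W) + k * (sqrt V + 12 * C\<Omega>) * (1 + W) + 32 * R\<^sup>2 * (1 + W))"
    using nn R(2) mult_nonneg_nonneg[of "R * V" W] by (intro mult_left_mono add_mono) (auto simp: algebra_simps)
  also have "\<dots> = c * (1 + W)" by (simp add: c k_def V_def field_simps)
  finally have ca: "a \<le> c * (1 + W)" .
  \<comment> \<open>Young's inequality again. The constants become 8192 = 2 * 64^2 and 512 = 2 *
    16^2; 9000 in the conclusion is a round majorant of 8192 and of 513.\<close>
  have "2 * (64 * sqrt W + 16) * sqrt a \<le> (64 * sqrt W + 16)\<^sup>2 + (sqrt a)\<^sup>2" by (rule sum_squares_bound)
  also have "(64 * sqrt W + 16)\<^sup>2 \<le> 2 * (64 * sqrt W)\<^sup>2 + 2 * 16\<^sup>2"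
  proof -
    have "(p + q)\<^sup>2 \<le> 2 * p\<^sup>2 + 2 * q\<^sup>2" for p q :: real
      using zero_le_power2[of "p - q"] by (simp add: power2_eq_square algebra_simps)
    then show ?thesis .
  qed
  finally have 4: "2 * (64 * sqrt W + 16) * sqrt a \<le> 8192 * W + 512 + a" using nn by (simp add: power_mult_distrib)
  have "u x \<le> m + 1 + 2 * (64 * sqrt W + 16) * sqrt a" "- u x \<le> m + 1 + 2 * (64 * sqrt W + 16) * sqrt a"
    using P.one_sided_bounds(3)[OF R x] N.one_sided_bounds(3)[OF R x] by (simp_all add: A W a_def W_def)
  then have "\<bar>u x\<bar> + a \<le> m + 513 + 8192 * W + 2 * a" using 4 by linarith
  also have "\<dots> \<le> m * (1 + W) + 9000 * (1 + W) + 2 * (c * (1 + W))"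
    using ca nn mult_nonneg_nonneg[OF nn(6,2)] unfolding distrib_left by linarith
  also have "\<dots> = (m + 9000 + 2 * c) * (1 + W)" by (simp add: algebra_simps)
  finally show ?thesis by (simp add: a_def W_def)
qed

text \<open>\<phi> enters through its bound \<open>m\<close> on the boundary and through the layer
  decay of \<open>u - \<phi>\<close>. The constants of that decay depend on \<open>u\<close> and
  \<phi>, but they only make cutoff terms vanish in the limit and so do not reach the final
  constant.\<close>

lemma graph_estimate:
  assumes \<Omega>: "bounded_C2_domain \<Omega>" and m: "0 \<le> m"
  shows "\<exists>C. \<forall>\<phi> u x. continuous_on (closure \<Omega>) \<phi> \<longrightarrow> (\<forall>p\<in>frontier \<Omega>. \<bar>\<phi> p\<bar> \<le> m) \<longrightarrow>
    u \<in> Hsob 2 \<Omega> \<longrightarrow> continuous_on \<Omega> u \<longrightarrow> (\<lambda>x. u x - \<phi> x) \<in> H10 \<Omega> \<longrightarrow> x \<in> \<Omega> \<longrightarrow>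
    \<bar>u x\<bar> + (\<integral>x. area_element \<Omega> u x \<partial>(lebesgue_on \<Omega>)) \<le> C * ((W0 \<Omega> u)\<^sup>2 + 1)"
proof -
  have op: "open \<Omega>" and bd: "bounded \<Omega>" using \<Omega> by (auto simp: bounded_C2_domain_def)
  obtain R where R: "\<Omega> \<subseteq> ball 0 R" "0 \<le> R" using bounded_subset_ballD[OF bd, of 0] by auto
  have "\<exists>C \<epsilon>0. 0 < C \<and> 0 < \<epsilon>0 \<and> (\<forall>\<epsilon>. 0 < \<epsilon> \<longrightarrow> \<epsilon> < \<epsilon>0 \<longrightarrow> emeasure lborel (layer \<Omega> \<epsilon>) \<le> ennreal (C * \<epsilon>))"
    by (rule layer_estimates[OF \<Omega>, folded layer_def]) meson
  then obtain C\<Omega> \<epsilon>0 where L: "0 < C\<Omega>" "0 < \<epsilon>0" "\<And>\<epsilon>. 0 < \<epsilon> \<Longrightarrow> \<epsilon> < \<epsilon>0 \<Longrightarrow> emeasure lborel (layer \<Omega> \<epsilon>) \<le> ennreal (C\<Omega> * \<epsilon>)"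
    by blast
  define c where "c = 2 * (16 * R * measure lborel \<Omega> + measure lborel \<Omega>
      + (1 + (m + 2)\<^sup>2) * (pi / 2 * (sqrt (measure lborel \<Omega>) + 12 * C\<Omega>)) + 32 * R\<^sup>2)"
  have c0: "0 \<le> c" using R(2) L(1) by (simp add: c_def)
  have "\<bar>u x\<bar> + (\<integral>x. area_element \<Omega> u x \<partial>(lebesgue_on \<Omega>)) \<le> 5 * (m + 9000 + 2 * c) * ((W0 \<Omega> u)\<^sup>2 + 1)"
    if \<phi>: "continuous_on (closure \<Omega>) \<phi>" "\<forall>p\<in>frontier \<Omega>. \<bar>\<phi> p\<bar> \<le> m"
      and u: "u \<in> Hsob 2 \<Omega>" "continuous_on \<Omega> u" and w: "(\<lambda>x. u x - \<phi> x) \<in> H10 \<Omega>" and x: "x \<in> \<Omega>" for \<phi> u x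
  proof -
    let ?u = "\<lambda>x. indicator \<Omega> x * u x"
    obtain gr h where g: "sobolev_graph \<Omega> ?u gr h" using sobolev_graph_exists[OF op bd u] by blast
    interpret g: sobolev_graph \<Omega> ?u gr h by (rule g)
    obtain w' C \<epsilon>1 where w': "rep \<Omega> (\<lambda>x. u x - \<phi> x) w'" "0 \<le> C" "0 < \<epsilon>1"
      "\<And>\<epsilon>. 0 < \<epsilon> \<Longrightarrow> \<epsilon> < \<epsilon>1 \<Longrightarrow> (\<integral>\<^sup>+x. indicator (layer \<Omega> \<epsilon>) x * ennreal ((w' x)\<^sup>2) \<partial>lborel) \<le> ennreal (C * \<epsilon>\<^sup>2)"
      using H10_layer[OF \<Omega> w] by blast
    have "AE x in lborel. x \<in> \<Omega> \<longrightarrow> u x - \<phi> x = w' x" using w'(1) by (simp add: rep_def AE_completion_iff)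
    then have ae: "AE x in lborel. x \<in> \<Omega> \<longrightarrow> \<bar>?u x - \<phi> x\<bar> = \<bar>w' x\<bar>"
      "AE x in lborel. x \<in> \<Omega> \<longrightarrow> \<bar>- ?u x - (- \<phi> x)\<bar> = \<bar>w' x\<bar>"
      by (eventually_elim, auto simp: abs_minus_commute)+
    have n\<phi>: "continuous_on (closure \<Omega>) (\<lambda>x. - \<phi> x)" using \<phi>(1) by (intro continuous_intros)
    have P: "trace_graph \<Omega> ?u gr h m C\<Omega> \<epsilon>0"
    proof (intro trace_graph.intro g trace_graph_axioms.intro m L)
      fix s assume s: "m < s"
      have "\<phi> p \<le> m" if "p \<in> frontier \<Omega>" for p using bspec[OF \<phi>(2) that] by linarith
      from trace_from_layer[OF op bd \<phi>(1) this ae(1) w'(2-4) s]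
      show "\<exists>C \<delta>. 0 \<le> C \<and> 0 < \<delta> \<and> (\<forall>\<epsilon>. 0 < \<epsilon> \<longrightarrow> \<epsilon> < \<delta> \<longrightarrow>
        (\<integral>\<^sup>+x. indicator (layer \<Omega> \<epsilon>) x * ennreal ((max 0 (?u x - s))\<^sup>2) \<partial>lborel) \<le> ennreal (C * \<epsilon>\<^sup>2))" .
    qed
    have N: "trace_graph \<Omega> (\<lambda>x. - ?u x) (\<lambda>x. - gr x) (\<lambda>i j x. - h i j x) m C\<Omega> \<epsilon>0"
    proof (intro trace_graph.intro g.neg_graph trace_graph_axioms.intro m L)
      fix s assume s: "m < s"
      have "- \<phi> p \<le> m" if "p \<in> frontier \<Omega>" for p using bspec[OF \<phi>(2) that] by linarith
      from trace_from_layer[OF op bd n\<phi> this ae(2) w'(2-4) s]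
      show "\<exists>C \<delta>. 0 \<le> C \<and> 0 < \<delta> \<and> (\<forall>\<epsilon>. 0 < \<epsilon> \<longrightarrow> \<epsilon> < \<delta> \<longrightarrow>
        (\<integral>\<^sup>+x. indicator (layer \<Omega> \<epsilon>) x * ennreal ((max 0 (- ?u x - s))\<^sup>2) \<partial>lborel) \<le> ennreal (C * \<epsilon>\<^sup>2))" .
    qed
    have "\<bar>?u x\<bar> + g.area \<le> (m + 9000 + 2 * c) * (1 + g.Ws)" by (rule two_sided_bound[OF P N R x c_def])
    moreover have v: "\<And>x. x \<in> \<Omega> \<Longrightarrow> u x = ?u x" by simp
    note t = g.area_transfer[OF v] g.W0_transfer[OF v]
    \<comment> \<open>The estimate obtained so far is linear in \<open>W0\<close>; here it is put
      into the quadratic form of the claim.\<close>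
    have "1 + 4 * W0 \<Omega> u \<le> 5 * ((W0 \<Omega> u)\<^sup>2 + 1)"
    proof -
      have "2 * W0 \<Omega> u \<le> (W0 \<Omega> u)\<^sup>2 + 1" using zero_le_power2[of "W0 \<Omega> u - 1"] by (simp add: power2_diff)
      then show ?thesis using zero_le_power2[of "W0 \<Omega> u"] unfolding distrib_left by linarith
    qed
    then have "1 + g.Ws \<le> 5 * ((W0 \<Omega> u)\<^sup>2 + 1)" using t(2) by linarith
    then have "(m + 9000 + 2 * c) * (1 + g.Ws) \<le> (m + 9000 + 2 * c) * (5 * ((W0 \<Omega> u)\<^sup>2 + 1))"
      using m c0 by (intro mult_left_mono) auto
    moreover have "\<bar>?u x\<bar> = \<bar>u x\<bar>" using x by simp
    moreover have "(\<integral>x. area_element \<Omega> u x \<partial>(lebesgue_on \<Omega>)) = g.area" by (rule t(1))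
    ultimately have "\<bar>u x\<bar> + (\<integral>x. area_element \<Omega> u x \<partial>(lebesgue_on \<Omega>)) \<le> (m + 9000 + 2 * c) * (5 * ((W0 \<Omega> u)\<^sup>2 + 1))"
      by (simp only: order_trans)
    then show ?thesis by (simp only: mult_ac)
  qed
  then show ?thesis by blast
qed

section \<open>Boundary values\<close>

lemma GDERIV_real: "GDERIV f (x::real) :> D \<longleftrightarrow> (f has_real_derivative D) (at x)"
  by (simp add: gderiv_def has_field_derivative_def mult.commute)

lemma emeasure_Ioo_finite: "emeasure lborel {a<..<b::real} < \<infinity>"
  by (rule emeasure_bounded_finite, rule bounded_subset[OF compact_imp_bounded[OF compact_Icc[of a b]]]) auto

text \<open>Identifies the weak derivative chosen in \<open>W21_norm\<close> with the classical one
  inside the interval. The bound \<open>B\<close> gives integrability up to the endpoints.\<close>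

lemma weak_partial_interval:
  fixes f f' :: "real \<Rightarrow> real"
  assumes c: "continuous_on {a<..<b} f" "continuous_on {a<..<b} f'"
    and d: "\<And>s. s \<in> {a<..<b} \<Longrightarrow> (f has_real_derivative f' s) (at s)"
    and B: "\<And>s. s \<in> {a<..<b} \<Longrightarrow> \<bar>f s\<bar> \<le> B" "\<And>s. s \<in> {a<..<b} \<Longrightarrow> \<bar>f' s\<bar> \<le> B"
  shows "has_weak_partial {a<..<b} 1 f f'" "integrable lborel (\<lambda>s. indicator {a<..<b} s * f' s)"
    "integrable lborel (\<lambda>s. indicator {a<..<b} s * f s)"
    "rep {a<..<b} f (\<lambda>s. indicator {a<..<b} s * f s)"
proof -
  let ?I = "{a<..<b}"
  have S: "?I \<in> sets borel" by simp
  have m: "(\<lambda>s. indicator ?I s * f s) \<in> borel_measurable borel" "(\<lambda>s. indicator ?I s * f' s) \<in> borel_measurable borel"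
    using borel_measurable_continuous_on_indicator[OF S c(1)] borel_measurable_continuous_on_indicator[OF S c(2)] by simp_all
  have bd: "integrable lborel (\<lambda>s. indicator ?I s * g s)"
    if "\<And>s. s \<in> ?I \<Longrightarrow> \<bar>g s\<bar> \<le> B" "(\<lambda>s. indicator ?I s * g s) \<in> borel_measurable borel" for g :: "real \<Rightarrow> real"
  proof (rule Bochner_Integration.integrable_bound[of lborel "\<lambda>s. B * indicator ?I s"])
    show "integrable lborel (\<lambda>s. B * indicator ?I s)" by (intro integrable_mult_right integrable_real_indicator emeasure_Ioo_finite) simp
    have "norm (indicator ?I s * g s) \<le> norm (B * indicator ?I s)" for s using that(1)[of s] by (cases "s \<in> ?I") auto
    then show "AE s in lborel. norm (indicator ?I s * g s) \<le> norm (B * indicator ?I s)" by (rule AE_I2)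
  qed (use that(2) in simp)
  show i': "integrable lborel (\<lambda>s. indicator ?I s * f' s)" by (rule bd[OF B(2) m(2)])
  show i: "integrable lborel (\<lambda>s. indicator ?I s * f s)" by (rule bd[OF B(1) m(1)])
  show r: "rep ?I f (\<lambda>s. indicator ?I s * f s)" using m by (auto simp: rep_def)
  have r': "rep ?I f' (\<lambda>s. indicator ?I s * f' s)" using m by (auto simp: rep_def)
  have "wder ?I 1 (\<lambda>s. indicator ?I s * f s) (\<lambda>s. indicator ?I s * f' s)"
    unfolding wder_def
  proof (intro allI impI)
    fix \<eta> :: "real \<Rightarrow> real" assume t: "test_function ?I \<eta>"
    obtain \<eta>' where \<eta>': "\<And>x. GDERIV \<eta> x :> \<eta>' x" using test_function_GDERIV[OF t] by blast
    have fr: "frechet_derivative \<eta> (at x) 1 = \<eta>' x" for x using GDERIV_frechet[OF \<eta>', of x 1] by simp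
    have t': "test_function ?I \<eta>'" using test_function_pd[OF t, of 1] by (simp add: fr)
    let ?K = "closure {x. \<eta> x \<noteq> 0}"
    have K: "compact ?K" "?K \<subseteq> ?I" using t by (auto simp: test_function_def)
    have K0: "\<eta> x = 0" if "x \<notin> ?K" for x using that closure_subset[of "{x. \<eta> x \<noteq> 0}"] by auto
    have A3: "f x * \<eta> x = 0" if "x \<notin> ?K" for x using K0[OF that] by (rule ssubst) simp
    have A1: "GDERIV (\<lambda>x. f x * \<eta> x) x :> f x * \<eta>' x + \<eta> x * f' x" if "x \<in> ?I" for x
      using GDERIV_mult[OF d[OF that, folded GDERIV_real] \<eta>'] by simp
    have A2: "continuous_on ?I (\<lambda>x. (f x * \<eta>' x + \<eta> x * f' x) \<bullet> 1)"
      using c test_function_continuous[OF t] test_function_continuous[OF t'] by (simp add: continuous_on_add continuous_on_mult)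
    have 0: "(LBINT x. indicator ?I x * (f x * \<eta>' x + \<eta> x * f' x)) = 0"
      using integral_pd_zero(2)[OF K(1) open_greaterThanLessThan K(2) A3 A1 _ A2] by simp
    have bi: "integrable lborel (\<lambda>x. (indicator ?I x * g x) * \<zeta> x)"
      if z: "test_function ?I \<zeta>" and g: "integrable lborel (\<lambda>s. indicator ?I s * g s)" for g \<zeta> :: "real \<Rightarrow> real"
    proof -
      obtain Z where Z: "\<And>x. \<bar>\<zeta> x\<bar> \<le> Z" using test_function_uniform(2)[OF z] by blast
      show ?thesis using bounded_mult_integrable[OF g test_function_borel[OF z] Z] by (simp only: mult.commute)
    qed
    have "indicator ?I x * (f x * \<eta>' x + \<eta> x * f' x) = (indicator ?I x * f x) * \<eta>' x + (indicator ?I x * f' x) * \<eta> x" for x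
      by (simp add: algebra_simps)
    with 0 show "(LBINT x. (indicator ?I x * f x) * frechet_derivative \<eta> (at x) 1) = - (LBINT x. (indicator ?I x * f' x) * \<eta> x)"
      using Bochner_Integration.integral_add[OF bi[OF t' i] bi[OF t i']] by (simp add: fr)
  qed
  then show "has_weak_partial ?I 1 f f'" by (rule rep_weak[OF S _ r r' i i']) simp
qed

text \<open>The one-dimensional Sobolev embedding: the oscillation of \<open>f\<close> is at most
  the integral of |f'|, and averaging over the interval adds the mean of |f|, hence the factor
  \<open>1 / l\<close>. The endpoints, where no derivative is given, are reached by
  continuity.\<close>

lemma W21_bound:
  fixes f f' :: "real \<Rightarrow> real"
  assumes l: "0 < l" and c: "continuous_on {0..l} f" "continuous_on {0<..<l} f'"
    and d: "\<And>s. s \<in> {0<..<l} \<Longrightarrow> (f has_real_derivative f' s) (at s)"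
    and B: "\<And>s. s \<in> {0<..<l} \<Longrightarrow> \<bar>f' s\<bar> \<le> B" and s: "s \<in> {0..l}"
  shows "\<bar>f s\<bar> \<le> (1 + 1 / l) * W21_norm {0<..<l} f"
proof -
  let ?I = "{0<..<l}"
  have S: "?I \<in> sets borel" by simp
  have "bounded (f ` {0..l})" by (intro compact_imp_bounded compact_continuous_image c(1)) simp
  then obtain B0 where B0: "\<forall>s\<in>{0..l}. \<bar>f s\<bar> \<le> B0" by (auto simp: bounded_iff)
  have cI: "continuous_on ?I f" by (rule continuous_on_subset[OF c(1)]) auto
  have B1: "\<bar>f s\<bar> \<le> max B B0" "\<bar>f' s\<bar> \<le> max B B0" if "s \<in> ?I" for s using B[OF that] bspec[OF B0, of s] that by auto
  have w: "has_weak_partial ?I 1 f f'" "integrable lborel (\<lambda>s. indicator ?I s * f' s)"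
    "integrable lborel (\<lambda>s. indicator ?I s * f s)" "rep ?I f (\<lambda>s. indicator ?I s * f s)"
    by (rule weak_partial_interval[OF cI c(2) d B1]; assumption)+
  define F where "F = (LBINT s. \<bar>indicator ?I s * f s\<bar>)"
  define D where "D = (LBINT s. \<bar>indicator ?I s * f' s\<bar>)"
  have F0: "0 \<le> F" "0 \<le> D" by (simp_all add: F_def D_def)
  have "rep ?I (\<lambda>s. \<bar>f s\<bar>) (\<lambda>s. \<bar>indicator ?I s * f s\<bar>)" using w(4) by (auto simp: rep_def)
  note F = rep_integral(1)[OF S this]
  have "rep ?I (\<lambda>s. \<bar>weak_partial ?I 1 f s\<bar>) (\<lambda>s. \<bar>indicator ?I s * f' s\<bar>)"
    unfolding rep_def
  proof (intro conjI allI impI)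
    show "(\<lambda>s. \<bar>indicator ?I s * f' s\<bar>) \<in> borel_measurable borel" using borel_measurable_integrable[OF w(2)] by simp
    show "AE s in lebesgue. s \<in> ?I \<longrightarrow> \<bar>weak_partial ?I 1 f s\<bar> = \<bar>indicator ?I s * f' s\<bar>"
      using weak_partial_AE[OF open_greaterThanLessThan[of 0 l] w(1)] by eventually_elim simp
  qed simp
  note D = rep_integral(1)[OF S this]
  have "0 \<le> (\<integral>s. \<bar>weak_partial ?I 1 (weak_partial ?I 1 f) s\<bar> \<partial>(lebesgue_on ?I))" by simp
  then have W: "F + D \<le> W21_norm ?I f" by (simp add: W21_norm_def F D F_def D_def)
  have osc: "\<bar>f q - f p\<bar> \<le> D" if "p \<in> ?I" "q \<in> ?I" "p \<le> q" for p q
  proof -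
    have sub: "{p..q} \<subseteq> ?I" using that by auto
    have ii: "integrable lborel (\<lambda>x. f' x * indicator {p..q} x)"
    proof -
      have "integrable lborel (\<lambda>x. indicator {p..q} x *\<^sub>R (indicator ?I x * f' x))" by (rule integrable_mult_indicator[OF _ w(2)]) simp
      moreover have eq: "indicator {p..q} x *\<^sub>R (indicator ?I x * f' x) = f' x * indicator {p..q} x" for x using sub by (auto simp: indicator_def)
      ultimately show ?thesis by (simp only: eq)
    qed
    have "f q - f p = (LBINT x. f' x * indicator {p..q} x)"
      by (rule integral_FTC_Icc_real[symmetric])
        (use that d c(2) in \<open>auto simp: continuous_on_eq_continuous_at\<close>)
    also have "\<bar>\<dots>\<bar> \<le> (LBINT x. \<bar>f' x * indicator {p..q} x\<bar>)" by (rule integral_abs_bound)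
    also have "\<dots> \<le> D" unfolding D_def
      by (rule integral_mono[OF integrable_abs[OF ii] integrable_abs[OF w(2)]]) (use sub in \<open>auto simp: indicator_def\<close>)
    finally show ?thesis .
  qed
  have bI: "\<bar>f q\<bar> \<le> F / l + D" if q: "q \<in> ?I" for q
  proof -
    have 1: "\<bar>f q\<bar> - D \<le> \<bar>f p\<bar>" if "p \<in> ?I" for p using osc[OF that q] osc[OF q that] by (cases "p \<le> q") auto
    have iI: "integrable lborel (indicator ?I :: real \<Rightarrow> real)" by (intro integrable_real_indicator emeasure_Ioo_finite) simp
    have "(LBINT p. (\<bar>f q\<bar> - D) * indicator ?I p) \<le> F" unfolding F_def
    proof (rule integral_mono[OF integrable_mult_right[OF iI] integrable_abs[OF w(3)]])
      fix p show "(\<bar>f q\<bar> - D) * indicator ?I p \<le> \<bar>indicator ?I p * f p\<bar>" using 1[of p] by (cases "p \<in> ?I") auto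
    qed
    then have "(\<bar>f q\<bar> - D) * l \<le> F" using l by simp
    then show ?thesis using l by (simp add: field_simps)
  qed
  have "\<bar>f s\<bar> \<le> F / l + D"
  proof (rule continuous_le_on_closure[where S = ?I and f = "\<lambda>s. \<bar>f s\<bar>"])
    show "continuous_on (closure ?I) (\<lambda>s. \<bar>f s\<bar>)" using l c(1) by (simp add: continuous_on_rabs)
    show "s \<in> closure ?I" using s l by simp
  qed (use bI in auto)
  also have "\<dots> \<le> (1 + 1 / l) * (F + D)" using F0 l by (simp add: field_simps)
  also have "\<dots> \<le> (1 + 1 / l) * W21_norm ?I f" using W l by (intro mult_left_mono) auto
  finally show ?thesis .
qed

lemma arclength_derivative:
  assumes "arclength_parametrisation l c \<Gamma>"
  shows "0 < l" "continuous_on {0..l} c"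
    "\<exists>c'. (\<forall>s\<in>{0<..<l}. (c has_vector_derivative c' s) (at s) \<and> norm (c' s) = 1) \<and> continuous_on {0<..<l} c'"
proof -
  have A: "0 < l" "\<And>b. b \<in> Basis \<Longrightarrow> Ck_on (Suc 1) {0<..<l} {0..l} (\<lambda>s. c s \<bullet> b)"
    "\<And>s. s \<in> {0<..<l} \<Longrightarrow> norm (vector_derivative c (at s)) = 1"
    using assms by (auto simp: arclength_parametrisation_def numeral_2_eq_2)
  show "0 < l" by (rule A)
  show "continuous_on {0..l} c"
    using A(2) by (subst continuous_on_componentwise) auto
  have "\<exists>d. \<forall>b\<in>Basis. (\<forall>s\<in>{0<..<l}. ((\<lambda>s. c s \<bullet> b) has_real_derivative d b s) (at s)) \<and> continuous_on {0..l} (d b)"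
  proof (rule bchoice, rule ballI)
    fix b :: "real^2" assume "b \<in> Basis"
    from A(2)[OF this] obtain f' where "\<forall>x\<in>{0<..<l}. GDERIV (\<lambda>s. c s \<bullet> b) x :> f' x" "Ck_on 1 {0<..<l} {0..l} f'" by auto
    then show "\<exists>f'. (\<forall>s\<in>{0<..<l}. ((\<lambda>s. c s \<bullet> b) has_real_derivative f' s) (at s)) \<and> continuous_on {0..l} f'"
      using Ck_on_continuous by (auto simp: GDERIV_real)
  qed
  then obtain d where d: "\<And>b s. b \<in> Basis \<Longrightarrow> s \<in> {0<..<l} \<Longrightarrow> ((\<lambda>s. c s \<bullet> b) has_real_derivative d b s) (at s)"
    "\<And>b. b \<in> Basis \<Longrightarrow> continuous_on {0..l} (d b)" by blast
  define c' where "c' s = (\<Sum>b\<in>Basis. d b s *\<^sub>R b)" for s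
  have c'b: "c' s \<bullet> b = d b s" if "b \<in> Basis" for s b using that by (simp add: c'_def inner_sum_left inner_Basis if_distrib cong: if_cong)
  have v: "(c has_vector_derivative c' s) (at s)" if s: "s \<in> {0<..<l}" for s
    unfolding has_vector_derivative_def
  proof (subst has_derivative_componentwise_within, rule ballI)
    fix b :: "real^2" assume b: "b \<in> Basis"
    show "((\<lambda>s. c s \<bullet> b) has_derivative (\<lambda>x. (x *\<^sub>R c' s) \<bullet> b)) (at s)"
      using d(1)[OF b s] b by (simp add: has_field_derivative_def c'b mult_commute_abs)
  qed
  have "continuous_on {0<..<l} (\<lambda>s. c' s \<bullet> b)" if "b \<in> Basis" for b
    unfolding c'b[OF that] by (rule continuous_on_subset[OF d(2)[OF that]]) auto
  then have "continuous_on {0<..<l} c'" by (subst continuous_on_componentwise) auto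
  moreover have "norm (c' s) = 1" if "s \<in> {0<..<l}" for s using A(3)[OF that] vector_derivative_at[OF v[OF that]] by simp
  ultimately show "\<exists>c'. (\<forall>s\<in>{0<..<l}. (c has_vector_derivative c' s) (at s) \<and> norm (c' s) = 1) \<and> continuous_on {0<..<l} c'"
    using v by blast
qed

text \<open>\<phi> is differentiable only inside \<Omega>, whereas the curve runs in the boundary.
  The curve is pushed inward along the chart direction \<open>e\<close>, where the ordinary chain
  rule holds, and then let back; uniform continuity of the extended gradient \<Phi> on the closure
  makes the derivatives converge uniformly.\<close>

lemma boundary_chain_rule:
  fixes \<phi> :: "real^2 \<Rightarrow> real"
  assumes \<Omega>: "bounded_C2_domain \<Omega>" and \<phi>: "continuous_on (closure \<Omega>) \<phi>" "\<And>x. x \<in> \<Omega> \<Longrightarrow> GDERIV \<phi> x :> \<Phi> x"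
    and \<Phi>: "continuous_on (closure \<Omega>) \<Phi>"
    and I: "open I" and c: "\<And>s. s \<in> I \<Longrightarrow> c s \<in> frontier \<Omega>"
    "\<And>s. s \<in> I \<Longrightarrow> (c has_vector_derivative c' s) (at s)" "\<And>s. s \<in> I \<Longrightarrow> norm (c' s) = 1" and s0: "s0 \<in> I"
  shows "((\<phi> \<circ> c) has_real_derivative \<Phi> (c s0) \<bullet> c' s0) (at s0)"
proof -
  have op: "open \<Omega>" "bounded \<Omega>" "C2_boundary \<Omega>" using \<Omega> by (auto simp: bounded_C2_domain_def)
  define p where "p = c s0"
  obtain r e L where "inward_chart \<Omega> p r e L" using inward_chart_exists[OF op(1,3) c(1)[OF s0]] unfolding p_def by blast
  then have r: "0 < r" "norm e = 1" "\<And>x t. x \<in> closure \<Omega> \<Longrightarrow> x \<in> ball p r \<Longrightarrow> 0 < t \<Longrightarrow> x + t *\<^sub>R e \<in> ball p r \<Longrightarrow> x + t *\<^sub>R e \<in> \<Omega>"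
    by (auto simp: inward_chart_def)
  have "isCont c s0" using c(2)[OF s0] by (rule has_vector_derivative_continuous)
  then obtain d1 where d1: "0 < d1" "\<And>s. dist s s0 < d1 \<Longrightarrow> dist (c s) p < r / 2"
    unfolding continuous_at_eps_delta p_def using r(1) by (meson half_gt_zero)
  obtain d2 where d2: "0 < d2" "ball s0 d2 \<subseteq> I" using I s0 open_contains_ball by blast
  define S where "S = ball s0 (min d1 d2)"
  have S: "open S" "convex S" "s0 \<in> S" "S \<subseteq> I" using d1 d2 by (auto simp: S_def)
  have Sp: "dist (c s) p < r / 2" if "s \<in> S" for s using that d1(2)[of s] by (auto simp: S_def dist_commute)
  \<comment> \<open>At most \<open>r / 3\<close>, so that curve points within \<open>r / 2\<close>
    of \<open>p\<close> remain in the chart after the shift.\<close>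
  define \<tau> where "\<tau> n = (r / 3) * inverse (real (Suc n))" for n
  have \<tau>: "0 < \<tau> n" "\<tau> n < r / 2" for n
  proof -
    show "0 < \<tau> n" using r(1) by (simp add: \<tau>_def)
    have "\<tau> n \<le> (r / 3) * 1" unfolding \<tau>_def using r(1) by (intro mult_left_mono) (auto simp: inverse_le_1_iff)
    then show "\<tau> n < r / 2" using r(1) by simp
  qed
  have \<tau>0: "\<tau> \<longlonglongrightarrow> 0"
    unfolding \<tau>_def[abs_def] by (rule tendsto_mult_right_zero[OF LIMSEQ_inverse_real_of_nat])
  have cl: "c s \<in> closure \<Omega>" if "s \<in> S" for s using c(1) that S(4) by (auto simp: frontier_def)
  have in\<Omega>: "c s + \<tau> n *\<^sub>R e \<in> \<Omega>" if s: "s \<in> S" for s n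
  proof (rule r(3)[OF cl[OF s]])
    show "c s \<in> ball p r" using Sp[OF s] r(1) by (simp add: dist_commute)
    have "dist p (c s + \<tau> n *\<^sub>R e) \<le> dist p (c s) + norm (\<tau> n *\<^sub>R e)"
      using norm_triangle_ineq4[of "p - c s" "\<tau> n *\<^sub>R e"] by (simp add: dist_norm diff_diff_eq)
    then show "c s + \<tau> n *\<^sub>R e \<in> ball p r" using Sp[OF s] \<tau>[of n] r(2) by (simp add: dist_commute)
  qed (rule \<tau>)
  let ?f = "\<lambda>n s. \<phi> (c s + \<tau> n *\<^sub>R e)"
  have shift: "(\<lambda>n. c s + \<tau> n *\<^sub>R e) \<longlonglongrightarrow> c s" for s
    using tendsto_add[OF tendsto_const tendsto_scaleR[OF \<tau>0 tendsto_const], of "c s" e] by simp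
  have lim: "(\<lambda>n. ?f n s) \<longlonglongrightarrow> \<phi> (c s)" if s: "s \<in> S" for s
    by (rule continuous_on_tendsto_compose[OF \<phi>(1) shift cl[OF s]])
       (use in\<Omega>[OF s] closure_subset[of \<Omega>] in \<open>auto intro!: always_eventually\<close>)
  have der: "(?f n has_derivative (\<lambda>h. h * (\<Phi> (c s + \<tau> n *\<^sub>R e) \<bullet> c' s))) (at s within S)" if s: "s \<in> S" for n s
  proof -
    have "(c has_derivative (\<lambda>h. h *\<^sub>R c' s)) (at s within S)"
      using c(2)[of s] s S(4) unfolding has_vector_derivative_def by (auto intro: has_derivative_at_withinI)
    from has_derivative_add[OF this has_derivative_const[of "\<tau> n *\<^sub>R e"]]
    have 1: "((\<lambda>s. c s + \<tau> n *\<^sub>R e) has_derivative (\<lambda>h. h *\<^sub>R c' s)) (at s within S)" by simp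
    have 2: "(\<phi> has_derivative (\<lambda>h. h \<bullet> \<Phi> (c s + \<tau> n *\<^sub>R e))) (at (c s + \<tau> n *\<^sub>R e))"
      using \<phi>(2)[OF in\<Omega>[OF s]] by (simp add: gderiv_def)
    show ?thesis using has_derivative_compose[OF 1 2] by (simp add: inner_commute)
  qed
  have comp: "compact (closure \<Omega>)" using op(2) by (simp add: compact_eq_bounded_closed bounded_closure)
  have uc: "uniformly_continuous_on (closure \<Omega>) \<Phi>" by (rule compact_uniformly_continuous[OF \<Phi> comp])
  have unif: "\<forall>\<^sub>F n in sequentially. \<forall>s\<in>S. \<forall>h. norm (h * (\<Phi> (c s + \<tau> n *\<^sub>R e) \<bullet> c' s) - h * (\<Phi> (c s) \<bullet> c' s)) \<le> \<epsilon> * norm h"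
    if \<epsilon>: "0 < \<epsilon>" for \<epsilon>
  proof -
    obtain \<delta> where \<delta>: "0 < \<delta>" "\<And>x y. x \<in> closure \<Omega> \<Longrightarrow> y \<in> closure \<Omega> \<Longrightarrow> dist y x < \<delta> \<Longrightarrow> dist (\<Phi> y) (\<Phi> x) < \<epsilon>"
      using uc \<epsilon> unfolding uniformly_continuous_on_def by meson
    have "\<forall>\<^sub>F n in sequentially. \<tau> n < \<delta>" by (rule order_tendstoD(2)[OF \<tau>0 \<delta>(1)])
    then show ?thesis
    proof eventually_elim
      case (elim n)
      show ?case
      proof (intro ballI allI)
        fix s h assume s: "s \<in> S"
        have "c s + \<tau> n *\<^sub>R e \<in> closure \<Omega>" using in\<Omega>[OF s] closure_subset by blast
        moreover have "dist (c s + \<tau> n *\<^sub>R e) (c s) < \<delta>" using elim r(2) \<tau>(1)[of n] by (simp add: dist_norm)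
        ultimately have "norm (\<Phi> (c s + \<tau> n *\<^sub>R e) - \<Phi> (c s)) < \<epsilon>" using \<delta>(2)[OF cl[OF s]] by (simp add: dist_norm)
        then have "\<bar>(\<Phi> (c s + \<tau> n *\<^sub>R e) - \<Phi> (c s)) \<bullet> c' s\<bar> \<le> \<epsilon>"
          using Cauchy_Schwarz_ineq2[of "\<Phi> (c s + \<tau> n *\<^sub>R e) - \<Phi> (c s)" "c' s"] c(3)[of s] s S(4) by auto
        then have "\<bar>h\<bar> * \<bar>(\<Phi> (c s + \<tau> n *\<^sub>R e) - \<Phi> (c s)) \<bullet> c' s\<bar> \<le> \<bar>h\<bar> * \<epsilon>" by (rule mult_left_mono) simp
        then show "norm (h * (\<Phi> (c s + \<tau> n *\<^sub>R e) \<bullet> c' s) - h * (\<Phi> (c s) \<bullet> c' s)) \<le> \<epsilon> * norm h"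
          by (simp add: inner_diff_left right_diff_distrib[symmetric] abs_mult mult.commute)
      qed
    qed
  qed
  have "\<exists>g. \<forall>s\<in>S. (\<lambda>n. ?f n s) \<longlonglongrightarrow> g s \<and> (g has_derivative (\<lambda>h. h * (\<Phi> (c s) \<bullet> c' s))) (at s within S)"
    by (rule has_derivative_sequence[OF S(2) der unif S(3) lim[OF S(3)]])
  then obtain g where g: "\<And>s. s \<in> S \<Longrightarrow> (\<lambda>n. ?f n s) \<longlonglongrightarrow> g s"
    "\<And>s. s \<in> S \<Longrightarrow> (g has_derivative (\<lambda>h. h * (\<Phi> (c s) \<bullet> c' s))) (at s within S)" by blast
  have "(g has_derivative (\<lambda>h. h * (\<Phi> (c s0) \<bullet> c' s0))) (at s0)"
    using g(2)[OF S(3)] at_within_open[OF S(3,1)] by simp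
  then have "((\<phi> \<circ> c) has_derivative (\<lambda>h. h * (\<Phi> (c s0) \<bullet> c' s0))) (at s0)"
    by (rule has_derivative_transform_within_open[OF _ S(1,3)]) (use LIMSEQ_unique[OF g(1) lim] in auto)
  then show ?thesis by (simp add: has_field_derivative_def mult_commute_abs)
qed

lemma W21_norm_nonneg: "0 \<le> W21_norm I f" by (simp add: W21_norm_def)

text \<open>Unit speed bounds distances by the length, and injectivity yields two distinct points.
  The purpose is to bound \<open>1 / l\<close> by a quantity of the component alone.\<close>

lemma arclength_diameter:
  assumes a: "arclength_parametrisation l c \<Gamma>"
  shows "0 < diameter \<Gamma>" "diameter \<Gamma> \<le> l"
proof -
  note A = arclength_derivative[OF a]
  have l: "0 < l" by (rule A)
  have im: "c ` {0..l} = \<Gamma>" and inj: "inj_on c {0..<l}" using a by (auto simp: arclength_parametrisation_def)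
  obtain c' where c': "\<And>s. s \<in> {0<..<l} \<Longrightarrow> (c has_vector_derivative c' s) (at s)" "\<And>s. s \<in> {0<..<l} \<Longrightarrow> norm (c' s) = 1"
    using A(3) by blast
  have lip: "norm (c t - c s) \<le> l" if st: "0 \<le> s" "s < t" "t \<le> l" for s t
  proof -
    have "norm (c t - c s) \<le> t - s"
    proof (rule differentiable_bound_general[OF st(2), of c "\<lambda>s. s" c' "\<lambda>_. 1"])
      show "continuous_on {s..t} c" by (rule continuous_on_subset[OF A(2)]) (use st in auto)
      show "(c has_vector_derivative c' x) (at x)" if "s < x" "x < t" for x using c'(1)[of x] that st by simp
      show "norm (c' x) \<le> 1" if "s < x" "x < t" for x using c'(2)[of x] that st by simp
      show "((\<lambda>s. s) has_vector_derivative 1) (at x)" for x :: real by (rule has_vector_derivative_id)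
    qed (rule continuous_on_id)
    then show ?thesis using st by simp
  qed
  have lip': "norm (c s - c t) \<le> l" if "s \<in> {0..l}" "t \<in> {0..l}" for s t
  proof (cases s t rule: linorder_cases)
    case less
    then show ?thesis using lip[of s t] that by (simp add: norm_minus_commute)
  next
    case equal
    then show ?thesis using l by simp
  next
    case greater
    then show ?thesis using lip[of t s] that by simp
  qed
  show "diameter \<Gamma> \<le> l"
  proof (rule diameter_le)
    show "norm (x - y) \<le> l" if "x \<in> \<Gamma>" "y \<in> \<Gamma>" for x y using that lip' unfolding im[symmetric] by auto
  qed (use l in simp)
  have "bounded \<Gamma>" unfolding im[symmetric] by (intro compact_imp_bounded compact_continuous_image A(2)) simp
  moreover have "c 0 \<in> \<Gamma>" "c (l / 2) \<in> \<Gamma>" using l unfolding im[symmetric] by auto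
  ultimately have "dist (c 0) (c (l / 2)) \<le> diameter \<Gamma>" by (rule diameter_bounded_bound)
  moreover have "c 0 \<noteq> c (l / 2)" using inj_onD[OF inj, of 0 "l / 2"] l by auto
  ultimately show "0 < diameter \<Gamma>" using zero_less_dist_iff[of "c 0" "c (l / 2)"] by linarith
qed

text \<open>\<open>K\<close> has to be chosen before the parametrisation is known; therefore the
  lengths in \<open>W21_bound\<close> are replaced by the diameters of the boundary
  components.\<close>

lemma boundary_sup_bound:
  assumes \<Omega>: "bounded_C2_domain \<Omega>"
  shows "\<exists>K\<ge>0. \<forall>l c \<phi> p. boundary_parametrisation \<Omega> l c \<longrightarrow> Ck_on 2 \<Omega> (closure \<Omega>) \<phi> \<longrightarrow> p \<in> frontier \<Omega> \<longrightarrow>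
    \<bar>\<phi> p\<bar> \<le> K * boundary_W21_norm \<Omega> l c \<phi>"
proof -
  have bd: "bounded \<Omega>" using \<Omega> by (simp add: bounded_C2_domain_def)
  let ?F = "components (frontier \<Omega>)"
  have fin: "finite ?F" by (rule finite_components_frontier[OF \<Omega>])
  define K where "K = 1 + (\<Sum>\<Gamma>\<in>?F. 1 / diameter \<Gamma>)"
  have bF: "bounded \<Gamma>" if "\<Gamma> \<in> ?F" for \<Gamma>
    by (rule bounded_subset[OF bounded_closure[OF bd]]) (use in_components_subset[OF that] in \<open>auto simp: frontier_def\<close>)
  have d0: "0 \<le> 1 / diameter \<Gamma>" if "\<Gamma> \<in> ?F" for \<Gamma> using diameter_ge_0[OF bF[OF that]] by simp
  have K0: "0 \<le> K" unfolding K_def using d0 by (intro add_nonneg_nonneg sum_nonneg) auto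
  have "\<bar>\<phi> p\<bar> \<le> K * boundary_W21_norm \<Omega> l c \<phi>"
    if bp: "boundary_parametrisation \<Omega> l c" and \<phi>: "Ck_on 2 \<Omega> (closure \<Omega>) \<phi>" and p: "p \<in> frontier \<Omega>" for l c \<phi> p
  proof -
    obtain \<Gamma> where \<Gamma>: "\<Gamma> \<in> ?F" "p \<in> \<Gamma>" using p Union_components[of "frontier \<Omega>"] by blast
    have sub: "\<Gamma> \<subseteq> frontier \<Omega>" by (rule in_components_subset[OF \<Gamma>(1)])
    have a: "arclength_parametrisation (l \<Gamma>) (c \<Gamma>) \<Gamma>" using bp \<Gamma>(1) by (auto simp: boundary_parametrisation_def)
    note A = arclength_derivative[OF a]
    have im: "c \<Gamma> ` {0..l \<Gamma>} = \<Gamma>" using a by (simp add: arclength_parametrisation_def)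
    then have "p \<in> c \<Gamma> ` {0..l \<Gamma>}" using \<Gamma>(2) by simp
    then obtain s where s: "s \<in> {0..l \<Gamma>}" "p = c \<Gamma> s" by (elim imageE)
    let ?I = "{0<..<l \<Gamma>}"
    obtain c' where c': "\<And>s. s \<in> ?I \<Longrightarrow> (c \<Gamma> has_vector_derivative c' s) (at s)" "\<And>s. s \<in> ?I \<Longrightarrow> norm (c' s) = 1"
      "continuous_on ?I c'" using A(3) by blast
    have inF: "c \<Gamma> s \<in> frontier \<Omega>" if "s \<in> {0..l \<Gamma>}" for s using that im sub by auto
    have "Ck_on (Suc 1) \<Omega> (closure \<Omega>) \<phi>" using \<phi> by (simp add: numeral_2_eq_2)
    then have cont: "continuous_on (closure \<Omega>) \<phi>" and
      "\<exists>f'. (\<forall>x\<in>\<Omega>. GDERIV \<phi> x :> f' x) \<and> (\<forall>b\<in>Basis. Ck_on 1 \<Omega> (closure \<Omega>) (\<lambda>x. f' x \<bullet> b))" by (simp_all only: Ck_on.simps)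
    then obtain \<Phi> where \<Phi>: "\<And>x. x \<in> \<Omega> \<Longrightarrow> GDERIV \<phi> x :> \<Phi> x" "\<And>b. b \<in> Basis \<Longrightarrow> Ck_on 1 \<Omega> (closure \<Omega>) (\<lambda>x. \<Phi> x \<bullet> b)"
      by blast
    have cont': "continuous_on (closure \<Omega>) \<Phi>"
      using Ck_on_continuous[OF \<Phi>(2)] by (subst continuous_on_componentwise) auto
    have "bounded (\<Phi> ` closure \<Omega>)"
      by (intro compact_imp_bounded compact_continuous_image cont') (simp add: compact_eq_bounded_closed bounded_closure[OF bd])
    then obtain B where B: "\<And>x. x \<in> closure \<Omega> \<Longrightarrow> norm (\<Phi> x) \<le> B" unfolding bounded_iff by blast
    have cl: "c \<Gamma> s \<in> closure \<Omega>" if "s \<in> {0..l \<Gamma>}" for s using inF[OF that] by (simp add: frontier_def)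
    have "\<bar>(\<phi> \<circ> c \<Gamma>) s\<bar> \<le> (1 + 1 / l \<Gamma>) * W21_norm ?I (\<phi> \<circ> c \<Gamma>)"
    proof (rule W21_bound[where f' = "\<lambda>s. \<Phi> (c \<Gamma> s) \<bullet> c' s" and B = B, OF A(1) _ _ _ _ s(1)])
      show "continuous_on {0..l \<Gamma>} (\<phi> \<circ> c \<Gamma>)"
        by (rule continuous_on_compose[OF A(2) continuous_on_subset[OF cont]]) (use cl in auto)
      have "continuous_on ?I (\<lambda>s. \<Phi> (c \<Gamma> s))"
        by (rule continuous_on_compose2[OF cont' continuous_on_subset[OF A(2)]]) (use cl in auto)
      then show "continuous_on ?I (\<lambda>s. \<Phi> (c \<Gamma> s) \<bullet> c' s)" using c'(3) by (intro continuous_on_inner)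
      show "((\<phi> \<circ> c \<Gamma>) has_real_derivative \<Phi> (c \<Gamma> t) \<bullet> c' t) (at t)" if "t \<in> ?I" for t
        by (rule boundary_chain_rule[OF \<Omega> cont \<Phi>(1) cont' open_greaterThanLessThan _ c'(1,2) that]) (use inF in auto)
      show "\<bar>\<Phi> (c \<Gamma> t) \<bullet> c' t\<bar> \<le> B" if "t \<in> ?I" for t
        using Cauchy_Schwarz_ineq2[of "\<Phi> (c \<Gamma> t)" "c' t"] B[OF cl[of t]] c'(2)[OF that] that by simp
    qed
    also have "\<dots> \<le> K * W21_norm ?I (\<phi> \<circ> c \<Gamma>)"
    proof (rule mult_right_mono[OF _ W21_norm_nonneg])
      note D = arclength_diameter[OF a]
      have "1 / l \<Gamma> \<le> 1 / diameter \<Gamma>" using D by (intro divide_left_mono) auto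
      also have "\<dots> \<le> (\<Sum>\<Gamma>\<in>?F. 1 / diameter \<Gamma>)" by (rule member_le_sum[OF \<Gamma>(1) _ fin]) (use d0 in auto)
      finally show "1 + 1 / l \<Gamma> \<le> K" by (simp add: K_def)
    qed
    also have "\<dots> \<le> K * boundary_W21_norm \<Omega> l c \<phi>"
      unfolding boundary_W21_norm_def
      by (intro mult_left_mono K0 member_le_sum[OF \<Gamma>(1) _ fin]) (rule W21_norm_nonneg)
    finally show ?thesis using s(2) by simp
  qed
  then show ?thesis using K0 by blast
qed

text \<open>The supremum is taken in the extended reals, so that boundedness of \<open>u\<close> is
  part of the claim, and continuity on \<Omega> selects the continuous representative.
  \<open>C\<close> is a function chosen before \<open>l\<close>, \<open>c\<close>, \<phi> and
  \<open>u\<close>, which expresses what the constant may depend on.\<close>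

theorem theorem2:
  fixes \<Omega> :: "(real^2) set"
  assumes "bounded_C2_domain \<Omega>"
  shows "\<exists>C :: real \<Rightarrow> real. \<forall>l c \<phi> u.
    boundary_parametrisation \<Omega> l c \<and>
    Ck_on 2 \<Omega> (closure \<Omega>) \<phi> \<and>
    u \<in> Hsob 2 \<Omega> \<and> continuous_on \<Omega> u \<and>
    (\<lambda>x. u x - \<phi> x) \<in> H10 \<Omega> \<longrightarrow>
    (SUP x\<in>\<Omega>. ereal \<bar>u x\<bar>) + ereal (\<integral>x. area_element \<Omega> u x \<partial>(lebesgue_on \<Omega>))
      \<le> ereal (C (boundary_W21_norm \<Omega> l c \<phi>) * ((W0 \<Omega> u)\<^sup>2 + 1))"
proof -
  obtain K where K: "0 \<le> K" "\<And>l c \<phi> p. boundary_parametrisation \<Omega> l c \<Longrightarrow> Ck_on 2 \<Omega> (closure \<Omega>) \<phi> \<Longrightarrow> p \<in> frontier \<Omega> \<Longrightarrow>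
    \<bar>\<phi> p\<bar> \<le> K * boundary_W21_norm \<Omega> l c \<phi>" using boundary_sup_bound[OF assms] by blast
  \<comment> \<open>\<open>N\<close> stands for the boundary norm, through which alone \<phi> and
    the parametrisation reach the constant. The absolute value makes the bound nonnegative for every
    real \<open>N\<close>, as \<open>graph_estimate\<close> demands.\<close>
  let ?P = "\<lambda>N C. \<forall>\<phi> u x. continuous_on (closure \<Omega>) \<phi> \<longrightarrow> (\<forall>p\<in>frontier \<Omega>. \<bar>\<phi> p\<bar> \<le> K * \<bar>N\<bar>) \<longrightarrow>
    u \<in> Hsob 2 \<Omega> \<longrightarrow> continuous_on \<Omega> u \<longrightarrow> (\<lambda>x. u x - \<phi> x) \<in> H10 \<Omega> \<longrightarrow> x \<in> \<Omega> \<longrightarrow>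
    \<bar>u x\<bar> + (\<integral>x. area_element \<Omega> u x \<partial>(lebesgue_on \<Omega>)) \<le> C * ((W0 \<Omega> u)\<^sup>2 + 1)"
  have "\<forall>N. \<exists>C. ?P N C" using graph_estimate[OF assms] K(1) by simp
  then obtain C where C: "\<And>N. ?P N (C N)" by (rule choice[THEN exE]) blast
  have "(SUP x\<in>\<Omega>. ereal \<bar>u x\<bar>) + ereal (\<integral>x. area_element \<Omega> u x \<partial>(lebesgue_on \<Omega>))
      \<le> ereal (C (boundary_W21_norm \<Omega> l c \<phi>) * ((W0 \<Omega> u)\<^sup>2 + 1))"
    if h: "boundary_parametrisation \<Omega> l c" "Ck_on 2 \<Omega> (closure \<Omega>) \<phi>" "u \<in> Hsob 2 \<Omega>" "continuous_on \<Omega> u"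
      "(\<lambda>x. u x - \<phi> x) \<in> H10 \<Omega>" for l c \<phi> u
  proof -
    let ?N = "boundary_W21_norm \<Omega> l c \<phi>" and ?A = "\<integral>x. area_element \<Omega> u x \<partial>(lebesgue_on \<Omega>)"
    have "\<bar>\<phi> p\<bar> \<le> K * \<bar>?N\<bar>" if "p \<in> frontier \<Omega>" for p
      using K(2)[OF h(1,2) that] mult_left_mono[OF abs_ge_self[of ?N] K(1)] by linarith
    then have b: "\<bar>u x\<bar> + ?A \<le> C ?N * ((W0 \<Omega> u)\<^sup>2 + 1)" if "x \<in> \<Omega>" for x
      using C[of ?N] Ck_on_continuous[OF h(2)] h(3-5) that by blast
    \<comment> \<open>The area is a fixed real number; moved to the right-hand side, it leaves a
      pointwise bound of |u| over which the supremum can be taken.\<close>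
    have "(SUP x\<in>\<Omega>. ereal \<bar>u x\<bar>) \<le> ereal (C ?N * ((W0 \<Omega> u)\<^sup>2 + 1) - ?A)"
    proof (rule SUP_least)
      fix x assume "x \<in> \<Omega>"
      then show "ereal \<bar>u x\<bar> \<le> ereal (C ?N * ((W0 \<Omega> u)\<^sup>2 + 1) - ?A)" using b[of x] by simp
    qed
    then have "(SUP x\<in>\<Omega>. ereal \<bar>u x\<bar>) + ereal ?A \<le> ereal (C ?N * ((W0 \<Omega> u)\<^sup>2 + 1) - ?A) + ereal ?A"
      by (rule add_right_mono)
    then show ?thesis by simp
  qed
  then show ?thesis by blast
qed

end
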